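(* Let $n\ge 1$ be a natural number, $R$ a commutative ring, and $\{\{S_i, \Psi_i: S_i \to R\}\}_{i \in [n]}$ an $n$-indivisible sequence in $R$. If $|S_i| \ge \aleph_{i-1}$ for all $i \in [n]$, then the class $$\bigotimes_{i \in [n],R} \bigl(R(\iota_{S_i}) \circ \mathrm{cl}(\Psi_{R,S_i})\bigr) \in \mathrm{Ext}^{n}_{R}\Bigl(\bigotimes_{i \in [n],R} \mathrm{coker}(\Psi_{R,S_i}),\; R\bigl\{\textstyle\coprod_{i \in [n]} S_i\bigr\}\Bigr)$$ is non-zero.
   Context: Notation: $[n]=\{1,\dots,n\}$. Indivisible sequences: for a commutative ring $R$, a set $S$ and a set map $\Psi:S\to R$, let $\Psi_{R,S}:\bigoplus_S R\to R\oplus\bigoplus_S R$ be the $R$-linear map sending the basis vector $1_s$ to the vector whose component in the extra factor $R$ is $1$ and whose component at $s'\in S$ is $\Psi(s)$ if $s'=s$ and $0$ otherwise. $\{S,\Psi\}$ is a $1$-indivisible sequence if $\Psi_{R,S}$ is $R$-universally injective, i.e. $\Psi_{R,S}\otimes_R R'$ is injective for every ring map $R\to R'$ (equivalently, $\Psi_{R,S}$ is injective with flat cokernel). An $n$-indivisible sequence is a family $\{\{S_i,\Psi_i:S_i\to R\}\}_{i\in[n]}$ such that each $\{S_i,\Psi_i\}$ is $1$-indivisible and for every choice of $s_i\in S_i$ ($i\in[n]$) the elements $\Psi_i(s_i)$, $i\in[n]$, do not generate the unit ideal of $R$. Classes: for an injective $R$-linear map $f:M\to N$, $\mathrm{cl}(f)\in\mathrm{Ext}^1_R(\mathrm{coker}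 f,M)$ is the class of $0\to M\to N\to\mathrm{coker} f\to0$. For an $R$-linear map $g:M\to M'$, $g\circ\mathrm{cl}(f)\in\mathrm{Ext}^1_R(\mathrm{coker} f,M')$ is the pushforward. Tensor products of Ext classes are formed using the symmetric monoidal structure $\otimes^{\mathbf L}_R$ on $D(R)$ (underived here since the modules involved are flat). For a set $S$, $R\{S\}=R[X_s]_{s\in S}/(X_s^2-X_s)_{s\in S}$, and $R(\iota_S):\bigoplus_S R\to R\{S\}$ is the $R$-linear map $1_s\mapsto X_s$. One has $R\{S\amalg T\}\simeq R\{S\}\otimes_R R\{T\}$, so that $\bigotimes_{i\in[n],R} R\{S_i\}=R\{\coprod_{i\in[n]}S_i\}$. *)

theory Defs
  imports "HOL-Algebra.QuotRing" "HOL-Algebra.Module" "HOL-Algebra.Indexed_Polynomials"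
    "HOL-Library.FSet"
begin

unbundle cardinal_syntax

section \<open>Modules over a commutative ring\<close>

text \<open>
  Modules are the records of \<^theory>\<open>HOL-Algebra.Module\<close>; their fields \<^const>\<open>monoid.mult\<close> and
  \<^const>\<open>one\<close> carry no information and are left unspecified below.
\<close>

text \<open>Linear maps are taken extensional, so that they form a module with the expected equality.\<close>

definition mod_hom :: "'r ring \<Rightarrow> ('r, 'm) module \<Rightarrow> ('r, 'n) module \<Rightarrow> ('m \<Rightarrow> 'n) set" where
  "mod_hom R M N = {f \<in> carrier M \<rightarrow>\<^sub>E carrier N.
     (\<forall>x \<in> carrier M. \<forall>y \<in> carrier M. f (x \<oplus>\<^bsub>M\<^esub> y) = f x \<oplus>\<^bsub>N\<^esub> f y) \<and>
     (\<forall>r \<in> carrier R. \<forall>x \<in> carrier M. f (r \<odot>\<^bsub>M\<^esub> x) = r \<odot>\<^bsub>N\<^esub> f x)}"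

definition hom_module :: "'r ring \<Rightarrow> ('r, 'm) module \<Rightarrow> ('r, 'n) module \<Rightarrow> ('r, 'm \<Rightarrow> 'n) module" where
  "hom_module R M N =
    \<lparr>carrier = mod_hom R M N, monoid.mult = undefined, one = undefined,
     zero = (\<lambda>x \<in> carrier M. \<zero>\<^bsub>N\<^esub>),
     add = (\<lambda>f g. \<lambda>x \<in> carrier M. f x \<oplus>\<^bsub>N\<^esub> g x),
     smult = (\<lambda>r f. \<lambda>x \<in> carrier M. r \<odot>\<^bsub>N\<^esub> f x)\<rparr>"

definition quot_module :: "('r, 'm) module \<Rightarrow> 'm set \<Rightarrow> ('r, 'm set) module" where
  "quot_module M H =
    \<lparr>carrier = a_rcosets\<^bsub>M\<^esub> H, monoid.mult = undefined, one = undefined,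
     zero = H, add = (<+>\<^bsub>M\<^esub>),
     smult = (\<lambda>r C. \<Union>x\<in>C. H +>\<^bsub>M\<^esub> (r \<odot>\<^bsub>M\<^esub> x))\<rparr>"

text \<open>The map induced on a quotient by a map that is constant on cosets.\<close>

definition coset_lift :: "('m \<Rightarrow> 'n) \<Rightarrow> 'm set \<Rightarrow> 'n" where
  "coset_lift f C = the_elem (f ` C)"

definition coker :: "('r, 'm) module \<Rightarrow> ('r, 'n) module \<Rightarrow> ('m \<Rightarrow> 'n) \<Rightarrow> ('r, 'n set) module" where
  "coker M N f = quot_module N (f ` carrier M)"

definition submod_span :: "'r ring \<Rightarrow> ('r, 'm) module \<Rightarrow> 'm set \<Rightarrow> 'm set" where
  "submod_span R M A = \<Inter>{H. submodule H R M \<and> A \<subseteq> H}"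

text \<open>A ring \<open>A\<close>, regarded as a module along a ring map \<open>\<phi>\<close> into it.\<close>

definition restrict_scalars :: "('r \<Rightarrow> 'a) \<Rightarrow> 'a ring \<Rightarrow> ('r, 'a) module" where
  "restrict_scalars \<phi> A =
    \<lparr>carrier = carrier A, monoid.mult = monoid.mult A, one = one A, zero = zero A, add = add A,
     smult = (\<lambda>r x. \<phi> r \<otimes>\<^bsub>A\<^esub> x)\<rparr>"

definition dsum_module :: "('r, 'm) module \<Rightarrow> ('r, 'n) module \<Rightarrow> ('r, 'm \<times> 'n) module" where
  "dsum_module M N =
    \<lparr>carrier = carrier M \<times> carrier N, monoid.mult = undefined, one = undefined,
     zero = (\<zero>\<^bsub>M\<^esub>, \<zero>\<^bsub>N\<^esub>),
     add = (\<lambda>(x, y) (x', y'). (x \<oplus>\<^bsub>M\<^esub> x', y \<oplus>\<^bsub>N\<^esub> y')),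
     smult = (\<lambda>r (x, y). (r \<odot>\<^bsub>M\<^esub> x, r \<odot>\<^bsub>N\<^esub> y))\<rparr>"

definition prod_module :: "'i set \<Rightarrow> ('i \<Rightarrow> ('r, 'm) module) \<Rightarrow> ('r, 'i \<Rightarrow> 'm) module" where
  "prod_module I M =
    \<lparr>carrier = (\<Pi>\<^sub>E i\<in>I. carrier (M i)), monoid.mult = undefined, one = undefined,
     zero = (\<lambda>i\<in>I. \<zero>\<^bsub>M i\<^esub>),
     add = (\<lambda>x y. \<lambda>i\<in>I. x i \<oplus>\<^bsub>M i\<^esub> y i),
     smult = (\<lambda>r x. \<lambda>i\<in>I. r \<odot>\<^bsub>M i\<^esub> x i)\<rparr>"


subsection \<open>Free modules\<close>

text \<open>The direct sum of copies of \<open>R\<close> indexed by \<open>B\<close>.\<close>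

definition free_module :: "'r ring \<Rightarrow> 'b set \<Rightarrow> ('r, 'b \<Rightarrow> 'r) module" where
  "free_module R B =
    \<lparr>carrier = {x. finite {b. x b \<noteq> \<zero>\<^bsub>R\<^esub>} \<and> (\<forall>b\<in>B. x b \<in> carrier R) \<and> (\<forall>b. b \<notin> B \<longrightarrow> x b = \<zero>\<^bsub>R\<^esub>)},
     monoid.mult = undefined, one = undefined,
     zero = (\<lambda>b. \<zero>\<^bsub>R\<^esub>),
     add = (\<lambda>x y b. x b \<oplus>\<^bsub>R\<^esub> y b),
     smult = (\<lambda>r x b. r \<otimes>\<^bsub>R\<^esub> x b)\<rparr>"

definition basis_vec :: "'r ring \<Rightarrow> 'b \<Rightarrow> 'b \<Rightarrow> 'r" where
  "basis_vec R b = (\<lambda>c. if c = b then \<one>\<^bsub>R\<^esub> else \<zero>\<^bsub>R\<^esub>)"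

text \<open>The linear map into \<open>N\<close> sending the basis vector of \<open>b\<close> to \<open>f b\<close>.\<close>

definition free_lift :: "'r ring \<Rightarrow> ('r, 'n) module \<Rightarrow> ('b \<Rightarrow> 'n) \<Rightarrow> ('b \<Rightarrow> 'r) \<Rightarrow> 'n" where
  "free_lift R N f x = (\<Oplus>\<^bsub>N\<^esub> b \<in> {b. x b \<noteq> \<zero>\<^bsub>R\<^esub>}. x b \<odot>\<^bsub>N\<^esub> f b)"


subsection \<open>Tensor products\<close>

definition tensor2_rels :: "'r ring \<Rightarrow> ('r, 'm) module \<Rightarrow> ('r, 'n) module \<Rightarrow> ('m \<times> 'n \<Rightarrow> 'r) set" where
  "tensor2_rels R M N =
    (let F = free_module R (carrier M \<times> carrier N); e = basis_vec R in
      {e (x \<oplus>\<^bsub>M\<^esub> x', y) \<ominus>\<^bsub>F\<^esub> (e (x, y) \<oplus>\<^bsub>F\<^esub> e (x', y)) | x x' y.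
         x \<in> carrier M \<and> x' \<in> carrier M \<and> y \<in> carrier N} \<union>
      {e (x, y \<oplus>\<^bsub>N\<^esub> y') \<ominus>\<^bsub>F\<^esub> (e (x, y) \<oplus>\<^bsub>F\<^esub> e (x, y')) | x y y'.
         x \<in> carrier M \<and> y \<in> carrier N \<and> y' \<in> carrier N} \<union>
      {e (r \<odot>\<^bsub>M\<^esub> x, y) \<ominus>\<^bsub>F\<^esub> r \<odot>\<^bsub>F\<^esub> e (x, y) | r x y.
         r \<in> carrier R \<and> x \<in> carrier M \<and> y \<in> carrier N} \<union>
      {e (x, r \<odot>\<^bsub>N\<^esub> y) \<ominus>\<^bsub>F\<^esub> r \<odot>\<^bsub>F\<^esub> e (x, y) | r x y.
         r \<in> carrier R \<and> x \<in> carrier M \<and> y \<in> carrier N})"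

definition tensor2_null :: "'r ring \<Rightarrow> ('r, 'm) module \<Rightarrow> ('r, 'n) module \<Rightarrow> ('m \<times> 'n \<Rightarrow> 'r) set" where
  "tensor2_null R M N =
    submod_span R (free_module R (carrier M \<times> carrier N)) (tensor2_rels R M N)"

definition tensor2 :: "'r ring \<Rightarrow> ('r, 'm) module \<Rightarrow> ('r, 'n) module \<Rightarrow> ('r, ('m \<times> 'n \<Rightarrow> 'r) set) module" where
  "tensor2 R M N = quot_module (free_module R (carrier M \<times> carrier N)) (tensor2_null R M N)"

definition tensor2_pure :: "'r ring \<Rightarrow> ('r, 'm) module \<Rightarrow> ('r, 'n) module \<Rightarrow> 'm \<Rightarrow> 'n \<Rightarrow> ('m \<times> 'n \<Rightarrow> 'r) set" where
  "tensor2_pure R M N x y =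
    tensor2_null R M N +>\<^bsub>free_module R (carrier M \<times> carrier N)\<^esub> basis_vec R (x, y)"

text \<open>The map \<open>f \<otimes> g\<close> with values in \<open>M' \<otimes> N'\<close>.\<close>

definition tensor2_map ::
  "'r ring \<Rightarrow> ('r, 'm2) module \<Rightarrow> ('r, 'n2) module \<Rightarrow> ('m \<Rightarrow> 'm2) \<Rightarrow> ('n \<Rightarrow> 'n2)
    \<Rightarrow> ('m \<times> 'n \<Rightarrow> 'r) set \<Rightarrow> ('m2 \<times> 'n2 \<Rightarrow> 'r) set" where
  "tensor2_map R M' N' f g =
    coset_lift (free_lift R (tensor2 R M' N') (\<lambda>(x, y). tensor2_pure R M' N' (f x) (g y)))"

text \<open>
  The tensor product of a finite family. It is constructed in one step, as the target of the
  universal multilinear map, because the type of an iterated binary tensor product would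
  depend on the number of factors.
\<close>

definition tensor_free :: "'r ring \<Rightarrow> 'i set \<Rightarrow> ('i \<Rightarrow> ('r, 'm) module) \<Rightarrow> ('r, ('i \<Rightarrow> 'm) \<Rightarrow> 'r) module" where
  "tensor_free R I M = free_module R (\<Pi>\<^sub>E i\<in>I. carrier (M i))"

definition tensor_rels :: "'r ring \<Rightarrow> 'i set \<Rightarrow> ('i \<Rightarrow> ('r, 'm) module) \<Rightarrow> (('i \<Rightarrow> 'm) \<Rightarrow> 'r) set" where
  "tensor_rels R I M =
    (let F = tensor_free R I M; e = basis_vec R in
      {e (m(i := x \<oplus>\<^bsub>M i\<^esub> y)) \<ominus>\<^bsub>F\<^esub> (e (m(i := x)) \<oplus>\<^bsub>F\<^esub> e (m(i := y))) | m i x y.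
         m \<in> (\<Pi>\<^sub>E i\<in>I. carrier (M i)) \<and> i \<in> I \<and> x \<in> carrier (M i) \<and> y \<in> carrier (M i)} \<union>
      {e (m(i := r \<odot>\<^bsub>M i\<^esub> x)) \<ominus>\<^bsub>F\<^esub> r \<odot>\<^bsub>F\<^esub> e (m(i := x)) | m i r x.
         m \<in> (\<Pi>\<^sub>E i\<in>I. carrier (M i)) \<and> i \<in> I \<and> r \<in> carrier R \<and> x \<in> carrier (M i)})"

definition tensor_null :: "'r ring \<Rightarrow> 'i set \<Rightarrow> ('i \<Rightarrow> ('r, 'm) module) \<Rightarrow> (('i \<Rightarrow> 'm) \<Rightarrow> 'r) set" where
  "tensor_null R I M = submod_span R (tensor_free R I M) (tensor_rels R I M)"

definition tensor :: "'r ring \<Rightarrow> 'i set \<Rightarrow> ('i \<Rightarrow> ('r, 'm) module) \<Rightarrow> ('r, (('i \<Rightarrow> 'm) \<Rightarrow> 'r) set) module" where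
  "tensor R I M = quot_module (tensor_free R I M) (tensor_null R I M)"

definition tensor_pure :: "'r ring \<Rightarrow> 'i set \<Rightarrow> ('i \<Rightarrow> ('r, 'm) module) \<Rightarrow> ('i \<Rightarrow> 'm) \<Rightarrow> (('i \<Rightarrow> 'm) \<Rightarrow> 'r) set" where
  "tensor_pure R I M m = tensor_null R I M +>\<^bsub>tensor_free R I M\<^esub> basis_vec R (restrict m I)"

text \<open>The linear map into \<open>N\<close> induced by a multilinear map \<open>b\<close>.\<close>

definition tensor_lift :: "'r ring \<Rightarrow> ('r, 'n) module \<Rightarrow> (('i \<Rightarrow> 'm) \<Rightarrow> 'n) \<Rightarrow> (('i \<Rightarrow> 'm) \<Rightarrow> 'r) set \<Rightarrow> 'n" where
  "tensor_lift R N b = coset_lift (free_lift R N b)"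

text \<open>The tensor product of the maps \<open>f i\<close> with values in the modules \<open>N i\<close>.\<close>

definition tensor_map ::
  "'r ring \<Rightarrow> 'i set \<Rightarrow> ('i \<Rightarrow> ('r, 'n) module) \<Rightarrow> ('i \<Rightarrow> 'm \<Rightarrow> 'n)
    \<Rightarrow> (('i \<Rightarrow> 'm) \<Rightarrow> 'r) set \<Rightarrow> (('i \<Rightarrow> 'n) \<Rightarrow> 'r) set" where
  "tensor_map R I N f =
    tensor_lift R (tensor R I N) (\<lambda>m. tensor_pure R I N (\<lambda>i. f i (m i)))"


section \<open>Augmented complexes and the standard free resolution\<close>

text \<open>
  Modules \<open>obj k\<close> in degrees \<open>k \<ge> 0\<close>, differentials \<open>bdry k\<close> from \<open>obj (Suc k)\<close> to \<open>obj k\<close>,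
  and an augmentation \<open>aug\<close> on \<open>obj 0\<close>.
\<close>

record ('r, 'm, 'c) aug_complex =
  obj :: "nat \<Rightarrow> ('r, 'm) module"
  bdry :: "nat \<Rightarrow> 'm \<Rightarrow> 'm"
  aug :: "'m \<Rightarrow> 'c"

text \<open>
  The standard free resolution of \<open>M\<close>: its module in degree \<open>0\<close> is free on the set \<open>M\<close>, and its
  module in degree \<open>k + 1\<close> is free on the set of all elements of the kernel in degree \<open>k\<close>. So
  that all degrees share one type, a basis element is represented by a term of the following
  datatype: \<open>Gen m\<close> stands for \<open>m \<in> M\<close>, and \<open>Syz A\<close> for the linear combination in the previous
  degree whose finite graph of nonzero coefficients is \<open>A\<close>.
\<close>

datatype ('r, 'm) syz = Gen (ungen: 'm) | Syz "(('r, 'm) syz \<times> 'r) fset"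

definition syz_of :: "'r ring \<Rightarrow> (('r, 'm) syz \<Rightarrow> 'r) \<Rightarrow> ('r, 'm) syz" where
  "syz_of R x = Syz (Abs_fset {(t, x t) | t. x t \<noteq> \<zero>\<^bsub>R\<^esub>})"

text \<open>The inverse of \<open>syz_of R\<close> on functions of finite support.\<close>

definition syz_vec :: "'r ring \<Rightarrow> ('r, 'm) syz \<Rightarrow> ('r, 'm) syz \<Rightarrow> 'r" where
  "syz_vec R s = (case s of
     Gen m \<Rightarrow> (\<lambda>t. \<zero>\<^bsub>R\<^esub>)
   | Syz A \<Rightarrow> (\<lambda>t. if \<exists>r. (t, r) |\<in>| A then THE r. (t, r) |\<in>| A else \<zero>\<^bsub>R\<^esub>))"

fun std_basis :: "'r ring \<Rightarrow> ('r, 'm) module \<Rightarrow> nat \<Rightarrow> ('r, 'm) syz set" where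
  "std_basis R M 0 = Gen ` carrier M"
| "std_basis R M (Suc 0) =
     syz_of R ` {x \<in> carrier (free_module R (std_basis R M 0)). free_lift R M ungen x = \<zero>\<^bsub>M\<^esub>}"
| "std_basis R M (Suc (Suc k)) =
     syz_of R ` {x \<in> carrier (free_module R (std_basis R M (Suc k))).
       free_lift R (free_module R (std_basis R M k)) (syz_vec R) x
         = \<zero>\<^bsub>free_module R (std_basis R M k)\<^esub>}"

definition std_res :: "'r ring \<Rightarrow> ('r, 'm) module \<Rightarrow> ('r, ('r, 'm) syz \<Rightarrow> 'r, 'm) aug_complex" where
  "std_res R M =
    \<lparr>obj = (\<lambda>k. free_module R (std_basis R M k)),
     bdry = (\<lambda>k. free_lift R (free_module R (std_basis R M k)) (syz_vec R)),
     aug = free_lift R M ungen\<rparr>"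

text \<open>Chain maps lying over the identity of the augmented module.\<close>

definition comparison_maps ::
  "'r ring \<Rightarrow> ('r, 'm, 'c) aug_complex \<Rightarrow> ('r, 'n, 'c) aug_complex \<Rightarrow> (nat \<Rightarrow> 'm \<Rightarrow> 'n) set" where
  "comparison_maps R P Q = {\<theta>.
     (\<forall>k. \<theta> k \<in> mod_hom R (obj P k) (obj Q k)) \<and>
     (\<forall>k. \<forall>x \<in> carrier (obj P (Suc k)). bdry Q k (\<theta> (Suc k) x) = \<theta> k (bdry P k x)) \<and>
     (\<forall>x \<in> carrier (obj P 0). aug Q (\<theta> 0 x) = aug P x)}"

text \<open>
  The total complex of the tensor product of the complexes \<open>P i\<close>, augmented towards the tensor
  product of the modules \<open>M i\<close>, with the usual sign rule for the differential.
\<close>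

definition multidegs :: "'i set \<Rightarrow> nat \<Rightarrow> ('i \<Rightarrow> nat) set" where
  "multidegs I k = {d \<in> I \<rightarrow>\<^sub>E UNIV. (\<Sum>i\<in>I. d i) = k}"

definition tensor_at ::
  "'r ring \<Rightarrow> 'i set \<Rightarrow> ('i \<Rightarrow> ('r, 'm, 'c) aug_complex) \<Rightarrow> ('i \<Rightarrow> nat) \<Rightarrow> ('r, (('i \<Rightarrow> 'm) \<Rightarrow> 'r) set) module" where
  "tensor_at R I P d = tensor R I (\<lambda>i. obj (P i) (d i))"

definition tensor_complex ::
  "'r ring \<Rightarrow> 'i::linorder set \<Rightarrow> ('i \<Rightarrow> ('r, 'm, 'c) aug_complex) \<Rightarrow> ('i \<Rightarrow> ('r, 'c) module)
    \<Rightarrow> ('r, ('i \<Rightarrow> nat) \<Rightarrow> (('i \<Rightarrow> 'm) \<Rightarrow> 'r) set, (('i \<Rightarrow> 'c) \<Rightarrow> 'r) set) aug_complex" where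
  "tensor_complex R I P M =
    \<lparr>obj = (\<lambda>k. prod_module (multidegs I k) (tensor_at R I P)),
     bdry = (\<lambda>k x. \<lambda>d \<in> multidegs I k. \<Oplus>\<^bsub>tensor_at R I P d\<^esub> j \<in> I.
       (let y = tensor_map R I (\<lambda>i. obj (P i) (d i))
                  (\<lambda>i. if i = j then bdry (P i) (d i) else (\<lambda>z. z))
                  (x (d(j := Suc (d j))))
        in if even (\<Sum>i\<in>{i \<in> I. i < j}. d i) then y else \<ominus>\<^bsub>tensor_at R I P d\<^esub> y)),
     aug = (\<lambda>x. tensor_map R I M (\<lambda>i. aug (P i)) (x (\<lambda>i\<in>I. 0)))\<rparr>"


section \<open>Ext modules\<close>

definition ext_cocycles ::
  "'r ring \<Rightarrow> nat \<Rightarrow> ('r, 'm) module \<Rightarrow> ('r, 'n) module \<Rightarrow> ((('r, 'm) syz \<Rightarrow> 'r) \<Rightarrow> 'n) set" where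
  "ext_cocycles R k M N =
    {\<phi> \<in> mod_hom R (obj (std_res R M) k) N.
       \<forall>x \<in> carrier (obj (std_res R M) (Suc k)). \<phi> (bdry (std_res R M) k x) = \<zero>\<^bsub>N\<^esub>}"

definition ext_coboundaries ::
  "'r ring \<Rightarrow> nat \<Rightarrow> ('r, 'm) module \<Rightarrow> ('r, 'n) module \<Rightarrow> ((('r, 'm) syz \<Rightarrow> 'r) \<Rightarrow> 'n) set" where
  "ext_coboundaries R k M N = (case k of
     0 \<Rightarrow> {\<zero>\<^bsub>hom_module R (obj (std_res R M) 0) N\<^esub>}
   | Suc l \<Rightarrow> {(\<lambda>x \<in> carrier (obj (std_res R M) (Suc l)). h (bdry (std_res R M) l x)) | h.
                h \<in> mod_hom R (obj (std_res R M) l) N})"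

text \<open>
  \<open>Ext R k M N\<close> is the \<open>k\<close>-th cohomology of the complex of linear maps from the standard free
  resolution of \<open>M\<close> to \<open>N\<close>; a class is a coset of coboundaries.
\<close>

definition Ext ::
  "'r ring \<Rightarrow> nat \<Rightarrow> ('r, 'm) module \<Rightarrow> ('r, 'n) module
    \<Rightarrow> ('r, ((('r, 'm) syz \<Rightarrow> 'r) \<Rightarrow> 'n) set) module" where
  "Ext R k M N =
    quot_module ((hom_module R (obj (std_res R M) k) N)\<lparr>carrier := ext_cocycles R k M N\<rparr>)
      (ext_coboundaries R k M N)"

definition ext_class ::
  "'r ring \<Rightarrow> nat \<Rightarrow> ('r, 'm) module \<Rightarrow> ('r, 'n) module \<Rightarrow> ((('r, 'm) syz \<Rightarrow> 'r) \<Rightarrow> 'n)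
    \<Rightarrow> ((('r, 'm) syz \<Rightarrow> 'r) \<Rightarrow> 'n) set" where
  "ext_class R k M N \<phi> =
    ext_coboundaries R k M N
      +>\<^bsub>hom_module R (obj (std_res R M) k) N\<^esub> restrict \<phi> (carrier (obj (std_res R M) k))"

text \<open>
  The class of \<open>0 \<rightarrow> M \<rightarrow> N \<rightarrow> coker f \<rightarrow> 0\<close> for injective \<open>f\<close>: lift the augmentation of the
  standard resolution of \<open>coker f\<close> to \<open>\<psi>\<close> in degree \<open>0\<close> and let \<open>\<phi>\<close> be the map induced in
  degree \<open>1\<close>. The maps \<open>\<phi>\<close> obtained from all choices of \<open>\<psi>\<close> form exactly one coset of coboundaries.
\<close>

definition ext_cl ::
  "'r ring \<Rightarrow> ('r, 'm) module \<Rightarrow> ('r, 'n) module \<Rightarrow> ('m \<Rightarrow> 'n)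
    \<Rightarrow> ((('r, 'n set) syz \<Rightarrow> 'r) \<Rightarrow> 'm) set" where
  "ext_cl R M N f =
    (let P = std_res R (coker M N f) in
     {\<phi> \<in> mod_hom R (obj P 1) M. \<exists>\<psi> \<in> mod_hom R (obj P 0) N.
        (\<forall>x \<in> carrier (obj P 0). f ` carrier M +>\<^bsub>N\<^esub> \<psi> x = aug P x) \<and>
        (\<forall>x \<in> carrier (obj P 1). f (\<phi> x) = \<psi> (bdry P 0 x))})"

text \<open>The image of \<open>\<alpha> \<in> Ext R k L N\<close> in \<open>Ext R k L N'\<close> under \<open>g\<close> from \<open>N\<close> to \<open>N'\<close>.\<close>

definition ext_push ::
  "'r ring \<Rightarrow> nat \<Rightarrow> ('r, 'l) module \<Rightarrow> ('r, 'n2) module \<Rightarrow> ('n \<Rightarrow> 'n2)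
    \<Rightarrow> ((('r, 'l) syz \<Rightarrow> 'r) \<Rightarrow> 'n) set \<Rightarrow> ((('r, 'l) syz \<Rightarrow> 'r) \<Rightarrow> 'n2) set" where
  "ext_push R k L N' g \<alpha> = (\<Union>\<phi>\<in>\<alpha>. ext_class R k L N' (\<lambda>x. g (\<phi> x)))"

text \<open>
  The tensor product of classes \<open>\<alpha> i \<in> Ext R (p i) (M i) (N i)\<close>, for flat \<open>M i\<close>. By flatness the
  tensor product of the standard resolutions of the \<open>M i\<close> is again a resolution of the tensor
  product of the \<open>M i\<close>, and so computes the derived tensor product. On it, the product of
  cocycles \<open>\<phi> i \<in> \<alpha> i\<close> is their tensor product on the summand of multidegree \<open>p\<close> and zero on all
  other summands; a comparison map \<open>\<theta>\<close> transports it to the standard resolution. The resulting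
  class does not depend on the choice of \<open>\<phi>\<close> and \<open>\<theta>\<close>, so the union below is a single coset (it
  would be empty if there were no \<open>\<theta>\<close>). Shifts are commuted past tensor products without sign;
  another convention changes the result by a global sign.
\<close>

definition ext_tensor ::
  "'r ring \<Rightarrow> 'i::linorder set \<Rightarrow> ('i \<Rightarrow> nat) \<Rightarrow> ('i \<Rightarrow> ('r, 'm) module) \<Rightarrow> ('i \<Rightarrow> ('r, 'n) module)
    \<Rightarrow> ('i \<Rightarrow> ((('r, 'm) syz \<Rightarrow> 'r) \<Rightarrow> 'n) set)
    \<Rightarrow> ((('r, (('i \<Rightarrow> 'm) \<Rightarrow> 'r) set) syz \<Rightarrow> 'r) \<Rightarrow> (('i \<Rightarrow> 'n) \<Rightarrow> 'r) set) set" where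
  "ext_tensor R I p M N \<alpha> =
    (\<Union>\<phi> \<in> Pi\<^sub>E I \<alpha>.
     \<Union>\<theta> \<in> comparison_maps R (std_res R (tensor R I M)) (tensor_complex R I (\<lambda>i. std_res R (M i)) M).
       ext_class R (\<Sum>i\<in>I. p i) (tensor R I M) (tensor R I N)
         (\<lambda>x. tensor_map R I N \<phi> (\<theta> (\<Sum>i\<in>I. p i) x (restrict p I))))"


section \<open>Indivisible sequences\<close>

definition indiv_source :: "'r ring \<Rightarrow> 's set \<Rightarrow> ('r, 's \<Rightarrow> 'r) module" where
  "indiv_source R S = free_module R S"

definition indiv_target :: "'r ring \<Rightarrow> 's set \<Rightarrow> ('r, 'r \<times> ('s \<Rightarrow> 'r)) module" where
  "indiv_target R S = dsum_module (restrict_scalars (\<lambda>r. r) R) (free_module R S)"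

definition indiv_map :: "'r ring \<Rightarrow> 's set \<Rightarrow> ('s \<Rightarrow> 'r) \<Rightarrow> ('s \<Rightarrow> 'r) \<Rightarrow> 'r \<times> ('s \<Rightarrow> 'r)" where
  "indiv_map R S \<Psi> =
    free_lift R (indiv_target R S) (\<lambda>s. (\<one>\<^bsub>R\<^esub>, \<Psi> s \<odot>\<^bsub>free_module R S\<^esub> basis_vec R s))"

text \<open>
  Universal injectivity quantifies over all commutative rings \<open>R'\<close> under \<open>R\<close>. A definition cannot
  quantify over types, but rings on the type of lists over the type of \<open>R\<close> suffice: if
  injectivity fails after base change to some \<open>R'\<close>, then, the relevant tensors and relations
  involving only finitely many elements of \<open>R'\<close>, it already fails after base change to a finitely
  generated \<open>R\<close>-subalgebra of \<open>R'\<close>. Its cardinality is at most the maximum of \<open>|R|\<close> and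
  \<open>\<aleph>\<^sub>0\<close>, so it is isomorphic to a ring on this type.
\<close>

definition universally_injective ::
  "'r ring \<Rightarrow> ('r, 'm) module \<Rightarrow> ('r, 'n) module \<Rightarrow> ('m \<Rightarrow> 'n) \<Rightarrow> bool" where
  "universally_injective R M N f \<longleftrightarrow>
    (\<forall>(R' :: 'r list ring) \<phi>. cring R' \<and> \<phi> \<in> ring_hom R R' \<longrightarrow>
       inj_on (tensor2_map R N (restrict_scalars \<phi> R') f (\<lambda>x. x))
         (carrier (tensor2 R M (restrict_scalars \<phi> R'))))"

definition one_indivisible :: "'r ring \<Rightarrow> 's set \<Rightarrow> ('s \<Rightarrow> 'r) \<Rightarrow> bool" where
  "one_indivisible R S \<Psi> \<longleftrightarrow>
    \<Psi> \<in> S \<rightarrow> carrier R \<and>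
    universally_injective R (indiv_source R S) (indiv_target R S) (indiv_map R S \<Psi>)"

definition indivisible :: "'r ring \<Rightarrow> nat \<Rightarrow> (nat \<Rightarrow> 's set) \<Rightarrow> (nat \<Rightarrow> 's \<Rightarrow> 'r) \<Rightarrow> bool" where
  "indivisible R n S \<Psi> \<longleftrightarrow>
    (\<forall>i \<in> {1..n}. one_indivisible R (S i) (\<Psi> i)) \<and>
    (\<forall>s \<in> (\<Pi> i\<in>{1..n}. S i). Idl\<^bsub>R\<^esub> ((\<lambda>i. \<Psi> i (s i)) ` {1..n}) \<noteq> carrier R)"

definition indiv_coker :: "'r ring \<Rightarrow> 's set \<Rightarrow> ('s \<Rightarrow> 'r) \<Rightarrow> ('r, ('r \<times> ('s \<Rightarrow> 'r)) set) module" where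
  "indiv_coker R S \<Psi> = coker (indiv_source R S) (indiv_target R S) (indiv_map R S \<Psi>)"

definition indiv_cl ::
  "'r ring \<Rightarrow> 's set \<Rightarrow> ('s \<Rightarrow> 'r)
    \<Rightarrow> ((('r, ('r \<times> ('s \<Rightarrow> 'r)) set) syz \<Rightarrow> 'r) \<Rightarrow> ('s \<Rightarrow> 'r)) set" where
  "indiv_cl R S \<Psi> = ext_cl R (indiv_source R S) (indiv_target R S) (indiv_map R S \<Psi>)"


section \<open>The algebra on free idempotents\<close>

text \<open>
  The polynomial ring in variables indexed by \<open>S\<close>. The library provides the set of
  polynomials, as coefficient functions on multisets of variables, and its additive structure.
\<close>

definition mpoly_ring :: "'r ring \<Rightarrow> 's set \<Rightarrow> ('s multiset \<Rightarrow> 'r) ring" where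
  "mpoly_ring R S =
    \<lparr>carrier = ring.indexed_pset R S (carrier R),
     monoid.mult = (\<lambda>P Q m. \<Oplus>\<^bsub>R\<^esub> a \<in> {a. a \<subseteq># m}. P a \<otimes>\<^bsub>R\<^esub> Q (m - a)),
     one = ring.indexed_const R \<one>\<^bsub>R\<^esub>,
     zero = ring.indexed_const R \<zero>\<^bsub>R\<^esub>,
     add = ring.indexed_padd R\<rparr>"

definition idem_ideal :: "'r ring \<Rightarrow> 's set \<Rightarrow> ('s multiset \<Rightarrow> 'r) set" where
  "idem_ideal R S =
    (let A = mpoly_ring R S; v = ring.indexed_var R
     in Idl\<^bsub>A\<^esub> ((\<lambda>s. v s \<otimes>\<^bsub>A\<^esub> v s \<ominus>\<^bsub>A\<^esub> v s) ` S))"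

definition idem_ring :: "'r ring \<Rightarrow> 's set \<Rightarrow> (('s multiset \<Rightarrow> 'r) set) ring" where
  "idem_ring R S = mpoly_ring R S Quot idem_ideal R S"

definition idem_cls :: "'r ring \<Rightarrow> 's set \<Rightarrow> ('s multiset \<Rightarrow> 'r) \<Rightarrow> ('s multiset \<Rightarrow> 'r) set" where
  "idem_cls R S P = idem_ideal R S +>\<^bsub>mpoly_ring R S\<^esub> P"

definition idem_module :: "'r ring \<Rightarrow> 's set \<Rightarrow> ('r, ('s multiset \<Rightarrow> 'r) set) module" where
  "idem_module R S = restrict_scalars (\<lambda>r. idem_cls R S (ring.indexed_const R r)) (idem_ring R S)"

definition idem_incl :: "'r ring \<Rightarrow> 's set \<Rightarrow> ('s \<Rightarrow> 'r) \<Rightarrow> ('s multiset \<Rightarrow> 'r) set" where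
  "idem_incl R S = free_lift R (idem_module R S) (\<lambda>s. idem_cls R S (ring.indexed_var R s))"

text \<open>
  The \<open>R\<close>-algebra map into the algebra on \<open>T\<close> sending each variable \<open>s\<close> to the variable \<open>f s\<close>,
  given on monomials by renaming the variables.
\<close>

definition idem_map ::
  "'r ring \<Rightarrow> 't set \<Rightarrow> ('s \<Rightarrow> 't) \<Rightarrow> ('s multiset \<Rightarrow> 'r) set \<Rightarrow> ('t multiset \<Rightarrow> 'r) set" where
  "idem_map R T f =
    coset_lift (free_lift R (idem_module R T) (\<lambda>m. idem_cls R T (basis_vec R (image_mset f m))))"

text \<open>
  The canonical isomorphism from the tensor product of the algebras on the \<open>S i\<close> to the algebra on
  their disjoint union: apply the maps induced by the coproduct inclusions and multiply.
\<close>

definition idem_tensor_iso ::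
  "'r ring \<Rightarrow> 'i set \<Rightarrow> ('i \<Rightarrow> 's set)
    \<Rightarrow> (('i \<Rightarrow> ('s multiset \<Rightarrow> 'r) set) \<Rightarrow> 'r) set \<Rightarrow> (('i \<times> 's) multiset \<Rightarrow> 'r) set" where
  "idem_tensor_iso R I S =
    tensor_lift R (idem_module R (Sigma I S))
      (\<lambda>a. \<Otimes>\<^bsub>idem_ring R (Sigma I S)\<^esub> i \<in> I. idem_map R (Sigma I S) (Pair i) (a i))"


section \<open>The alephs of finite index\<close>

text \<open>\<open>is_aleph k r\<close>: the cardinal \<open>r\<close>, realised on the type \<open>'a\<close>, is the \<open>k\<close>-th aleph.\<close>

primrec is_aleph :: "nat \<Rightarrow> 'a rel \<Rightarrow> bool" where
  "is_aleph 0 r \<longleftrightarrow> r =o natLeq"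
| "is_aleph (Suc k) r \<longleftrightarrow> (\<exists>r' :: 'a rel. is_aleph k r' \<and> r =o cardSuc r')"

definition aleph_le :: "nat \<Rightarrow> 'a set \<Rightarrow> bool" where
  "aleph_le k S \<longleftrightarrow> (\<exists>r :: 'a rel. is_aleph k r \<and> r \<le>o |S| )"

end

theory Submission
  imports Defs
begin

text \<open>
  Write \<open>M i\<close> for the cokernel of the map \<open>f i\<close> attached to \<open>(S i, \<Psi> i)\<close>. The class is represented by an
  explicit cochain on an explicit resolution of the tensor product of the \<open>M i\<close>, and a combinatorial
  property of the alephs keeps this cochain from being a coboundary.

  The resolution. After base change along \<open>R \<rightarrow> R / (\<Psi> s, \<Psi> t)\<close> the basis vectors of \<open>s\<close> and \<open>t\<close> have the
  same image, so universal injectivity forces \<open>\<Psi> s\<close> and \<open>\<Psi> t\<close> to be comaximal for \<open>s \<noteq> t\<close>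
  (\<open>comaximal\<close>, \<open>comaximal_finite\<close>). Comaximality gives, for every finite set of basis vectors, a
  linear left inverse of \<open>f i\<close> on their span (\<open>cell_bdry_split\<close>). These local left inverses
  do the work of flatness: they make the tensor product of the two-term resolutions of the \<open>M i\<close> exact
  in positive degrees (\<open>bd_exact\<close>), hence a free resolution of the tensor product
  (\<open>Cx_resolution\<close>). Its basis consists of the cells of a cube: families \<open>c\<close> whose coordinate \<open>c i\<close>
  is a basis element of the \<open>i\<close>-th two-term resolution, of degree \<open>0\<close> (a vertex) or \<open>1\<close> (an edge).

  The cochain. Each two-term resolution is enlarged by a contractible summand, so that every cocycle
  representing the \<open>i\<close>-th class factors, without a homotopy, through one fixed cochain on it
  (\<open>factor_cocycle\<close>). Multiplying these cochains gives \<open>cube_val\<close> on the cells of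
  top degree \<open>n\<close>, and the tensor product of the cocycles is its pullback (\<open>tensor_cocycle\<close>). Since
  chain maps between free resolutions are unique up to homotopy, the class in \<open>Ext\<close> is the
  transport of \<open>cube_val\<close>, and it is zero only if \<open>cube_val\<close> is a coboundary on the cube
  (\<open>transported_class\<close>).

  Why it is no coboundary (\<open>cube_val_nontrivial\<close>). Suppose \<open>cube_val = h \<circ> bd\<close>. On the cell made of the
  edges \<open>s 1, \<dots>, s n\<close> this says that the product of the variables \<open>X (j, s j)\<close> is the sum over \<open>j\<close> of
  \<open>\<plusminus> (h (a j) + \<Psi> j (s j) h (b j))\<close>, where \<open>a j\<close> and \<open>b j\<close> are the faces with \<open>j\<close>-th coordinate the
  vertex of the extra factor \<open>R\<close> and the vertex \<open>s j\<close>. The element \<open>h (a j)\<close> does not depend on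
  \<open>s j\<close> and involves finitely many variables. As \<open>S i\<close> has at least \<open>\<aleph>\<^sub>i\<^sub>-\<^sub>1\<close> elements,
  Kuratowski's free set theorem (\<open>free_set\<close>) yields \<open>s\<close> such that for every \<open>j\<close> the
  variable \<open>X (j, s j)\<close> does not occur in \<open>h (a j)\<close>. The coefficient of the full product then exhibits
  \<open>1\<close> as an element of the ideal generated by the \<open>\<Psi> j (s j)\<close>, contrary to indivisibility.
\<close>

section \<open>Linear maps\<close>

text \<open>
  Unlike \<^const>\<open>mod_hom\<close>, the predicate ignores values outside the carrier, so linear maps can be
  composed and added as plain functions.
\<close>

definition lin :: "'r ring \<Rightarrow> ('r, 'm) module \<Rightarrow> ('r, 'n) module \<Rightarrow> ('m \<Rightarrow> 'n) \<Rightarrow> bool" where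
  "lin R M N f \<longleftrightarrow> f \<in> carrier M \<rightarrow> carrier N \<and>
     (\<forall>x \<in> carrier M. \<forall>y \<in> carrier M. f (x \<oplus>\<^bsub>M\<^esub> y) = f x \<oplus>\<^bsub>N\<^esub> f y) \<and>
     (\<forall>r \<in> carrier R. \<forall>x \<in> carrier M. f (r \<odot>\<^bsub>M\<^esub> x) = r \<odot>\<^bsub>N\<^esub> f x)"

lemma mod_hom_iff: "f \<in> mod_hom R M N \<longleftrightarrow> lin R M N f \<and> f \<in> extensional (carrier M)"
  by (auto simp: mod_hom_def lin_def PiE_def)

lemma lin_closed: "lin R M N f \<Longrightarrow> x \<in> carrier M \<Longrightarrow> f x \<in> carrier N"
  by (auto simp: lin_def)

lemma lin_add: "lin R M N f \<Longrightarrow> x \<in> carrier M \<Longrightarrow> y \<in> carrier M \<Longrightarrow> f (x \<oplus>\<^bsub>M\<^esub> y) = f x \<oplus>\<^bsub>N\<^esub> f y"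
  by (auto simp: lin_def)

lemma lin_smult: "lin R M N f \<Longrightarrow> r \<in> carrier R \<Longrightarrow> x \<in> carrier M \<Longrightarrow> f (r \<odot>\<^bsub>M\<^esub> x) = r \<odot>\<^bsub>N\<^esub> f x"
  by (auto simp: lin_def)

lemma linI:
  assumes "\<And>x. x \<in> carrier M \<Longrightarrow> f x \<in> carrier N"
    and "\<And>x y. x \<in> carrier M \<Longrightarrow> y \<in> carrier M \<Longrightarrow> f (x \<oplus>\<^bsub>M\<^esub> y) = f x \<oplus>\<^bsub>N\<^esub> f y"
    and "\<And>r x. r \<in> carrier R \<Longrightarrow> x \<in> carrier M \<Longrightarrow> f (r \<odot>\<^bsub>M\<^esub> x) = r \<odot>\<^bsub>N\<^esub> f x"
  shows "lin R M N f"
  using assms by (auto simp: lin_def)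

lemma lin_comp: "lin R M N f \<Longrightarrow> lin R N P g \<Longrightarrow> lin R M P (\<lambda>x. g (f x))"
  by (rule linI) (simp_all add: lin_closed lin_add lin_smult)

lemma lin_id: "lin R M M (\<lambda>x. x)"
  by (rule linI) auto

lemma lin_cong:
  assumes "module R M" "lin R M N f" "\<And>x. x \<in> carrier M \<Longrightarrow> g x = f x"
  shows "lin R M N g"
proof -
  interpret module R M by fact
  show ?thesis
    by (rule linI) (simp_all add: assms(3) lin_closed[OF assms(2)] lin_add[OF assms(2)] lin_smult[OF assms(2)])
qed

lemma lin_restrict:
  assumes "module R M" "lin R M N f"
  shows "restrict f (carrier M) \<in> mod_hom R M N"
  using lin_cong[OF assms, of "restrict f (carrier M)"] by (simp add: mod_hom_iff)

lemma lin_zero: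
  assumes "module R M" "module R N" "lin R M N f"
  shows "f \<zero>\<^bsub>M\<^esub> = \<zero>\<^bsub>N\<^esub>"
proof -
  interpret M: module R M by fact
  interpret N: module R N by fact
  have "f (\<zero>\<^bsub>R\<^esub> \<odot>\<^bsub>M\<^esub> \<zero>\<^bsub>M\<^esub>) = \<zero>\<^bsub>R\<^esub> \<odot>\<^bsub>N\<^esub> f \<zero>\<^bsub>M\<^esub>"
    using lin_smult[OF assms(3), of "\<zero>\<^bsub>R\<^esub>" "\<zero>\<^bsub>M\<^esub>"] by simp
  then show ?thesis using lin_closed[OF assms(3), of "\<zero>\<^bsub>M\<^esub>"] by simp
qed

lemma lin_uminus:
  assumes "module R M" "module R N" "lin R M N f" "x \<in> carrier M"
  shows "f (\<ominus>\<^bsub>M\<^esub> x) = \<ominus>\<^bsub>N\<^esub> f x"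
proof -
  interpret M: module R M by fact
  interpret N: module R N by fact
  have "f (\<ominus>\<^bsub>M\<^esub> x) \<oplus>\<^bsub>N\<^esub> f x = f (\<ominus>\<^bsub>M\<^esub> x \<oplus>\<^bsub>M\<^esub> x)"
    using lin_add[OF assms(3)] assms(4) by simp
  also have "\<dots> = \<zero>\<^bsub>N\<^esub>" using assms(4) by (simp add: M.M.l_neg lin_zero[OF assms(1-3)])
  finally show ?thesis
    using N.M.minus_equality[of "f (\<ominus>\<^bsub>M\<^esub> x)" "f x"] lin_closed[OF assms(3)] assms(4) by simp
qed

lemma lin_minus:
  assumes "module R M" "module R N" "lin R M N f" "x \<in> carrier M" "y \<in> carrier M"
  shows "f (x \<ominus>\<^bsub>M\<^esub> y) = f x \<ominus>\<^bsub>N\<^esub> f y"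
proof -
  interpret M: module R M by fact
  interpret N: module R N by fact
  show ?thesis
    using assms(4,5) by (simp add: a_minus_def lin_add[OF assms(3)] lin_uminus[OF assms(1-3)])
qed

lemma lin_finsum:
  assumes "module R M" "module R N" "lin R M N f" "finite A" "g \<in> A \<rightarrow> carrier M"
  shows "f (\<Oplus>\<^bsub>M\<^esub>a\<in>A. g a) = (\<Oplus>\<^bsub>N\<^esub>a\<in>A. f (g a))"
proof -
  interpret M: module R M by fact
  interpret N: module R N by fact
  show ?thesis using assms(4,5)
  proof (induction A rule: finite_induct)
    case empty
    then show ?case by (simp add: lin_zero[OF assms(1-3)])
  next
    case (insert a A)
    then have "g a \<in> carrier M" "g \<in> A \<rightarrow> carrier M" by auto
    moreover have "(\<lambda>a. f (g a)) \<in> A \<rightarrow> carrier N" "f (g a) \<in> carrier N"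
      using calculation lin_closed[OF assms(3)] by auto
    ultimately show ?case
      using insert by (simp add: lin_add[OF assms(3)] M.M.finsum_closed)
  qed
qed

lemma lin_plus:
  assumes "module R N" "lin R M N f" "lin R M N g"
  shows "lin R M N (\<lambda>x. f x \<oplus>\<^bsub>N\<^esub> g x)"
proof -
  interpret N: module R N by fact
  show ?thesis
    by (rule linI)
      (simp_all add: lin_closed[OF assms(2)] lin_closed[OF assms(3)] lin_add[OF assms(2)] lin_add[OF assms(3)]
        lin_smult[OF assms(2)] lin_smult[OF assms(3)] N.smult_r_distr N.M.a_ac)
qed

lemma lin_neg:
  assumes "module R N" "lin R M N f"
  shows "lin R M N (\<lambda>x. \<ominus>\<^bsub>N\<^esub> f x)"
proof -
  interpret N: module R N by fact
  show ?thesis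
    by (rule linI)
      (simp_all add: lin_closed[OF assms(2)] lin_add[OF assms(2)]
        lin_smult[OF assms(2)] N.smult_r_minus N.M.minus_add)
qed

lemma lin_diff:
  assumes "module R N" "lin R M N f" "lin R M N g"
  shows "lin R M N (\<lambda>x. f x \<ominus>\<^bsub>N\<^esub> g x)"
  using lin_plus[OF assms(1,2) lin_neg[OF assms(1,3)]] by (simp add: a_minus_def)

lemma lin_const_zero:
  assumes "module R N"
  shows "lin R M N (\<lambda>x. \<zero>\<^bsub>N\<^esub>)"
proof -
  interpret N: module R N by fact
  show ?thesis by (rule linI) simp_all
qed

lemma lin_scale:
  assumes "module R N" "lin R M N f" "r \<in> carrier R"
  shows "lin R M N (\<lambda>x. r \<odot>\<^bsub>N\<^esub> f x)"
proof -
  interpret N: module R N by fact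
  have "r \<odot>\<^bsub>N\<^esub> (s \<odot>\<^bsub>N\<^esub> y) = s \<odot>\<^bsub>N\<^esub> (r \<odot>\<^bsub>N\<^esub> y)" if "s \<in> carrier R" "y \<in> carrier N" for s y
    using that assms(3) by (simp flip: N.smult_assoc1 add: N.R.m_comm)
  then show ?thesis
    by (intro linI)
      (simp_all add: assms(3) lin_closed[OF assms(2)] lin_add[OF assms(2)]
        lin_smult[OF assms(2)] N.smult_r_distr)
qed

lemma lin_sum:
  assumes "module R N" "finite A" "\<And>a. a \<in> A \<Longrightarrow> lin R M N (f a)"
  shows "lin R M N (\<lambda>x. \<Oplus>\<^bsub>N\<^esub>a\<in>A. f a x)"
proof -
  interpret N: module R N by fact
  show ?thesis using assms(2,3)
  proof (induction A rule: finite_induct)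
    case empty
    then show ?case using lin_const_zero[OF assms(1)] by simp
  next
    case (insert a A)
    then have 1: "lin R M N (\<lambda>x. f a x \<oplus>\<^bsub>N\<^esub> (\<Oplus>\<^bsub>N\<^esub>a\<in>A. f a x))"
      by (intro lin_plus[OF assms(1)]) auto
    have 2: "(\<Oplus>\<^bsub>N\<^esub>a\<in>insert a A. f a x) = f a x \<oplus>\<^bsub>N\<^esub> (\<Oplus>\<^bsub>N\<^esub>a\<in>A. f a x)" if "x \<in> carrier M" for x
      using insert(1,2) lin_closed[OF insert(4) that] by (subst N.M.finsum_insert) auto
    show ?case
    proof (rule linI)
      fix x assume "x \<in> carrier M"
      then show "(\<Oplus>\<^bsub>N\<^esub>a\<in>insert a A. f a x) \<in> carrier N"
        using insert.prems lin_closed by (intro N.M.finsum_closed) fastforce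
    next
      fix x y assume xy: "x \<in> carrier M" "y \<in> carrier M"
      then show "(\<Oplus>\<^bsub>N\<^esub>a\<in>insert a A. f a (x \<oplus>\<^bsub>M\<^esub> y)) =
          (\<Oplus>\<^bsub>N\<^esub>a\<in>insert a A. f a x) \<oplus>\<^bsub>N\<^esub> (\<Oplus>\<^bsub>N\<^esub>a\<in>insert a A. f a y)"
        using insert.prems lin_closed lin_add
        by (subst N.M.finsum_addf[symmetric]) (fastforce intro!: N.M.finsum_cong')+
    next
      fix r x assume rx: "r \<in> carrier R" "x \<in> carrier M"
      then show "(\<Oplus>\<^bsub>N\<^esub>a\<in>insert a A. f a (r \<odot>\<^bsub>M\<^esub> x)) = r \<odot>\<^bsub>N\<^esub> (\<Oplus>\<^bsub>N\<^esub>a\<in>insert a A. f a x)"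
        using insert.prems insert.hyps lin_closed lin_smult
        by (subst N.finsum_smult_ldistr) (fastforce intro!: N.M.finsum_cong')+
    qed
  qed
qed

section \<open>Free modules\<close>

locale coeff_ring = cring R for R :: "'r ring" (structure)
begin

abbreviation "bv \<equiv> basis_vec R"

lemma free_carrier:
  "x \<in> carrier (free_module R B) \<longleftrightarrow>
     finite {b. x b \<noteq> \<zero>} \<and> (\<forall>b\<in>B. x b \<in> carrier R) \<and> (\<forall>b. b \<notin> B \<longrightarrow> x b = \<zero>)"
  by (simp add: free_module_def)

lemma free_simps [simp]:
  "\<zero>\<^bsub>free_module R B\<^esub> = (\<lambda>b. \<zero>)"
  "x \<oplus>\<^bsub>free_module R B\<^esub> y = (\<lambda>b. x b \<oplus> y b)"
  "r \<odot>\<^bsub>free_module R B\<^esub> x = (\<lambda>b. r \<otimes> x b)"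
  by (simp_all add: free_module_def)

lemma free_closed: "x \<in> carrier (free_module R B) \<Longrightarrow> x b \<in> carrier R"
  by (cases "b \<in> B") (auto simp: free_carrier)

lemma free_outside: "x \<in> carrier (free_module R B) \<Longrightarrow> b \<notin> B \<Longrightarrow> x b = \<zero>"
  by (auto simp: free_carrier)

lemma free_finite: "x \<in> carrier (free_module R B) \<Longrightarrow> finite {b. x b \<noteq> \<zero>}"
  by (auto simp: free_carrier)

lemma free_supp: "x \<in> carrier (free_module R B) \<Longrightarrow> {b. x b \<noteq> \<zero>} \<subseteq> B"
  by (auto simp: free_carrier)

lemma freeI:
  "finite A \<Longrightarrow> A \<subseteq> B \<Longrightarrow> (\<And>b. b \<in> A \<Longrightarrow> x b \<in> carrier R) \<Longrightarrow> (\<And>b. b \<notin> A \<Longrightarrow> x b = \<zero>)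
    \<Longrightarrow> x \<in> carrier (free_module R B)"
  by (auto simp: free_carrier intro: finite_subset[of _ A]) (metis zero_closed)

lemma free_module_module: "module R (free_module R B)"
proof (rule moduleI[OF is_cring])
  let ?F = "free_module R B"
  have add: "(\<lambda>b. x b \<oplus> y b) \<in> carrier ?F" if "x \<in> carrier ?F" "y \<in> carrier ?F" for x y
  proof (rule freeI[of "{b. x b \<noteq> \<zero>} \<union> {b. y b \<noteq> \<zero>}"])
    show "finite ({b. x b \<noteq> \<zero>} \<union> {b. y b \<noteq> \<zero>})" "{b. x b \<noteq> \<zero>} \<union> {b. y b \<noteq> \<zero>} \<subseteq> B"
      using that by (auto simp: free_carrier)
    show "x b \<oplus> y b \<in> carrier R" for b
      using that by (auto simp: free_closed)
  qed auto
  show "abelian_group ?F"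
  proof (rule abelian_groupI)
    fix x y z assume xyz: "x \<in> carrier ?F" "y \<in> carrier ?F" "z \<in> carrier ?F"
    show "x \<oplus>\<^bsub>?F\<^esub> y \<in> carrier ?F" using add xyz by simp
    show "x \<oplus>\<^bsub>?F\<^esub> y \<oplus>\<^bsub>?F\<^esub> z = x \<oplus>\<^bsub>?F\<^esub> (y \<oplus>\<^bsub>?F\<^esub> z)"
      using xyz by (auto simp: free_closed a_assoc)
    show "x \<oplus>\<^bsub>?F\<^esub> y = y \<oplus>\<^bsub>?F\<^esub> x"
      using xyz by (auto simp: free_closed a_comm)
    show "\<zero>\<^bsub>?F\<^esub> \<oplus>\<^bsub>?F\<^esub> x = x"
      using xyz by (auto simp: free_closed)
    have "(\<lambda>b. \<ominus> x b) \<in> carrier ?F"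
      using xyz by (intro freeI[of "{b. x b \<noteq> \<zero>}"]) (auto simp: free_carrier)
    then show "\<exists>y\<in>carrier ?F. y \<oplus>\<^bsub>?F\<^esub> x = \<zero>\<^bsub>?F\<^esub>"
      using xyz by (intro bexI) (auto simp: free_closed l_neg)
  next
    show "\<zero>\<^bsub>?F\<^esub> \<in> carrier ?F" by (simp add: free_carrier)
  qed
  fix a b x y assume ab: "a \<in> carrier R" "b \<in> carrier R" and xy: "x \<in> carrier ?F" "y \<in> carrier ?F"
  show "a \<odot>\<^bsub>?F\<^esub> x \<in> carrier ?F"
    using ab xy by (simp, intro freeI[of "{b. x b \<noteq> \<zero>}"]) (auto simp: free_carrier)
  show "(a \<oplus> b) \<odot>\<^bsub>?F\<^esub> x = a \<odot>\<^bsub>?F\<^esub> x \<oplus>\<^bsub>?F\<^esub> b \<odot>\<^bsub>?F\<^esub> x"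
    using ab xy by (auto simp: free_closed l_distr)
  show "a \<odot>\<^bsub>?F\<^esub> (x \<oplus>\<^bsub>?F\<^esub> y) = a \<odot>\<^bsub>?F\<^esub> x \<oplus>\<^bsub>?F\<^esub> a \<odot>\<^bsub>?F\<^esub> y"
    using ab xy by (auto simp: free_closed r_distr)
  show "(a \<otimes> b) \<odot>\<^bsub>?F\<^esub> x = a \<odot>\<^bsub>?F\<^esub> (b \<odot>\<^bsub>?F\<^esub> x)"
    using ab xy by (auto simp: free_closed m_assoc)
next
  fix x assume "x \<in> carrier (free_module R B)"
  then show "\<one> \<odot>\<^bsub>free_module R B\<^esub> x = x" by (auto simp: free_closed)
qed

lemma free_uminus:
  assumes "x \<in> carrier (free_module R B)"
  shows "\<ominus>\<^bsub>free_module R B\<^esub> x = (\<lambda>b. \<ominus> x b)"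
proof -
  interpret F: module R "free_module R B" by (rule free_module_module)
  have "\<ominus>\<^bsub>free_module R B\<^esub> x = (\<ominus> \<one>) \<odot>\<^bsub>free_module R B\<^esub> x"
    using F.smult_l_minus[of \<one> x] assms F.smult_one by fastforce
  then show ?thesis using assms by (auto simp: free_closed l_minus)
qed

lemma free_minus:
  assumes "x \<in> carrier (free_module R B)" "y \<in> carrier (free_module R B)"
  shows "x \<ominus>\<^bsub>free_module R B\<^esub> y = (\<lambda>b. x b \<ominus> y b)"
  using assms by (simp add: a_minus_def free_uminus)

lemma free_finsum:
  assumes "finite A" "f \<in> A \<rightarrow> carrier (free_module R B)"
  shows "(\<Oplus>\<^bsub>free_module R B\<^esub>a\<in>A. f a) = (\<lambda>b. \<Oplus>a\<in>A. f a b)"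
proof -
  interpret F: module R "free_module R B" by (rule free_module_module)
  show ?thesis using assms
  proof (induction A rule: finite_induct)
    case empty then show ?case by simp
  next
    case (insert a A)
    then have "f a \<in> carrier (free_module R B)" "f \<in> A \<rightarrow> carrier (free_module R B)" by auto
    then show ?case using insert
      by (subst F.M.finsum_insert, simp_all add: fun_eq_iff, intro allI add.finprod_insert[symmetric])
        (auto intro: free_closed)
  qed
qed

lemma free_mono: "A \<subseteq> B \<Longrightarrow> carrier (free_module R A) \<subseteq> carrier (free_module R B)"
  by (auto simp: free_carrier subset_iff)

lemma basis_vec_closed: "b \<in> B \<Longrightarrow> bv b \<in> carrier (free_module R B)"
  by (rule freeI[of "{b}"]) (auto simp: basis_vec_def)

lemma free_lift_eq_sum:
  assumes "module R N" "x \<in> carrier (free_module R B)" "f \<in> B \<rightarrow> carrier N"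
    "finite A" "{b. x b \<noteq> \<zero>} \<subseteq> A" "A \<subseteq> B"
  shows "free_lift R N f x = (\<Oplus>\<^bsub>N\<^esub>b\<in>A. x b \<odot>\<^bsub>N\<^esub> f b)"
proof -
  interpret N: module R N by fact
  show ?thesis unfolding free_lift_def
    using assms by (intro N.M.add.finprod_mono_neutral_cong_left) (auto simp: free_closed Pi_iff subset_iff)
qed

lemma free_lift_lin:
  assumes "module R N" "f \<in> B \<rightarrow> carrier N"
  shows "lin R (free_module R B) N (free_lift R N f)"
proof -
  interpret N: module R N by fact
  interpret F: module R "free_module R B" by (rule free_module_module)
  let ?S = "\<lambda>x. {b. x b \<noteq> \<zero>}"
  note eq = free_lift_eq_sum[OF assms(1) _ assms(2)]
  show ?thesis
  proof (rule linI)
    fix x assume x: "x \<in> carrier (free_module R B)"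
    show "free_lift R N f x \<in> carrier N"
      unfolding free_lift_def using assms(2) free_supp[OF x] free_closed[OF x]
      by (intro N.M.finsum_closed) (auto intro!: N.smult_closed)
  next
    fix x y assume x: "x \<in> carrier (free_module R B)" and y: "y \<in> carrier (free_module R B)"
    let ?A = "?S x \<union> ?S y"
    have A: "finite ?A" "?A \<subseteq> B" using free_finite[OF x] free_finite[OF y] free_supp[OF x] free_supp[OF y] by auto
    have fA: "f b \<in> carrier N" if "b \<in> ?A" for b using A assms(2) that by auto
    have sub: "?S (x \<oplus>\<^bsub>free_module R B\<^esub> y) \<subseteq> ?A" by auto
    show "free_lift R N f (x \<oplus>\<^bsub>free_module R B\<^esub> y) = free_lift R N f x \<oplus>\<^bsub>N\<^esub> free_lift R N f y"
      unfolding eq[OF F.M.a_closed[OF x y] A(1) sub A(2)] eq[OF x A(1) _ A(2), simplified]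
        eq[OF y A(1) _ A(2), simplified]
    proof -
      have 1: "(\<Oplus>\<^bsub>N\<^esub>b\<in>?A. (x \<oplus>\<^bsub>free_module R B\<^esub> y) b \<odot>\<^bsub>N\<^esub> f b) = (\<Oplus>\<^bsub>N\<^esub>b\<in>?A. x b \<odot>\<^bsub>N\<^esub> f b \<oplus>\<^bsub>N\<^esub> y b \<odot>\<^bsub>N\<^esub> f b)"
        using fA by (intro N.M.finsum_cong') (auto simp: free_closed[OF x] free_closed[OF y] N.smult_l_distr)
      show "(\<Oplus>\<^bsub>N\<^esub>b\<in>?A. (x \<oplus>\<^bsub>free_module R B\<^esub> y) b \<odot>\<^bsub>N\<^esub> f b) =
        (\<Oplus>\<^bsub>N\<^esub>b\<in>?A. x b \<odot>\<^bsub>N\<^esub> f b) \<oplus>\<^bsub>N\<^esub> (\<Oplus>\<^bsub>N\<^esub>b\<in>?A. y b \<odot>\<^bsub>N\<^esub> f b)"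
        unfolding 1 using fA free_closed[OF x] free_closed[OF y]
        by (intro N.M.finsum_addf funcsetI N.smult_closed) auto
    qed
  next
    fix r x assume r: "r \<in> carrier R" and x: "x \<in> carrier (free_module R B)"
    have A: "finite (?S x)" "?S x \<subseteq> B" using free_finite[OF x] free_supp[OF x] by auto
    have fA: "f b \<in> carrier N" if "b \<in> ?S x" for b using A assms(2) that by auto
    have sub: "?S (r \<odot>\<^bsub>free_module R B\<^esub> x) \<subseteq> ?S x" using r by auto
    show "free_lift R N f (r \<odot>\<^bsub>free_module R B\<^esub> x) = r \<odot>\<^bsub>N\<^esub> free_lift R N f x"
      unfolding eq[OF F.smult_closed[OF r x] A(1) sub A(2)] eq[OF x A(1) _ A(2), simplified]
      using fA by (subst N.finsum_smult_ldistr)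
        (auto simp: r A free_closed[OF x] N.smult_assoc1 intro!: N.M.finsum_cong')
  qed
qed

lemma free_lift_basis:
  assumes "module R N" "f b \<in> carrier N"
  shows "free_lift R N f (bv b) = f b"
proof -
  interpret N: module R N by fact
  show ?thesis
  proof -
    have "free_lift R N f (bv b) = (\<Oplus>\<^bsub>N\<^esub>c\<in>{b}. bv b c \<odot>\<^bsub>N\<^esub> f c)"
      using assms(2) by (intro free_lift_eq_sum[OF assms(1) basis_vec_closed[of b "{b}"]]) (auto simp: basis_vec_def)
    then show ?thesis using assms(2) by (simp add: basis_vec_def)
  qed
qed

lemma free_expand:
  assumes "x \<in> carrier (free_module R B)"
  shows "x = (\<Oplus>\<^bsub>free_module R B\<^esub>b\<in>{b. x b \<noteq> \<zero>}. x b \<odot>\<^bsub>free_module R B\<^esub> bv b)"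
proof -
  interpret F: module R "free_module R B" by (rule free_module_module)
  let ?S = "{b. x b \<noteq> \<zero>}"
  have c: "(\<lambda>b. x b \<odot>\<^bsub>free_module R B\<^esub> bv b) \<in> ?S \<rightarrow> carrier (free_module R B)"
    using free_supp[OF assms] free_closed[OF assms] by (intro funcsetI F.smult_closed basis_vec_closed) auto
  show ?thesis
    unfolding free_finsum[OF free_finite[OF assms] c]
  proof
    fix c
    have "(\<Oplus>b\<in>?S. (x b \<odot>\<^bsub>free_module R B\<^esub> bv b) c) = (\<Oplus>b\<in>?S. if c = b then x b else \<zero>)"
      by (intro add.finprod_cong') (auto simp: basis_vec_def free_closed[OF assms])
    also have "\<dots> = x c"
    proof (cases "x c = \<zero>")
      case True
      then have "(\<Oplus>b\<in>?S. if c = b then x b else \<zero>) = (\<Oplus>b\<in>?S. \<zero>)"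
        by (intro add.finprod_cong') auto
      then show ?thesis using True by simp
    next
      case False
      then show ?thesis
        using add.finprod_singleton[of c ?S x] free_finite[OF assms] free_closed[OF assms] by simp
    qed
    finally show "x c = (\<Oplus>b\<in>?S. (x b \<odot>\<^bsub>free_module R B\<^esub> bv b) c)" by simp
  qed
qed

text \<open>
  Linear maps out of a free module are compared through this principle; it hides the finite sums.
\<close>

lemma free_induct [consumes 1, case_names basis zero add smult]:
  assumes "x \<in> carrier (free_module R B)"
    and basis: "\<And>b. b \<in> B \<Longrightarrow> P (bv b)"
    and zero: "P (\<lambda>b. \<zero>)"
    and add: "\<And>x y. x \<in> carrier (free_module R B) \<Longrightarrow> y \<in> carrier (free_module R B) \<Longrightarrow> P x \<Longrightarrow> P y
      \<Longrightarrow> P (\<lambda>b. x b \<oplus> y b)"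
    and smult: "\<And>r x. r \<in> carrier R \<Longrightarrow> x \<in> carrier (free_module R B) \<Longrightarrow> P x \<Longrightarrow> P (\<lambda>b. r \<otimes> x b)"
  shows "P x"
proof -
  interpret F: module R "free_module R B" by (rule free_module_module)
  have *: "(\<Oplus>\<^bsub>free_module R B\<^esub>b\<in>A. x b \<odot>\<^bsub>free_module R B\<^esub> bv b) \<in> carrier (free_module R B) \<and>
      P (\<Oplus>\<^bsub>free_module R B\<^esub>b\<in>A. x b \<odot>\<^bsub>free_module R B\<^esub> bv b)"
    if "finite A" "A \<subseteq> B" for A
    using that
  proof (induction A rule: finite_induct)
    case empty
    then show ?case using zero by simp (simp add: free_carrier)
  next
    case (insert b A)
    have mem: "x c \<odot>\<^bsub>free_module R B\<^esub> bv c \<in> carrier (free_module R B)" if "c \<in> B" for c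
      using that free_closed[OF assms(1)] by (intro F.smult_closed basis_vec_closed) auto
    have "P (x b \<odot>\<^bsub>free_module R B\<^esub> bv b)"
      using smult[OF free_closed[OF assms(1)] basis_vec_closed[of b B] basis[of b]] insert.prems by simp
    then have "P ((x b \<odot>\<^bsub>free_module R B\<^esub> bv b) \<oplus>\<^bsub>free_module R B\<^esub>
        (\<Oplus>\<^bsub>free_module R B\<^esub>b\<in>A. x b \<odot>\<^bsub>free_module R B\<^esub> bv b))"
      using add[OF mem[of b], of "\<Oplus>\<^bsub>free_module R B\<^esub>b\<in>A. x b \<odot>\<^bsub>free_module R B\<^esub> bv b"] insert by simp
    moreover have "(\<Oplus>\<^bsub>free_module R B\<^esub>b\<in>insert b A. x b \<odot>\<^bsub>free_module R B\<^esub> bv b) =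
       (x b \<odot>\<^bsub>free_module R B\<^esub> bv b) \<oplus>\<^bsub>free_module R B\<^esub>
        (\<Oplus>\<^bsub>free_module R B\<^esub>b\<in>A. x b \<odot>\<^bsub>free_module R B\<^esub> bv b)"
      using insert mem by (intro F.M.finsum_insert) auto
    ultimately show ?case
      using F.M.a_closed[OF mem[of b]] insert by (metis (no_types, lifting) insert_subset)
  qed
  show ?thesis
    using *[OF free_finite[OF assms(1)] free_supp[OF assms(1)]] free_expand[OF assms(1)] by simp
qed

lemma free_lin_eq:
  assumes "module R N" "lin R (free_module R B) N f" "lin R (free_module R B) N g"
    "\<And>b. b \<in> B \<Longrightarrow> f (bv b) = g (bv b)" "x \<in> carrier (free_module R B)"
  shows "f x = g x"
  using assms(5)
proof (induction rule: free_induct)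
  case (basis b)
  then show ?case by fact
next
  case zero
  then show ?case
    using lin_zero[OF free_module_module assms(1,2)] lin_zero[OF free_module_module assms(1,3)] by simp
next
  case (add x y)
  then show ?case
    using lin_add[OF assms(2) add(1,2)] lin_add[OF assms(3) add(1,2)] by simp
next
  case (smult r x)
  then show ?case
    using lin_smult[OF assms(2) smult(1,2)] lin_smult[OF assms(3) smult(1,2)] by simp
qed

end

section \<open>Quotients, products and tensor products\<close>

context coeff_ring
begin

lemma module_minus_eq:
  assumes "module R M" "x \<in> carrier M" "y \<in> carrier M"
  shows "x \<ominus>\<^bsub>M\<^esub> y = \<zero>\<^bsub>M\<^esub> \<longleftrightarrow> x = y"
proof -
  interpret M: module R M by fact
  show ?thesis using assms(2,3)
    by (metis a_minus_def M.M.minus_equality M.M.minus_minus M.M.a_inv_closed M.M.r_neg)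
qed

lemma submodule_abelian_subgroup:
  assumes "module R M" "submodule H R M"
  shows "abelian_subgroup H M"
proof -
  interpret M: module R M by fact
  show ?thesis
    using assms(2) by (intro abelian_subgroupI3 additive_subgroupI M.M.abelian_group_axioms) (rule submodule.axioms(1))
qed

lemma lin_kernel_submodule:
  assumes "module R M" "module R N" "lin R M N f"
  shows "submodule {x \<in> carrier M. f x = \<zero>\<^bsub>N\<^esub>} R M"
proof -
  interpret M: module R M by fact
  interpret N: module R N by fact
  show ?thesis
    by (rule M.submoduleI)
      (auto simp: lin_zero[OF assms] lin_add[OF assms(3)] lin_uminus[OF assms] lin_smult[OF assms(3)])
qed

lemma lin_image_submodule:
  assumes "module R M" "module R N" "lin R M N f"
  shows "submodule (f ` carrier M) R N"
proof -
  interpret M: module R M by fact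
  interpret N: module R N by fact
  show ?thesis
  proof (rule N.submoduleI)
    show "f ` carrier M \<subseteq> carrier N" using lin_closed[OF assms(3)] by auto
    show "\<zero>\<^bsub>N\<^esub> \<in> f ` carrier M" using lin_zero[OF assms] by (metis M.M.zero_closed imageI)
    show "\<ominus>\<^bsub>N\<^esub> a \<in> f ` carrier M" if "a \<in> f ` carrier M" for a
      using that lin_uminus[OF assms] by (metis (no_types, lifting) M.M.a_inv_closed imageE imageI)
    show "a \<oplus>\<^bsub>N\<^esub> b \<in> f ` carrier M" if "a \<in> f ` carrier M" "b \<in> f ` carrier M" for a b
      using that lin_add[OF assms(3)] by (metis (no_types, lifting) M.M.a_closed imageE imageI)
    show "r \<odot>\<^bsub>N\<^esub> a \<in> f ` carrier M" if "r \<in> carrier R" "a \<in> f ` carrier M" for r a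
      using that lin_smult[OF assms(3)] by (metis (no_types, lifting) M.smult_closed imageE imageI)
  qed
qed

lemma coset_eq_iff:
  assumes "module R M" "submodule H R M" "x \<in> carrier M" "y \<in> carrier M"
  shows "H +>\<^bsub>M\<^esub> x = H +>\<^bsub>M\<^esub> y \<longleftrightarrow> x \<ominus>\<^bsub>M\<^esub> y \<in> H"
proof -
  interpret M: module R M by fact
  interpret H: abelian_subgroup H M by (rule submodule_abelian_subgroup[OF assms(1,2)])
  show ?thesis
    unfolding a_minus_def H.a_rcos_module[OF assms(4,3), symmetric]
    using H.a_repr_independence'[OF _ assms(4), of x] H.a_rcos_self[OF assms(3)] by metis
qed

lemma coset_self:
  assumes "module R M" "submodule H R M" "x \<in> carrier M"
  shows "x \<in> H +>\<^bsub>M\<^esub> x"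
proof -
  interpret H: abelian_subgroup H M by (rule submodule_abelian_subgroup[OF assms(1,2)])
  show ?thesis using assms(3) by (rule H.a_rcos_self)
qed

lemma coset_mem:
  assumes "module R M" "submodule H R M" "x \<in> carrier M" "y \<in> H +>\<^bsub>M\<^esub> x"
  shows "y \<in> carrier M" "H +>\<^bsub>M\<^esub> y = H +>\<^bsub>M\<^esub> x"
proof -
  interpret M: module R M by fact
  interpret H: abelian_subgroup H M by (rule submodule_abelian_subgroup[OF assms(1,2)])
  show "y \<in> carrier M" using assms(3,4) by (rule H.a_elemrcos_carrier)
  show "H +>\<^bsub>M\<^esub> y = H +>\<^bsub>M\<^esub> x" using H.a_repr_independence'[OF assms(4,3)] by simp
qed

lemma quot_carrier: "carrier (quot_module M H) = (\<lambda>x. H +>\<^bsub>M\<^esub> x) ` carrier M"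
  by (auto simp: quot_module_def A_RCOSETS_def' a_r_coset_def')

lemma quot_zero:
  assumes "module R M" "submodule H R M"
  shows "\<zero>\<^bsub>quot_module M H\<^esub> = H +>\<^bsub>M\<^esub> \<zero>\<^bsub>M\<^esub>"
proof -
  interpret M: module R M by fact
  interpret H: abelian_subgroup H M by (rule submodule_abelian_subgroup[OF assms])
  show ?thesis using M.M.a_coset_add_zero[OF H.a_subset] by (simp add: quot_module_def)
qed

lemma quot_add:
  assumes "module R M" "submodule H R M" "x \<in> carrier M" "y \<in> carrier M"
  shows "(H +>\<^bsub>M\<^esub> x) \<oplus>\<^bsub>quot_module M H\<^esub> (H +>\<^bsub>M\<^esub> y) = H +>\<^bsub>M\<^esub> (x \<oplus>\<^bsub>M\<^esub> y)"
proof -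
  interpret M: module R M by fact
  interpret H: abelian_subgroup H M by (rule submodule_abelian_subgroup[OF assms(1,2)])
  show ?thesis using H.a_rcos_sum[OF assms(3,4)] by (simp add: quot_module_def)
qed

lemma quot_smult:
  assumes "module R M" "submodule H R M" "r \<in> carrier R" "x \<in> carrier M"
  shows "r \<odot>\<^bsub>quot_module M H\<^esub> (H +>\<^bsub>M\<^esub> x) = H +>\<^bsub>M\<^esub> (r \<odot>\<^bsub>M\<^esub> x)"
proof -
  interpret M: module R M by fact
  interpret H: submodule H R M by fact
  have *: "H +>\<^bsub>M\<^esub> (r \<odot>\<^bsub>M\<^esub> y) = H +>\<^bsub>M\<^esub> (r \<odot>\<^bsub>M\<^esub> x)" if "y \<in> H +>\<^bsub>M\<^esub> x" for y
  proof -
    have y: "y \<in> carrier M" "y \<ominus>\<^bsub>M\<^esub> x \<in> H"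
      using coset_mem[OF assms(1,2,4) that] coset_eq_iff[OF assms(1,2) _ assms(4)] by auto
    have "r \<odot>\<^bsub>M\<^esub> y \<ominus>\<^bsub>M\<^esub> r \<odot>\<^bsub>M\<^esub> x = r \<odot>\<^bsub>M\<^esub> (y \<ominus>\<^bsub>M\<^esub> x)"
      using y(1) assms(3,4) by (simp add: a_minus_def M.smult_r_distr M.smult_r_minus)
    then show ?thesis
      using y assms(3,4) by (simp add: coset_eq_iff[OF assms(1,2)])
  qed
  have "(\<Union>y\<in>H +>\<^bsub>M\<^esub> x. H +>\<^bsub>M\<^esub> (r \<odot>\<^bsub>M\<^esub> y)) = (\<Union>y\<in>H +>\<^bsub>M\<^esub> x. H +>\<^bsub>M\<^esub> (r \<odot>\<^bsub>M\<^esub> x))"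
    by (intro SUP_cong refl *)
  also have "\<dots> = H +>\<^bsub>M\<^esub> (r \<odot>\<^bsub>M\<^esub> x)" using coset_self[OF assms(1,2,4)] by blast
  finally show ?thesis by (simp add: quot_module_def)
qed

lemma quot_module_module:
  assumes "module R M" "submodule H R M"
  shows "module R (quot_module M H)"
proof -
  interpret M: module R M by fact
  note s = quot_carrier quot_zero[OF assms] quot_add[OF assms] quot_smult[OF assms]
  show ?thesis
  proof (rule moduleI[OF is_cring])
    show "abelian_group (quot_module M H)"
    proof (rule abelian_groupI)
      fix C assume "C \<in> carrier (quot_module M H)"
      then obtain x where "x \<in> carrier M" "C = H +>\<^bsub>M\<^esub> x" by (auto simp: s)
      then show "\<exists>Y\<in>carrier (quot_module M H). Y \<oplus>\<^bsub>quot_module M H\<^esub> C = \<zero>\<^bsub>quot_module M H\<^esub>"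
        by (intro bexI[of _ "H +>\<^bsub>M\<^esub> (\<ominus>\<^bsub>M\<^esub> x)"]) (auto simp: s M.M.l_neg)
    qed (auto simp: s M.M.a_ac)
  qed (auto simp: s M.smult_l_distr M.smult_r_distr M.smult_assoc1)
qed

lemma quot_proj_lin:
  assumes "module R M" "submodule H R M"
  shows "lin R M (quot_module M H) (\<lambda>x. H +>\<^bsub>M\<^esub> x)"
  by (rule linI) (auto simp: quot_carrier quot_add[OF assms] quot_smult[OF assms])

lemma coset_lift_coset:
  assumes "module R M" "submodule H R M" "module R N" "lin R M N f" "\<And>x. x \<in> H \<Longrightarrow> f x = \<zero>\<^bsub>N\<^esub>"
    "x \<in> carrier M"
  shows "coset_lift f (H +>\<^bsub>M\<^esub> x) = f x"
proof -
  interpret M: module R M by fact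
  interpret N: module R N by fact
  have "f y = f x" if "y \<in> H +>\<^bsub>M\<^esub> x" for y
  proof -
    have y: "y \<in> carrier M" "y \<ominus>\<^bsub>M\<^esub> x \<in> H"
      using coset_mem[OF assms(1,2,6) that] coset_eq_iff[OF assms(1,2) _ assms(6)] by auto
    then have "f y \<ominus>\<^bsub>N\<^esub> f x = \<zero>\<^bsub>N\<^esub>" using assms(5) lin_minus[OF assms(1,3,4) y(1) assms(6)] by simp
    then show ?thesis using lin_closed[OF assms(4)] y(1) assms(6) by (simp add: module_minus_eq[OF assms(3)])
  qed
  then have "f ` (H +>\<^bsub>M\<^esub> x) = {f x}" using coset_self[OF assms(1,2,6)] by blast
  then show ?thesis by (simp add: coset_lift_def)
qed

lemma coset_lift_lin:
  assumes "module R M" "submodule H R M" "module R N" "lin R M N f" "\<And>x. x \<in> H \<Longrightarrow> f x = \<zero>\<^bsub>N\<^esub>"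
  shows "lin R (quot_module M H) N (coset_lift f)"
proof -
  interpret M: module R M by fact
  note s = coset_lift_coset[OF assms]
  show ?thesis
    by (rule linI)
      (auto simp: quot_carrier quot_add[OF assms(1,2)] quot_smult[OF assms(1,2)] s lin_closed[OF assms(4)]
        lin_add[OF assms(4)] lin_smult[OF assms(4)])
qed

lemma submod_span_submodule:
  assumes "module R M" "A \<subseteq> carrier M"
  shows "submodule (submod_span R M A) R M"
proof -
  interpret M: module R M by fact
  let ?S = "{H. submodule H R M \<and> A \<subseteq> H}"
  have c: "carrier M \<in> ?S" using M.carrier_is_submodule assms(2) by auto
  show ?thesis
    unfolding submod_span_def
  proof (rule M.submoduleI)
    show "\<Inter> ?S \<subseteq> carrier M" using c by blast
  qed (auto intro: M.submoduleE subgroup.one_closed[OF submodule.axioms(1), simplified])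
qed

lemma submod_span_superset: "A \<subseteq> submod_span R M A"
  by (auto simp: submod_span_def)

lemma submod_span_least: "submodule H R M \<Longrightarrow> A \<subseteq> H \<Longrightarrow> submod_span R M A \<subseteq> H"
  by (auto simp: submod_span_def)

lemma lin_vanish_span:
  assumes "module R M" "module R N" "lin R M N f" "A \<subseteq> carrier M" "\<And>a. a \<in> A \<Longrightarrow> f a = \<zero>\<^bsub>N\<^esub>"
    "x \<in> submod_span R M A"
  shows "f x = \<zero>\<^bsub>N\<^esub>"
  using submod_span_least[OF lin_kernel_submodule[OF assms(1-3)], of A] assms(4-6) by blast

text \<open>
  Coordinates are changed by function update, the form in which the relations of \<^const>\<open>tensor\<close> are
  stated.
\<close>

definition multilin :: "'i set \<Rightarrow> ('i \<Rightarrow> ('r, 'm) module) \<Rightarrow> ('r, 'n) module \<Rightarrow> (('i \<Rightarrow> 'm) \<Rightarrow> 'n) \<Rightarrow> bool" where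
  "multilin I M N b \<longleftrightarrow>
    (\<forall>m \<in> (\<Pi>\<^sub>E i\<in>I. carrier (M i)). b m \<in> carrier N) \<and>
    (\<forall>m \<in> (\<Pi>\<^sub>E i\<in>I. carrier (M i)). \<forall>i \<in> I. \<forall>x \<in> carrier (M i). \<forall>y \<in> carrier (M i).
       b (m(i := x \<oplus>\<^bsub>M i\<^esub> y)) = b (m(i := x)) \<oplus>\<^bsub>N\<^esub> b (m(i := y))) \<and>
    (\<forall>m \<in> (\<Pi>\<^sub>E i\<in>I. carrier (M i)). \<forall>i \<in> I. \<forall>r \<in> carrier R. \<forall>x \<in> carrier (M i).
       b (m(i := r \<odot>\<^bsub>M i\<^esub> x)) = r \<odot>\<^bsub>N\<^esub> b (m(i := x)))"

lemma PiE_upd: "m \<in> (\<Pi>\<^sub>E i\<in>I. A i) \<Longrightarrow> i \<in> I \<Longrightarrow> x \<in> A i \<Longrightarrow> m(i := x) \<in> (\<Pi>\<^sub>E i\<in>I. A i)"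
  by (auto simp: PiE_iff extensional_def)

lemma tensor_free_module: "module R (tensor_free R I M)"
  unfolding tensor_free_def by (rule free_module_module)

lemma tensor_rels_closed:
  assumes "\<And>i. i \<in> I \<Longrightarrow> module R (M i)"
  shows "tensor_rels R I M \<subseteq> carrier (tensor_free R I M)"
proof -
  interpret F: module R "tensor_free R I M" by (rule tensor_free_module)
  have e: "bv (m(i := x)) \<in> carrier (tensor_free R I M)"
    if "m \<in> (\<Pi>\<^sub>E i\<in>I. carrier (M i))" "i \<in> I" "x \<in> carrier (M i)" for m i x
    using that unfolding tensor_free_def by (intro basis_vec_closed PiE_upd) auto
  have "x \<oplus>\<^bsub>M i\<^esub> y \<in> carrier (M i)" if "i \<in> I" "x \<in> carrier (M i)" "y \<in> carrier (M i)" for x y i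
    using assms[OF that(1)] that(2,3) by (meson abelian_monoid.a_closed abelian_group_def module_def)
  moreover have "r \<odot>\<^bsub>M i\<^esub> x \<in> carrier (M i)" if "i \<in> I" "r \<in> carrier R" "x \<in> carrier (M i)" for r x i
    using assms[OF that(1)] that(2,3) by (meson module.smult_closed)
  ultimately show ?thesis
    unfolding tensor_rels_def Let_def by (auto intro!: e F.M.minus_closed F.M.a_closed F.smult_closed)
qed

lemma tensor_null_submodule:
  assumes "\<And>i. i \<in> I \<Longrightarrow> module R (M i)"
  shows "submodule (tensor_null R I M) R (tensor_free R I M)"
  unfolding tensor_null_def
  by (rule submod_span_submodule[OF tensor_free_module tensor_rels_closed[OF assms]])

lemma tensor_module:
  assumes "\<And>i. i \<in> I \<Longrightarrow> module R (M i)"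
  shows "module R (tensor R I M)"
  unfolding tensor_def by (rule quot_module_module[OF tensor_free_module tensor_null_submodule[OF assms]])

lemma tensor_proj_lin:
  assumes "\<And>i. i \<in> I \<Longrightarrow> module R (M i)"
  shows "lin R (tensor_free R I M) (tensor R I M) (\<lambda>x. tensor_null R I M +>\<^bsub>tensor_free R I M\<^esub> x)"
  unfolding tensor_def by (rule quot_proj_lin[OF tensor_free_module tensor_null_submodule[OF assms]])

lemma tensor_pure_closed:
  assumes "\<And>i. i \<in> I \<Longrightarrow> module R (M i)" "m \<in> (\<Pi> i\<in>I. carrier (M i))"
  shows "tensor_pure R I M m \<in> carrier (tensor R I M)"
  unfolding tensor_pure_def using assms(2)
  by (intro lin_closed[OF tensor_proj_lin[OF assms(1)]])
    (auto simp: tensor_free_def intro!: basis_vec_closed)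

lemma tensor_pure_multilin:
  assumes "\<And>i. i \<in> I \<Longrightarrow> module R (M i)"
  shows "multilin I M (tensor R I M) (tensor_pure R I M)"
proof -
  interpret F: module R "tensor_free R I M" by (rule tensor_free_module)
  note sub = tensor_null_submodule[of I M, OF assms]
  have e: "bv (m(i := x)) \<in> carrier (tensor_free R I M)"
    if "m \<in> (\<Pi>\<^sub>E i\<in>I. carrier (M i))" "i \<in> I" "x \<in> carrier (M i)" for m i x
    using that unfolding tensor_free_def by (intro basis_vec_closed PiE_upd) auto
  have add: "x \<oplus>\<^bsub>M i\<^esub> y \<in> carrier (M i)" if "i \<in> I" "x \<in> carrier (M i)" "y \<in> carrier (M i)" for x y i
    using assms[OF that(1)] that(2,3) by (meson abelian_monoid.a_closed abelian_group_def module_def)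
  have sm: "r \<odot>\<^bsub>M i\<^esub> x \<in> carrier (M i)" if "i \<in> I" "r \<in> carrier R" "x \<in> carrier (M i)" for r x i
    using assms[OF that(1)] that(2,3) by (meson module.smult_closed)
  have rs: "restrict (m(i := x)) I = m(i := x)" if "m \<in> (\<Pi>\<^sub>E i\<in>I. carrier (M i))" "i \<in> I" for m i x
    using that by (auto simp: fun_eq_iff PiE_iff extensional_def)
  have span: "tensor_rels R I M \<subseteq> tensor_null R I M"
    unfolding tensor_null_def by (rule submod_span_superset)
  show ?thesis
    unfolding multilin_def
  proof (intro conjI ballI)
    fix m assume "m \<in> (\<Pi>\<^sub>E i\<in>I. carrier (M i))"
    then show "tensor_pure R I M m \<in> carrier (tensor R I M)" by (intro tensor_pure_closed[OF assms]) auto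
  next
    fix m i x y assume m: "m \<in> (\<Pi>\<^sub>E i\<in>I. carrier (M i))" "i \<in> I" "x \<in> carrier (M i)" "y \<in> carrier (M i)"
    note s = rs[OF m(1,2)]
    have "bv (m(i := x \<oplus>\<^bsub>M i\<^esub> y)) \<ominus>\<^bsub>tensor_free R I M\<^esub>
       (bv (m(i := x)) \<oplus>\<^bsub>tensor_free R I M\<^esub> bv (m(i := y))) \<in> tensor_rels R I M"
      unfolding tensor_rels_def Let_def using m by blast
    then have "tensor_null R I M +>\<^bsub>tensor_free R I M\<^esub> bv (m(i := x \<oplus>\<^bsub>M i\<^esub> y)) =
      tensor_null R I M +>\<^bsub>tensor_free R I M\<^esub>
        (bv (m(i := x)) \<oplus>\<^bsub>tensor_free R I M\<^esub> bv (m(i := y)))"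
      using span m add e by (subst coset_eq_iff[OF tensor_free_module sub]) auto
    then show "tensor_pure R I M (m(i := x \<oplus>\<^bsub>M i\<^esub> y)) =
      tensor_pure R I M (m(i := x)) \<oplus>\<^bsub>tensor R I M\<^esub> tensor_pure R I M (m(i := y))"
      unfolding tensor_pure_def s using e[OF m(1,2)] m(3,4) lin_add[OF tensor_proj_lin[of I M, OF assms]] by simp
  next
    fix m i r x assume m: "m \<in> (\<Pi>\<^sub>E i\<in>I. carrier (M i))" "i \<in> I" "r \<in> carrier R" "x \<in> carrier (M i)"
    note s = rs[OF m(1,2)]
    have "bv (m(i := r \<odot>\<^bsub>M i\<^esub> x)) \<ominus>\<^bsub>tensor_free R I M\<^esub>
       r \<odot>\<^bsub>tensor_free R I M\<^esub> bv (m(i := x)) \<in> tensor_rels R I M"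
      unfolding tensor_rels_def Let_def using m by blast
    then have "tensor_null R I M +>\<^bsub>tensor_free R I M\<^esub> bv (m(i := r \<odot>\<^bsub>M i\<^esub> x)) =
      tensor_null R I M +>\<^bsub>tensor_free R I M\<^esub> (r \<odot>\<^bsub>tensor_free R I M\<^esub> bv (m(i := x)))"
      using span m sm e by (subst coset_eq_iff[OF tensor_free_module sub]) auto
    then show "tensor_pure R I M (m(i := r \<odot>\<^bsub>M i\<^esub> x)) =
      r \<odot>\<^bsub>tensor R I M\<^esub> tensor_pure R I M (m(i := x))"
      unfolding tensor_pure_def s using e[OF m(1,2)] m(3,4) lin_smult[OF tensor_proj_lin[of I M, OF assms]] by simp
  qed
qed

lemma tensor_lift:
  assumes "\<And>i. i \<in> I \<Longrightarrow> module R (M i)" "module R N" "multilin I M N b"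
  shows "lin R (tensor R I M) N (tensor_lift R N b)"
    and "m \<in> (\<Pi>\<^sub>E i\<in>I. carrier (M i)) \<Longrightarrow> tensor_lift R N b (tensor_pure R I M m) = b m"
proof -
  interpret F: module R "tensor_free R I M" by (rule tensor_free_module)
  interpret N: module R N by fact
  have bc: "b m \<in> carrier N" if "m \<in> (\<Pi>\<^sub>E i\<in>I. carrier (M i))" for m using that assms(3) by (simp add: multilin_def)
  then have bc': "b \<in> (\<Pi>\<^sub>E i\<in>I. carrier (M i)) \<rightarrow> carrier N" by blast
  have l: "lin R (tensor_free R I M) N (free_lift R N b)"
    unfolding tensor_free_def by (rule free_lift_lin[OF assms(2) bc'])
  have e: "bv (m(i := x)) \<in> carrier (tensor_free R I M)"
    if "m \<in> (\<Pi>\<^sub>E i\<in>I. carrier (M i))" "i \<in> I" "x \<in> carrier (M i)" for m i x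
    using that unfolding tensor_free_def by (intro basis_vec_closed PiE_upd) auto
  have eb: "free_lift R N b (bv (m(i := x))) = b (m(i := x))"
    if "m \<in> (\<Pi>\<^sub>E i\<in>I. carrier (M i))" "i \<in> I" "x \<in> carrier (M i)" for m i x
    using that by (intro free_lift_basis[OF assms(2)] bc PiE_upd) auto
  have bu: "b (m(i := x)) \<in> carrier N"
    if "m \<in> (\<Pi>\<^sub>E i\<in>I. carrier (M i))" "i \<in> I" "x \<in> carrier (M i)" for m i x
    using that by (intro bc PiE_upd) auto
  have add: "x \<oplus>\<^bsub>M i\<^esub> y \<in> carrier (M i)" if "i \<in> I" "x \<in> carrier (M i)" "y \<in> carrier (M i)" for x y i
    using assms(1)[OF that(1)] that(2,3) by (meson abelian_monoid.a_closed abelian_group_def module_def)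
  have sm: "r \<odot>\<^bsub>M i\<^esub> x \<in> carrier (M i)" if "i \<in> I" "r \<in> carrier R" "x \<in> carrier (M i)" for r x i
    using assms(1)[OF that(1)] that(2,3) by (meson module.smult_closed)
  have rel: "free_lift R N b z = \<zero>\<^bsub>N\<^esub>" if "z \<in> tensor_rels R I M" for z
    using that unfolding tensor_rels_def Let_def
  proof (elim UnE CollectE exE conjE)
    fix m i x y
    assume z: "z = bv (m(i := x \<oplus>\<^bsub>M i\<^esub> y)) \<ominus>\<^bsub>tensor_free R I M\<^esub>
       (bv (m(i := x)) \<oplus>\<^bsub>tensor_free R I M\<^esub> bv (m(i := y)))"
      and m: "m \<in> (\<Pi>\<^sub>E i\<in>I. carrier (M i))" "i \<in> I" "x \<in> carrier (M i)" "y \<in> carrier (M i)"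
    have "b (m(i := x \<oplus>\<^bsub>M i\<^esub> y)) = b (m(i := x)) \<oplus>\<^bsub>N\<^esub> b (m(i := y))"
      using assms(3) m by (simp add: multilin_def)
    then show ?thesis
      using m e[OF m(1,2)] add[OF m(2-4)] bu[OF m(1,2)]
      by (simp add: z lin_minus[OF tensor_free_module assms(2) l] lin_add[OF l] eb module_minus_eq[OF assms(2)])
  next
    fix m i r x
    assume z: "z = bv (m(i := r \<odot>\<^bsub>M i\<^esub> x)) \<ominus>\<^bsub>tensor_free R I M\<^esub>
       r \<odot>\<^bsub>tensor_free R I M\<^esub> bv (m(i := x))"
      and m: "m \<in> (\<Pi>\<^sub>E i\<in>I. carrier (M i))" "i \<in> I" "r \<in> carrier R" "x \<in> carrier (M i)"
    have "b (m(i := r \<odot>\<^bsub>M i\<^esub> x)) = r \<odot>\<^bsub>N\<^esub> b (m(i := x))"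
      using assms(3) m by (simp add: multilin_def)
    then show ?thesis
      using m e[OF m(1,2)] sm[OF m(2-4)] bu[OF m(1,2)]
      by (simp add: z lin_minus[OF tensor_free_module assms(2) l] lin_smult[OF l] eb module_minus_eq[OF assms(2)])
  qed
  have null: "free_lift R N b z = \<zero>\<^bsub>N\<^esub>" if "z \<in> tensor_null R I M" for z
    using that lin_vanish_span[OF tensor_free_module assms(2) l tensor_rels_closed[OF assms(1)] rel]
    unfolding tensor_null_def by blast
  show "lin R (tensor R I M) N (tensor_lift R N b)"
    unfolding tensor_lift_def tensor_def
    using null by (intro coset_lift_lin[OF tensor_free_module tensor_null_submodule[OF assms(1)] assms(2) l])
  assume m: "m \<in> (\<Pi>\<^sub>E i\<in>I. carrier (M i))"
  then have "bv m \<in> carrier (tensor_free R I M)"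
    unfolding tensor_free_def by (rule basis_vec_closed)
  then show "tensor_lift R N b (tensor_pure R I M m) = b m"
    unfolding tensor_lift_def tensor_pure_def PiE_restrict[OF m]
    using null by (subst coset_lift_coset[OF tensor_free_module tensor_null_submodule[OF assms(1)] assms(2) l])
      (auto simp: free_lift_basis[where f=b, OF assms(2) bc[OF m]])
qed

lemma tensor_lin_eq:
  assumes "\<And>i. i \<in> I \<Longrightarrow> module R (M i)" "module R N"
    "lin R (tensor R I M) N f" "lin R (tensor R I M) N g"
    "\<And>m. m \<in> (\<Pi>\<^sub>E i\<in>I. carrier (M i)) \<Longrightarrow> f (tensor_pure R I M m) = g (tensor_pure R I M m)"
    "x \<in> carrier (tensor R I M)"
  shows "f x = g x"
proof -
  let ?p = "\<lambda>x. tensor_null R I M +>\<^bsub>tensor_free R I M\<^esub> x"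
  obtain y where y: "y \<in> carrier (free_module R (\<Pi>\<^sub>E i\<in>I. carrier (M i)))" "x = ?p y"
    using assms(6) unfolding tensor_def quot_carrier tensor_free_def by auto
  have p: "lin R (free_module R (\<Pi>\<^sub>E i\<in>I. carrier (M i))) (tensor R I M) ?p"
    using tensor_proj_lin[of I M, OF assms(1)] by (simp add: tensor_free_def)
  have "f (?p y) = g (?p y)"
  proof (rule free_lin_eq[OF assms(2) lin_comp[OF p assms(3)] lin_comp[OF p assms(4)] _ y(1)])
    fix m assume m: "m \<in> (\<Pi>\<^sub>E i\<in>I. carrier (M i))"
    then show "f (?p (bv m)) = g (?p (bv m))"
      using assms(5)[OF m] unfolding tensor_pure_def PiE_restrict[OF m] by simp
  qed
  then show ?thesis using y(2) by simp
qed

lemma multilin_comp: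
  assumes "multilin I N P b" "\<And>i. i \<in> I \<Longrightarrow> lin R (M i) (N i) (f i)"
  shows "multilin I M P (\<lambda>m. b (\<lambda>i\<in>I. f i (m i)))"
proof -
  have c: "(\<lambda>i\<in>I. f i (m i)) \<in> (\<Pi>\<^sub>E i\<in>I. carrier (N i))" if "m \<in> (\<Pi>\<^sub>E i\<in>I. carrier (M i))" for m
    using that lin_closed[OF assms(2)] by (auto simp: PiE_iff)
  have u: "(\<lambda>j\<in>I. f j ((m(i := x)) j)) = (\<lambda>j\<in>I. f j (m j))(i := f i x)" if "i \<in> I" for m i x
    using that by (auto simp: fun_eq_iff)
  show ?thesis
    unfolding multilin_def
  proof (intro conjI ballI)
    fix m assume "m \<in> (\<Pi>\<^sub>E i\<in>I. carrier (M i))"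
    then show "b (\<lambda>i\<in>I. f i (m i)) \<in> carrier P" using c assms(1) by (simp add: multilin_def)
  next
    fix m i x y assume m: "m \<in> (\<Pi>\<^sub>E i\<in>I. carrier (M i))" "i \<in> I" "x \<in> carrier (M i)" "y \<in> carrier (M i)"
    then show "b (\<lambda>j\<in>I. f j ((m(i := x \<oplus>\<^bsub>M i\<^esub> y)) j)) =
        b (\<lambda>j\<in>I. f j ((m(i := x)) j)) \<oplus>\<^bsub>P\<^esub> b (\<lambda>j\<in>I. f j ((m(i := y)) j))"
      using c[OF m(1)] assms(1) lin_closed[OF assms(2)] lin_add[OF assms(2)[OF m(2)] m(3,4)]
      unfolding u[OF m(2)] by (simp add: multilin_def)
  next
    fix m i r x assume m: "m \<in> (\<Pi>\<^sub>E i\<in>I. carrier (M i))" "i \<in> I" "r \<in> carrier R" "x \<in> carrier (M i)"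
    then show "b (\<lambda>j\<in>I. f j ((m(i := r \<odot>\<^bsub>M i\<^esub> x)) j)) =
        r \<odot>\<^bsub>P\<^esub> b (\<lambda>j\<in>I. f j ((m(i := x)) j))"
      using c[OF m(1)] assms(1) lin_closed[OF assms(2)] lin_smult[OF assms(2)[OF m(2)] m(3,4)]
      unfolding u[OF m(2)] by (simp add: multilin_def)
  qed
qed

lemma multilin_post:
  assumes "multilin I M N b" "lin R N P f"
  shows "multilin I M P (\<lambda>m. f (b m))"
  using assms(1) unfolding multilin_def
  by (simp add: lin_closed[OF assms(2)] lin_add[OF assms(2)] lin_smult[OF assms(2)] PiE_upd)

lemma tensor_pure_restrict: "tensor_pure R I M (restrict m I) = tensor_pure R I M m"
  by (simp add: tensor_pure_def)

lemma tensor_pure_cong: "(\<And>i. i \<in> I \<Longrightarrow> m i = m' i) \<Longrightarrow> tensor_pure R I M m = tensor_pure R I M m'"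
  unfolding tensor_pure_def by (metis restrict_ext)

lemma tensor_map:
  assumes "\<And>i. i \<in> I \<Longrightarrow> module R (M i)" "\<And>i. i \<in> I \<Longrightarrow> module R (N i)"
    "\<And>i. i \<in> I \<Longrightarrow> lin R (M i) (N i) (f i)"
  shows "lin R (tensor R I M) (tensor R I N) (tensor_map R I N f)"
    and "m \<in> (\<Pi>\<^sub>E i\<in>I. carrier (M i)) \<Longrightarrow>
      tensor_map R I N f (tensor_pure R I M m) = tensor_pure R I N (\<lambda>i. f i (m i))"
proof -
  have m: "multilin I M (tensor R I N) (\<lambda>m. tensor_pure R I N (\<lambda>i. f i (m i)))"
    using multilin_comp[OF tensor_pure_multilin[of I N, OF assms(2)] assms(3)]
    by (simp add: tensor_pure_restrict)
  show "lin R (tensor R I M) (tensor R I N) (tensor_map R I N f)"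
    unfolding tensor_map_def by (rule tensor_lift(1)[OF assms(1) tensor_module[OF assms(2)] m])
  show "m \<in> (\<Pi>\<^sub>E i\<in>I. carrier (M i)) \<Longrightarrow>
      tensor_map R I N f (tensor_pure R I M m) = tensor_pure R I N (\<lambda>i. f i (m i))"
    unfolding tensor_map_def by (rule tensor_lift(2)[OF assms(1) tensor_module[OF assms(2)] m])
qed

lemma prod_module_module:
  assumes "\<And>i. i \<in> I \<Longrightarrow> module R (M i)"
  shows "module R (prod_module I M)"
proof (rule moduleI[OF is_cring])
  have g: "abelian_group (M i)" if "i \<in> I" for i using assms[OF that] by (simp add: module_def)
  note m = abelian_group.axioms(1)[OF g]
  show "abelian_group (prod_module I M)"
  proof (rule abelian_groupI)
    fix x y z assume "x \<in> carrier (prod_module I M)" "y \<in> carrier (prod_module I M)" "z \<in> carrier (prod_module I M)"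
    then show "x \<oplus>\<^bsub>prod_module I M\<^esub> y \<in> carrier (prod_module I M)"
      "x \<oplus>\<^bsub>prod_module I M\<^esub> y \<oplus>\<^bsub>prod_module I M\<^esub> z = x \<oplus>\<^bsub>prod_module I M\<^esub> (y \<oplus>\<^bsub>prod_module I M\<^esub> z)"
      "x \<oplus>\<^bsub>prod_module I M\<^esub> y = y \<oplus>\<^bsub>prod_module I M\<^esub> x"
      using m by (auto simp: prod_module_def PiE_iff fun_eq_iff abelian_monoid.a_closed abelian_monoid.a_assoc
        intro: abelian_monoid.a_comm)
    show "\<zero>\<^bsub>prod_module I M\<^esub> \<oplus>\<^bsub>prod_module I M\<^esub> x = x"
      using m \<open>x \<in> _\<close> by (auto simp: prod_module_def PiE_iff fun_eq_iff abelian_monoid.l_zero extensional_def)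
    show "\<exists>y\<in>carrier (prod_module I M). y \<oplus>\<^bsub>prod_module I M\<^esub> x = \<zero>\<^bsub>prod_module I M\<^esub>"
      using g \<open>x \<in> _\<close> by (intro bexI[of _ "\<lambda>i\<in>I. \<ominus>\<^bsub>M i\<^esub> x i"])
        (auto simp: prod_module_def PiE_iff fun_eq_iff abelian_group.l_neg abelian_group.a_inv_closed)
  next
    show "\<zero>\<^bsub>prod_module I M\<^esub> \<in> carrier (prod_module I M)"
      using m by (auto simp: prod_module_def abelian_monoid.zero_closed)
  qed
qed (use assms in \<open>auto simp: prod_module_def PiE_iff fun_eq_iff extensional_def module.smult_l_distr
   module.smult_assoc1 module.smult_one intro: module.smult_closed intro!: module.smult_r_distr[of R "M i" for i]\<close>)

lemma prod_component_lin:
  assumes "i \<in> I"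
  shows "lin R (prod_module I M) (M i) (\<lambda>x. x i)"
  using assms by (intro linI) (auto simp: prod_module_def)

lemma prod_lin:
  assumes "\<And>i. i \<in> I \<Longrightarrow> lin R N (M i) (\<lambda>x. f x i)" "\<And>x. x \<in> carrier N \<Longrightarrow> f x \<in> extensional I" "module R N"
  shows "lin R N (prod_module I M) f"
proof -
  interpret N: module R N by fact
  show ?thesis
  using assms(2) lin_closed[OF assms(1)] lin_add[OF assms(1)] lin_smult[OF assms(1)]
  by (intro linI) (auto simp: prod_module_def PiE_iff fun_eq_iff extensional_def)
qed

end

section \<open>Resolutions and the comparison theorem\<close>

context coeff_ring
begin

lemma free_lifting:
  assumes "module R M" "module R N" "lin R M N g" "lin R (free_module R B) N f"
    "\<And>b. b \<in> B \<Longrightarrow> \<exists>y\<in>carrier M. g y = f (bv b)"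
  shows "\<exists>h. lin R (free_module R B) M h \<and> (\<forall>x\<in>carrier (free_module R B). g (h x) = f x)"
proof -
  obtain c where c: "\<And>b. b \<in> B \<Longrightarrow> c b \<in> carrier M" "\<And>b. b \<in> B \<Longrightarrow> g (c b) = f (bv b)"
    using assms(5) by metis
  have l: "lin R (free_module R B) M (free_lift R M c)"
    using c(1) by (intro free_lift_lin assms(1)) auto
  have "g (free_lift R M c x) = f x" if "x \<in> carrier (free_module R B)" for x
    using that by (rule free_lin_eq[OF assms(2) lin_comp[OF l assms(3)] assms(4), rotated])
      (auto simp: free_lift_basis[OF assms(1)] c)
  then show ?thesis using l by blast
qed

definition complex :: "('r, 'm, 'c) aug_complex \<Rightarrow> ('r, 'c) module \<Rightarrow> bool" where
  "complex P M \<longleftrightarrow> module R M \<and> (\<forall>k. module R (obj P k)) \<and>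
     (\<forall>k. lin R (obj P (Suc k)) (obj P k) (bdry P k)) \<and> lin R (obj P 0) M (aug P) \<and>
     (\<forall>k. \<forall>x\<in>carrier (obj P (Suc (Suc k))). bdry P k (bdry P (Suc k) x) = \<zero>\<^bsub>obj P k\<^esub>) \<and>
     (\<forall>x\<in>carrier (obj P (Suc 0)). aug P (bdry P 0 x) = \<zero>\<^bsub>M\<^esub>)"

definition cycle :: "('r, 'm, 'c) aug_complex \<Rightarrow> ('r, 'c) module \<Rightarrow> nat \<Rightarrow> 'm \<Rightarrow> bool" where
  "cycle P M k x \<longleftrightarrow> x \<in> carrier (obj P k) \<and>
     (case k of 0 \<Rightarrow> aug P x = \<zero>\<^bsub>M\<^esub> | Suc j \<Rightarrow> bdry P j x = \<zero>\<^bsub>obj P j\<^esub>)"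

definition resolution :: "('r, 'm, 'c) aug_complex \<Rightarrow> ('r, 'c) module \<Rightarrow> bool" where
  "resolution P M \<longleftrightarrow> complex P M \<and> aug P ` carrier (obj P 0) = carrier M \<and>
     (\<forall>k x. cycle P M k x \<longrightarrow> (\<exists>y\<in>carrier (obj P (Suc k)). bdry P k y = x))"

definition chain_map :: "('r, 'm, 'c) aug_complex \<Rightarrow> ('r, 'n, 'c) aug_complex \<Rightarrow> (nat \<Rightarrow> 'm \<Rightarrow> 'n) \<Rightarrow> bool" where
  "chain_map P Q \<theta> \<longleftrightarrow> (\<forall>k. lin R (obj P k) (obj Q k) (\<theta> k)) \<and>
     (\<forall>k. \<forall>x\<in>carrier (obj P (Suc k)). bdry Q k (\<theta> (Suc k) x) = \<theta> k (bdry P k x)) \<and>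
     (\<forall>x\<in>carrier (obj P 0). aug Q (\<theta> 0 x) = aug P x)"

lemma complexD:
  assumes "complex P M"
  shows "module R M" "module R (obj P k)" "lin R (obj P (Suc k)) (obj P k) (bdry P k)" "lin R (obj P 0) M (aug P)"
    "x \<in> carrier (obj P (Suc (Suc k))) \<Longrightarrow> bdry P k (bdry P (Suc k) x) = \<zero>\<^bsub>obj P k\<^esub>"
    "x \<in> carrier (obj P (Suc 0)) \<Longrightarrow> aug P (bdry P 0 x) = \<zero>\<^bsub>M\<^esub>"
  using assms by (auto simp: complex_def)

lemma chain_mapD:
  assumes "chain_map P Q \<theta>"
  shows "lin R (obj P k) (obj Q k) (\<theta> k)"
    "x \<in> carrier (obj P (Suc k)) \<Longrightarrow> bdry Q k (\<theta> (Suc k) x) = \<theta> k (bdry P k x)"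
    "x \<in> carrier (obj P 0) \<Longrightarrow> aug Q (\<theta> 0 x) = aug P x"
  using assms by (auto simp: chain_map_def)

lemma chain_map_comp:
  assumes "chain_map P Q \<theta>" "chain_map Q S \<eta>"
  shows "chain_map P S (\<lambda>k x. \<eta> k (\<theta> k x))"
  unfolding chain_map_def
  using lin_comp[OF chain_mapD(1)[OF assms(1)] chain_mapD(1)[OF assms(2)]]
  by (simp add: chain_mapD(2,3)[OF assms(1)] chain_mapD(2,3)[OF assms(2)] lin_closed[OF chain_mapD(1)[OF assms(1)]])

lemma chain_map_id: "chain_map P P (\<lambda>k x. x)"
  by (simp add: chain_map_def lin_id)

text \<open>
  The comparison theorem: the components are chosen one degree at a time. \<open>Inv\<close> says that the
  component chosen last maps boundaries to cycles, which are boundaries by exactness of \<open>Q\<close> and can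
  therefore be lifted.
\<close>

lemma chain_map_exists:
  assumes P: "complex P M" and free: "\<And>k. obj P k = free_module R (B k)" and Q: "resolution Q M"
  shows "\<exists>\<theta>. chain_map P Q \<theta>"
proof -
  have Qc: "complex Q M" and Qs: "aug Q ` carrier (obj Q 0) = carrier M"
    and Qe: "\<And>k x. cycle Q M k x \<Longrightarrow> \<exists>y\<in>carrier (obj Q (Suc k)). bdry Q k y = x"
    using Q by (auto simp: resolution_def)
  define Inv where "Inv = (\<lambda>k \<theta>. lin R (obj P k) (obj Q k) \<theta> \<and>
    (\<forall>x\<in>carrier (obj P (Suc k)). cycle Q M k (\<theta> (bdry P k x))) \<and>
    (k = 0 \<longrightarrow> (\<forall>x\<in>carrier (obj P 0). aug Q (\<theta> x) = aug P x)))"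
  define Stp where "Stp = (\<lambda>k \<theta> \<theta>'. \<forall>x\<in>carrier (obj P (Suc k)). bdry Q k (\<theta>' x) = \<theta> (bdry P k x))"
  have "\<exists>\<theta>. \<forall>k. Inv k (\<theta> k) \<and> Stp k (\<theta> k) (\<theta> (Suc k))"
  proof (rule dependent_nat_choice)
    have "\<exists>h. lin R (free_module R (B 0)) (obj Q 0) h \<and> (\<forall>x\<in>carrier (free_module R (B 0)). aug Q (h x) = aug P x)"
    proof (rule free_lifting[OF complexD(2)[OF Qc] complexD(1,4)[OF Qc]])
      show l: "lin R (free_module R (B 0)) M (aug P)" using complexD(4)[OF P] by (simp add: free)
      fix b assume "b \<in> B 0"
      then have "aug P (bv b) \<in> carrier M" by (intro lin_closed[OF l] basis_vec_closed)
      then show "\<exists>y\<in>carrier (obj Q 0). aug Q y = aug P (bv b)" using Qs by (metis imageE)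
    qed
    then obtain h where h: "lin R (obj P 0) (obj Q 0) h" "\<And>x. x \<in> carrier (obj P 0) \<Longrightarrow> aug Q (h x) = aug P x"
      by (auto simp: free)
    have "cycle Q M 0 (h (bdry P 0 x))" if "x \<in> carrier (obj P (Suc 0))" for x
      using that lin_closed[OF complexD(3)[OF P]] lin_closed[OF h(1)]
      by (simp add: cycle_def h complexD(6)[OF P])
    then show "\<exists>\<theta>. Inv 0 \<theta>" using h unfolding Inv_def by blast
  next
    fix \<theta> k assume I: "Inv k \<theta>"
    have "\<exists>h. lin R (free_module R (B (Suc k))) (obj Q (Suc k)) h \<and>
       (\<forall>x\<in>carrier (free_module R (B (Suc k))). bdry Q k (h x) = \<theta> (bdry P k x))"
    proof (rule free_lifting[OF complexD(2)[OF Qc] complexD(2,3)[OF Qc]])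
      show "lin R (free_module R (B (Suc k))) (obj Q k) (\<lambda>x. \<theta> (bdry P k x))"
        using lin_comp[OF complexD(3)[OF P, of k], of "obj Q k" \<theta>] I by (simp add: free Inv_def)
      fix b assume "b \<in> B (Suc k)"
      then have "bv b \<in> carrier (obj P (Suc k))" unfolding free by (rule basis_vec_closed)
      then show "\<exists>y\<in>carrier (obj Q (Suc k)). bdry Q k y = \<theta> (bdry P k (bv b))"
        using I Qe unfolding Inv_def by blast
    qed
    then obtain h where h: "lin R (obj P (Suc k)) (obj Q (Suc k)) h"
        "\<And>x. x \<in> carrier (obj P (Suc k)) \<Longrightarrow> bdry Q k (h x) = \<theta> (bdry P k x)"
      by (auto simp: free)
    have "lin R (obj P k) (obj Q k) \<theta>" using I by (simp add: Inv_def)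
    then have "\<theta> \<zero>\<^bsub>obj P k\<^esub> = \<zero>\<^bsub>obj Q k\<^esub>"
      by (rule lin_zero[OF complexD(2)[OF P] complexD(2)[OF Qc]])
    then have "cycle Q M (Suc k) (h (bdry P (Suc k) x))" if "x \<in> carrier (obj P (Suc (Suc k)))" for x
      using that lin_closed[OF complexD(3)[OF P]] lin_closed[OF h(1)]
      by (simp add: cycle_def h complexD(5)[OF P])
    then show "\<exists>\<theta>'. Inv (Suc k) \<theta>' \<and> Stp k \<theta> \<theta>'" using h unfolding Inv_def Stp_def by blast
  qed
  then show ?thesis unfolding Inv_def Stp_def chain_map_def by metis
qed

text \<open>
  The same recursion one degree higher; \<open>err\<close> is the difference of the two maps corrected by the part
  of the homotopy already chosen.
\<close>

lemma chain_homotopy_exists: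
  assumes P: "complex P M" and free: "\<And>k. obj P k = free_module R (B k)" and Q: "resolution Q M"
    and \<theta>: "chain_map P Q \<theta>" and \<eta>: "chain_map P Q \<eta>"
  shows "\<exists>s. (\<forall>k. lin R (obj P k) (obj Q (Suc k)) (s k)) \<and>
     (\<forall>k. \<forall>x\<in>carrier (obj P (Suc k)). bdry Q (Suc k) (s (Suc k) x) =
        \<theta> (Suc k) x \<ominus>\<^bsub>obj Q (Suc k)\<^esub> \<eta> (Suc k) x \<ominus>\<^bsub>obj Q (Suc k)\<^esub> s k (bdry P k x))"
proof -
  have Qc: "complex Q M"
    and Qe: "\<And>k x. cycle Q M k x \<Longrightarrow> \<exists>y\<in>carrier (obj Q (Suc k)). bdry Q k y = x"
    using Q by (auto simp: resolution_def)
  note mQ = complexD(2)[OF Qc] and mP = complexD(2)[OF P]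
  define \<delta> where "\<delta> = (\<lambda>k x. \<theta> k x \<ominus>\<^bsub>obj Q k\<^esub> \<eta> k x)"
  have \<delta>_lin: "lin R (obj P k) (obj Q k) (\<delta> k)" for k
    unfolding \<delta>_def by (rule lin_diff[OF mQ chain_mapD(1)[OF \<theta>] chain_mapD(1)[OF \<eta>]])
  have \<delta>_bdry: "bdry Q k (\<delta> (Suc k) x) = \<delta> k (bdry P k x)" if "x \<in> carrier (obj P (Suc k))" for k x
    unfolding \<delta>_def
    using that by (simp add: lin_minus[OF mQ mQ complexD(3)[OF Qc]] lin_closed[OF chain_mapD(1)[OF \<theta>]]
      lin_closed[OF chain_mapD(1)[OF \<eta>]] chain_mapD(2)[OF \<theta>] chain_mapD(2)[OF \<eta>])
  have \<delta>_aug: "aug Q (\<delta> 0 x) = \<zero>\<^bsub>M\<^esub>" if "x \<in> carrier (obj P 0)" for x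
    unfolding \<delta>_def
    using that by (simp add: lin_minus[OF mQ complexD(1)[OF Qc] complexD(4)[OF Qc]] lin_closed[OF chain_mapD(1)[OF \<theta>]]
      lin_closed[OF chain_mapD(1)[OF \<eta>]] chain_mapD(3)[OF \<theta>] chain_mapD(3)[OF \<eta>]
      module_minus_eq[OF complexD(1)[OF P]] lin_closed[OF complexD(4)[OF P]])
  define err where "err = (\<lambda>k s x. \<delta> (Suc k) x \<ominus>\<^bsub>obj Q (Suc k)\<^esub> s (bdry P k x))"
  have err_lin: "lin R (obj P (Suc k)) (obj Q (Suc k)) (err k s)" if "lin R (obj P k) (obj Q (Suc k)) s" for k s
    unfolding err_def by (rule lin_diff[OF mQ \<delta>_lin lin_comp[OF complexD(3)[OF P] that]])
  have err_bdry: "bdry Q k (err k s x) = \<delta> k (bdry P k x) \<ominus>\<^bsub>obj Q k\<^esub> bdry Q k (s (bdry P k x))"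
    if "lin R (obj P k) (obj Q (Suc k)) s" "x \<in> carrier (obj P (Suc k))" for k s x
    unfolding err_def using that
    by (simp add: lin_minus[OF mQ mQ complexD(3)[OF Qc]] lin_closed[OF \<delta>_lin] lin_closed[OF that(1)]
      lin_closed[OF complexD(3)[OF P]] \<delta>_bdry)
  define Inv where "Inv = (\<lambda>k s. lin R (obj P k) (obj Q (Suc k)) s \<and>
    (\<forall>x\<in>carrier (obj P (Suc k)). cycle Q M (Suc k) (err k s x)))"
  define Stp where "Stp = (\<lambda>k s s'. \<forall>x\<in>carrier (obj P (Suc k)). bdry Q (Suc k) (s' x) = err k s x)"
  have "\<exists>s. \<forall>k. Inv k (s k) \<and> Stp k (s k) (s (Suc k))"
  proof (rule dependent_nat_choice)
    have "\<exists>h. lin R (free_module R (B 0)) (obj Q (Suc 0)) h \<and> (\<forall>x\<in>carrier (free_module R (B 0)). bdry Q 0 (h x) = \<delta> 0 x)"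
    proof (rule free_lifting[OF mQ mQ complexD(3)[OF Qc]])
      show l: "lin R (free_module R (B 0)) (obj Q 0) (\<delta> 0)" using \<delta>_lin[of 0] by (simp add: free)
      fix b assume "b \<in> B 0"
      then have b: "bv b \<in> carrier (obj P 0)" unfolding free by (rule basis_vec_closed)
      then have "cycle Q M 0 (\<delta> 0 (bv b))"
        using \<delta>_aug[OF b] lin_closed[OF \<delta>_lin b] by (simp add: cycle_def)
      then show "\<exists>y\<in>carrier (obj Q (Suc 0)). bdry Q 0 y = \<delta> 0 (bv b)" by (rule Qe)
    qed
    then obtain h where h: "lin R (obj P 0) (obj Q (Suc 0)) h" "\<And>x. x \<in> carrier (obj P 0) \<Longrightarrow> bdry Q 0 (h x) = \<delta> 0 x"
      by (auto simp: free)
    have "cycle Q M (Suc 0) (err 0 h x)" if "x \<in> carrier (obj P (Suc 0))" for x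
      using that lin_closed[OF err_lin[OF h(1)]] lin_closed[OF complexD(3)[OF P]] lin_closed[OF \<delta>_lin]
      by (simp add: cycle_def err_bdry[OF h(1)] h(2) module_minus_eq[OF mQ])
    then show "\<exists>\<theta>. Inv 0 \<theta>" using h unfolding Inv_def by blast
  next
    fix s k assume I: "Inv k s"
    then have s: "lin R (obj P k) (obj Q (Suc k)) s" by (simp add: Inv_def)
    have "\<exists>h. lin R (free_module R (B (Suc k))) (obj Q (Suc (Suc k))) h \<and>
       (\<forall>x\<in>carrier (free_module R (B (Suc k))). bdry Q (Suc k) (h x) = err k s x)"
    proof (rule free_lifting[OF mQ mQ complexD(3)[OF Qc]])
      show "lin R (free_module R (B (Suc k))) (obj Q (Suc k)) (err k s)"
        using err_lin[OF s] by (simp add: free)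
      fix b assume "b \<in> B (Suc k)"
      then have "bv b \<in> carrier (obj P (Suc k))" unfolding free by (rule basis_vec_closed)
      then show "\<exists>y\<in>carrier (obj Q (Suc (Suc k))). bdry Q (Suc k) y = err k s (bv b)"
        using I Qe unfolding Inv_def by blast
    qed
    then obtain h where h: "lin R (obj P (Suc k)) (obj Q (Suc (Suc k))) h"
        "\<And>x. x \<in> carrier (obj P (Suc k)) \<Longrightarrow> bdry Q (Suc k) (h x) = err k s x"
      by (auto simp: free)
    have "cycle Q M (Suc (Suc k)) (err (Suc k) h x)" if x: "x \<in> carrier (obj P (Suc (Suc k)))" for x
    proof -
      let ?z = "bdry P (Suc k) x"
      have z: "?z \<in> carrier (obj P (Suc k))" by (rule lin_closed[OF complexD(3)[OF P] x])
      have "err k s ?z = \<delta> (Suc k) ?z"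
        unfolding err_def complexD(5)[OF P x] lin_zero[OF mP mQ s]
      proof -
        interpret Q: module R "obj Q (Suc k)" by (rule mQ)
        show "\<delta> (Suc k) ?z \<ominus>\<^bsub>obj Q (Suc k)\<^esub> \<zero>\<^bsub>obj Q (Suc k)\<^esub> = \<delta> (Suc k) ?z"
          using lin_closed[OF \<delta>_lin z] by (simp add: a_minus_def)
      qed
      then show ?thesis
        using lin_closed[OF err_lin[OF h(1)] x] lin_closed[OF \<delta>_lin z]
        by (simp add: cycle_def err_bdry[OF h(1) x] h(2)[OF z] module_minus_eq[OF mQ])
    qed
    then show "\<exists>s'. Inv (Suc k) s' \<and> Stp k s s'" using h unfolding Inv_def Stp_def by blast
  qed
  then obtain s where "\<And>k. Inv k (s k)" "\<And>k. Stp k (s k) (s (Suc k))" by auto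
  then show ?thesis unfolding Inv_def Stp_def err_def \<delta>_def by blast
qed

subsection \<open>The standard resolution\<close>

lemma syz_vec_syz_of:
  assumes "finite {t. x t \<noteq> \<zero>}"
  shows "syz_vec R (syz_of R x) = x"
proof -
  have "{(t, x t) |t. x t \<noteq> \<zero>} = (\<lambda>t. (t, x t)) ` {t. x t \<noteq> \<zero>}" by auto
  then have "fset (Abs_fset {(t, x t) |t. x t \<noteq> \<zero>}) = {(t, x t) |t. x t \<noteq> \<zero>}"
    using assms by (intro Abs_fset_inverse) simp
  then show ?thesis by (auto simp: syz_vec_def syz_of_def fun_eq_iff)
qed

text \<open>
  One description of the basis for the two recursive clauses, so that later arguments need not
  distinguish degree \<open>1\<close> from the higher degrees.
\<close>

lemma std_basis_Suc:
  assumes "module R M"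
  shows "std_basis R M (Suc k) = syz_of R ` {x. cycle (std_res R M) M k x}"
proof (cases k)
  case 0
  then show ?thesis by (simp add: cycle_def std_res_def)
next
  case (Suc j)
  then show ?thesis by (simp add: cycle_def std_res_def)
qed

lemma std_res_obj: "obj (std_res R M) k = free_module R (std_basis R M k)"
  by (simp add: std_res_def)

lemma std_res_resolution:
  assumes M: "module R M"
  shows "resolution (std_res R M) M"
proof -
  let ?P = "std_res R M" and ?B = "std_basis R M"
  have mP: "module R (obj ?P k)" for k unfolding std_res_obj by (rule free_module_module)
  have vec: "syz_vec R b \<in> carrier (obj ?P k) \<and> cycle ?P M k (syz_vec R b)" if b: "b \<in> ?B (Suc k)" for b k
  proof -
    obtain x where x: "cycle ?P M k x" "b = syz_of R x" using b unfolding std_basis_Suc[OF M] by auto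
    then have "x \<in> carrier (free_module R (?B k))" by (simp add: cycle_def std_res_obj)
    then have "syz_vec R b = x" unfolding x(2) by (intro syz_vec_syz_of free_finite)
    then show ?thesis using x(1) by (simp add: cycle_def)
  qed
  have bd: "bdry ?P k = free_lift R (obj ?P k) (syz_vec R)" for k by (simp add: std_res_def)
  have bdl: "lin R (obj ?P (Suc k)) (obj ?P k) (bdry ?P k)" for k
    unfolding bd unfolding std_res_obj[of _ "Suc k"] using vec by (intro free_lift_lin mP) auto
  have au: "aug ?P = free_lift R M ungen" by (simp add: std_res_def)
  have aul: "lin R (obj ?P 0) M (aug ?P)"
    unfolding au std_res_obj by (rule free_lift_lin[OF M]) auto
  have bdb: "bdry ?P k (bv b) = syz_vec R b" if "b \<in> ?B (Suc k)" for b k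
    unfolding bd using vec[OF that] by (intro free_lift_basis mP) auto
  have cx: "complex ?P M"
    unfolding complex_def
  proof (intro conjI allI ballI M mP bdl aul)
    fix k x assume x: "x \<in> carrier (obj ?P (Suc (Suc k)))"
    have b: "bdry ?P k (bdry ?P (Suc k) (bv b)) = \<zero>\<^bsub>obj ?P k\<^esub>" if "b \<in> ?B (Suc (Suc k))" for b
      unfolding bdb[OF that] using vec[OF that] by (simp add: cycle_def)
    show "bdry ?P k (bdry ?P (Suc k) x) = \<zero>\<^bsub>obj ?P k\<^esub>"
      by (rule free_lin_eq[OF mP lin_comp[OF bdl bdl[of k], unfolded std_res_obj[of M "Suc (Suc k)"]]
        lin_const_zero[OF mP] b x[unfolded std_res_obj]])
  next
    fix x assume x: "x \<in> carrier (obj ?P (Suc 0))"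
    have b: "aug ?P (bdry ?P 0 (bv b)) = \<zero>\<^bsub>M\<^esub>" if "b \<in> ?B (Suc 0)" for b
      unfolding bdb[OF that] using vec[OF that] by (simp add: cycle_def)
    show "aug ?P (bdry ?P 0 x) = \<zero>\<^bsub>M\<^esub>"
      by (rule free_lin_eq[OF M lin_comp[OF bdl aul, unfolded std_res_obj[of _ "Suc 0"]]
        lin_const_zero[OF M] b x[unfolded std_res_obj]])
  qed
  have "\<exists>y\<in>carrier (obj ?P (Suc k)). bdry ?P k y = x" if x: "cycle ?P M k x" for k x
  proof -
    have s: "syz_of R x \<in> ?B (Suc k)" unfolding std_basis_Suc[OF M] using x by simp
    have "x \<in> carrier (free_module R (?B k))" using x by (simp add: cycle_def std_res_obj)
    then have "syz_vec R (syz_of R x) = x" by (intro syz_vec_syz_of free_finite)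
    then show ?thesis using bdb[OF s] basis_vec_closed[OF s] unfolding std_res_obj[of _ "Suc k"] by auto
  qed
  moreover have "aug ?P ` carrier (obj ?P 0) = carrier M"
  proof -
    have "m \<in> aug ?P ` carrier (obj ?P 0)" if m: "m \<in> carrier M" for m
    proof (rule image_eqI)
      show "bv (Gen m) \<in> carrier (obj ?P 0)"
        unfolding std_res_obj using m by (intro basis_vec_closed) auto
      show "m = aug ?P (bv (Gen m))"
        unfolding au using m by (subst free_lift_basis[OF M]) auto
    qed
    then show ?thesis using lin_closed[OF aul] by auto
  qed
  ultimately show ?thesis using cx by (simp add: resolution_def)
qed

end

section \<open>Tensor products of two-term complexes of free modules\<close>

text \<open>
  For each \<open>i\<close>, \<open>B i\<close> is the basis of a two-term complex: \<open>D i\<close> maps edges to combinations of vertices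
  and kills vertices. By \<open>D_split\<close>, \<open>D i\<close> is split injective on finitely many edges at a time; the left
  inverse \<open>L\<close> depends on these edges.
\<close>

locale free_cube = coeff_ring R for R :: "'r ring" (structure) +
  fixes n :: nat and B :: "nat \<Rightarrow> 'b set" and edge :: "'b \<Rightarrow> bool"
    and D :: "nat \<Rightarrow> ('b \<Rightarrow> 'r) \<Rightarrow> ('b \<Rightarrow> 'r)"
  assumes D_lin: "i \<in> {1..n} \<Longrightarrow> lin R (free_module R (B i)) (free_module R (B i)) (D i)"
    and D_vertex: "i \<in> {1..n} \<Longrightarrow> b \<in> B i \<Longrightarrow> \<not> edge b \<Longrightarrow> D i (bv b) = (\<lambda>b. \<zero>)"
    and D_edge: "i \<in> {1..n} \<Longrightarrow> b \<in> B i \<Longrightarrow> edge b \<Longrightarrow> edge c \<Longrightarrow> D i (bv b) c = \<zero>"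
    and D_split: "i \<in> {1..n} \<Longrightarrow> finite F \<Longrightarrow> F \<subseteq> B i \<Longrightarrow> (\<And>b. b \<in> F \<Longrightarrow> edge b) \<Longrightarrow>
      \<exists>L. lin R (free_module R (B i)) (free_module R (B i)) L \<and>
        (\<forall>b\<in>B i. \<forall>c. edge b \<or> \<not> edge c \<longrightarrow> L (bv b) c = \<zero>) \<and>
        (\<forall>b\<in>F. L (D i (bv b)) = bv b)"
begin

abbreviation "I \<equiv> {1..n}"
abbreviation "FB i \<equiv> free_module R (B i)"

definition cells :: "(nat \<Rightarrow> 'b) set" where "cells = (\<Pi>\<^sub>E i\<in>I. B i)"

abbreviation "C \<equiv> free_module R cells"

lemma FB_module: "module R (FB i)" by (rule free_module_module)
lemma C_module: "module R C" by (rule free_module_module)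

sublocale C: module R C by (rule C_module)

text \<open>
  The canonical multilinear map onto the tensor product of free modules, which is realised as the free
  module on the product of the bases.
\<close>

definition pr :: "(nat \<Rightarrow> 'b \<Rightarrow> 'r) \<Rightarrow> (nat \<Rightarrow> 'b) \<Rightarrow> 'r" where
  "pr z = (\<lambda>c. if c \<in> cells then \<Otimes>i\<in>I. z i (c i) else \<zero>)"

lemma cells_upd: "c \<in> cells \<Longrightarrow> j \<in> I \<Longrightarrow> c(j := b) \<in> cells \<longleftrightarrow> b \<in> B j"
  unfolding cells_def by (auto simp: PiE_iff extensional_def split: if_splits)

lemma finprod_split:
  assumes "j \<in> I" "\<And>i. i \<in> I \<Longrightarrow> g i \<in> carrier R"
  shows "(\<Otimes>i\<in>I. g i) = g j \<otimes> (\<Otimes>i\<in>I-{j}. g i)"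
proof -
  have "(\<Otimes>i\<in>insert j (I-{j}). g i) = g j \<otimes> (\<Otimes>i\<in>I-{j}. g i)"
    using assms by (intro finprod_insert) auto
  then show ?thesis using assms(1) by (simp add: insert_absorb)
qed

lemma pr_upd:
  assumes "j \<in> I" "\<And>i. i \<in> I \<Longrightarrow> z i \<in> carrier (FB i)" "w \<in> carrier (FB j)"
  shows "pr (z(j := w)) c = (if c \<in> cells then w (c j) \<otimes> (\<Otimes>i\<in>I-{j}. z i (c i)) else \<zero>)"
proof -
  have "(\<Otimes>i\<in>I. (z(j := w)) i (c i)) = (z(j := w)) j (c j) \<otimes> (\<Otimes>i\<in>I-{j}. (z(j := w)) i (c i))"
    using assms free_closed[OF assms(2)] free_closed[OF assms(3)] by (intro finprod_split) auto
  also have "(\<Otimes>i\<in>I-{j}. (z(j := w)) i (c i)) = (\<Otimes>i\<in>I-{j}. z i (c i))"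
    using free_closed[OF assms(2)] by (intro finprod_cong') auto
  finally show ?thesis by (simp add: pr_def)
qed

lemma pr_closed:
  assumes "\<And>i. i \<in> I \<Longrightarrow> z i \<in> carrier (FB i)"
  shows "pr z \<in> carrier C"
proof (rule freeI)
  let ?A = "\<Pi>\<^sub>E i\<in>I. {b. z i b \<noteq> \<zero>}"
  show "finite ?A" using free_finite[OF assms] by (intro finite_PiE) auto
  show "?A \<subseteq> cells" unfolding cells_def using free_supp[OF assms] by (intro PiE_mono) auto
  show "pr z c \<in> carrier R" for c unfolding pr_def using free_closed[OF assms] by auto
  show "pr z c = \<zero>" if nc: "c \<notin> ?A" for c
  proof (cases "c \<in> cells")
    case True
    then obtain j where j: "j \<in> I" "z j (c j) = \<zero>" using nc unfolding cells_def by (auto simp: PiE_iff)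
    have "pr (z(j := z j)) c = \<zero>" using assms free_closed[OF assms] j by (subst pr_upd) auto
    then show ?thesis by simp
  qed (simp add: pr_def)
qed

lemma pr_cong:
  assumes "\<And>i. i \<in> I \<Longrightarrow> z i = z' i" "\<And>i. i \<in> I \<Longrightarrow> z' i \<in> carrier (FB i)"
  shows "pr z = pr z'"
  unfolding pr_def using assms(1) free_closed[OF assms(2)] by (intro ext) (auto intro!: finprod_cong')

lemma pr_multilin: "multilin I FB C pr"
  unfolding multilin_def
proof (intro conjI ballI)
  fix z assume z: "z \<in> (\<Pi>\<^sub>E i\<in>I. carrier (FB i))"
  then have zc: "\<And>i. i \<in> I \<Longrightarrow> z i \<in> carrier (FB i)" by auto
  show "pr z \<in> carrier C" by (rule pr_closed[OF zc])

  fix j x assume j: "j \<in> I" and x: "x \<in> carrier (FB j)"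
  have P: "(\<Otimes>i\<in>I-{j}. z i (c i)) \<in> carrier R" for c
    using free_closed[OF zc] by (intro finprod_closed funcsetI) auto
  { fix y assume y: "y \<in> carrier (FB j)"
    interpret F: module R "FB j" by (rule FB_module)
    show "pr (z(j := x \<oplus>\<^bsub>FB j\<^esub> y)) = pr (z(j := x)) \<oplus>\<^bsub>C\<^esub> pr (z(j := y))"
      using pr_upd[OF j zc x] pr_upd[OF j zc y] pr_upd[OF j zc F.M.a_closed[OF x y]]
        free_closed[OF x] free_closed[OF y] P
      by (auto simp: fun_eq_iff l_distr) }
  { fix r assume r: "r \<in> carrier R"
    interpret F: module R "FB j" by (rule FB_module)
    show "pr (z(j := r \<odot>\<^bsub>FB j\<^esub> x)) = r \<odot>\<^bsub>C\<^esub> pr (z(j := x))"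
      using pr_upd[OF j zc x] pr_upd[OF j zc F.smult_closed[OF r x]]
        free_closed[OF x] P r
      by (auto simp: fun_eq_iff m_assoc) }
qed

lemma basis_pr: "c \<in> cells \<Longrightarrow> bv c = pr (\<lambda>i. bv (c i))"
proof
  fix c' assume c: "c \<in> cells"
  show "bv c c' = pr (\<lambda>i. bv (c i)) c'"
  proof (cases "c' = c")
    case True
    have "(\<Otimes>i\<in>I. bv (c i) (c i)) = \<one>"
      unfolding basis_vec_def by (rule finprod_one_eqI) auto
    then show ?thesis using True c by (simp add: pr_def) (simp add: basis_vec_def)
  next
    case False
    have z: "\<And>i. i \<in> I \<Longrightarrow> bv (c i) \<in> carrier (FB i)"
      using c unfolding cells_def by (intro basis_vec_closed) auto
    show ?thesis
    proof (cases "c' \<in> cells")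
      case True
      then obtain j where j: "j \<in> I" "c' j \<noteq> c j" using False c unfolding cells_def by (meson PiE_ext)
      then have "(\<Otimes>i\<in>I. bv (c i) (c' i)) = \<zero>"
        using free_closed[OF z]
        by (subst finprod_split[OF j(1)]) (auto simp: basis_vec_def intro!: l_null finprod_closed)
      then show ?thesis using False by (simp add: pr_def) (simp add: basis_vec_def)
    qed (use False in \<open>simp add: pr_def basis_vec_def\<close>)
  qed
qed

subsection \<open>Operators acting on one coordinate\<close>

text \<open>
  The map \<open>id \<otimes> \<dots> \<otimes> f \<otimes> \<dots> \<otimes> id\<close> with \<open>f\<close> in coordinate \<open>j\<close>.
\<close>

definition op :: "nat \<Rightarrow> (('b \<Rightarrow> 'r) \<Rightarrow> ('b \<Rightarrow> 'r)) \<Rightarrow> ((nat \<Rightarrow> 'b) \<Rightarrow> 'r) \<Rightarrow> ((nat \<Rightarrow> 'b) \<Rightarrow> 'r)" where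
  "op j f x = (\<lambda>c. if c \<in> cells then f (\<lambda>b. x (c(j := b))) (c j) else \<zero>)"

definition endo :: "nat \<Rightarrow> (('b \<Rightarrow> 'r) \<Rightarrow> ('b \<Rightarrow> 'r)) \<Rightarrow> bool" where
  "endo j f \<longleftrightarrow> lin R (FB j) (FB j) f"

lemma slice_closed:
  assumes "x \<in> carrier C" "c \<in> cells" "j \<in> I"
  shows "(\<lambda>b. x (c(j := b))) \<in> carrier (FB j)"
proof (rule freeI)
  let ?A = "(\<lambda>c. c j) ` {c. x c \<noteq> \<zero>}"
  show "finite ?A" using free_finite[OF assms(1)] by simp
  show "?A \<subseteq> B j" using free_supp[OF assms(1)] assms(3) unfolding cells_def by (auto dest!: subsetD PiE_mem)
  show "x (c(j := b)) \<in> carrier R" for b by (rule free_closed[OF assms(1)])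
  show "x (c(j := b)) = \<zero>" if "b \<notin> ?A" for b
    using that by (metis (mono_tags, lifting) fun_upd_same image_eqI mem_Collect_eq)
qed

lemma op_support:
  assumes "x \<in> carrier C" "j \<in> I" "endo j f" "op j f x c \<noteq> \<zero>"
    "\<And>b b'. b \<in> B j \<Longrightarrow> f (bv b) b' \<noteq> \<zero> \<Longrightarrow> Q b b'"
  shows "c \<in> cells \<and> (\<exists>b. x (c(j := b)) \<noteq> \<zero> \<and> Q b (c j))"
proof -
  have c: "c \<in> cells" using assms(4) by (auto simp: op_def split: if_splits)
  let ?z = "\<lambda>b. x (c(j := b))"
  have z: "?z \<in> carrier (FB j)" by (rule slice_closed[OF assms(1) c assms(2)])
  have f: "lin R (FB j) (FB j) f" using assms(3) by (simp add: endo_def)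
  have fb: "f (bv b) \<in> carrier (FB j)" if "b \<in> B j" for b using lin_closed[OF f basis_vec_closed[OF that]] .
  let ?S = "{b. ?z b \<noteq> \<zero>}"
  have "f ?z = free_lift R (FB j) (\<lambda>b. f (bv b)) ?z"
  proof (rule free_lin_eq[OF FB_module f free_lift_lin[OF FB_module] _ z])
    show "(\<lambda>b. f (bv b)) \<in> B j \<rightarrow> carrier (FB j)" using fb by auto
    show "\<And>b. b \<in> B j \<Longrightarrow> f (bv b) = free_lift R (FB j) (\<lambda>b. f (bv b)) (bv b)"
      using free_lift_basis[where f="\<lambda>b. f (bv b)", OF FB_module fb] by simp
  qed
  also have "\<dots> = (\<lambda>b'. \<Oplus>b\<in>?S. ?z b \<otimes> f (bv b) b')"
  proof -
    interpret F: module R "FB j" by (rule FB_module)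
    have "(\<lambda>b. ?z b \<odot>\<^bsub>FB j\<^esub> f (bv b)) \<in> ?S \<rightarrow> carrier (FB j)"
      using free_supp[OF z] free_closed[OF z] by (intro funcsetI F.smult_closed fb) auto
    then show ?thesis unfolding free_lift_def by (subst free_finsum[OF free_finite[OF z]]) auto
  qed
  finally have "(\<Oplus>b\<in>?S. ?z b \<otimes> f (bv b) (c j)) \<noteq> \<zero>"
    using assms(4) c by (simp add: op_def)
  moreover have "(\<Oplus>b\<in>?S. ?z b \<otimes> f (bv b) (c j)) = \<zero>" if "\<And>b. b \<in> ?S \<Longrightarrow> f (bv b) (c j) = \<zero>"
    using that free_closed[OF z] by (intro add.finprod_one_eqI) auto
  ultimately obtain b where "b \<in> ?S" "f (bv b) (c j) \<noteq> \<zero>" by blast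
  then show ?thesis using assms(5) c free_supp[OF z] by blast
qed

lemma op_closed:
  assumes "x \<in> carrier C" "j \<in> I" "endo j f"
  shows "op j f x \<in> carrier C"
proof (rule freeI)
  have f: "lin R (FB j) (FB j) f" using assms(3) by (simp add: endo_def)
  have s: "f (\<lambda>b. x (c(j := b))) \<in> carrier (FB j)" if "c \<in> cells" for c
    by (rule lin_closed[OF f slice_closed[OF assms(1) that assms(2)]])
  let ?A = "\<Union>c\<in>{c. x c \<noteq> \<zero>}. (\<lambda>b. c(j := b)) ` {b. f (\<lambda>b. x (c(j := b))) b \<noteq> \<zero>}"
  have cells: "c \<in> cells" if "x c \<noteq> \<zero>" for c using free_supp[OF assms(1)] that by auto
  show "finite ?A" using free_finite[OF assms(1)] cells free_finite[OF s] by auto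
  show "?A \<subseteq> cells" using cells free_supp[OF s] cells_upd[OF _ assms(2)] by fastforce
  show "op j f x c \<in> carrier R" for c using free_closed[OF s] by (simp add: op_def)
  show "op j f x c = \<zero>" if "c \<notin> ?A" for c
  proof (rule ccontr)
    assume nz: "op j f x c \<noteq> \<zero>"
    obtain b where c: "c \<in> cells" "x (c(j := b)) \<noteq> \<zero>" using op_support[OF assms nz, of "\<lambda>_ _. True"] by auto
    have "f (\<lambda>b. x (c(j := b))) (c j) \<noteq> \<zero>" using nz c(1) by (simp add: op_def)
    then have "c \<in> ?A" using c(2) by (intro UN_I[of "c(j := b)"]) (auto intro!: image_eqI[of _ _ "c j"])
    then show False using that by simp
  qed
qed

lemma op_lin: "j \<in> I \<Longrightarrow> endo j f \<Longrightarrow> lin R C C (op j f)"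
proof (rule linI)
  assume j: "j \<in> I" and f': "endo j f"
  have f: "lin R (FB j) (FB j) f" using f' by (simp add: endo_def)
  fix x assume x: "x \<in> carrier C"
  show "op j f x \<in> carrier C" by (rule op_closed[OF x j f'])
  { fix y assume y: "y \<in> carrier C"
    show "op j f (x \<oplus>\<^bsub>C\<^esub> y) = op j f x \<oplus>\<^bsub>C\<^esub> op j f y"
      using lin_add[OF f slice_closed[OF x _ j] slice_closed[OF y _ j]] by (auto simp: op_def fun_eq_iff) }
  { fix r assume r: "r \<in> carrier R"
    show "op j f (r \<odot>\<^bsub>C\<^esub> x) = r \<odot>\<^bsub>C\<^esub> op j f x"
      using lin_smult[OF f r slice_closed[OF x _ j]] r by (auto simp: op_def fun_eq_iff) }
qed

lemma op_comp:
  assumes "x \<in> carrier C" "j \<in> I" "endo j g"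
  shows "op j f (op j g x) = op j (\<lambda>z. f (g z)) x"
proof
  fix c
  have "(\<lambda>b. op j g x (c(j := b))) = g (\<lambda>b. x (c(j := b)))" if c: "c \<in> cells"
  proof
    fix b
    have "g (\<lambda>b. x (c(j := b))) \<in> carrier (FB j)"
      using lin_closed[OF assms(3)[unfolded endo_def] slice_closed[OF assms(1) c assms(2)]] .
    then show "op j g x (c(j := b)) = g (\<lambda>b. x (c(j := b))) b"
      using cells_upd[OF c assms(2), of b] by (auto simp: op_def free_outside)
  qed
  then show "op j f (op j g x) c = op j (\<lambda>z. f (g z)) x c"
    unfolding op_def[of j f] by (simp add: op_def)
qed

lemma op_cong:
  assumes "x \<in> carrier C" "j \<in> I" "\<And>z. z \<in> carrier (FB j) \<Longrightarrow> f z = g z"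
  shows "op j f x = op j g x"
  using slice_closed[OF assms(1) _ assms(2)] assms(3) by (auto simp: op_def fun_eq_iff)

lemma op_zero: "op j (\<lambda>z b. \<zero>) x = (\<lambda>c. \<zero>)"
  by (auto simp: op_def fun_eq_iff)

lemma op_pr:
  assumes "j \<in> I" "endo j f" "\<And>i. i \<in> I \<Longrightarrow> z i \<in> carrier (FB i)"
  shows "op j f (pr z) = pr (z(j := f (z j)))"
proof
  fix c
  have f: "lin R (FB j) (FB j) f" using assms(2) by (simp add: endo_def)
  let ?P = "\<Otimes>i\<in>I-{j}. z i (c i)"
  have P: "?P \<in> carrier R"
    using free_closed[OF assms(3)] by (intro finprod_closed funcsetI) auto
  have zj: "z j \<in> carrier (FB j)" using assms by auto
  have fz: "f (z j) \<in> carrier (FB j)" by (rule lin_closed[OF f zj])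
  show "op j f (pr z) c = pr (z(j := f (z j))) c"
  proof (cases "c \<in> cells")
    case True
    have "(\<lambda>b. pr z (c(j := b))) = ?P \<odot>\<^bsub>FB j\<^esub> z j"
    proof
      fix b
      have "pr (z(j := z j)) (c(j := b)) = (if b \<in> B j then z j b \<otimes> (\<Otimes>i\<in>I-{j}. z i ((c(j := b)) i)) else \<zero>)"
        using cells_upd[OF True assms(1), of b] pr_upd[OF assms(1,3) zj] by auto
      also have "(\<Otimes>i\<in>I-{j}. z i ((c(j := b)) i)) = ?P"
        using free_closed[OF assms(3)] by (intro finprod_cong') auto
      finally show "pr z (c(j := b)) = (?P \<odot>\<^bsub>FB j\<^esub> z j) b"
        unfolding fun_upd_triv free_simps m_comm[OF P free_closed[OF zj]]
        by (cases "b \<in> B j") (simp_all only: simp_thms if_True if_False P l_null r_null free_outside[OF zj] refl)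
    qed
    then have "op j f (pr z) c = (?P \<odot>\<^bsub>FB j\<^esub> f (z j)) (c j)"
      using True lin_smult[OF f P zj] by (simp add: op_def)
    then show ?thesis
      using True pr_upd[OF assms(1,3) fz] P free_closed[OF fz] by (simp add: m_comm)
  qed (simp add: op_def pr_def)
qed

lemma basis_B: "c \<in> cells \<Longrightarrow> i \<in> I \<Longrightarrow> bv (c i) \<in> carrier (FB i)"
  unfolding cells_def by (intro basis_vec_closed) auto

lemma op_commute:
  assumes "x \<in> carrier C" "i \<in> I" "j \<in> I" "i \<noteq> j" "endo i f" "endo j g"
  shows "op i f (op j g x) = op j g (op i f x)"
proof (rule free_lin_eq[OF C_module lin_comp[OF op_lin[OF assms(3,6)] op_lin[OF assms(2,5)]]
    lin_comp[OF op_lin[OF assms(2,5)] op_lin[OF assms(3,6)]] _ assms(1)])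
  fix c assume c: "c \<in> cells"
  note b = basis_B[OF c]
  have f: "f (bv (c i)) \<in> carrier (FB i)" "g (bv (c j)) \<in> carrier (FB j)"
    using lin_closed[OF assms(5)[unfolded endo_def] b[OF assms(2)]]
      lin_closed[OF assms(6)[unfolded endo_def] b[OF assms(3)]] by auto
  let ?z = "\<lambda>i. bv (c i)"
  have "op i f (op j g (pr ?z)) = op i f (pr (?z(j := g (?z j))))"
    by (subst op_pr[OF assms(3,6) b]) auto
  also have "\<dots> = pr (?z(j := g (?z j), i := f (?z i)))"
    using assms(4) b f by (subst op_pr[OF assms(2,5)]) auto
  also have "\<dots> = pr (?z(i := f (?z i), j := g (?z j)))"
    using assms(4) by (simp add: fun_upd_twist)
  also have "\<dots> = op j g (pr (?z(i := f (?z i))))"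
    using assms(4) b f by (subst op_pr[OF assms(3,6)]) auto
  also have "\<dots> = op j g (op i f (pr ?z))"
    by (subst op_pr[OF assms(2,5) b]) auto
  finally show "op i f (op j g (bv c)) = op j g (op i f (bv c))"
    unfolding basis_pr[OF c] .
qed

subsection \<open>The differential\<close>

text \<open>
  \<open>sg\<close> is the sign \<open>(-1)\<^sup>d\<close> on degree \<open>d\<close>, needed for the Koszul sign rule; \<open>cut\<close> projects to the edges or
  to the vertices.
\<close>

definition sg :: "('b \<Rightarrow> 'r) \<Rightarrow> ('b \<Rightarrow> 'r)" where
  "sg z = (\<lambda>b. if edge b then \<ominus> z b else z b)"

definition cut :: "bool \<Rightarrow> ('b \<Rightarrow> 'r) \<Rightarrow> ('b \<Rightarrow> 'r)" where
  "cut e z = (\<lambda>b. if edge b = e then z b else \<zero>)"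

lemma sg_endo: "endo j sg"
  unfolding endo_def
proof (rule linI)
  fix x assume x: "x \<in> carrier (FB j)"
  show "sg x \<in> carrier (FB j)"
    using free_closed[OF x] free_outside[OF x] free_supp[OF x] by (intro freeI[OF free_finite[OF x]]) (auto simp: sg_def)
  { fix y assume "y \<in> carrier (FB j)"
    then show "sg (x \<oplus>\<^bsub>FB j\<^esub> y) = sg x \<oplus>\<^bsub>FB j\<^esub> sg y"
      using x by (auto simp: sg_def fun_eq_iff free_closed minus_add) }
  { fix r assume "r \<in> carrier R"
    then show "sg (r \<odot>\<^bsub>FB j\<^esub> x) = r \<odot>\<^bsub>FB j\<^esub> sg x"
      using x by (auto simp: sg_def fun_eq_iff free_closed r_minus) }
qed

lemma cut_endo: "endo j (cut e)"
  unfolding endo_def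
proof (rule linI)
  fix x assume x: "x \<in> carrier (FB j)"
  show "cut e x \<in> carrier (FB j)"
    using free_closed[OF x] free_outside[OF x] free_supp[OF x] by (intro freeI[OF free_finite[OF x]]) (auto simp: cut_def)
  { fix y assume "y \<in> carrier (FB j)"
    then show "cut e (x \<oplus>\<^bsub>FB j\<^esub> y) = cut e x \<oplus>\<^bsub>FB j\<^esub> cut e y"
      using x by (auto simp: cut_def fun_eq_iff free_closed) }
  { fix r assume "r \<in> carrier R"
    then show "cut e (r \<odot>\<^bsub>FB j\<^esub> x) = r \<odot>\<^bsub>FB j\<^esub> cut e x"
      using x by (auto simp: cut_def fun_eq_iff free_closed) }
qed

lemma D_endo: "j \<in> I \<Longrightarrow> endo j (D j)"
  using D_lin by (simp add: endo_def)

lemma endo_comp: "endo j f \<Longrightarrow> endo j g \<Longrightarrow> endo j (\<lambda>z. f (g z))"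
  unfolding endo_def by (rule lin_comp[of R _ _ g])

lemma endo_eq:
  assumes "endo j f" "endo j g" "\<And>b. b \<in> B j \<Longrightarrow> f (bv b) = g (bv b)" "z \<in> carrier (FB j)"
  shows "f z = g z"
  using free_lin_eq[OF FB_module assms(1)[unfolded endo_def] assms(2)[unfolded endo_def] assms(3,4)] .

lemma endo_neg: "endo j f \<Longrightarrow> endo j (\<lambda>z b. \<ominus> f z b)"
proof -
  assume f: "endo j f"
  show "endo j (\<lambda>z b. \<ominus> f z b)"
    unfolding endo_def
    by (rule lin_cong[OF FB_module lin_neg[OF FB_module f[unfolded endo_def]]])
      (simp add: free_uminus[OF lin_closed[OF f[unfolded endo_def]]])
qed

lemma endo_zero: "endo j (\<lambda>z b. \<zero>)"
  unfolding endo_def using lin_const_zero[OF FB_module, where M="FB j"] by simp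

context
  fixes j assumes j: "j \<in> I"
begin

lemma cut_basis: "cut e (bv b) = (if edge b = e then bv b else (\<lambda>b. \<zero>))"
  by (auto simp: cut_def basis_vec_def fun_eq_iff)

lemma sg_basis: "b \<in> B j \<Longrightarrow> sg (bv b) = (if edge b then (\<lambda>c. \<ominus> bv b c) else bv b)"
  by (auto simp: sg_def basis_vec_def fun_eq_iff)

lemma endo_null: "endo j f \<Longrightarrow> f (\<lambda>b. \<zero>) = (\<lambda>b. \<zero>)"
  unfolding endo_def using lin_zero[OF FB_module FB_module, where f=f] by simp

lemma endo_minus: "endo j f \<Longrightarrow> z \<in> carrier (FB j) \<Longrightarrow> f (\<lambda>b. \<ominus> z b) = (\<lambda>b. \<ominus> f z b)"
  unfolding endo_def using lin_uminus[OF FB_module FB_module, where f=f and x=z] lin_closed[of R "FB j" "FB j" f z]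
  by (simp add: free_uminus)

lemma D_cut_edge: "z \<in> carrier (FB j) \<Longrightarrow> D j (cut True z) = D j z"
  by (rule endo_eq[OF endo_comp[OF D_endo[OF j] cut_endo] D_endo[OF j]])
    (auto simp: cut_basis D_vertex[OF j] endo_null[OF D_endo[OF j]])

lemma D_cut_vertex: "z \<in> carrier (FB j) \<Longrightarrow> D j (cut False z) = (\<lambda>b. \<zero>)"
  by (rule endo_eq[OF endo_comp[OF D_endo[OF j] cut_endo] endo_zero])
    (auto simp: cut_basis D_vertex[OF j] endo_null[OF D_endo[OF j]])

lemma D_no_edge: "b \<in> B j \<Longrightarrow> edge c \<Longrightarrow> D j (bv b) c = \<zero>"
  using D_vertex[OF j, of b] D_edge[OF j, of b c] by (cases "edge b") auto

lemma cut_D: "z \<in> carrier (FB j) \<Longrightarrow> cut e (D j z) = (if e then (\<lambda>b. \<zero>) else D j z)"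
proof -
  assume z: "z \<in> carrier (FB j)"
  have "cut True (D j z) = (\<lambda>b. \<zero>)"
    by (rule endo_eq[OF endo_comp[OF cut_endo D_endo[OF j]] endo_zero _ z])
      (auto simp: cut_def fun_eq_iff D_no_edge)
  moreover have "cut False (D j z) = D j z"
    by (rule endo_eq[OF endo_comp[OF cut_endo D_endo[OF j]] D_endo[OF j] _ z])
      (auto simp: cut_def fun_eq_iff D_no_edge)
  ultimately show ?thesis by (cases e) auto
qed

lemma sg_D: "z \<in> carrier (FB j) \<Longrightarrow> sg (D j z) = D j z"
    by (rule endo_eq[OF endo_comp[OF sg_endo D_endo[OF j]] D_endo[OF j]])
      (auto simp: sg_def fun_eq_iff D_no_edge)

lemma D_sg: "z \<in> carrier (FB j) \<Longrightarrow> D j (sg z) = (\<lambda>b. \<ominus> D j z b)"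
    by (rule endo_eq[OF endo_comp[OF D_endo[OF j] sg_endo] endo_neg[OF D_endo[OF j]]])
      (auto simp: sg_basis endo_minus[OF D_endo[OF j] basis_vec_closed] D_vertex[OF j])

lemma D_D: "z \<in> carrier (FB j) \<Longrightarrow> D j (D j z) = (\<lambda>b. \<zero>)"
  using D_cut_vertex[OF lin_closed[OF D_lin[OF j]], of z] cut_D[of z False] by simp

end

text \<open>
  \<open>tau m\<close> is the Koszul sign of the first \<open>m\<close> coordinates. The differential \<open>bd m\<close> differentiates only
  these coordinates; the truncation is what exactness is proved for, by induction on \<open>m\<close>.
\<close>

primrec tau :: "nat \<Rightarrow> ((nat \<Rightarrow> 'b) \<Rightarrow> 'r) \<Rightarrow> ((nat \<Rightarrow> 'b) \<Rightarrow> 'r)" where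
  "tau 0 x = x"
| "tau (Suc m) x = tau m (op (Suc m) sg x)"

primrec bd :: "nat \<Rightarrow> ((nat \<Rightarrow> 'b) \<Rightarrow> 'r) \<Rightarrow> ((nat \<Rightarrow> 'b) \<Rightarrow> 'r)" where
  "bd 0 x = (\<lambda>c. \<zero>)"
| "bd (Suc m) x = bd m x \<oplus>\<^bsub>C\<^esub> tau m (op (Suc m) (D (Suc m)) x)"

lemma in_I: "Suc m \<le> n \<Longrightarrow> Suc m \<in> I" by auto

lemma tau_lin: "m \<le> n \<Longrightarrow> lin R C C (tau m)"
proof (induction m)
  case 0
  then show ?case using lin_id[of R C] by (simp add: tau_def)
next
  case (Suc m)
  then have 1: "lin R C C (tau m)" by simp
  show ?case using lin_comp[OF op_lin[OF in_I[OF Suc.prems] sg_endo] 1] by simp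
qed

lemma bd_lin: "m \<le> n \<Longrightarrow> lin R C C (bd m)"
proof (induction m)
  case 0
  then show ?case using lin_const_zero[OF C_module, of C] by simp
next
  case (Suc m)
  then have 1: "lin R C C (bd m)" "lin R C C (tau m)" using tau_lin by auto
  show ?case
    using lin_plus[OF C_module 1(1) lin_comp[OF op_lin[OF in_I[OF Suc.prems] D_endo[OF in_I[OF Suc.prems]]] 1(2)]]
    by (simp del: free_simps)
qed

lemma op_tau:
  "m < j \<Longrightarrow> j \<le> n \<Longrightarrow> endo j f \<Longrightarrow> x \<in> carrier C \<Longrightarrow> op j f (tau m x) = tau m (op j f x)"
proof (induction m arbitrary: x)
  case (Suc m)
  then have "op (Suc m) sg x \<in> carrier C" by (intro op_closed sg_endo) auto
  then show ?case using Suc by (simp add: op_commute[OF _ _ _ _ _ sg_endo])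
qed simp

lemma op_bd:
  "m < j \<Longrightarrow> j \<le> n \<Longrightarrow> endo j f \<Longrightarrow> x \<in> carrier C \<Longrightarrow> op j f (bd m x) = bd m (op j f x)"
proof (induction m arbitrary: x)
  case 0
  then show ?case using lin_zero[OF C_module C_module op_lin[of j f]] by simp
next
  case (Suc m)
  then have m: "Suc m \<in> I" "j \<in> I" "m \<le> n" by auto
  have c: "op (Suc m) (D (Suc m)) x \<in> carrier C" using Suc m by (intro op_closed D_endo) auto
  have "op j f (bd (Suc m) x) = op j f (bd m x) \<oplus>\<^bsub>C\<^esub> op j f (tau m (op (Suc m) (D (Suc m)) x))"
    using Suc m c by (simp del: free_simps add: lin_add[OF op_lin] lin_closed[OF bd_lin] lin_closed[OF tau_lin])
  also have "\<dots> = bd m (op j f x) \<oplus>\<^bsub>C\<^esub> tau m (op (Suc m) (D (Suc m)) (op j f x))"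
    using Suc m c by (simp del: free_simps add: op_tau op_commute[OF _ m(2,1) _ _ D_endo])
  finally show ?case by (simp del: free_simps)
qed

lemma bd_tau: "m \<le> n \<Longrightarrow> x \<in> carrier C \<Longrightarrow> bd m (tau m x) = \<ominus>\<^bsub>C\<^esub> tau m (bd m x)"
proof (induction m arbitrary: x)
  case 0
  then show ?case using free_uminus[OF C.M.zero_closed] by simp
next
  case (Suc m)
  let ?j = "Suc m"
  have j: "?j \<in> I" "m \<le> n" "m < ?j" "?j \<le> n" using Suc by auto
  let ?s = "op ?j sg x" and ?d = "op ?j (D ?j) x"
  have s: "?s \<in> carrier C" "?d \<in> carrier C" using j Suc by (auto intro!: op_closed sg_endo D_endo)
  note cl = lin_closed[OF tau_lin[OF j(2)]] lin_closed[OF bd_lin[OF j(2)]]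
  have 1: "op ?j (D ?j) ?s = \<ominus>\<^bsub>C\<^esub> ?d"
    unfolding op_comp[OF Suc.prems(2) j(1) sg_endo] free_uminus[OF s(2)]
  proof
    fix c
    show "op ?j (\<lambda>z. D ?j (sg z)) x c = \<ominus> ?d c"
      unfolding op_def by (cases "c \<in> cells") (simp_all only: D_sg[OF j(1) slice_closed[OF Suc.prems(2) _ j(1)]] simp_thms if_True if_False minus_zero)
  qed
  have 2: "op ?j sg ?d = ?d"
    unfolding op_comp[OF Suc.prems(2) j(1) D_endo[OF j(1)]]
    by (rule op_cong[OF Suc.prems(2) j(1)]) (simp add: sg_D[OF j(1)])
  have "bd ?j (tau ?j x) = bd m (tau m ?s) \<oplus>\<^bsub>C\<^esub> tau m (op ?j (D ?j) (tau m ?s))"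
    by (simp del: free_simps)
  also have "\<dots> = \<ominus>\<^bsub>C\<^esub> tau m (bd m ?s) \<oplus>\<^bsub>C\<^esub> \<ominus>\<^bsub>C\<^esub> tau m (tau m ?d)"
    using j s cl by (simp del: free_simps add: Suc.IH op_tau D_endo 1 lin_uminus[OF C_module C_module tau_lin[OF j(2)]])
  also have "\<dots> = \<ominus>\<^bsub>C\<^esub> (tau m (bd m ?s) \<oplus>\<^bsub>C\<^esub> tau m (tau m ?d))"
    using s cl by (simp del: free_simps add: C.M.minus_add)
  also have "tau m (bd m ?s) \<oplus>\<^bsub>C\<^esub> tau m (tau m ?d) = tau ?j (bd ?j x)"
    using j s cl Suc.prems
    by (simp del: free_simps add: lin_add[OF op_lin[OF j(1) sg_endo]] lin_add[OF tau_lin[OF j(2)]] op_bd[OF _ _ sg_endo]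
      op_tau[OF _ _ sg_endo] 2 op_closed[OF _ j(1) sg_endo])
  finally show ?case .
qed

lemma bd_bd: "m \<le> n \<Longrightarrow> x \<in> carrier C \<Longrightarrow> bd m (bd m x) = \<zero>\<^bsub>C\<^esub>"
proof (induction m arbitrary: x)
  case 0
  then show ?case by simp
next
  case (Suc m)
  let ?j = "Suc m"
  have j: "?j \<in> I" "m \<le> n" "m < ?j" "?j \<le> n" using Suc by auto
  let ?d = "op ?j (D ?j)"
  have d: "?d y \<in> carrier C" if "y \<in> carrier C" for y using j that by (auto intro!: op_closed D_endo)
  note cl = lin_closed[OF tau_lin[OF j(2)]] lin_closed[OF bd_lin[OF j(2)]]
  have 1: "?d (?d x) = \<zero>\<^bsub>C\<^esub>"
    unfolding op_comp[OF Suc.prems(2) j(1) D_endo[OF j(1)]]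
    using op_cong[OF Suc.prems(2) j(1), of "\<lambda>z. D ?j (D ?j z)" "\<lambda>z b. \<zero>"] by (simp add: D_D[OF j(1)] op_zero)
  have "bd ?j (bd ?j x) = bd m (bd m x \<oplus>\<^bsub>C\<^esub> tau m (?d x)) \<oplus>\<^bsub>C\<^esub> tau m (?d (bd m x \<oplus>\<^bsub>C\<^esub> tau m (?d x)))"
    by (simp del: free_simps)
  also have "\<dots> = (bd m (bd m x) \<oplus>\<^bsub>C\<^esub> bd m (tau m (?d x))) \<oplus>\<^bsub>C\<^esub> (tau m (bd m (?d x)) \<oplus>\<^bsub>C\<^esub> tau m (tau m (?d (?d x))))"
    using Suc.prems j cl d by (simp del: free_simps add: lin_add[OF bd_lin[OF j(2)]] lin_add[OF tau_lin[OF j(2)]]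
      lin_add[OF op_lin[OF j(1) D_endo[OF j(1)]]] op_bd[OF _ _ D_endo[OF j(1)]] op_tau[OF _ _ D_endo[OF j(1)]])
  also have "\<dots> = \<zero>\<^bsub>C\<^esub>"
    using Suc.prems j cl d unfolding 1 by (simp del: free_simps add: Suc.IH bd_tau lin_zero[OF C_module C_module tau_lin[OF j(2)]]
      C.M.l_neg)
  finally show ?case .
qed

subsection \<open>Exactness in positive degrees\<close>

definition dg :: "nat \<Rightarrow> (nat \<Rightarrow> 'b) \<Rightarrow> nat" where
  "dg m c = (\<Sum>i\<in>{1..m}. if edge (c i) then 1 else 0)"

definition cellsk :: "nat \<Rightarrow> nat \<Rightarrow> (nat \<Rightarrow> 'b) set" where
  "cellsk m k = {c \<in> cells. dg m c = k}"

abbreviation "CK m k \<equiv> free_module R (cellsk m k)"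

lemma dg_Suc: "dg (Suc m) c = dg m c + (if edge (c (Suc m)) then 1 else 0)"
  by (simp add: dg_def)

lemma dg_upd: "m < j \<Longrightarrow> dg m (c(j := b)) = dg m c"
  unfolding dg_def by (rule sum.cong) auto

lemma cellsk_iff:
  "x \<in> carrier (CK m k) \<longleftrightarrow> x \<in> carrier C \<and> (\<forall>c. x c \<noteq> \<zero> \<longrightarrow> dg m c = k)"
  unfolding cellsk_def free_carrier
  by auto (metis zero_closed)?

lemma cellskD:
  assumes "x \<in> carrier (CK m k)"
  shows "x \<in> carrier C" "x c \<noteq> \<zero> \<Longrightarrow> dg m c = k"
  using assms unfolding cellsk_iff by auto

lemma tau_apply:
  "m \<le> n \<Longrightarrow> x \<in> carrier C \<Longrightarrow> tau m x c = (if even (dg m c) then x c else \<ominus> x c)"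
proof (induction m arbitrary: x)
  case 0
  then show ?case by (simp add: dg_def)
next
  case (Suc m)
  have j: "Suc m \<in> I" using Suc by auto
  have s: "op (Suc m) sg x c = (if edge (c (Suc m)) then \<ominus> x c else x c)"
    using free_outside[OF Suc.prems(2), of c] by (auto simp: op_def sg_def)
  show ?case
    using Suc.IH[OF _ op_closed[OF Suc.prems(2) j sg_endo]] Suc.prems(1) free_closed[OF Suc.prems(2)]
    by (auto simp: s dg_Suc)
qed

lemma tau_nonzero: "m \<le> n \<Longrightarrow> x \<in> carrier C \<Longrightarrow> tau m x c \<noteq> \<zero> \<Longrightarrow> x c \<noteq> \<zero>"
  by (auto simp: tau_apply split: if_splits)

lemma D_support: "j \<in> I \<Longrightarrow> b \<in> B j \<Longrightarrow> D j (bv b) b' \<noteq> \<zero> \<Longrightarrow> edge b \<and> \<not> edge b'"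
  using D_vertex[of j b] D_edge[of j b b'] by fastforce

lemma cut_apply: "x \<in> carrier C \<Longrightarrow> op j (cut e) x c = (if edge (c j) = e then x c else \<zero>)"
  using free_outside[of x cells c] by (auto simp: op_def cut_def)

lemma bd_support:
  "m \<le> n \<Longrightarrow> x \<in> carrier C \<Longrightarrow> bd m x c \<noteq> \<zero> \<Longrightarrow>
    \<exists>c'. x c' \<noteq> \<zero> \<and> dg m c' = Suc (dg m c) \<and> (\<forall>i>m. c' i = c i)"
proof (induction m)
  case 0
  then show ?case by simp
next
  case (Suc m)
  have j: "Suc m \<in> I" "m \<le> n" using Suc by auto
  let ?d = "op (Suc m) (D (Suc m)) x"
  have d: "?d \<in> carrier C" by (rule op_closed[OF Suc.prems(2) j(1) D_endo[OF j(1)]])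
  consider "bd m x c \<noteq> \<zero>" | "tau m ?d c \<noteq> \<zero>"
    using Suc.prems(3) by (cases "bd m x c = \<zero>"; cases "tau m ?d c = \<zero>") auto
  then show ?case
  proof cases
    case 1
    then obtain c' where c': "x c' \<noteq> \<zero>" "dg m c' = Suc (dg m c)" "\<forall>i>m. c' i = c i"
      using Suc.IH[OF j(2) Suc.prems(2)] by blast
    then show ?thesis by (intro exI[of _ c']) (auto simp: dg_Suc)
  next
    case 2
    then have "?d c \<noteq> \<zero>" by (rule tau_nonzero[OF j(2) d])
    from op_support[OF Suc.prems(2) j(1) D_endo[OF j(1)] this, of "\<lambda>b b'. edge b \<and> \<not> edge b'"] D_support[OF j(1)]
    obtain b where "x (c(Suc m := b)) \<noteq> \<zero>" "edge b" "\<not> edge (c (Suc m))" by blast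
    moreover from this have "dg (Suc m) (c(Suc m := b)) = Suc (dg (Suc m) c)"
      unfolding dg_Suc dg_upd[OF lessI] fun_upd_same by simp
    moreover have "\<forall>i>Suc m. (c(Suc m := b)) i = c i" by simp
    ultimately show ?thesis by blast
  qed
qed

lemma bd_cellsk:
  assumes "m \<le> n" "x \<in> carrier (CK m (Suc k))"
  shows "bd m x \<in> carrier (CK m k)"
  unfolding cellsk_iff
proof (intro conjI allI impI)
  show "bd m x \<in> carrier C" using lin_closed[OF bd_lin[OF assms(1)] cellskD(1)[OF assms(2)]] .
  fix c assume "bd m x c \<noteq> \<zero>"
  then show "dg m c = k" using bd_support[OF assms(1) cellskD(1)[OF assms(2)]] cellskD(2)[OF assms(2)] by fastforce
qed

lemma lin_free_mono: "A \<subseteq> A' \<Longrightarrow> lin R (free_module R A') N f \<Longrightarrow> lin R (free_module R A) N f"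
  using free_mono[of A A'] unfolding lin_def by (auto simp: Pi_iff subset_iff)

text \<open>
  Only finitely many edges occur in the \<open>j\<close>-th coordinate of \<open>x\<close>, so one left inverse of \<open>D j\<close> serves
  for all of them.
\<close>

lemma local_splitting:
  assumes x: "x \<in> carrier C" and j: "j \<in> I"
  shows "\<exists>L. endo j L \<and> (\<forall>b\<in>B j. \<forall>c. L (bv b) c \<noteq> \<zero> \<longrightarrow> \<not> edge b \<and> edge c) \<and>
    op j L (op j (D j) x) = op j (cut True) x"
proof -
  let ?F = "{b \<in> (\<lambda>c. c j) ` {c. x c \<noteq> \<zero>}. edge b}"
  let ?G = "?F \<union> {b \<in> B j. \<not> edge b}"
  have sub: "?F \<subseteq> B j"
    using free_supp[OF x] j unfolding cells_def by (auto dest!: subsetD PiE_mem)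
  have "\<exists>L. lin R (FB j) (FB j) L \<and> (\<forall>b\<in>B j. \<forall>c. edge b \<or> \<not> edge c \<longrightarrow> L (bv b) c = \<zero>) \<and>
     (\<forall>b\<in>?F. L (D j (bv b)) = bv b)"
    using free_finite[OF x] sub by (intro D_split[OF j]) auto
  then obtain L where L: "endo j L" "\<And>b c. b \<in> B j \<Longrightarrow> edge b \<or> \<not> edge c \<Longrightarrow> L (bv b) c = \<zero>"
    "\<And>b. b \<in> ?F \<Longrightarrow> L (D j (bv b)) = bv b" unfolding endo_def by blast
  have L0: "L (\<lambda>b. \<zero>) = (\<lambda>b. \<zero>)" by (rule endo_null[OF j L(1)])
  have eq: "L (D j z) = cut True z" if z: "z \<in> carrier (free_module R ?G)" for z
  proof (rule free_lin_eq[OF FB_module _ _ _ z])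
    show "lin R (free_module R ?G) (FB j) (\<lambda>z. L (D j z))" "lin R (free_module R ?G) (FB j) (cut True)"
      using sub endo_comp[OF L(1) D_endo[OF j]] cut_endo[of j True] unfolding endo_def
      by (auto intro: lin_free_mono[of ?G "B j"])
    fix b assume "b \<in> ?G"
    then consider "b \<in> ?F" | "b \<in> B j" "\<not> edge b" by blast
    then show "L (D j (bv b)) = cut True (bv b)"
    proof cases
      case 1
      then have "edge b" by blast
      then show ?thesis unfolding L(3)[OF 1] cut_basis[OF j] by simp
    next
      case 2
      then show ?thesis unfolding D_vertex[OF j 2] cut_basis[OF j] L0 by simp
    qed
  qed
  have "op j (\<lambda>z. L (D j z)) x = op j (cut True) x"
  proof
    fix c
    have "L (D j (\<lambda>b. x (c(j := b)))) = cut True (\<lambda>b. x (c(j := b)))" if c: "c \<in> cells"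
    proof (rule eq)
      have s: "(\<lambda>b. x (c(j := b))) \<in> carrier (FB j)" by (rule slice_closed[OF x c j])
      show "(\<lambda>b. x (c(j := b))) \<in> carrier (free_module R ?G)"
      proof (rule freeI[OF free_finite[OF s]])
        show "{b. x (c(j := b)) \<noteq> \<zero>} \<subseteq> ?G"
        proof
          fix b assume b: "b \<in> {b. x (c(j := b)) \<noteq> \<zero>}"
          then have "b \<in> (\<lambda>c. c j) ` {c. x c \<noteq> \<zero>}" by (intro image_eqI[of _ _ "c(j := b)"]) auto
          moreover have "b \<in> B j" using free_supp[OF s] b by blast
          ultimately show "b \<in> ?G" by blast
        qed
      qed (use free_closed[OF s] in auto)
    qed
    then show "op j (\<lambda>z. L (D j z)) x c = op j (cut True) x c" unfolding op_def by simp
  qed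
  then have "op j L (op j (D j) x) = op j (cut True) x" by (simp add: op_comp[OF x j D_endo[OF j]])
  then show ?thesis using L(1,2) by blast
qed

lemma bd_Suc_edge:
  assumes "m < n" "y \<in> carrier C" "op (Suc m) (cut False) y = y"
  shows "bd (Suc m) y = bd m y"
proof -
  let ?j = "Suc m"
  have j: "?j \<in> I" "m \<le> n" using assms(1) by auto
  have "op ?j (D ?j) (op ?j (cut False) y) = op ?j (\<lambda>z b. \<zero>) y"
    unfolding op_comp[OF assms(2) j(1) cut_endo]
    by (rule op_cong[OF assms(2) j(1)]) (rule D_cut_vertex[OF j(1)])
  then have "op ?j (D ?j) y = \<zero>\<^bsub>C\<^esub>" unfolding assms(3) op_zero by simp
  then show ?thesis
    using lin_zero[OF C_module C_module tau_lin[OF j(2)]] lin_closed[OF bd_lin[OF j(2)] assms(2)]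
    by (simp del: free_simps)
qed

lemma bd_edge_part:
  assumes "m < n" "x \<in> carrier C" "bd (Suc m) x = \<zero>\<^bsub>C\<^esub>"
  shows "bd m (op (Suc m) (cut True) x) = \<zero>\<^bsub>C\<^esub>"
proof -
  let ?j = "Suc m"
  have j: "?j \<in> I" "m \<le> n" "m < ?j" "?j \<le> n" using assms(1) by auto
  have d: "op ?j (D ?j) x \<in> carrier C" by (rule op_closed[OF assms(2) j(1) D_endo[OF j(1)]])
  have "op ?j (cut True) (op ?j (D ?j) x) = op ?j (\<lambda>z b. \<zero>) x"
    unfolding op_comp[OF assms(2) j(1) D_endo[OF j(1)]]
    by (rule op_cong[OF assms(2) j(1)]) (simp add: cut_D[OF j(1)])
  then have z: "op ?j (cut True) (op ?j (D ?j) x) = \<zero>\<^bsub>C\<^esub>" unfolding op_zero by simp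
  have "\<zero>\<^bsub>C\<^esub> = op ?j (cut True) (bd ?j x)"
    unfolding assms(3) by (rule lin_zero[OF C_module C_module op_lin[OF j(1) cut_endo], symmetric])
  also have "\<dots> = op ?j (cut True) (bd m x) \<oplus>\<^bsub>C\<^esub> op ?j (cut True) (tau m (op ?j (D ?j) x))"
    unfolding bd.simps
    by (rule lin_add[OF op_lin[OF j(1) cut_endo] lin_closed[OF bd_lin[OF j(2)] assms(2)] lin_closed[OF tau_lin[OF j(2)] d]])
  also have "\<dots> = bd m (op ?j (cut True) x) \<oplus>\<^bsub>C\<^esub> \<zero>\<^bsub>C\<^esub>"
    unfolding op_bd[OF j(3,4) cut_endo assms(2)] op_tau[OF j(3,4) cut_endo d] z
    by (simp only: lin_zero[OF C_module C_module tau_lin[OF j(2)]])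
  also have "\<dots> = bd m (op ?j (cut True) x)"
    using lin_closed[OF bd_lin[OF j(2)] op_closed[OF assms(2) j(1) cut_endo]] by (simp del: free_simps)
  finally show ?thesis by simp
qed

text \<open>
  Split a cycle \<open>x\<close> of \<open>bd (m + 1)\<close> into its parts with an edge and with a vertex in coordinate
  \<open>m + 1\<close>. The edge part is a cycle of \<open>bd m\<close>. If its degree in the first \<open>m\<close> coordinates is positive, it
  is a boundary by induction; in degree \<open>0\<close> induction is not available, and the local left inverse of
  \<open>D (m + 1)\<close> is applied to the equation \<open>bd (m + 1) x = 0\<close> instead. Subtracting the resulting
  boundary leaves a cycle supported on vertices in coordinate \<open>m + 1\<close>, to which induction applies.
\<close>

lemma bd_exact:
  "m \<le> n \<Longrightarrow> x \<in> carrier (CK m (Suc k)) \<Longrightarrow> bd m x = \<zero>\<^bsub>C\<^esub> \<Longrightarrow>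
    \<exists>y\<in>carrier (CK m (Suc (Suc k))). bd m y = x"
proof (induction m arbitrary: x k)
  case 0
  then have "x c = \<zero>" for c using cellskD(2)[OF 0(2), of c] by (auto simp: dg_def)
  then show ?case
    by (intro bexI[of _ "\<lambda>c. \<zero>"]) (auto simp: free_carrier)
next
  case (Suc m)
  let ?j = "Suc m"
  have j: "?j \<in> I" "m \<le> n" "m < ?j" "?j \<le> n" "m < n" using Suc.prems(1) by auto
  have x: "x \<in> carrier C" using Suc.prems(2) by (rule cellskD)
  have xd: "dg ?j c = Suc k" if "x c \<noteq> \<zero>" for c using cellskD(2)[OF Suc.prems(2) that] .
  let ?E = "op ?j (cut True)" and ?V = "op ?j (cut False)"
  have Ec: "?E y \<in> carrier C" "?V y \<in> carrier C" if "y \<in> carrier C" for y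
    using op_closed[OF that j(1) cut_endo] by auto
  have idem: "?E (?E y) = ?E y" "?V (?V y) = ?V y" "?E (?V y) = \<zero>\<^bsub>C\<^esub>" "?V (?E y) = \<zero>\<^bsub>C\<^esub>"
    if "y \<in> carrier C" for y
    using that by (auto simp: fun_eq_iff cut_apply Ec)
  have sumEV: "y = ?E y \<oplus>\<^bsub>C\<^esub> ?V y" if "y \<in> carrier C" for y
    using that free_closed[OF that] by (auto simp: fun_eq_iff cut_apply)
  have mE: "bd m (?E x) = \<zero>\<^bsub>C\<^esub>" by (rule bd_edge_part[OF j(5) x Suc.prems(3)])
  have "\<exists>y\<in>carrier (CK m (Suc k)). ?E y = y \<and> bd m y = ?E x"
  proof (cases k)
    case (Suc k')
    have "?E x \<in> carrier (CK m (Suc k'))"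
      unfolding cellsk_iff using Ec(1)[OF x] xd
      by (fastforce simp: cut_apply[OF x] dg_Suc Suc split: if_splits)
    from Suc.IH[OF j(2) this mE] obtain y
      where y: "y \<in> carrier (CK m (Suc k))" "bd m y = ?E x" unfolding Suc by blast
    note yC = cellskD(1)[OF y(1)]
    have "?E y \<in> carrier (CK m (Suc k))"
      unfolding cellsk_iff using Ec(1)[OF yC] cellskD(2)[OF y(1)] by (auto simp: cut_apply[OF yC])
    moreover have "bd m (?E y) = ?E x"
      using op_bd[OF j(3,4) cut_endo yC, of True] y(2) idem(1)[OF x] by simp
    ultimately show ?thesis using idem(1)[OF yC] by blast
  next
    case 0
    from local_splitting[OF x j(1)] obtain L where L: "endo ?j L"
      "\<forall>b\<in>B ?j. \<forall>c. L (bv b) c \<noteq> \<zero> \<longrightarrow> \<not> edge b \<and> edge c"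
      "op ?j L (op ?j (D ?j) x) = ?E x" by blast
    let ?d = "op ?j (D ?j) x" and ?y = "op ?j L x"
    have d: "?d \<in> carrier C" by (rule op_closed[OF x j(1) D_endo[OF j(1)]])
    have yC: "?y \<in> carrier C" by (rule op_closed[OF x j(1) L(1)])
    have ysupp: "edge (c ?j) \<and> dg m c = Suc k" if "?y c \<noteq> \<zero>" for c
    proof -
      from op_support[OF x j(1) L(1) that, of "\<lambda>b b'. \<not> edge b \<and> edge b'"] L(2)
      obtain b where "x (c(?j := b)) \<noteq> \<zero>" "\<not> edge b" "edge (c ?j)" by blast
      then show ?thesis using xd[of "c(?j := b)"] by (simp add: dg_Suc dg_upd)
    qed
    have taud: "tau m ?d = ?d"
    proof
      fix c
      have "dg m c = 0" if dc: "?d c \<noteq> \<zero>"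
      proof -
        from op_support[OF x j(1) D_endo[OF j(1)] dc, of "\<lambda>b b'. edge b \<and> \<not> edge b'"] D_support[OF j(1)]
        obtain b where "x (c(?j := b)) \<noteq> \<zero>" "edge b" by blast
        then show ?thesis using xd[of "c(?j := b)"] 0 by (simp add: dg_Suc dg_upd)
      qed
      then show "tau m ?d c = ?d c" unfolding tau_apply[OF j(2) d] by (cases "?d c = \<zero>") auto
    qed
    have "\<zero>\<^bsub>C\<^esub> = op ?j L (bd ?j x)"
      unfolding Suc.prems(3) by (rule lin_zero[OF C_module C_module op_lin[OF j(1) L(1)], symmetric])
    also have "\<dots> = op ?j L (bd m x) \<oplus>\<^bsub>C\<^esub> op ?j L ?d"
      unfolding bd.simps taud
      by (rule lin_add[OF op_lin[OF j(1) L(1)] lin_closed[OF bd_lin[OF j(2)] x] d])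
    also have "\<dots> = bd m ?y \<oplus>\<^bsub>C\<^esub> ?E x"
      unfolding op_bd[OF j(3,4) L(1) x] L(3) ..
    finally have "bd m ?y \<oplus>\<^bsub>C\<^esub> ?E x = \<zero>\<^bsub>C\<^esub>" by simp
    then have "\<ominus>\<^bsub>C\<^esub> (bd m ?y) = ?E x"
      using lin_closed[OF bd_lin[OF j(2)] yC] Ec(1)[OF x] C.M.minus_equality C.M.a_comm by metis
    then have "bd m (\<ominus>\<^bsub>C\<^esub> ?y) = ?E x" using lin_uminus[OF C_module C_module bd_lin[OF j(2)] yC] by simp
    moreover have nz: "(\<ominus>\<^bsub>C\<^esub> ?y) c \<noteq> \<zero> \<Longrightarrow> ?y c \<noteq> \<zero>" for c unfolding free_uminus[OF yC] by auto
    have nC: "\<ominus>\<^bsub>C\<^esub> ?y \<in> carrier C" using yC by (rule C.M.a_inv_closed)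
    have "\<ominus>\<^bsub>C\<^esub> ?y \<in> carrier (CK m (Suc k))"
      unfolding cellsk_iff using nz ysupp nC by blast
    moreover have "?E (\<ominus>\<^bsub>C\<^esub> ?y) = \<ominus>\<^bsub>C\<^esub> ?y"
      using nz ysupp unfolding fun_eq_iff cut_apply[OF nC] by metis
    ultimately show ?thesis by blast
  qed
  then obtain y where y: "y \<in> carrier (CK m (Suc k))" "?E y = y" "bd m y = ?E x" by blast
  note yC = cellskD(1)[OF y(1)]
  have yS: "y \<in> carrier (CK ?j (Suc (Suc k)))"
  proof -
    have "edge (c ?j)" if "y c \<noteq> \<zero>" for c
      using fun_cong[OF y(2), of c] that by (auto simp: cut_apply[OF yC] split: if_splits)
    then show ?thesis
      unfolding cellsk_iff using yC cellskD(2)[OF y(1)] by (auto simp: dg_Suc)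
  qed
  define w where "w = x \<ominus>\<^bsub>C\<^esub> bd ?j y"
  let ?d = "op ?j (D ?j) y"
  have d: "?d \<in> carrier C" by (rule op_closed[OF yC j(1) D_endo[OF j(1)]])
  have td: "tau m ?d \<in> carrier C" by (rule lin_closed[OF tau_lin[OF j(2)] d])
  have bC: "bd ?j y \<in> carrier C" by (rule lin_closed[OF bd_lin[OF j(4)] yC])
  have wC: "w \<in> carrier C" unfolding w_def using x bC by (rule C.M.minus_closed)
  have Vd: "?V (tau m ?d) = tau m ?d"
    unfolding op_tau[OF j(3,4) cut_endo d] op_comp[OF yC j(1) D_endo[OF j(1)]]
    by (rule arg_cong[of _ _ "tau m"], rule op_cong[OF yC j(1)]) (simp add: cut_D[OF j(1)])
  have bdy: "bd ?j y = ?E x \<oplus>\<^bsub>C\<^esub> tau m ?d" unfolding bd.simps y(3) ..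
  have weq: "w = ?V x \<ominus>\<^bsub>C\<^esub> tau m ?d"
  proof -
    have "w = (?E x \<oplus>\<^bsub>C\<^esub> ?V x) \<ominus>\<^bsub>C\<^esub> (?E x \<oplus>\<^bsub>C\<^esub> tau m ?d)"
      unfolding w_def bdy using sumEV[OF x] by (rule arg_cong)
    also have "\<dots> = ?V x \<ominus>\<^bsub>C\<^esub> tau m ?d"
      using Ec[OF x] td by (simp del: free_simps add: a_minus_def C.M.minus_add C.M.a_ac C.M.r_neg2 C.M.r_neg1 C.M.l_neg C.M.r_neg)
    finally show ?thesis .
  qed
  have wV: "?V w = w"
    unfolding weq lin_minus[OF C_module C_module op_lin[OF j(1) cut_endo] Ec(2)[OF x] td] idem(2)[OF x] Vd ..
  have "bd ?j w = \<zero>\<^bsub>C\<^esub>"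
    unfolding w_def lin_minus[OF C_module C_module bd_lin[OF j(4)] x bC] Suc.prems(3) bd_bd[OF j(4) yC]
    by (simp only: a_minus_def C.M.r_neg C.M.zero_closed)
  then have wb: "bd m w = \<zero>\<^bsub>C\<^esub>" unfolding bd_Suc_edge[OF j(5) wC wV] .
  have wS: "w \<in> carrier (CK ?j (Suc k))"
  proof -
    interpret F: module R "CK ?j (Suc k)" by (rule free_module_module)
    have b: "bd ?j y \<in> carrier (CK ?j (Suc k))" by (rule bd_cellsk[OF j(4) yS])
    have "x \<ominus>\<^bsub>CK ?j (Suc k)\<^esub> bd ?j y = w"
      unfolding w_def free_minus[OF Suc.prems(2) b] free_minus[OF x bC] ..
    then show ?thesis using F.M.minus_closed[OF Suc.prems(2) b] by simp
  qed
  have "w \<in> carrier (CK m (Suc k))"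
    unfolding cellsk_iff using wC cellskD(2)[OF wS] arg_cong[OF wV, of "\<lambda>z. z c" for c]
    by (fastforce simp: dg_Suc cut_apply[OF wC] split: if_splits)
  from Suc.IH[OF j(2) this wb] obtain u
    where u: "u \<in> carrier (CK m (Suc (Suc k)))" "bd m u = w" by blast
  note uC = cellskD(1)[OF u(1)]
  let ?u = "?V u"
  have uS: "?u \<in> carrier (CK ?j (Suc (Suc k)))"
    unfolding cellsk_iff using Ec(2)[OF uC] cellskD(2)[OF u(1)] by (auto simp: cut_apply[OF uC] dg_Suc)
  have "bd ?j ?u = bd m ?u" by (rule bd_Suc_edge[OF j(5) Ec(2)[OF uC] idem(2)[OF uC]])
  also have "\<dots> = w" using op_bd[OF j(3,4) cut_endo uC, of False] u(2) wV by simp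
  finally have bu: "bd ?j ?u = w" .
  interpret F: module R "CK ?j (Suc (Suc k))" by (rule free_module_module)
  have "bd ?j (y \<oplus>\<^bsub>C\<^esub> ?u) = bd ?j y \<oplus>\<^bsub>C\<^esub> w"
    unfolding lin_add[OF bd_lin[OF j(4)] yC Ec(2)[OF uC]] bu ..
  also have "\<dots> = x"
    unfolding w_def using x bC by (simp del: free_simps bd.simps add: a_minus_def C.M.a_ac C.M.r_neg2 C.M.r_neg1 C.M.l_neg C.M.r_neg)
  finally have "bd ?j (y \<oplus>\<^bsub>C\<^esub> ?u) = x" .
  moreover have "y \<oplus>\<^bsub>C\<^esub> ?u \<in> carrier (CK ?j (Suc (Suc k)))"
    using F.M.a_closed[OF yS uS] by simp
  ultimately show ?case by blast
qed

subsection \<open>The differential on products\<close>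

lemma tau_pr:
  "m \<le> n \<Longrightarrow> (\<And>i. i \<in> I \<Longrightarrow> z i \<in> carrier (FB i)) \<Longrightarrow>
    tau m (pr z) = pr (\<lambda>i. if i \<le> m then sg (z i) else z i)"
proof (induction m arbitrary: z)
  case 0
  then show ?case by (simp, intro pr_cong) auto
next
  case (Suc m)
  have j: "Suc m \<in> I" "m \<le> n" using Suc.prems by auto
  have s: "sg (z i) \<in> carrier (FB i)" if "i \<in> I" for i
    using lin_closed[OF sg_endo[unfolded endo_def] Suc.prems(2)[OF that]] .
  have "tau (Suc m) (pr z) = tau m (pr (z(Suc m := sg (z (Suc m)))))"
    unfolding tau.simps by (subst op_pr[OF j(1) sg_endo Suc.prems(2)]) auto
  also have "\<dots> = pr (\<lambda>i. if i \<le> m then sg ((z(Suc m := sg (z (Suc m)))) i) else (z(Suc m := sg (z (Suc m)))) i)"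
    using Suc.prems s j by (intro Suc.IH) auto
  also have "\<dots> = pr (\<lambda>i. if i \<le> Suc m then sg (z i) else z i)"
    using Suc.prems s by (intro pr_cong) (auto simp: le_Suc_eq)
  finally show ?case .
qed

lemma bd_pr:
  assumes z: "\<And>i. i \<in> I \<Longrightarrow> z i \<in> carrier (FB i)"
  shows "m \<le> n \<Longrightarrow>
    bd m (pr z) = (\<Oplus>\<^bsub>C\<^esub>j\<in>{1..m}. pr (\<lambda>i. if i < j then sg (z i) else if i = j then D i (z i) else z i))"
proof (induction m)
  case 0
  then show ?case by simp
next
  case (Suc m)
  have j: "Suc m \<in> I" "m \<le> n" using Suc.prems by auto
  have s: "sg (z i) \<in> carrier (FB i)" if "i \<in> I" for i
    using lin_closed[OF sg_endo[unfolded endo_def] z[OF that]] .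
  have d: "D i (z i) \<in> carrier (FB i)" if "i \<in> I" for i
    using lin_closed[OF D_lin z] that by auto
  let ?t = "\<lambda>j. pr (\<lambda>i. if i < j then sg (z i) else if i = j then D i (z i) else z i)"
  have t: "?t j \<in> carrier C" for j using s d z by (intro pr_closed) auto
  have "tau m (op (Suc m) (D (Suc m)) (pr z)) = tau m (pr (z(Suc m := D (Suc m) (z (Suc m)))))"
    by (subst op_pr[OF j(1) D_endo[OF j(1)] z]) auto
  also have "\<dots> = pr (\<lambda>i. if i \<le> m then sg ((z(Suc m := D (Suc m) (z (Suc m)))) i) else (z(Suc m := D (Suc m) (z (Suc m)))) i)"
    using z d j by (intro tau_pr) auto
  also have "\<dots> = ?t (Suc m)"
    using s d z by (intro pr_cong) auto
  finally have "bd (Suc m) (pr z) = (\<Oplus>\<^bsub>C\<^esub>j\<in>{1..m}. ?t j) \<oplus>\<^bsub>C\<^esub> ?t (Suc m)"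
    using Suc.IH[OF j(2)] by (simp only: bd.simps)
  also have "\<dots> = (\<Oplus>\<^bsub>C\<^esub>j\<in>insert (Suc m) {1..m}. ?t j)"
    using t by (subst C.M.finsum_insert) (auto simp del: free_simps simp: C.M.a_comm C.M.finsum_closed)
  also have "insert (Suc m) {1..m} = {1..Suc m}" by auto
  finally show ?case .
qed

end

context coeff_ring
begin

lemma multilin_closed: "multilin I M N b \<Longrightarrow> m \<in> (\<Pi>\<^sub>E i\<in>I. carrier (M i)) \<Longrightarrow> b m \<in> carrier N"
  by (simp add: multilin_def)

lemma multilin_coordinate:
  assumes "multilin I M N b" "m \<in> (\<Pi>\<^sub>E i\<in>I. carrier (M i))" "i \<in> I"
  shows "lin R (M i) N (\<lambda>x. b (m(i := x)))"
  using assms multilin_closed[OF assms(1)] by (intro linI) (auto simp: multilin_def PiE_upd)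

lemma multilin_null:
  assumes "multilin I M N b" "m \<in> (\<Pi>\<^sub>E i\<in>I. carrier (M i))" "i \<in> I" "m i = \<zero>\<^bsub>M i\<^esub>"
    "module R (M i)" "module R N"
  shows "b m = \<zero>\<^bsub>N\<^esub>"
  using lin_zero[OF assms(5,6) multilin_coordinate[OF assms(1-3)]] assms(4) by (metis fun_upd_triv)

text \<open>
  The coordinates are replaced by basis vectors one after another; \<open>J\<close> collects those not yet treated.
\<close>

lemma multilin_free_eq:
  assumes fin: "finite I" and N: "module R N"
    and b: "multilin I (\<lambda>i. free_module R (B i)) N b" and b': "multilin I (\<lambda>i. free_module R (B i)) N b'"
    and eq: "\<And>c. c \<in> (\<Pi>\<^sub>E i\<in>I. B i) \<Longrightarrow> b (\<lambda>i\<in>I. bv (c i)) = b' (\<lambda>i\<in>I. bv (c i))"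
    and m: "m \<in> (\<Pi>\<^sub>E i\<in>I. carrier (free_module R (B i)))"
  shows "b m = b' m"
proof -
  have "b m = b' m" if "finite J" "J \<subseteq> I" "m \<in> (\<Pi>\<^sub>E i\<in>I. carrier (free_module R (B i)))"
      "\<And>i. i \<in> I - J \<Longrightarrow> \<exists>c\<in>B i. m i = bv c" for J m
    using that
  proof (induction J arbitrary: m rule: finite_induct)
    case empty
    then obtain c where c: "\<And>i. i \<in> I \<Longrightarrow> c i \<in> B i" "\<And>i. i \<in> I \<Longrightarrow> m i = bv (c i)" by (metis Diff_empty)
    have "m = (\<lambda>i\<in>I. bv (restrict c I i))"
      using c(2) empty(2) by (auto simp: fun_eq_iff PiE_iff extensional_def)
    moreover have "restrict c I \<in> (\<Pi>\<^sub>E i\<in>I. B i)" using c(1) by auto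
    ultimately show ?case using eq by metis
  next
    case (insert j J)
    then have j: "j \<in> I" by auto
    have "b (m(j := m j)) = b' (m(j := m j))"
    proof (rule free_lin_eq[OF N multilin_coordinate[OF b insert.prems(2) j] multilin_coordinate[OF b' insert.prems(2) j]])
      show "m j \<in> carrier (free_module R (B j))" using insert.prems(2) j by auto
      fix c assume c: "c \<in> B j"
      show "b (m(j := bv c)) = b' (m(j := bv c))"
      proof (rule insert.IH)
        show "m(j := bv c) \<in> (\<Pi>\<^sub>E i\<in>I. carrier (free_module R (B i)))"
          by (rule PiE_upd[OF insert.prems(2) j basis_vec_closed[OF c]])
      qed (use insert.prems c in auto)
    qed
    then show ?case by simp
  qed
  from this[of I m] show ?thesis using fin m by auto
qed

lemma coset_zero_iff:
  assumes "module R M" "submodule H R M" "y \<in> carrier M"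
  shows "H +>\<^bsub>M\<^esub> y = \<zero>\<^bsub>quot_module M H\<^esub> \<longleftrightarrow> y \<in> H"
proof -
  interpret M: module R M by fact
  have "y \<ominus>\<^bsub>M\<^esub> \<zero>\<^bsub>M\<^esub> = y" using assms(3) by (simp add: a_minus_def)
  then show ?thesis
    using coset_eq_iff[OF assms M.M.zero_closed] quot_zero[OF assms(1,2)] by simp
qed

lemma tensor_generated:
  assumes M: "\<And>i. i \<in> I \<Longrightarrow> module R (M i)" and H: "submodule H R (tensor R I M)"
    and "\<And>m. m \<in> (\<Pi>\<^sub>E i\<in>I. carrier (M i)) \<Longrightarrow> tensor_pure R I M m \<in> H"
  shows "carrier (tensor R I M) \<subseteq> H"
proof
  fix x assume x: "x \<in> carrier (tensor R I M)"
  have T: "module R (tensor R I M)" by (rule tensor_module[OF M])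
  interpret T: module R "tensor R I M" by (rule T)
  note Q = quot_module_module[OF T H]
  note mem = coset_zero_iff[OF T H]
  have "H +>\<^bsub>tensor R I M\<^esub> x = \<zero>\<^bsub>quot_module (tensor R I M) H\<^esub>"
  proof (rule tensor_lin_eq[OF M Q quot_proj_lin[OF T H] lin_const_zero[OF Q] _ x])
    fix m assume m: "m \<in> (\<Pi>\<^sub>E i\<in>I. carrier (M i))"
    then have "tensor_pure R I M m \<in> carrier (tensor R I M)" by (intro tensor_pure_closed M) auto
    then show "H +>\<^bsub>tensor R I M\<^esub> tensor_pure R I M m = \<zero>\<^bsub>quot_module (tensor R I M) H\<^esub>"
      using mem assms(3)[OF m] by simp
  qed
  then show "x \<in> H" using mem[OF x] by simp
qed

end

context free_cube
begin

definition bcell :: "nat \<Rightarrow> nat \<Rightarrow> 'b set" where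
  "bcell i k = {b \<in> B i. (if edge b then 1 else 0) = k}"

abbreviation "BK i k \<equiv> free_module R (bcell i k)"

lemma bcell_sub: "carrier (BK i k) \<subseteq> carrier (FB i)"
  unfolding bcell_def by (rule free_mono) auto

lemma bcellD: "x \<in> carrier (BK i k) \<Longrightarrow> x b \<noteq> \<zero> \<Longrightarrow> (if edge b then 1 else 0) = k"
  using free_supp[of x "bcell i k"] by (auto simp: bcell_def)

lemma bcellI:
  assumes "x \<in> carrier (FB i)" "\<And>b. x b \<noteq> \<zero> \<Longrightarrow> (if edge b then 1 else 0) = k"
  shows "x \<in> carrier (BK i k)"
proof (rule freeI[OF free_finite[OF assms(1)]])
  show "{b. x b \<noteq> \<zero>} \<subseteq> bcell i k"
    using free_supp[OF assms(1)] assms(2) unfolding bcell_def by blast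
qed (use free_closed[OF assms(1)] in auto)

lemma pr_factor:
  assumes "\<And>i. i \<in> I \<Longrightarrow> z i \<in> carrier (FB i)" "j \<in> I"
  shows "z j (c j) = \<zero> \<Longrightarrow> pr z c = \<zero>"
proof -
  assume 0: "z j (c j) = \<zero>"
  have P: "(\<Otimes>i\<in>I-{j}. z i (c i)) \<in> carrier R"
    using free_closed[OF assms(1)] by (intro finprod_closed funcsetI) auto
  have "pr (z(j := z j)) c = (if c \<in> cells then z j (c j) \<otimes> (\<Otimes>i\<in>I-{j}. z i (c i)) else \<zero>)"
    by (rule pr_upd[OF assms(2,1) assms(1)[OF assms(2)]])
  then show ?thesis using 0 P by simp
qed

lemma pr_support:
  assumes "\<And>i. i \<in> I \<Longrightarrow> z i \<in> carrier (BK i (d i))" "pr z c \<noteq> \<zero>" "i \<in> I"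
  shows "(if edge (c i) then 1 else 0) = d i"
proof -
  have z: "z i \<in> carrier (FB i)" if "i \<in> I" for i using bcell_sub assms(1)[OF that] by blast
  have "z i (c i) \<noteq> \<zero>" using pr_factor[of z, OF z assms(3)] assms(2) by blast
  then show ?thesis using bcellD[OF assms(1)[OF assms(3)]] by simp
qed

lemma pr_cellsk:
  assumes "\<And>i. i \<in> I \<Longrightarrow> z i \<in> carrier (BK i (d i))" "(\<Sum>i\<in>I. d i) = k"
  shows "pr z \<in> carrier (CK n k)"
  unfolding cellsk_iff
proof (intro conjI allI impI)
  show "pr z \<in> carrier C" using assms(1) bcell_sub by (intro pr_closed) blast
  fix c assume "pr z c \<noteq> \<zero>"
  then show "dg n c = k" using pr_support[of z d, OF assms(1)] assms(2) by (auto simp: dg_def)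
qed

lemma D_bcell:
  assumes "i \<in> I" "z \<in> carrier (FB i)"
  shows "D i z \<in> carrier (BK i 0)"
proof (rule bcellI)
  show "D i z \<in> carrier (FB i)" by (rule lin_closed[OF D_lin[OF assms(1)] assms(2)])
  fix b assume "D i z b \<noteq> \<zero>"
  then have "cut False (D i z) b \<noteq> \<zero>" using cut_D[OF assms, of False] by simp
  then show "(if edge b then 1 else 0) = (0::nat)" by (auto simp: cut_def split: if_splits)
qed

lemma D_bcell_zero:
  assumes "i \<in> I" "z \<in> carrier (BK i k)" "k \<noteq> 1"
  shows "D i z = (\<lambda>b. \<zero>)"
proof -
  have z: "z \<in> carrier (FB i)" using bcell_sub assms(2) by blast
  have "\<not> edge b" if "z b \<noteq> \<zero>" for b using bcellD[OF assms(2) that] assms(3) by (auto split: if_splits)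
  then have "cut False z = z" unfolding cut_def fun_eq_iff by metis
  then show ?thesis using D_cut_vertex[OF assms(1) z] by simp
qed

lemma pr_zero:
  assumes "\<And>i. i \<in> I \<Longrightarrow> z i \<in> carrier (FB i)" "j \<in> I" "z j = (\<lambda>b. \<zero>)"
  shows "pr z = \<zero>\<^bsub>C\<^esub>"
proof
  fix c
  show "pr z c = \<zero>\<^bsub>C\<^esub> c" using pr_factor[of z, OF assms(1,2)] assms(3) by simp
qed

text \<open>
  The usual sign rule on products of homogeneous elements, the form in which \<^const>\<open>tensor_complex\<close>
  states its differential.
\<close>

lemma bd_pr_hom:
  assumes "\<And>i. i \<in> I \<Longrightarrow> z i \<in> carrier (BK i (d i))"
  shows "bd n (pr z) = (\<Oplus>\<^bsub>C\<^esub>j\<in>I. if even (\<Sum>i\<in>{i\<in>I. i < j}. d i) then pr (z(j := D j (z j)))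
     else \<ominus>\<^bsub>C\<^esub> pr (z(j := D j (z j))))"
proof -
  have z: "z i \<in> carrier (FB i)" if "i \<in> I" for i using bcell_sub assms(1)[OF that] by blast
  have d: "D i (z i) \<in> carrier (FB i)" if "i \<in> I" for i
    using lin_closed[OF D_lin z] that by auto
  have zj: "(z(j := D j (z j))) i \<in> carrier (FB i)" if "i \<in> I" for i j using z d that by auto
  have s: "sg (z i) \<in> carrier (FB i)" if "i \<in> I" for i
    using lin_closed[OF sg_endo[unfolded endo_def] z[OF that]] .
  have p: "pr (z(j := D j (z j))) \<in> carrier C" for j by (rule pr_closed[OF zj])
  have "bd n (pr z) = (\<Oplus>\<^bsub>C\<^esub>j\<in>I. pr (\<lambda>i. if i < j then sg (z i) else if i = j then D i (z i) else z i))"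
    by (rule bd_pr[OF z order_refl])
  also have "\<dots> = (\<Oplus>\<^bsub>C\<^esub>j\<in>I. if even (\<Sum>i\<in>{i\<in>I. i < j}. d i) then pr (z(j := D j (z j)))
     else \<ominus>\<^bsub>C\<^esub> pr (z(j := D j (z j))))"
  proof (rule C.M.finsum_cong')
    fix j assume j: "j \<in> I"
    let ?w = "z(j := D j (z j))"
    have hom: "?w i \<in> carrier (BK i ((d(j := 0)) i))" if "i \<in> I" for i
      using assms[OF that] D_bcell[OF j z[OF j]] by auto
    have "pr (\<lambda>i. if i < j then sg (z i) else if i = j then D i (z i) else z i) =
       pr (\<lambda>i. if i \<le> j - 1 then sg (?w i) else ?w i)"
      using j s d z by (intro pr_cong) (auto simp: le_diff_conv2 less_eq_Suc_le)
    also have "\<dots> = tau (j - 1) (pr ?w)" using j zj by (intro tau_pr[symmetric]) auto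
    also have "\<dots> = (if even (\<Sum>i\<in>{i\<in>I. i < j}. d i) then pr ?w else \<ominus>\<^bsub>C\<^esub> pr ?w)"
    proof
      fix c
      have I: "{i\<in>I. i < j} = {1..j - 1}" using j by auto
      have dgc: "dg (j - 1) c = (\<Sum>i\<in>{i\<in>I. i < j}. d i)" if nz: "pr ?w c \<noteq> \<zero>"
        unfolding dg_def I
      proof (rule sum.cong[OF refl])
        fix i assume i: "i \<in> {1..j - 1}"
        then have "(if edge (c i) then 1 else 0) = (d(j := 0)) i"
          using j by (intro pr_support[OF hom nz]) auto
        then show "(if edge (c i) then 1 else 0) = d i" using i j by auto
      qed
      have jn: "j - 1 \<le> n" using j by auto
      show "tau (j - 1) (pr ?w) c = (if even (\<Sum>i\<in>{i\<in>I. i < j}. d i) then pr ?w else \<ominus>\<^bsub>C\<^esub> pr ?w) c"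
      proof (cases "pr ?w c = \<zero>")
        case True
        then show ?thesis unfolding tau_apply[OF jn p] free_uminus[OF p] by simp
      next
        case False
        then show ?thesis unfolding tau_apply[OF jn p] free_uminus[OF p] dgc[OF False] by simp
      qed
    qed
    finally show "pr (\<lambda>i. if i < j then sg (z i) else if i = j then D i (z i) else z i) =
      (if even (\<Sum>i\<in>{i\<in>I. i < j}. d i) then pr ?w else \<ominus>\<^bsub>C\<^esub> pr ?w)" .
  qed (use p in auto)
  finally show ?thesis .
qed

end

section \<open>The augmented cube complex\<close>

text \<open>
  The two-term complexes resolve the modules \<open>M i\<close> through \<open>\<epsilon> i\<close>, apart from injectivity of the
  differential, which \<open>D_split\<close> provides.
\<close>

locale aug_cube = free_cube R n B edge D
  for R :: "'r ring" (structure) and n and B :: "nat \<Rightarrow> 'b set" and edge and D +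
  fixes M :: "nat \<Rightarrow> ('r, 'm) module" and \<epsilon> :: "nat \<Rightarrow> ('b \<Rightarrow> 'r) \<Rightarrow> 'm"
  assumes M_module: "i \<in> {1..n} \<Longrightarrow> module R (M i)"
    and \<epsilon>_lin: "i \<in> {1..n} \<Longrightarrow> lin R (free_module R (B i)) (M i) (\<epsilon> i)"
    and \<epsilon>_D: "i \<in> {1..n} \<Longrightarrow> z \<in> carrier (free_module R (B i)) \<Longrightarrow> \<epsilon> i (D i z) = \<zero>\<^bsub>M i\<^esub>"
    and \<epsilon>_surj: "i \<in> {1..n} \<Longrightarrow> x \<in> carrier (M i) \<Longrightarrow>
      \<exists>z\<in>carrier (free_module R {b \<in> B i. \<not> edge b}). \<epsilon> i z = x"
    and \<epsilon>_ker: "i \<in> {1..n} \<Longrightarrow> z \<in> carrier (free_module R {b \<in> B i. \<not> edge b}) \<Longrightarrow> \<epsilon> i z = \<zero>\<^bsub>M i\<^esub> \<Longrightarrow>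
      \<exists>w\<in>carrier (free_module R (B i)). D i w = z"
begin

lemma bcell_0: "bcell i 0 = {b \<in> B i. \<not> edge b}" by (auto simp: bcell_def)

definition K :: "nat \<Rightarrow> ('r, 'b \<Rightarrow> 'r, 'm) aug_complex" where
  "K i = \<lparr>obj = (\<lambda>k. BK i k), bdry = (\<lambda>k. D i), aug = \<epsilon> i\<rparr>"

lemma K_simps [simp]: "obj (K i) k = BK i k" "bdry (K i) k = D i" "aug (K i) = \<epsilon> i"
  by (simp_all add: K_def)

lemma K_complex:
  assumes i: "i \<in> I"
  shows "complex (K i) (M i)"
proof -
  have F: "x \<in> carrier (FB i)" if "x \<in> carrier (BK i k)" for x k
    using that bcell_sub by blast
  have l: "lin R (BK i k) N f" if "lin R (FB i) N f" for k f and N :: "('r, 'z) module"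
    using that by (intro lin_free_mono[of "bcell i k" "B i"]) (auto simp: bcell_def)
  have "lin R (BK i (Suc k)) (BK i k) (D i)" for k
  proof -
    have "D i x \<in> carrier (BK i k)" if x: "x \<in> carrier (BK i (Suc k))" for x
    proof (cases k)
      case 0
      then show ?thesis using D_bcell[OF i F[OF x]] by simp
    next
      case (Suc j)
      then have "D i x = (\<lambda>b. \<zero>)" by (intro D_bcell_zero[OF i x]) auto
      then show ?thesis by (simp add: free_carrier)
    qed
    then show ?thesis using l[OF D_lin[OF i], of "Suc k"] by (simp add: lin_def)
  qed
  then show ?thesis
    unfolding complex_def K_simps
    using M_module[OF i] l[OF \<epsilon>_lin[OF i]] D_D[OF i F] \<epsilon>_D[OF i F] by (simp add: free_module_module)
qed

definition augC :: "((nat \<Rightarrow> 'b) \<Rightarrow> 'r) \<Rightarrow> ((nat \<Rightarrow> 'm) \<Rightarrow> 'r) set" where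
  "augC = free_lift R (tensor R I M) (\<lambda>c. tensor_pure R I M (\<lambda>i. \<epsilon> i (bv (c i))))"

definition Cx :: "('r, (nat \<Rightarrow> 'b) \<Rightarrow> 'r, ((nat \<Rightarrow> 'm) \<Rightarrow> 'r) set) aug_complex" where
  "Cx = \<lparr>obj = (\<lambda>k. CK n k), bdry = (\<lambda>k. bd n), aug = augC\<rparr>"

lemma Cx_simps [simp]: "obj Cx k = CK n k" "bdry Cx k = bd n" "aug Cx = augC"
  by (simp_all add: Cx_def)

abbreviation "TM \<equiv> tensor R I M"

lemma TM_module: "module R TM" by (rule tensor_module[OF M_module])

lemma \<epsilon>_closed: "i \<in> I \<Longrightarrow> z \<in> carrier (FB i) \<Longrightarrow> \<epsilon> i z \<in> carrier (M i)"
  using lin_closed[OF \<epsilon>_lin] .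

lemma augC_lin: "lin R C TM augC"
  unfolding augC_def
  by (intro free_lift_lin[OF TM_module] funcsetI tensor_pure_closed M_module) (auto intro!: \<epsilon>_closed basis_B)

lemma augC_basis: "c \<in> cells \<Longrightarrow> augC (bv c) = tensor_pure R I M (\<lambda>i. \<epsilon> i (bv (c i)))"
  unfolding augC_def
  by (intro free_lift_basis[OF TM_module] tensor_pure_closed M_module) (auto intro!: \<epsilon>_closed basis_B)

lemma augC_pr:
  assumes z: "\<And>i. i \<in> I \<Longrightarrow> z i \<in> carrier (FB i)"
  shows "augC (pr z) = tensor_pure R I M (\<lambda>i. \<epsilon> i (z i))"
proof -
  have m: "multilin I FB TM (\<lambda>z. augC (pr z))"
    by (rule multilin_post[OF pr_multilin augC_lin])
  have m': "multilin I FB TM (\<lambda>z. tensor_pure R I M (\<lambda>i\<in>I. \<epsilon> i (z i)))"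
    by (rule multilin_comp[OF tensor_pure_multilin[OF M_module] \<epsilon>_lin])
  have "augC (pr (restrict z I)) = tensor_pure R I M (\<lambda>i\<in>I. \<epsilon> i (restrict z I i))"
  proof (rule multilin_free_eq[OF _ TM_module m m'])
    fix c assume "c \<in> (\<Pi>\<^sub>E i\<in>I. B i)"
    then have c: "c \<in> cells" by (simp add: cells_def)
    have "augC (pr (\<lambda>i\<in>I. bv (c i))) = augC (bv c)"
      unfolding basis_pr[OF c] using basis_B[OF c] by (intro arg_cong[of _ _ augC] pr_cong) auto
    also have "\<dots> = tensor_pure R I M (\<lambda>i\<in>I. \<epsilon> i ((\<lambda>i\<in>I. bv (c i)) i))"
      unfolding augC_basis[OF c] by (rule tensor_pure_cong) auto
    finally show "augC (pr (\<lambda>i\<in>I. bv (c i))) = \<dots>" .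
  qed (use z in auto)
  moreover have "pr (restrict z I) = pr z" using z by (intro pr_cong) auto
  moreover have "tensor_pure R I M (\<lambda>i\<in>I. \<epsilon> i (restrict z I i)) = tensor_pure R I M (\<lambda>i. \<epsilon> i (z i))"
    by (rule tensor_pure_cong) auto
  ultimately show ?thesis by simp
qed

lemma pure_zero:
  assumes "\<And>i. i \<in> I \<Longrightarrow> m i \<in> carrier (M i)" "j \<in> I" "m j = \<zero>\<^bsub>M j\<^esub>"
  shows "tensor_pure R I M m = \<zero>\<^bsub>TM\<^esub>"
  using multilin_null[OF tensor_pure_multilin[of "I" M, OF M_module], of "restrict m I" j] assms
    M_module TM_module
  by (simp add: tensor_pure_restrict)

lemma augC_bd:
  assumes x: "x \<in> carrier C"
  shows "augC (bd n x) = \<zero>\<^bsub>TM\<^esub>"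
proof (rule free_lin_eq[OF TM_module lin_comp[OF bd_lin[OF order_refl] augC_lin] lin_const_zero[OF TM_module] _ x])
  fix c assume c: "c \<in> cells"
  interpret T: module R TM by (rule TM_module)
  let ?t = "\<lambda>j i. if i < j then sg (bv (c i)) else if i = j then D i (bv (c i)) else bv (c i)"
  note b = basis_B[OF c]
  have t: "?t j i \<in> carrier (FB i)" if "i \<in> I" for i j
    using that b lin_closed[OF D_lin b] lin_closed[OF sg_endo[unfolded endo_def] b] by auto
  have pt: "pr (?t j) \<in> carrier C" for j by (rule pr_closed[OF t])
  have "bd n (bv c) = (\<Oplus>\<^bsub>C\<^esub>j\<in>I. pr (?t j))"
    unfolding basis_pr[OF c] by (rule bd_pr[OF b order_refl])
  then have "augC (bd n (bv c)) = (\<Oplus>\<^bsub>TM\<^esub>j\<in>I. augC (pr (?t j)))"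
    using pt lin_finsum[OF C_module TM_module augC_lin, of "I" "\<lambda>j. pr (?t j)"] by auto
  also have "\<dots> = (\<Oplus>\<^bsub>TM\<^esub>j\<in>I. \<zero>\<^bsub>TM\<^esub>)"
  proof (rule T.M.finsum_cong')
    fix j assume j: "j \<in> I"
    have "augC (pr (?t j)) = tensor_pure R I M (\<lambda>i. \<epsilon> i (?t j i))" by (rule augC_pr[OF t])
    also have "\<dots> = \<zero>\<^bsub>TM\<^esub>"
      by (rule pure_zero[of "\<lambda>i. \<epsilon> i (?t j i)" j, OF \<epsilon>_closed[OF _ t] j])
        (use \<epsilon>_D[OF j b[OF j]] in auto)
    finally show "augC (pr (?t j)) = \<zero>\<^bsub>TM\<^esub>" .
  qed (use T.M.zero_closed in auto)
  finally show "augC (bd n (bv c)) = \<zero>\<^bsub>TM\<^esub>" by (simp only: T.M.finsum_zero)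
qed

definition boundaries :: "((nat \<Rightarrow> 'b) \<Rightarrow> 'r) set" where
  "boundaries = bd n ` carrier (CK n 1)"

lemma cellsk_sub: "carrier (CK m k) \<subseteq> carrier C"
  unfolding cellsk_def by (rule free_mono) auto

lemma boundaries_submodule: "submodule boundaries R C"
  unfolding boundaries_def using bd_lin[OF order_refl]
  by (intro lin_image_submodule[OF free_module_module C_module] lin_free_mono[of "cellsk n 1" cells])
    (auto simp: cellsk_def)

text \<open>
  Two lifts of one element of \<open>M j\<close> differ by a value of \<open>D j\<close>, and in multidegree \<open>0\<close> elsewhere a
  value of \<open>D j\<close> in coordinate \<open>j\<close> is a boundary of the cube.
\<close>

lemma pr_coset_step:
  assumes y: "\<And>i. i \<in> I \<Longrightarrow> y i \<in> carrier (BK i 0)"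
    and j: "j \<in> I" and y': "y' \<in> carrier (BK j 0)" and eq: "\<epsilon> j (y j) = \<epsilon> j y'"
  shows "boundaries +>\<^bsub>C\<^esub> pr y = boundaries +>\<^bsub>C\<^esub> pr (y(j := y'))"
proof -
  interpret F0: module R "BK j 0" by (rule free_module_module)
  interpret F: module R "FB j" by (rule free_module_module)
  have yF: "y i \<in> carrier (FB i)" if "i \<in> I" for i using y[OF that] bcell_sub by blast
  have yF': "y' \<in> carrier (FB j)" using y' bcell_sub by blast
  have cl: "(y(j := y')) i \<in> carrier (FB i)" if "i \<in> I" for i using yF yF' that by auto
  let ?u = "y j \<ominus>\<^bsub>BK j 0\<^esub> y'"
  have u: "?u \<in> carrier (BK j 0)" using y[OF j] y' by (rule F0.M.minus_closed)
  have uF: "?u = y j \<ominus>\<^bsub>FB j\<^esub> y'" unfolding free_minus[OF y[OF j] y'] free_minus[OF yF[OF j] yF'] ..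
  have "\<epsilon> j ?u = \<zero>\<^bsub>M j\<^esub>"
    unfolding uF lin_minus[OF FB_module M_module[OF j] \<epsilon>_lin[OF j] yF[OF j] yF'] eq
    by (simp add: module_minus_eq[OF M_module[OF j]] \<epsilon>_closed[OF j yF'])
  then obtain w where w: "w \<in> carrier (FB j)" "D j w = ?u"
    using \<epsilon>_ker[OF j] u unfolding bcell_0 by blast
  let ?w = "cut True w"
  have wc: "?w \<in> carrier (BK j 1)"
    by (rule bcellI[OF lin_closed[OF cut_endo[unfolded endo_def] w(1)]]) (auto simp: cut_def split: if_splits)
  have Dw: "D j ?w = ?u" using D_cut_edge[OF j w(1)] w(2) by simp
  define z where "z = y(j := ?w)"
  define d :: "nat \<Rightarrow> nat" where "d = (\<lambda>i. 0)(j := 1)"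
  have z: "z i \<in> carrier (BK i (d i))" if "i \<in> I" for i
    using y[OF that] wc by (auto simp: z_def d_def)
  have zF: "z i \<in> carrier (FB i)" if "i \<in> I" for i using z[OF that] bcell_sub by blast
  have DzF: "(z(i := D i (z i))) l \<in> carrier (FB l)" if "i \<in> I" "l \<in> I" for i l
    using zF[OF that(2)] lin_closed[OF D_lin[OF that(1)] zF[OF that(1)]] by auto
  have sumd: "(\<Sum>i\<in>I. d i) = 1" unfolding d_def using j by (simp add: sum.remove[OF _ j])
  have "pr z \<in> carrier (CK n 1)" by (rule pr_cellsk[OF z sumd])
  then have mem: "bd n (pr z) \<in> boundaries" by (simp add: boundaries_def)
  let ?f = "\<lambda>i. if even (\<Sum>l\<in>{l\<in>I. l < i}. d l) then pr (z(i := D i (z i))) else \<ominus>\<^bsub>C\<^esub> pr (z(i := D i (z i)))"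
  have pj: "pr (z(j := D j (z j))) \<in> carrier C" by (rule pr_closed[OF DzF[OF j]])
  have "bd n (pr z) = (\<Oplus>\<^bsub>C\<^esub>i\<in>I. ?f i)" by (rule bd_pr_hom[of z d, OF z])
  also have "\<dots> = (\<Oplus>\<^bsub>C\<^esub>i\<in>I. if j = i then pr (z(j := D j (z j))) else \<zero>\<^bsub>C\<^esub>)"
  proof (rule C.M.finsum_cong')
    fix i assume i: "i \<in> I"
    show "?f i = (if j = i then pr (z(j := D j (z j))) else \<zero>\<^bsub>C\<^esub>)"
    proof (cases "j = i")
      case True
      have "(\<Sum>l\<in>{l\<in>I. l < j}. d l) = 0" by (auto simp: d_def)
      then show ?thesis using True by simp
    next
      case False
      have "D i (z i) = (\<lambda>b. \<zero>)" using False by (intro D_bcell_zero[OF i z[OF i]]) (auto simp: d_def)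
      then have "pr (z(i := D i (z i))) = \<zero>\<^bsub>C\<^esub>" by (intro pr_zero[OF DzF[OF i] i]) auto
      then show ?thesis using False C.M.add.inv_one free_uminus[OF C.M.zero_closed] by simp
    qed
  qed (use pj C.M.zero_closed in auto)
  also have "\<dots> = pr (z(j := D j (z j)))"
    using C.M.add.finprod_singleton[OF j, of "\<lambda>i. pr (z(j := D j (z j)))"] pj by simp
  also have "\<dots> = pr (y(j := y j \<ominus>\<^bsub>FB j\<^esub> y'))" unfolding z_def using Dw uF by simp
  also have "\<dots> = pr y \<ominus>\<^bsub>C\<^esub> pr (y(j := y'))"
  proof -
    have m: "restrict y I \<in> (\<Pi>\<^sub>E i\<in>I. carrier (FB i))" using yF by auto
    note l = multilin_coordinate[OF pr_multilin m j]
    have r: "pr ((restrict y I)(j := v)) = pr (y(j := v))" if "v \<in> carrier (FB j)" for v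
      using yF that by (intro pr_cong) auto
    show ?thesis
      using lin_minus[OF FB_module C_module l yF[OF j] yF'] r[OF yF[OF j]] r[OF yF'] r[OF F.M.minus_closed[OF yF[OF j] yF']]
      by simp
  qed
  finally have "pr y \<ominus>\<^bsub>C\<^esub> pr (y(j := y')) \<in> boundaries" using mem by simp
  moreover have "pr y \<in> carrier C" "pr (y(j := y')) \<in> carrier C"
    using pr_closed[of y, OF yF] pr_closed[of "y(j := y')", OF cl] by auto
  ultimately show ?thesis using coset_eq_iff[OF C_module boundaries_submodule] by blast
qed

lemma pr_coset:
  assumes y: "\<And>i. i \<in> I \<Longrightarrow> y i \<in> carrier (BK i 0)"
    and y': "\<And>i. i \<in> I \<Longrightarrow> y' i \<in> carrier (BK i 0)"
    and eq: "\<And>i. i \<in> I \<Longrightarrow> \<epsilon> i (y i) = \<epsilon> i (y' i)"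
  shows "boundaries +>\<^bsub>C\<^esub> pr y = boundaries +>\<^bsub>C\<^esub> pr y'"
proof -
  have F: "y' i \<in> carrier (FB i)" if "i \<in> I" for i using y'[OF that] bcell_sub by blast
  have "boundaries +>\<^bsub>C\<^esub> pr y = boundaries +>\<^bsub>C\<^esub> pr (\<lambda>i. if i \<le> m then y' i else y i)" if "m \<le> n" for m
    using that
  proof (induction m)
    case 0
    have "pr (\<lambda>i. if i \<le> 0 then y' i else y i) = pr y"
      using y bcell_sub by (intro pr_cong) auto
    then show ?case by simp
  next
    case (Suc m)
    let ?u = "\<lambda>i. if i \<le> m then y' i else y i"
    have "boundaries +>\<^bsub>C\<^esub> pr ?u = boundaries +>\<^bsub>C\<^esub> pr (?u(Suc m := y' (Suc m)))"
      using y y' eq Suc.prems by (intro pr_coset_step) auto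
    also have "?u(Suc m := y' (Suc m)) = (\<lambda>i. if i \<le> Suc m then y' i else y i)"
      by (auto simp: fun_eq_iff le_Suc_eq)
    finally show ?case using Suc by simp
  qed
  from this[of n] have "boundaries +>\<^bsub>C\<^esub> pr y = boundaries +>\<^bsub>C\<^esub> pr (\<lambda>i. if i \<le> n then y' i else y i)" by simp
  also have "pr (\<lambda>i. if i \<le> n then y' i else y i) = pr y'"
    using F by (intro pr_cong) auto
  finally show ?thesis .
qed

lemma vertex_lift:
  "\<exists>ch. \<forall>i\<in>I. \<forall>x\<in>carrier (M i). ch i x \<in> carrier (BK i 0) \<and> \<epsilon> i (ch i x) = x"
proof (rule bchoice, rule ballI)
  fix i assume "i \<in> I"
  then show "\<exists>f. \<forall>x\<in>carrier (M i). f x \<in> carrier (BK i 0) \<and> \<epsilon> i (f x) = x"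
    using \<epsilon>_surj unfolding bcell_0 by (intro bchoice ballI) blast
qed

text \<open>
  Right exactness of the tensor product: lifting each coordinate through \<open>\<epsilon>\<close> is well defined and
  multilinear modulo boundaries, so it induces an inverse of the augmentation on the quotient.
\<close>

lemma augC_kernel:
  assumes x: "x \<in> carrier (CK n 0)" and 0: "augC x = \<zero>\<^bsub>TM\<^esub>"
  shows "x \<in> boundaries"
proof -
  from vertex_lift obtain ch where ch: "\<And>i x. i \<in> I \<Longrightarrow> x \<in> carrier (M i) \<Longrightarrow> ch i x \<in> carrier (BK i 0)"
    "\<And>i x. i \<in> I \<Longrightarrow> x \<in> carrier (M i) \<Longrightarrow> \<epsilon> i (ch i x) = x" by blast
  have chF: "ch i x \<in> carrier (FB i)" if "i \<in> I" "x \<in> carrier (M i)" for i x using ch(1)[OF that] bcell_sub by blast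
  let ?Q = "quot_module C boundaries"
  note Q = quot_module_module[OF C_module boundaries_submodule]
  note qp = quot_proj_lin[OF C_module boundaries_submodule]
  define b where "b = (\<lambda>m. boundaries +>\<^bsub>C\<^esub> pr (\<lambda>i\<in>I. ch i (m i)))"
  have bml: "multilin I M ?Q b"
    unfolding multilin_def
  proof (intro conjI ballI)
    fix m assume m: "m \<in> (\<Pi>\<^sub>E i\<in>I. carrier (M i))"
    then have mc: "m i \<in> carrier (M i)" if "i \<in> I" for i using that by auto
    define z where "z = (\<lambda>i\<in>I. ch i (m i))"
    have z: "z \<in> (\<Pi>\<^sub>E i\<in>I. carrier (FB i))" unfolding z_def using chF mc by auto
    have z0: "z i \<in> carrier (BK i 0)" if "i \<in> I" for i unfolding z_def using ch(1) mc that by auto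
    show "b m \<in> carrier ?Q" unfolding b_def quot_carrier using z multilin_closed[OF pr_multilin] by (simp add: z_def)
    fix j x assume j: "j \<in> I" and x: "x \<in> carrier (M j)"
    interpret M: module R "M j" by (rule M_module[OF j])
    interpret F0: module R "BK j 0" by (rule free_module_module)
    have upd: "b (m(j := v)) = boundaries +>\<^bsub>C\<^esub> pr (z(j := u))"
      if v: "v \<in> carrier (M j)" and u: "u \<in> carrier (BK j 0)" "\<epsilon> j u = v" for v u
      unfolding b_def
      by (rule pr_coset) (use ch mc v u j z0 in \<open>auto simp: z_def\<close>)
    note l = lin_comp[OF multilin_coordinate[OF pr_multilin z j] qp]
    { fix y assume y: "y \<in> carrier (M j)"
      have "b (m(j := x \<oplus>\<^bsub>M j\<^esub> y)) = boundaries +>\<^bsub>C\<^esub> pr (z(j := ch j x \<oplus>\<^bsub>BK j 0\<^esub> ch j y))"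
        using j x y ch lin_add[OF \<epsilon>_lin[OF j] chF[OF j x] chF[OF j y]]
        by (intro upd M.M.a_closed F0.M.a_closed) auto
      then show "b (m(j := x \<oplus>\<^bsub>M j\<^esub> y)) = b (m(j := x)) \<oplus>\<^bsub>?Q\<^esub> b (m(j := y))"
        using lin_add[OF l chF[OF j x] chF[OF j y]] upd[OF x ch[OF j x]] upd[OF y ch[OF j y]] by simp }
    { fix r assume r: "r \<in> carrier R"
      have "b (m(j := r \<odot>\<^bsub>M j\<^esub> x)) = boundaries +>\<^bsub>C\<^esub> pr (z(j := r \<odot>\<^bsub>BK j 0\<^esub> ch j x))"
        using j x r ch lin_smult[OF \<epsilon>_lin[OF j] r chF[OF j x]]
        by (intro upd M.smult_closed F0.smult_closed) auto
      then show "b (m(j := r \<odot>\<^bsub>M j\<^esub> x)) = r \<odot>\<^bsub>?Q\<^esub> b (m(j := x))"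
        using lin_smult[OF l r chF[OF j x]] upd[OF x ch[OF j x]] by simp }
  qed
  note lift = tensor_lift[OF M_module Q bml]
  have sub: "cellsk n 0 \<subseteq> cells" by (auto simp: cellsk_def)
  have "tensor_lift R ?Q b (augC x) = boundaries +>\<^bsub>C\<^esub> x"
  proof (rule free_lin_eq[OF Q lin_comp[OF lin_free_mono[OF sub augC_lin] lift(1)] lin_free_mono[OF sub qp] _ x])
    fix c assume c0: "c \<in> cellsk n 0"
    then have c: "c \<in> cells" by (simp add: cellsk_def)
    have vert: "bv (c i) \<in> carrier (BK i 0)" if "i \<in> I" for i
      using c0 that unfolding cellsk_def dg_def cells_def bcell_def by (intro basis_vec_closed) auto
    have m: "(\<lambda>i\<in>I. \<epsilon> i (bv (c i))) \<in> (\<Pi>\<^sub>E i\<in>I. carrier (M i))"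
      using \<epsilon>_closed basis_B[OF c] by auto
    have "augC (bv c) = tensor_pure R I M (\<lambda>i\<in>I. \<epsilon> i (bv (c i)))"
      unfolding augC_basis[OF c] by (simp add: tensor_pure_restrict)
    then have "tensor_lift R ?Q b (augC (bv c)) = b (\<lambda>i\<in>I. \<epsilon> i (bv (c i)))"
      using lift(2)[OF _ m] by simp
    also have "\<dots> = boundaries +>\<^bsub>C\<^esub> pr (\<lambda>i. bv (c i))"
      unfolding b_def using ch vert \<epsilon>_closed basis_B[OF c] by (intro pr_coset) auto
    finally show "tensor_lift R ?Q b (augC (bv c)) = boundaries +>\<^bsub>C\<^esub> bv c"
      unfolding basis_pr[OF c] .
  qed
  moreover have "tensor_lift R ?Q b \<zero>\<^bsub>TM\<^esub> = \<zero>\<^bsub>?Q\<^esub>" by (rule lin_zero[OF TM_module Q lift(1)]) auto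
  ultimately have "boundaries +>\<^bsub>C\<^esub> x = boundaries +>\<^bsub>C\<^esub> \<zero>\<^bsub>C\<^esub>" using 0 quot_zero[OF C_module boundaries_submodule] by simp
  then have "x \<ominus>\<^bsub>C\<^esub> \<zero>\<^bsub>C\<^esub> \<in> boundaries"
    unfolding coset_eq_iff[OF C_module boundaries_submodule cellskD(1)[OF x] C.M.zero_closed] .
  then show ?thesis using cellskD(1)[OF x] unfolding free_minus[OF cellskD(1)[OF x] C.M.zero_closed]
    by (simp add: a_minus_def free_closed)
qed

lemma Cx_complex: "complex Cx TM"
  unfolding complex_def Cx_simps
proof (intro conjI allI ballI TM_module free_module_module)
  fix k
  have sub: "cellsk n k \<subseteq> cells" for k by (auto simp: cellsk_def)
  have "lin R (CK n (Suc k)) C (bd n)" by (rule lin_free_mono[OF sub bd_lin]) simp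
  then show "lin R (CK n (Suc k)) (CK n k) (bd n)"
    using bd_cellsk[OF order_refl] by (simp add: lin_def)
  show "lin R (CK n 0) TM augC" by (rule lin_free_mono[OF sub augC_lin])
  { fix x assume "x \<in> carrier (CK n (Suc (Suc k)))"
    then show "bd n (bd n x) = \<zero>\<^bsub>CK n k\<^esub>" using bd_bd[OF order_refl cellskD(1)] by simp }
  { fix x assume "x \<in> carrier (CK n (Suc 0))"
    then show "augC (bd n x) = \<zero>\<^bsub>TM\<^esub>" using augC_bd[OF cellskD(1)] by simp }
qed

lemma Cx_resolution: "resolution Cx TM"
  unfolding resolution_def
proof (intro conjI allI impI Cx_complex)
  fix k x assume c: "cycle Cx TM k x"
  show "\<exists>y\<in>carrier (obj Cx (Suc k)). bdry Cx k y = x"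
  proof (cases k)
    case 0
    then have "x \<in> boundaries" using c by (intro augC_kernel) (auto simp: cycle_def)
    then show ?thesis using 0 by (auto simp: boundaries_def)
  next
    case (Suc j)
    then show ?thesis using c bd_exact[OF order_refl, of x j] by (auto simp: cycle_def)
  qed
next
  interpret T: module R TM by (rule TM_module)
  have l: "lin R (CK n 0) TM augC"
    using lin_free_mono[OF _ augC_lin] by (auto simp: cellsk_def)
  from vertex_lift obtain ch where ch: "\<And>i x. i \<in> I \<Longrightarrow> x \<in> carrier (M i) \<Longrightarrow> ch i x \<in> carrier (BK i 0)"
    "\<And>i x. i \<in> I \<Longrightarrow> x \<in> carrier (M i) \<Longrightarrow> \<epsilon> i (ch i x) = x" by blast
  have "carrier TM \<subseteq> augC ` carrier (CK n 0)"
  proof (rule tensor_generated[OF M_module lin_image_submodule[OF free_module_module TM_module l]])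
    fix m assume m: "m \<in> (\<Pi>\<^sub>E i\<in>I. carrier (M i))"
    then have c: "ch i (m i) \<in> carrier (BK i 0)" if "i \<in> I" for i using that by (intro ch) auto
    have "pr (\<lambda>i. ch i (m i)) \<in> carrier (CK n 0)"
      by (rule pr_cellsk[of _ "\<lambda>i. 0", OF c]) auto
    moreover have "augC (pr (\<lambda>i. ch i (m i))) = tensor_pure R I M (\<lambda>i. \<epsilon> i (ch i (m i)))"
      using c bcell_sub by (intro augC_pr) blast
    moreover have "\<dots> = tensor_pure R I M m"
    proof (rule tensor_pure_cong)
      fix i assume i: "i \<in> I"
      then have "m i \<in> carrier (M i)" using m by auto
      then show "\<epsilon> i (ch i (m i)) = m i" by (rule ch(2)[OF i])
    qed
    ultimately show "tensor_pure R I M m \<in> augC ` carrier (CK n 0)" by (metis imageI)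
  qed auto
  then show "aug Cx ` carrier (obj Cx 0) = carrier TM" using lin_closed[OF l] by auto
qed

end

context coeff_ring
begin

lemma finsum_swap:
  assumes "module R N" "finite A" "finite B'" "\<And>a b. a \<in> A \<Longrightarrow> b \<in> B' \<Longrightarrow> f a b \<in> carrier N"
  shows "(\<Oplus>\<^bsub>N\<^esub>a\<in>A. \<Oplus>\<^bsub>N\<^esub>b\<in>B'. f a b) = (\<Oplus>\<^bsub>N\<^esub>b\<in>B'. \<Oplus>\<^bsub>N\<^esub>a\<in>A. f a b)"
proof -
  interpret N: module R N by fact
  show ?thesis using assms(2,4)
  proof (induction A rule: finite_induct)
    case empty
    then show ?case by simp
  next
    case (insert a A)
    have c: "(\<Oplus>\<^bsub>N\<^esub>a\<in>A. f a b) \<in> carrier N" if "b \<in> B'" for b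
      using that insert.prems by (intro N.M.finsum_closed) auto
    have "(\<Oplus>\<^bsub>N\<^esub>a\<in>insert a A. \<Oplus>\<^bsub>N\<^esub>b\<in>B'. f a b) = (\<Oplus>\<^bsub>N\<^esub>b\<in>B'. f a b) \<oplus>\<^bsub>N\<^esub> (\<Oplus>\<^bsub>N\<^esub>b\<in>B'. \<Oplus>\<^bsub>N\<^esub>a\<in>A. f a b)"
      using insert by (subst N.M.finsum_insert) (auto intro!: N.M.finsum_closed)
    also have "\<dots> = (\<Oplus>\<^bsub>N\<^esub>b\<in>B'. f a b \<oplus>\<^bsub>N\<^esub> (\<Oplus>\<^bsub>N\<^esub>a\<in>A. f a b))"
      using insert.prems c by (intro N.M.finsum_addf[symmetric]) auto
    also have "\<dots> = (\<Oplus>\<^bsub>N\<^esub>b\<in>B'. \<Oplus>\<^bsub>N\<^esub>a\<in>insert a A. f a b)"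
    proof (rule N.M.finsum_cong')
      fix b assume "b \<in> B'"
      then show "f a b \<oplus>\<^bsub>N\<^esub> (\<Oplus>\<^bsub>N\<^esub>a\<in>A. f a b) = (\<Oplus>\<^bsub>N\<^esub>a\<in>insert a A. f a b)"
        using insert by (subst N.M.finsum_insert) auto
    next
      show "(\<lambda>b. \<Oplus>\<^bsub>N\<^esub>a\<in>insert a A. f a b) \<in> B' \<rightarrow> carrier N"
        using insert.prems by (intro funcsetI N.M.finsum_closed) auto
    qed simp
    finally show ?case .
  qed
qed

lemma finite_multidegs: "finite I \<Longrightarrow> finite (multidegs I k)"
proof (rule finite_subset)
  assume I: "finite I"
  show "multidegs I k \<subseteq> (\<Pi>\<^sub>E i\<in>I. {..k})"
  proof
    fix d assume d: "d \<in> multidegs I k"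
    then have "d i \<le> k" if "i \<in> I" for i
      using member_le_sum[of i I d] that I by (simp add: multidegs_def)
    then show "d \<in> (\<Pi>\<^sub>E i\<in>I. {..k})" using d by (auto simp: multidegs_def PiE_iff)
  qed
  show "finite (\<Pi>\<^sub>E i\<in>I. {..k})" using I by (intro finite_PiE) auto
qed

text \<open>Reindexing the summands of positive degree in coordinate \<open>j\<close> by lowering that degree.\<close>

lemma finsum_multidegs_shift:
  fixes I :: "'i set"
  assumes N: "module R N" and I: "finite I" "j \<in> I" and G: "\<And>d. d \<in> multidegs I (Suc k) \<Longrightarrow> d j \<noteq> 0 \<Longrightarrow> G d \<in> carrier N"
  shows "(\<Oplus>\<^bsub>N\<^esub>d\<in>multidegs I (Suc k). if d j = 0 then \<zero>\<^bsub>N\<^esub> else G d) =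
     (\<Oplus>\<^bsub>N\<^esub>d\<in>multidegs I k. G (d(j := Suc (d j))))"
proof -
  interpret N: module R N by fact
  let ?h = "\<lambda>d. d(j := Suc (d j))"
  have sum_upd: "(\<Sum>i\<in>I. (d(j := v)) i) = v + (\<Sum>i\<in>I-{j}. d i)" for d and v :: nat
    using I by (subst sum.remove[of I j]) (auto intro!: sum.cong)
  have split: "(\<Sum>i\<in>I. d i) = d j + (\<Sum>i\<in>I-{j}. d i)" for d :: "'i \<Rightarrow> nat"
    using I by (subst sum.remove[of I j]) auto
  have im: "?h ` multidegs I k = {d \<in> multidegs I (Suc k). d j \<noteq> 0}"
  proof (intro equalityI subsetI)
    fix d assume "d \<in> ?h ` multidegs I k"
    then obtain d' where d': "d' \<in> multidegs I k" "d = ?h d'" by blast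
    have "d \<in> I \<rightarrow>\<^sub>E UNIV" unfolding d'(2) using d'(1) I(2) unfolding multidegs_def by (intro PiE_upd) auto
    moreover have "(\<Sum>i\<in>I. d i) = Suc k" unfolding d'(2) sum_upd using d'(1) split[of d'] by (simp add: multidegs_def)
    ultimately show "d \<in> {d \<in> multidegs I (Suc k). d j \<noteq> 0}" using d'(2) by (simp add: multidegs_def)
  next
    fix d assume d: "d \<in> {d \<in> multidegs I (Suc k). d j \<noteq> 0}"
    let ?d = "d(j := d j - 1)"
    have "?d \<in> I \<rightarrow>\<^sub>E UNIV" using d I(2) unfolding multidegs_def by (intro PiE_upd) auto
    moreover have "(\<Sum>i\<in>I. ?d i) = k" unfolding sum_upd using d split[of d] by (simp add: multidegs_def)
    ultimately have "?d \<in> multidegs I k" by (simp add: multidegs_def)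
    moreover have "d = ?h ?d" using d by auto
    ultimately show "d \<in> ?h ` multidegs I k" by blast
  qed
  have inj: "inj_on ?h (multidegs I k)"
  proof (rule inj_onI)
    fix d d' assume "?h d = ?h d'"
    then show "d = d'" by (metis (no_types, lifting) ext fun_upd_apply nat.inject)
  qed
  have "(\<Oplus>\<^bsub>N\<^esub>d\<in>multidegs I (Suc k). if d j = 0 then \<zero>\<^bsub>N\<^esub> else G d) = (\<Oplus>\<^bsub>N\<^esub>d\<in>?h ` multidegs I k. G d)"
    unfolding im using finite_multidegs[OF I(1)] G
    by (intro N.M.add.finprod_mono_neutral_cong_right) auto
  also have "\<dots> = (\<Oplus>\<^bsub>N\<^esub>d\<in>multidegs I k. G (?h d))"
    using G by (intro N.M.finsum_reindex inj) (auto simp: im)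
  finally show ?thesis .
qed

end

section \<open>Comparison of the cube complex with a tensor product of resolutions\<close>

locale cube_resolutions = aug_cube R n B edge D M \<epsilon>
  for R :: "'r ring" (structure) and n and B :: "nat \<Rightarrow> 'b set" and edge and D
    and M :: "nat \<Rightarrow> ('r, 'm) module" and \<epsilon> :: "nat \<Rightarrow> ('b \<Rightarrow> 'r) \<Rightarrow> 'm" +
  fixes P :: "nat \<Rightarrow> ('r, 'p, 'm) aug_complex"
  assumes P_complex: "i \<in> {1..n} \<Longrightarrow> complex (P i) (M i)"
begin

abbreviation "T \<equiv> tensor_complex R I P M"
abbreviation "TP d \<equiv> tensor R I (\<lambda>i. obj (P i) (d i))"

lemma P_module: "i \<in> I \<Longrightarrow> module R (obj (P i) k)"
  by (rule complexD(2)[OF P_complex])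

lemma TP_module: "module R (TP d)"
  by (rule tensor_module[OF P_module])

lemma T_obj: "obj T k = prod_module (multidegs I k) (\<lambda>d. TP d)"
  by (simp add: tensor_complex_def tensor_at_def[abs_def])

lemma T_module: "module R (obj T k)"
  unfolding T_obj by (rule prod_module_module[OF TP_module])

abbreviation tmap :: "(nat \<Rightarrow> nat) \<Rightarrow> nat \<Rightarrow> ((nat \<Rightarrow> 'p) \<Rightarrow> 'r) set \<Rightarrow> ((nat \<Rightarrow> 'p) \<Rightarrow> 'r) set" where
  "tmap d j \<equiv> tensor_map R I (\<lambda>i. obj (P i) (d i)) (\<lambda>i. if i = j then bdry (P i) (d i) else (\<lambda>z. z))"

abbreviation par :: "(nat \<Rightarrow> nat) \<Rightarrow> nat \<Rightarrow> bool" where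
  "par d j \<equiv> even (\<Sum>i\<in>{i \<in> I. i < j}. d i)"

lemma T_bdry: "bdry T k x = (\<lambda>d\<in>multidegs I k. \<Oplus>\<^bsub>TP d\<^esub>j\<in>I.
   (if par d j then tmap d j (x (d(j := Suc (d j)))) else \<ominus>\<^bsub>TP d\<^esub> tmap d j (x (d(j := Suc (d j))))))"
  unfolding tensor_complex_def tensor_at_def Let_def by (simp only: aug_complex.simps)

lemma T_aug: "aug T x = tensor_map R I M (\<lambda>i. aug (P i)) (x (\<lambda>i\<in>I. 0))"
  by (simp add: tensor_complex_def)

lemma tmap:
  assumes j: "j \<in> I"
  shows "lin R (TP (d(j := Suc (d j)))) (TP d) (tmap d j)"
    and "m \<in> (\<Pi>\<^sub>E i\<in>I. carrier (obj (P i) ((d(j := Suc (d j))) i))) \<Longrightarrow>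
      tmap d j (tensor_pure R I (\<lambda>i. obj (P i) ((d(j := Suc (d j))) i)) m) =
      tensor_pure R I (\<lambda>i. obj (P i) (d i)) (m(j := bdry (P j) (d j) (m j)))"
proof -
  have f: "lin R (obj (P i) ((d(j := Suc (d j))) i)) (obj (P i) (d i)) (if i = j then bdry (P i) (d i) else (\<lambda>z. z))"
    if "i \<in> I" for i
    using complexD(3)[OF P_complex[OF that]] lin_id by auto
  note tm = tensor_map[of "I" "\<lambda>i. obj (P i) ((d(j := Suc (d j))) i)" "\<lambda>i. obj (P i) (d i)", OF P_module P_module f]
  show "lin R (TP (d(j := Suc (d j)))) (TP d) (tmap d j)" by (rule tm(1))
  assume m: "m \<in> (\<Pi>\<^sub>E i\<in>I. carrier (obj (P i) ((d(j := Suc (d j))) i)))"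
  have "tmap d j (tensor_pure R I (\<lambda>i. obj (P i) ((d(j := Suc (d j))) i)) m) =
    tensor_pure R I (\<lambda>i. obj (P i) (d i)) (\<lambda>i. (if i = j then bdry (P i) (d i) else (\<lambda>z. z)) (m i))"
    by (rule tm(2)[OF _ _ _ m])
  also have "\<dots> = tensor_pure R I (\<lambda>i. obj (P i) (d i)) (m(j := bdry (P j) (d j) (m j)))"
    by (rule tensor_pure_cong) auto
  finally show "tmap d j (tensor_pure R I (\<lambda>i. obj (P i) ((d(j := Suc (d j))) i)) m) =
      tensor_pure R I (\<lambda>i. obj (P i) (d i)) (m(j := bdry (P j) (d j) (m j)))" .
qed

lemma TP_sub: "d \<in> multidegs I k \<Longrightarrow> x \<in> carrier (obj T k) \<Longrightarrow> x d \<in> carrier (TP d)"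
  unfolding T_obj prod_module_def by auto

lemma multidegs_Suc:
  assumes "d \<in> multidegs I k" "j \<in> I"
  shows "d(j := Suc (d j)) \<in> multidegs I (Suc k)"
proof -
  have "(\<Sum>i\<in>I-{j}. (d(j := Suc (d j))) i) = (\<Sum>i\<in>I-{j}. d i)" by (rule sum.cong) auto
  then have "(\<Sum>i\<in>I. (d(j := Suc (d j))) i) = Suc (\<Sum>i\<in>I. d i)"
    using assms(2) unfolding sum.remove[OF finite_atLeastAtMost assms(2)] by simp
  moreover have "d(j := Suc (d j)) \<in> I \<rightarrow>\<^sub>E UNIV"
    using assms unfolding multidegs_def by (intro PiE_upd) auto
  ultimately show ?thesis using assms(1) by (simp add: multidegs_def)
qed

lemma multidegs_0: "multidegs I 0 = {\<lambda>i\<in>I. 0}"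
  by (auto simp: multidegs_def PiE_iff extensional_def fun_eq_iff)

subsection \<open>From the tensor product of resolutions to the cube complex\<close>

context
  fixes \<rho> :: "nat \<Rightarrow> nat \<Rightarrow> 'p \<Rightarrow> 'b \<Rightarrow> 'r"
begin

definition rmul :: "(nat \<Rightarrow> nat) \<Rightarrow> (nat \<Rightarrow> 'p) \<Rightarrow> ((nat \<Rightarrow> 'b) \<Rightarrow> 'r)" where
  "rmul d m = pr (\<lambda>i\<in>I. \<rho> i (d i) (m i))"

text \<open>
  The summand of multidegree \<open>d\<close> of the chain map \<open>rho\<close> from the tensor product of the complexes
  \<open>P i\<close> to the cube, induced by chain maps \<open>\<rho> i\<close> from \<open>P i\<close> to the two-term complexes.
\<close>

definition rlift :: "(nat \<Rightarrow> nat) \<Rightarrow> ((nat \<Rightarrow> 'p) \<Rightarrow> 'r) set \<Rightarrow> ((nat \<Rightarrow> 'b) \<Rightarrow> 'r)" where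
  "rlift d = tensor_lift R C (rmul d)"

definition rho :: "nat \<Rightarrow> ((nat \<Rightarrow> nat) \<Rightarrow> ((nat \<Rightarrow> 'p) \<Rightarrow> 'r) set) \<Rightarrow> ((nat \<Rightarrow> 'b) \<Rightarrow> 'r)" where
  "rho k x = (\<Oplus>\<^bsub>C\<^esub>d\<in>multidegs I k. rlift d (x d))"

context
  assumes \<rho>: "\<And>i. i \<in> I \<Longrightarrow> chain_map (P i) (K i) (\<rho> i)"
begin

lemma \<rho>_lin: "i \<in> I \<Longrightarrow> lin R (obj (P i) k) (BK i k) (\<rho> i k)"
  using chain_mapD(1)[OF \<rho>] by simp

lemma \<rho>_FB: "i \<in> I \<Longrightarrow> lin R (obj (P i) k) (FB i) (\<rho> i k)"
  using \<rho>_lin[of i k] bcell_sub[of i k] unfolding lin_def by auto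

lemma rmul_multilin: "multilin I (\<lambda>i. obj (P i) (d i)) C (rmul d)"
  unfolding rmul_def by (rule multilin_comp[OF pr_multilin \<rho>_FB])

lemma rlift:
  shows "lin R (TP d) C (rlift d)"
    and "m \<in> (\<Pi>\<^sub>E i\<in>I. carrier (obj (P i) (d i))) \<Longrightarrow>
      rlift d (tensor_pure R I (\<lambda>i. obj (P i) (d i)) m) = rmul d m"
  unfolding rlift_def
  using tensor_lift[of "I" "\<lambda>i. obj (P i) (d i)", OF P_module C_module rmul_multilin] by auto

lemma rho_lin_C: "lin R (obj T k) C (rho k)"
  unfolding rho_def T_obj
  by (rule lin_sum[OF C_module finite_multidegs[OF finite_atLeastAtMost]
    lin_comp[OF prod_component_lin[where M="\<lambda>d. TP d"] rlift(1)]])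

lemma rlift_cellsk:
  assumes d: "d \<in> multidegs I k" and x: "x \<in> carrier (TP d)"
  shows "rlift d x \<in> carrier (CK n k)"
proof -
  have sub: "submodule (carrier (CK n k)) R C"
  proof (rule C.submoduleI)
    interpret F: module R "CK n k" by (rule free_module_module)
    show "carrier (CK n k) \<subseteq> carrier C" by (rule cellsk_sub)
    show "\<zero>\<^bsub>C\<^esub> \<in> carrier (CK n k)" using F.M.zero_closed by simp
    show "\<ominus>\<^bsub>C\<^esub> a \<in> carrier (CK n k)" if "a \<in> carrier (CK n k)" for a
      using F.M.a_inv_closed[OF that] free_uminus[OF that] free_uminus[OF cellskD(1)[OF that]] by simp
    show "a \<oplus>\<^bsub>C\<^esub> b \<in> carrier (CK n k)"
      if "a \<in> carrier (CK n k)" "b \<in> carrier (CK n k)" for a b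
      using F.M.a_closed[OF that] by simp
    show "r \<odot>\<^bsub>C\<^esub> b \<in> carrier (CK n k)"
      if "r \<in> carrier R" "b \<in> carrier (CK n k)" for r b
      using F.smult_closed[OF that] by simp
  qed
  let ?Q = "quot_module C (carrier (CK n k))"
  note Q = quot_module_module[OF C_module sub]
  have "carrier (CK n k) +>\<^bsub>C\<^esub> rlift d x = \<zero>\<^bsub>?Q\<^esub>"
  proof (rule tensor_lin_eq[of "I" "\<lambda>i. obj (P i) (d i)",
        OF P_module Q lin_comp[OF rlift(1) quot_proj_lin[OF C_module sub]] lin_const_zero[OF Q] _ x])
    fix m assume m: "m \<in> (\<Pi>\<^sub>E i\<in>I. carrier (obj (P i) (d i)))"
    have "rmul d m \<in> carrier (CK n k)"
      unfolding rmul_def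
    proof (rule pr_cellsk[of _ d])
      fix i assume i: "i \<in> I"
      then have "m i \<in> carrier (obj (P i) (d i))" using m by auto
      then show "(\<lambda>i\<in>I. \<rho> i (d i) (m i)) i \<in> carrier (BK i (d i))"
        using i lin_closed[OF \<rho>_lin[OF i]] by simp
    qed (use d in \<open>simp add: multidegs_def\<close>)
    then show "carrier (CK n k) +>\<^bsub>C\<^esub> rlift d (tensor_pure R I (\<lambda>i. obj (P i) (d i)) m) = \<zero>\<^bsub>?Q\<^esub>"
      unfolding rlift(2)[OF m] using coset_zero_iff[OF C_module sub] cellskD(1) by blast
  qed
  then show ?thesis using coset_zero_iff[OF C_module sub lin_closed[OF rlift(1) x]] by blast
qed

lemma rho_lin: "lin R (obj T k) (CK n k) (rho k)"
proof -
  interpret F: module R "CK n k" by (rule free_module_module)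
  have "rho k x \<in> carrier (CK n k)" if x: "x \<in> carrier (obj T k)" for x
  proof -
    have r: "(\<lambda>d. rlift d (x d)) \<in> multidegs I k \<rightarrow> carrier (CK n k)"
      using rlift_cellsk TP_sub[OF _ x] by auto
    have r': "(\<lambda>d. rlift d (x d)) \<in> multidegs I k \<rightarrow> carrier C"
      using r cellsk_sub by blast
    have "rho k x = (\<Oplus>\<^bsub>CK n k\<^esub>d\<in>multidegs I k. rlift d (x d))"
      unfolding rho_def free_finsum[OF finite_multidegs[OF finite_atLeastAtMost] r]
        free_finsum[OF finite_multidegs[OF finite_atLeastAtMost] r'] ..
    then show ?thesis using F.M.finsum_closed[OF r] by simp
  qed
  then show ?thesis using rho_lin_C[of k] by (simp add: lin_def)
qed

lemma bd_rlift:
  assumes d: "d \<in> multidegs I (Suc k)" and x: "x \<in> carrier (TP d)"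
  shows "bd n (rlift d x) = (\<Oplus>\<^bsub>C\<^esub>j\<in>I. if d j = 0 then \<zero>\<^bsub>C\<^esub> else
     if par d j then rlift (d(j := d j - 1)) (tmap (d(j := d j - 1)) j x)
     else \<ominus>\<^bsub>C\<^esub> rlift (d(j := d j - 1)) (tmap (d(j := d j - 1)) j x))"
proof -
  let ?e = "\<lambda>j. d(j := d j - 1)"
  have tl: "lin R (TP d) (TP (?e j)) (tmap (?e j) j)" if "j \<in> I" "d j \<noteq> 0" for j
    using tmap(1)[OF that(1), of "?e j"] that(2) by simp
  let ?g = "\<lambda>j x. if d j = 0 then \<zero>\<^bsub>C\<^esub> else
     if par d j then rlift (?e j) (tmap (?e j) j x) else \<ominus>\<^bsub>C\<^esub> rlift (?e j) (tmap (?e j) j x)"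
  have gl: "lin R (TP d) C (?g j)" if j: "j \<in> I" for j
  proof (cases "d j = 0")
    case True
    then show ?thesis using lin_const_zero[OF C_module] by simp
  next
    case False
    note l = lin_comp[OF tl[OF j False] rlift(1)]
    show ?thesis using l lin_neg[OF C_module l] by (cases "par d j") (simp_all only: False if_True if_False)
  qed
  show ?thesis
  proof (rule tensor_lin_eq[of "I" "\<lambda>i. obj (P i) (d i)", OF P_module C_module lin_comp[OF rlift(1) bd_lin[OF order_refl]] _ _ x])
    show "lin R (TP d) C (\<lambda>x. \<Oplus>\<^bsub>C\<^esub>j\<in>I. ?g j x)"
      by (rule lin_sum[OF C_module finite_atLeastAtMost gl])
    fix m assume m: "m \<in> (\<Pi>\<^sub>E i\<in>I. carrier (obj (P i) (d i)))"
    have mi: "m i \<in> carrier (obj (P i) (d i))" if "i \<in> I" for i using m that by auto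
    let ?pm = "tensor_pure R I (\<lambda>i. obj (P i) (d i)) m"
    define z where "z = (\<lambda>i\<in>I. \<rho> i (d i) (m i))"
    have z: "z i \<in> carrier (BK i (d i))" if "i \<in> I" for i
      using lin_closed[OF \<rho>_lin[OF that] mi[OF that]] that by (simp add: z_def)
    have zF: "z i \<in> carrier (FB i)" if "i \<in> I" for i using z[OF that] bcell_sub by blast
    have DzF: "(z(i := D i (z i))) l \<in> carrier (FB l)" if "i \<in> I" "l \<in> I" for i l
      using zF[OF that(2)] lin_closed[OF D_lin[OF that(1)] zF[OF that(1)]] by auto
    have pDz: "pr (z(i := D i (z i))) \<in> carrier C" if "i \<in> I" for i by (rule pr_closed[OF DzF[OF that]])
    have "bd n (rlift d ?pm) = bd n (pr z)"
      unfolding rlift(2)[OF m] rmul_def z_def ..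
    also have "\<dots> = (\<Oplus>\<^bsub>C\<^esub>j\<in>I. if par d j then pr (z(j := D j (z j))) else \<ominus>\<^bsub>C\<^esub> pr (z(j := D j (z j))))"
      by (rule bd_pr_hom[of z d, OF z])
    also have "\<dots> = (\<Oplus>\<^bsub>C\<^esub>j\<in>I. ?g j ?pm)"
    proof (rule C.M.finsum_cong')
      show "(\<lambda>j. ?g j ?pm) \<in> I \<rightarrow> carrier C"
        using lin_closed[OF gl] tensor_pure_closed[of "I" "\<lambda>i. obj (P i) (d i)" m, OF P_module] mi by blast
      fix j assume j: "j \<in> I"
      show "(if par d j then pr (z(j := D j (z j))) else \<ominus>\<^bsub>C\<^esub> pr (z(j := D j (z j)))) = ?g j ?pm"
      proof (cases "d j = 0")
        case True
        then have "D j (z j) = (\<lambda>b. \<zero>)" using z[OF j] by (intro D_bcell_zero[OF j]) auto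
        then have "pr (z(j := D j (z j))) = \<zero>\<^bsub>C\<^esub>" by (intro pr_zero[OF DzF[OF j] j]) auto
        then show ?thesis using True free_uminus[OF C.M.zero_closed] by simp
      next
        case False
        then have s: "(?e j)(j := Suc (?e j j)) = d" by simp
        have "rlift (?e j) (tmap (?e j) j ?pm) =
          rlift (?e j) (tensor_pure R I (\<lambda>i. obj (P i) (?e j i)) (m(j := bdry (P j) (d j - 1) (m j))))"
          using tmap(2)[OF j, of m "?e j"] m unfolding s by simp
        also have "\<dots> = rmul (?e j) (m(j := bdry (P j) (d j - 1) (m j)))"
        proof (rule rlift(2))
          have "bdry (P j) (d j - 1) (m j) \<in> carrier (obj (P j) (d j - 1))"
            using lin_closed[OF complexD(3)[OF P_complex[OF j]]] mi[OF j] False by (metis Suc_pred' not_gr_zero)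
          then show "m(j := bdry (P j) (d j - 1) (m j)) \<in> (\<Pi>\<^sub>E i\<in>I. carrier (obj (P i) (?e j i)))"
            using m j by (auto simp: PiE_iff extensional_def)
        qed
        also have "\<dots> = pr (z(j := D j (z j)))"
        proof -
          have "D j (\<rho> j (d j) (m j)) = \<rho> j (d j - 1) (bdry (P j) (d j - 1) (m j))"
            using chain_mapD(2)[OF \<rho>[OF j], of "m j" "d j - 1"] mi[OF j] False by simp
          then show ?thesis
            unfolding rmul_def using j DzF[OF j] by (intro pr_cong) (auto simp: z_def)
        qed
        finally show ?thesis using False by simp
      qed
    qed simp
    finally show "bd n (rlift d ?pm) = (\<Oplus>\<^bsub>C\<^esub>j\<in>I. ?g j ?pm)" .
  qed
qed

lemma rho_bdry:
  assumes x: "x \<in> carrier (obj T (Suc k))"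
  shows "bd n (rho (Suc k) x) = rho k (bdry T k x)"
proof -
  let ?I = "I"
  define G where "G = (\<lambda>j d. if par d j then rlift (d(j := d j - 1)) (tmap (d(j := d j - 1)) j (x d))
     else \<ominus>\<^bsub>C\<^esub> rlift (d(j := d j - 1)) (tmap (d(j := d j - 1)) j (x d)))"
  have xd: "x d \<in> carrier (TP d)" if "d \<in> multidegs ?I (Suc k)" for d by (rule TP_sub[OF that x])
  have tc: "tmap d j (x (d(j := Suc (d j)))) \<in> carrier (TP d)" if "d \<in> multidegs ?I k" "j \<in> ?I" for d j
    by (rule lin_closed[OF tmap(1)[OF that(2)] xd[OF multidegs_Suc[OF that]]])
  have G: "G j d \<in> carrier C" if j: "j \<in> ?I" and d: "d \<in> multidegs ?I (Suc k)" "d j \<noteq> 0" for j d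
  proof -
    have "(d(j := d j - 1))(j := Suc ((d(j := d j - 1)) j)) = d" using d(2) by simp
    then have "tmap (d(j := d j - 1)) j (x d) \<in> carrier (TP (d(j := d j - 1)))"
      using lin_closed[OF tmap(1)[OF j, of "d(j := d j - 1)"], of "x d"] xd[OF d(1)] by simp
    then have "rlift (d(j := d j - 1)) (tmap (d(j := d j - 1)) j (x d)) \<in> carrier C"
      by (rule lin_closed[OF rlift(1)])
    then show ?thesis by (auto simp del: free_simps simp: G_def)
  qed
  have bdG: "bd n (rlift d (x d)) = (\<Oplus>\<^bsub>C\<^esub>j\<in>?I. if d j = 0 then \<zero>\<^bsub>C\<^esub> else G j d)"
    if "d \<in> multidegs ?I (Suc k)" for d
    unfolding G_def by (rule bd_rlift[OF that xd[OF that]])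
  have G0: "(if d j = 0 then \<zero>\<^bsub>C\<^esub> else G j d) \<in> carrier C" if "j \<in> ?I" "d \<in> multidegs ?I (Suc k)" for j d
    using G[OF that] by (simp del: free_simps)
  have GS: "G j (d(j := Suc (d j))) \<in> carrier C" if "j \<in> ?I" "d \<in> multidegs ?I k" for j d
    using G[OF that(1) multidegs_Suc[OF that(2,1)]] by simp
  have "bd n (rho (Suc k) x) = (\<Oplus>\<^bsub>C\<^esub>d\<in>multidegs ?I (Suc k). bd n (rlift d (x d)))"
    unfolding rho_def using lin_closed[OF rlift(1) xd]
    by (intro lin_finsum[OF C_module C_module bd_lin[OF order_refl] finite_multidegs]) auto
  also have "\<dots> = (\<Oplus>\<^bsub>C\<^esub>d\<in>multidegs ?I (Suc k). \<Oplus>\<^bsub>C\<^esub>j\<in>?I. if d j = 0 then \<zero>\<^bsub>C\<^esub> else G j d)"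
    by (rule C.M.finsum_cong'[OF refl _ bdG]) (intro funcsetI C.M.finsum_closed G0)
  also have "\<dots> = (\<Oplus>\<^bsub>C\<^esub>j\<in>?I. \<Oplus>\<^bsub>C\<^esub>d\<in>multidegs ?I (Suc k). if d j = 0 then \<zero>\<^bsub>C\<^esub> else G j d)"
    by (rule finsum_swap[OF C_module finite_multidegs[OF finite_atLeastAtMost] finite_atLeastAtMost G0])
  also have "\<dots> = (\<Oplus>\<^bsub>C\<^esub>j\<in>?I. \<Oplus>\<^bsub>C\<^esub>d\<in>multidegs ?I k. G j (d(j := Suc (d j))))"
  proof (rule C.M.finsum_cong'[OF refl])
    show "(\<lambda>j. \<Oplus>\<^bsub>C\<^esub>d\<in>multidegs ?I k. G j (d(j := Suc (d j)))) \<in> ?I \<rightarrow> carrier C"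
      by (intro funcsetI C.M.finsum_closed GS)
    fix j assume j: "j \<in> ?I"
    show "(\<Oplus>\<^bsub>C\<^esub>d\<in>multidegs ?I (Suc k). if d j = 0 then \<zero>\<^bsub>C\<^esub> else G j d) =
        (\<Oplus>\<^bsub>C\<^esub>d\<in>multidegs ?I k. G j (d(j := Suc (d j))))"
      by (rule finsum_multidegs_shift[OF C_module finite_atLeastAtMost j G[OF j]])
  qed
  also have "\<dots> = (\<Oplus>\<^bsub>C\<^esub>d\<in>multidegs ?I k. \<Oplus>\<^bsub>C\<^esub>j\<in>?I. G j (d(j := Suc (d j))))"
    by (rule finsum_swap[OF C_module finite_atLeastAtMost finite_multidegs[OF finite_atLeastAtMost] GS])
  also have "\<dots> = (\<Oplus>\<^bsub>C\<^esub>d\<in>multidegs ?I k. rlift d (bdry T k x d))"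
  proof (rule C.M.finsum_cong')
    have bT: "bdry T k x d \<in> carrier (TP d)" if "d \<in> multidegs ?I k" for d
    proof -
      interpret TP: module R "TP d" by (rule TP_module)
      have "(if par d j then tmap d j (x (d(j := Suc (d j)))) else \<ominus>\<^bsub>TP d\<^esub> tmap d j (x (d(j := Suc (d j))))) \<in> carrier (TP d)"
        if j: "j \<in> ?I" for j
        using tc[OF \<open>d \<in> multidegs ?I k\<close> j] by (cases "par d j") (simp_all only: if_True if_False TP.M.a_inv_closed)
      then show ?thesis unfolding T_bdry restrict_apply'[OF that] by (intro TP.M.finsum_closed funcsetI)
    qed
    show "(\<lambda>d. rlift d (bdry T k x d)) \<in> multidegs ?I k \<rightarrow> carrier C"
      using bT lin_closed[OF rlift(1)] by blast
    fix d assume d: "d \<in> multidegs ?I k"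
    interpret TP: module R "TP d" by (rule TP_module)
    let ?y = "\<lambda>j. tmap d j (x (d(j := Suc (d j))))"
    have "rlift d (bdry T k x d) = rlift d (\<Oplus>\<^bsub>TP d\<^esub>j\<in>?I. if par d j then ?y j else \<ominus>\<^bsub>TP d\<^esub> ?y j)"
      unfolding T_bdry using d by simp
    also have "\<dots> = (\<Oplus>\<^bsub>C\<^esub>j\<in>?I. rlift d (if par d j then ?y j else \<ominus>\<^bsub>TP d\<^esub> ?y j))"
    proof (rule lin_finsum[OF TP_module C_module rlift(1) finite_atLeastAtMost], rule funcsetI)
      fix j assume j: "j \<in> ?I"
      show "(if par d j then ?y j else \<ominus>\<^bsub>TP d\<^esub> ?y j) \<in> carrier (TP d)"
        using tc[OF d j] by (cases "par d j") (simp_all only: if_True if_False TP.M.a_inv_closed)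
    qed
    also have "\<dots> = (\<Oplus>\<^bsub>C\<^esub>j\<in>?I. G j (d(j := Suc (d j))))"
    proof (rule C.M.finsum_cong')
      show "(\<lambda>j. G j (d(j := Suc (d j)))) \<in> ?I \<rightarrow> carrier C"
        using GS d by blast
      fix j assume j: "j \<in> ?I"
      have p: "par (d(j := Suc (d j))) j = par d j"
        by (intro arg_cong[of _ _ even] sum.cong) auto
      have e: "(d(j := Suc (d j)))(j := (d(j := Suc (d j))) j - 1) = d" by simp
      show "rlift d (if par d j then ?y j else \<ominus>\<^bsub>TP d\<^esub> ?y j) = G j (d(j := Suc (d j)))"
        unfolding G_def p e
        by (cases "par d j") (simp_all only: if_True if_False lin_uminus[OF TP_module C_module rlift(1) tc[OF d j]])
    qed simp
    finally show "(\<Oplus>\<^bsub>C\<^esub>j\<in>?I. G j (d(j := Suc (d j)))) = rlift d (bdry T k x d)" by simp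
  qed simp
  finally show ?thesis unfolding rho_def .
qed

lemma rho_aug:
  assumes x: "x \<in> carrier (obj T 0)"
  shows "augC (rho 0 x) = aug T x"
proof -
  let ?d = "\<lambda>i\<in>I. 0::nat"
  have "?d \<in> multidegs I 0" unfolding multidegs_0 by simp
  then have xd: "x ?d \<in> carrier (TP ?d)" by (rule TP_sub[OF _ x])
  have "rho 0 x = rlift ?d (x ?d)"
  proof -
    have r: "rlift ?d (x ?d) \<in> carrier C" by (rule lin_closed[OF rlift(1) xd])
    have "(\<Oplus>\<^bsub>C\<^esub>d\<in>{?d}. rlift d (x d)) = rlift ?d (x ?d) \<oplus>\<^bsub>C\<^esub> (\<Oplus>\<^bsub>C\<^esub>d\<in>{}. rlift d (x d))"
      using r by (intro C.M.finsum_insert) auto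
    then show ?thesis unfolding rho_def multidegs_0 by (simp only: C.M.finsum_empty C.M.r_zero[OF r])
  qed
  moreover have "augC (rlift ?d (x ?d)) = tensor_map R I M (\<lambda>i. aug (P i)) (x ?d)"
  proof (rule tensor_lin_eq[of "I" "\<lambda>i. obj (P i) (?d i)", OF P_module TM_module lin_comp[OF rlift(1) augC_lin] _ _ xd])
    have al: "lin R (obj (P i) (?d i)) (M i) (aug (P i))" if "i \<in> I" for i
      using complexD(4)[OF P_complex[OF that]] that by simp
    note tm = tensor_map[of "I" "\<lambda>i. obj (P i) (?d i)" M, OF P_module M_module al]
    show "lin R (TP ?d) TM (tensor_map R I M (\<lambda>i. aug (P i)))" by (rule tm(1))
    fix m assume m: "m \<in> (\<Pi>\<^sub>E i\<in>I. carrier (obj (P i) (?d i)))"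
    have mi: "m i \<in> carrier (obj (P i) 0)" if "i \<in> I" for i using PiE_mem[OF m that] that by simp
    have "augC (rlift ?d (tensor_pure R I (\<lambda>i. obj (P i) (?d i)) m)) = augC (pr (\<lambda>i\<in>I. \<rho> i (?d i) (m i)))"
      unfolding rlift(2)[OF m] rmul_def ..
    also have "\<dots> = tensor_pure R I M (\<lambda>i. \<epsilon> i ((\<lambda>i\<in>I. \<rho> i (?d i) (m i)) i))"
      using lin_closed[OF \<rho>_FB mi] by (intro augC_pr) auto
    also have "\<dots> = tensor_pure R I M (\<lambda>i. aug (P i) (m i))"
      using chain_mapD(3)[OF \<rho> mi] by (intro tensor_pure_cong) auto
    also have "\<dots> = tensor_map R I M (\<lambda>i. aug (P i)) (tensor_pure R I (\<lambda>i. obj (P i) (?d i)) m)"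
      by (rule tm(2)[OF _ _ _ m, symmetric])
    finally show "augC (rlift ?d (tensor_pure R I (\<lambda>i. obj (P i) (?d i)) m)) =
      tensor_map R I M (\<lambda>i. aug (P i)) (tensor_pure R I (\<lambda>i. obj (P i) (?d i)) m)" .
  qed
  ultimately show ?thesis unfolding T_aug by simp
qed

lemma rho_chain_map: "chain_map T Cx rho"
  unfolding chain_map_def using rho_lin rho_bdry rho_aug by simp

end

end

end

context free_cube
begin

definition degs :: "(nat \<Rightarrow> 'b) \<Rightarrow> nat \<Rightarrow> nat" where
  "degs c = (\<lambda>i\<in>I. if edge (c i) then 1 else 0)"

lemma degs_multidegs: "c \<in> cellsk n k \<Longrightarrow> degs c \<in> multidegs I k"
  by (auto simp: degs_def multidegs_def cellsk_def dg_def)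

lemma dg_le: "dg m c \<le> m"
proof -
  have "dg m c \<le> (\<Sum>i\<in>{1..m}. 1)" unfolding dg_def by (rule sum_mono) auto
  then show ?thesis by simp
qed

lemma cellsk_beyond: "cellsk n (Suc n) = {}"
  using dg_le[of n] unfolding cellsk_def by (auto) (metis Suc_n_not_le_n)

lemma pr_multilin_cellsk:
  assumes "d \<in> multidegs I k"
  shows "multilin I (\<lambda>i. BK i (d i)) (CK n k) pr"
  unfolding multilin_def
proof (intro conjI ballI)
  fix z assume z: "z \<in> (\<Pi>\<^sub>E i\<in>I. carrier (BK i (d i)))"
  have z': "z \<in> (\<Pi>\<^sub>E i\<in>I. carrier (FB i))"
    using z bcell_sub by (fastforce simp: PiE_iff)
  show "pr z \<in> carrier (CK n k)"
    using z assms by (intro pr_cellsk[of z d]) (auto simp: multidegs_def)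
  fix j x assume j: "j \<in> I" and x: "x \<in> carrier (BK j (d j))"
  have x': "x \<in> carrier (FB j)" using x bcell_sub by blast
  note l = multilin_coordinate[OF pr_multilin z' j]
  { fix y assume "y \<in> carrier (BK j (d j))"
    then have "y \<in> carrier (FB j)" using bcell_sub by blast
    then show "pr (z(j := x \<oplus>\<^bsub>BK j (d j)\<^esub> y)) =
        pr (z(j := x)) \<oplus>\<^bsub>CK n k\<^esub> pr (z(j := y))"
      using lin_add[OF l x'] by simp }
  { fix r assume "r \<in> carrier R"
    then show "pr (z(j := r \<odot>\<^bsub>BK j (d j)\<^esub> x)) =
        r \<odot>\<^bsub>CK n k\<^esub> pr (z(j := x))"
      using lin_smult[OF l _ x'] by simp }
qed

end

context cube_resolutions
begin

subsection \<open>From the cube complex to the tensor product of resolutions\<close>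

context
  fixes s :: "nat \<Rightarrow> nat \<Rightarrow> ('b \<Rightarrow> 'r) \<Rightarrow> 'p"
  assumes s: "\<And>i. i \<in> I \<Longrightarrow> chain_map (K i) (P i) (s i)"
begin

lemma s_lin: "i \<in> I \<Longrightarrow> lin R (BK i k) (obj (P i) k) (s i k)"
  using chain_mapD(1)[OF s] by simp

definition single :: "nat \<Rightarrow> (nat \<Rightarrow> nat) \<Rightarrow> ((nat \<Rightarrow> 'p) \<Rightarrow> 'r) set \<Rightarrow> ((nat \<Rightarrow> nat) \<Rightarrow> ((nat \<Rightarrow> 'p) \<Rightarrow> 'r) set)" where
  "single k d y = (\<lambda>d'\<in>multidegs I k. if d' = d then y else \<zero>\<^bsub>TP d'\<^esub>)"

abbreviation pureP :: "(nat \<Rightarrow> nat) \<Rightarrow> (nat \<Rightarrow> 'p) \<Rightarrow> ((nat \<Rightarrow> 'p) \<Rightarrow> 'r) set" where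
  "pureP d m \<equiv> tensor_pure R I (\<lambda>i. obj (P i) (d i)) m"

text \<open>
  The tensor product of chain maps \<open>s i\<close> in the opposite direction. It is what shows that a free
  resolution of the tensor product maps to the tensor product of the \<open>P i\<close> at all.
\<close>

definition sigma :: "nat \<Rightarrow> ((nat \<Rightarrow> 'b) \<Rightarrow> 'r) \<Rightarrow> ((nat \<Rightarrow> nat) \<Rightarrow> ((nat \<Rightarrow> 'p) \<Rightarrow> 'r) set)" where
  "sigma k = free_lift R (obj T k)
     (\<lambda>c. single k (degs c) (pureP (degs c) (\<lambda>i. s i (degs c i) (bv (c i)))))"

lemma single_lin: "lin R (TP d) (obj T k) (single k d)"
  unfolding T_obj
proof (rule prod_lin[OF _ _ TP_module])
  fix d' assume d': "d' \<in> multidegs I k"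
  show "lin R (TP d) (TP d') (\<lambda>x. single k d x d')"
    using d' lin_id[of R "TP d"] lin_const_zero[OF TP_module, of "TP d" d']
    by (cases "d' = d") (simp_all only: single_def restrict_apply' if_True if_False simp_thms)
qed (simp add: single_def)

lemma pureP_closed: "(\<And>i. i \<in> I \<Longrightarrow> m i \<in> carrier (obj (P i) (d i))) \<Longrightarrow> pureP d m \<in> carrier (TP d)"
  by (rule tensor_pure_closed[OF P_module]) auto

lemma basis_bcell: "c \<in> cells \<Longrightarrow> i \<in> I \<Longrightarrow> bv (c i) \<in> carrier (BK i (degs c i))"
  unfolding cells_def bcell_def degs_def by (intro basis_vec_closed) auto

lemma s_basis: "c \<in> cells \<Longrightarrow> i \<in> I \<Longrightarrow> s i (degs c i) (bv (c i)) \<in> carrier (obj (P i) (degs c i))"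
  by (rule lin_closed[OF s_lin basis_bcell])

lemma sigma_gen:
  assumes "c \<in> cells"
  shows "single k (degs c) (pureP (degs c) (\<lambda>i. s i (degs c i) (bv (c i)))) \<in> carrier (obj T k)"
  by (rule lin_closed[OF single_lin pureP_closed[OF s_basis[OF assms]]])

lemma sigma_lin: "lin R (CK n k) (obj T k) (sigma k)"
  unfolding sigma_def using sigma_gen by (intro free_lift_lin[OF T_module]) (auto simp: cellsk_def)

lemma sigma_basis:
  assumes "c \<in> cells"
  shows "sigma k (bv c) = single k (degs c) (pureP (degs c) (\<lambda>i. s i (degs c i) (bv (c i))))"
  unfolding sigma_def
  by (rule free_lift_basis[where f="\<lambda>c. single k (degs c) (pureP (degs c) (\<lambda>i. s i (degs c i) (bv (c i))))",
    OF T_module sigma_gen[OF assms]])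

lemma sigma_pr:
  assumes d: "d \<in> multidegs I k" and z: "\<And>i. i \<in> I \<Longrightarrow> z i \<in> carrier (BK i (d i))"
  shows "sigma k (pr z) = single k d (pureP d (\<lambda>i. s i (d i) (z i)))"
proof -
  have m: "multilin I (\<lambda>i. BK i (d i)) (obj T k) (\<lambda>z. sigma k (pr z))"
    by (rule multilin_post[OF pr_multilin_cellsk[OF d] sigma_lin])
  have m': "multilin I (\<lambda>i. BK i (d i)) (obj T k)
      (\<lambda>z. single k d (pureP d (\<lambda>i\<in>I. s i (d i) (z i))))"
    by (rule multilin_post[OF multilin_comp[OF tensor_pure_multilin[of "I" "\<lambda>i. obj (P i) (d i)", OF P_module] s_lin] single_lin])
  have zz: "restrict z I \<in> (\<Pi>\<^sub>E i\<in>I. carrier (BK i (d i)))" using z by auto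
  have "sigma k (pr (restrict z I)) = single k d (pureP d (\<lambda>i\<in>I. s i (d i) (restrict z I i)))"
  proof (rule multilin_free_eq[OF finite_atLeastAtMost T_module m m' _ zz])
    fix c assume c: "c \<in> (\<Pi>\<^sub>E i\<in>I. bcell i (d i))"
    then have cc: "c \<in> cells" unfolding cells_def bcell_def by auto
    have dc: "degs c = d"
    proof
      fix i show "degs c i = d i"
        using c d PiE_mem[OF c, of i] unfolding degs_def multidegs_def bcell_def
        by (cases "i \<in> I") (auto simp: PiE_iff extensional_def)
    qed
    have "pr (\<lambda>i\<in>I. bv (c i)) = bv c"
      unfolding basis_pr[OF cc] using basis_B[OF cc] by (intro pr_cong) auto
    then have "sigma k (pr (\<lambda>i\<in>I. bv (c i))) = single k d (pureP d (\<lambda>i. s i (d i) (bv (c i))))"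
      using sigma_basis[OF cc] unfolding dc by simp
    also have "\<dots> = single k d (pureP d (\<lambda>i\<in>I. s i (d i) ((\<lambda>i\<in>I. bv (c i)) i)))"
      by (rule arg_cong[of _ _ "single k d"], rule tensor_pure_cong) auto
    finally show "sigma k (pr (\<lambda>i\<in>I. bv (c i))) = \<dots>" .
  qed
  moreover have "z i \<in> carrier (FB i)" if "i \<in> I" for i using z[OF that] bcell_sub by blast
  then have "pr (restrict z I) = pr z" by (intro pr_cong) auto
  moreover have "pureP d (\<lambda>i\<in>I. s i (d i) (restrict z I i)) = pureP d (\<lambda>i. s i (d i) (z i))"
    by (rule tensor_pure_cong) auto
  ultimately show ?thesis by simp
qed

lemma finsum_component:
  assumes "finite A" "f \<in> A \<rightarrow> carrier (obj T k)" "d \<in> multidegs I k"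
  shows "(\<Oplus>\<^bsub>obj T k\<^esub>a\<in>A. f a) d = (\<Oplus>\<^bsub>TP d\<^esub>a\<in>A. f a d)"
  by (rule lin_finsum[OF T_module TP_module _ assms(1,2)])
    (unfold T_obj, rule prod_component_lin[OF assms(3), where M="\<lambda>d. TP d"])

text \<open>
  Both sides are sums over the coordinates \<open>j\<close> at which \<open>c\<close> has an edge; the summand of \<open>j\<close> lies in the
  multidegree of \<open>c\<close> with the \<open>j\<close>-th degree lowered to \<open>0\<close>. The proof compares them one multidegree
  at a time.
\<close>

lemma sigma_bdry_basis:
  assumes c: "c \<in> cellsk n (Suc k)"
  shows "bdry T k (sigma (Suc k) (bv c)) = sigma k (bd n (bv c))"
proof -
  have cc: "c \<in> cells" using c by (simp add: cellsk_def)
  define e where "e = degs c"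
  have e: "e \<in> multidegs I (Suc k)" unfolding e_def by (rule degs_multidegs[OF c])
  have e01: "e i = 0 \<or> e i = 1" if "i \<in> I" for i using that by (simp add: e_def degs_def)
  define z where "z = (\<lambda>i. bv (c i))"
  have z: "z i \<in> carrier (BK i (e i))" if "i \<in> I" for i
    unfolding z_def e_def by (rule basis_bcell[OF cc that])
  have zF: "z i \<in> carrier (FB i)" if "i \<in> I" for i using z[OF that] bcell_sub by blast
  have Dz: "(z(j := D j (z j))) i \<in> carrier (BK i ((e(j := 0)) i))" if "j \<in> I" "i \<in> I" for i j
    using z[OF that(2)] D_bcell[OF that(1) zF[OF that(1)]] by auto
  have DzF: "(z(j := D j (z j))) i \<in> carrier (FB i)" if "j \<in> I" "i \<in> I" for i j
    using Dz[OF that] bcell_sub by blast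
  have e0: "e(j := 0) \<in> multidegs I k" if j: "j \<in> I" "e j \<noteq> 0" for j
  proof -
    have "(\<Sum>i\<in>I-{j}. (e(j := 0)) i) = (\<Sum>i\<in>I-{j}. e i)" by (rule sum.cong) auto
    then have "(\<Sum>i\<in>I. (e(j := 0)) i) = k"
      using e e01[OF j(1)] j(2) unfolding multidegs_def sum.remove[OF finite_atLeastAtMost j(1)] by simp
    moreover have "e(j := 0) \<in> I \<rightarrow>\<^sub>E UNIV" using e j(1) unfolding multidegs_def by (intro PiE_upd) auto
    ultimately show ?thesis by (simp add: multidegs_def)
  qed
  let ?F = "CK n k"
  interpret F: module R ?F by (rule free_module_module)
  interpret Tk: module R "obj T k" by (rule T_module)
  define t where "t = (\<lambda>j. if par e j then pr (z(j := D j (z j))) else \<ominus>\<^bsub>C\<^esub> pr (z(j := D j (z j))))"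
  have prF: "pr (z(j := D j (z j))) \<in> carrier ?F" if j: "j \<in> I" for j
  proof (cases "e j = 0")
    case True
    then have "D j (z j) = (\<lambda>b. \<zero>)" using z[OF j] by (intro D_bcell_zero[OF j]) auto
    then have "pr (z(j := D j (z j))) = \<zero>\<^bsub>C\<^esub>" by (intro pr_zero[OF DzF[OF j] j]) auto
    then show ?thesis using F.M.zero_closed by simp
  next
    case False
    then show ?thesis using e0[OF j] by (intro pr_cellsk[OF Dz[OF j]]) (auto simp: multidegs_def)
  qed
  have negF: "\<ominus>\<^bsub>C\<^esub> x = \<ominus>\<^bsub>?F\<^esub> x" if "x \<in> carrier ?F" for x
    unfolding free_uminus[OF that] free_uminus[OF cellskD(1)[OF that]] ..
  have tF: "t j \<in> carrier ?F" if "j \<in> I" for j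
    using prF[OF that] F.M.a_inv_closed[OF prF[OF that]] unfolding t_def negF[OF prF[OF that]] by simp
  have tC: "t j \<in> carrier C" if "j \<in> I" for j using tF[OF that] cellsk_sub by blast
  have "bd n (bv c) = (\<Oplus>\<^bsub>C\<^esub>j\<in>I. t j)"
    unfolding basis_pr[OF cc] z_def[symmetric] t_def by (rule bd_pr_hom[of z e, OF z])
  also have "\<dots> = (\<Oplus>\<^bsub>?F\<^esub>j\<in>I. t j)"
    using tF tC by (simp only: free_finsum[OF finite_atLeastAtMost funcsetI])
  finally have rhs: "sigma k (bd n (bv c)) = (\<Oplus>\<^bsub>obj T k\<^esub>j\<in>I. sigma k (t j))"
    using lin_finsum[where g=t, OF free_module_module T_module sigma_lin finite_atLeastAtMost funcsetI[OF tF]] by simp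
  have sx: "sigma (Suc k) (bv c) = single (Suc k) e (pureP e (\<lambda>i. s i (e i) (z i)))"
    unfolding sigma_basis[OF cc] e_def z_def ..
  show ?thesis
    unfolding rhs
  proof (rule extensionalityI[of _ "multidegs I k"])
    show "bdry T k (sigma (Suc k) (bv c)) \<in> extensional (multidegs I k)" unfolding T_bdry by simp
    have stc: "(\<lambda>j. sigma k (t j)) \<in> I \<rightarrow> carrier (obj T k)"
      using tF lin_closed[OF sigma_lin] by blast
    then have "(\<Oplus>\<^bsub>obj T k\<^esub>j\<in>I. sigma k (t j)) \<in> carrier (obj T k)" by (rule Tk.M.finsum_closed)
    then show "(\<Oplus>\<^bsub>obj T k\<^esub>j\<in>I. sigma k (t j)) \<in> extensional (multidegs I k)"
      unfolding T_obj prod_module_def by (simp add: PiE_iff)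
    fix d assume d: "d \<in> multidegs I k"
    interpret TP: module R "TP d" by (rule TP_module)
    have "(\<Oplus>\<^bsub>obj T k\<^esub>j\<in>I. sigma k (t j)) d = (\<Oplus>\<^bsub>TP d\<^esub>j\<in>I. sigma k (t j) d)"
      by (rule finsum_component[OF finite_atLeastAtMost stc d])
    also have "\<dots> = bdry T k (sigma (Suc k) (bv c)) d"
      unfolding T_bdry restrict_apply'[OF d] sx
    proof (rule TP.M.finsum_cong'[OF refl])
      let ?x = "single (Suc k) e (pureP e (\<lambda>i. s i (e i) (z i)))"
      have xd: "?x (d(j := Suc (d j))) = (if d(j := Suc (d j)) = e then pureP e (\<lambda>i. s i (e i) (z i)) else \<zero>\<^bsub>TP (d(j := Suc (d j)))\<^esub>)"
        if "j \<in> I" for j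
        unfolding single_def restrict_apply'[OF multidegs_Suc[OF d that]] ..
      have sm: "(\<lambda>i. s i (e i) (z i)) i \<in> carrier (obj (P i) (e i))" if "i \<in> I" for i
        by (rule lin_closed[OF s_lin[OF that] z[OF that]])
      have xc: "?x (d(j := Suc (d j))) \<in> carrier (TP (d(j := Suc (d j))))" if "j \<in> I" for j
      proof -
        interpret Q: module R "TP (d(j := Suc (d j)))" by (rule TP_module)
        show ?thesis unfolding xd[OF that] using pureP_closed[of _ e, OF sm] Q.M.zero_closed by (auto simp del: One_nat_def)
      qed
      have yc: "tmap d j (?x (d(j := Suc (d j)))) \<in> carrier (TP d)" if "j \<in> I" for j
        by (rule lin_closed[OF tmap(1)[OF that] xc[OF that]])
      show "(\<lambda>j. if par d j then tmap d j (?x (d(j := Suc (d j)))) else \<ominus>\<^bsub>TP d\<^esub> tmap d j (?x (d(j := Suc (d j)))))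
         \<in> I \<rightarrow> carrier (TP d)"
      proof (rule funcsetI)
        fix j assume "j \<in> I"
        then show "(if par d j then tmap d j (?x (d(j := Suc (d j)))) else \<ominus>\<^bsub>TP d\<^esub> tmap d j (?x (d(j := Suc (d j))))) \<in> carrier (TP d)"
          using yc[of j] by (cases "par d j") (simp_all only: if_True if_False TP.M.a_inv_closed)
      qed
      fix j assume j: "j \<in> I"
      have sneg: "sigma k (\<ominus>\<^bsub>C\<^esub> pr (z(j := D j (z j)))) d = \<ominus>\<^bsub>TP d\<^esub> sigma k (pr (z(j := D j (z j)))) d"
      proof -
        have l: "lin R ?F (TP d) (\<lambda>x. sigma k x d)"
          by (rule lin_comp[OF sigma_lin prod_component_lin[OF d, where M="\<lambda>d. TP d", folded T_obj]])
        show ?thesis unfolding negF[OF prF[OF j]] by (rule lin_uminus[OF free_module_module TP_module l prF[OF j]])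
      qed
      have main: "sigma k (pr (z(j := D j (z j)))) d = tmap d j (?x (d(j := Suc (d j))))"
      proof (cases "d(j := Suc (d j)) = e")
        case True
        have "e j = Suc (d j)" using fun_cong[OF True, of j] by simp
        then have ej: "e j = 1" "d j = 0" using e01[OF j] by auto
        have de: "e(j := 0) = d" using True ej(2) by (metis fun_upd_triv fun_upd_upd)
        have zd: "(z(j := D j (z j))) i \<in> carrier (BK i (d i))" if "i \<in> I" for i
          using Dz[OF j that] unfolding de .
        have mm: "(\<lambda>i\<in>I. s i (e i) (z i)) \<in> (\<Pi>\<^sub>E i\<in>I. carrier (obj (P i) ((d(j := Suc (d j))) i)))"
          unfolding True using sm by auto
        have "tmap d j (?x (d(j := Suc (d j)))) = tmap d j (pureP (d(j := Suc (d j))) (\<lambda>i\<in>I. s i (e i) (z i)))"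
          unfolding xd[OF j] unfolding True by (simp add: tensor_pure_restrict)
        also have "\<dots> = pureP d ((\<lambda>i\<in>I. s i (e i) (z i))(j := bdry (P j) (d j) ((\<lambda>i\<in>I. s i (e i) (z i)) j)))"
          by (rule tmap(2)[OF j mm])
        also have "\<dots> = pureP d (\<lambda>i. s i (d i) ((z(j := D j (z j))) i))"
        proof (rule tensor_pure_cong)
          fix i assume i: "i \<in> I"
          have "bdry (P j) 0 (s j 1 (z j)) = s j 0 (D j (z j))"
            using chain_mapD(2)[OF s[OF j], of "z j" 0] z[OF j] ej by simp
          moreover have "e i = d i" if "i \<noteq> j" using fun_cong[OF True, of i] that by simp
          ultimately show "((\<lambda>i\<in>I. s i (e i) (z i))(j := bdry (P j) (d j) ((\<lambda>i\<in>I. s i (e i) (z i)) j))) i =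
              s i (d i) ((z(j := D j (z j))) i)"
            using i j ej by auto
        qed
        also have "\<dots> = sigma k (pr (z(j := D j (z j)))) d"
        proof -
          have "sigma k (pr (z(j := D j (z j)))) = single k d (pureP d (\<lambda>i. s i (d i) ((z(j := D j (z j))) i)))"
            by (rule sigma_pr[OF d zd])
          then show ?thesis unfolding single_def by (simp only: restrict_apply'[OF d] simp_thms if_True)
        qed
        finally show ?thesis ..
      next
        case False
        have r: "tmap d j (?x (d(j := Suc (d j)))) = \<zero>\<^bsub>TP d\<^esub>"
          unfolding xd[OF j] using False lin_zero[OF TP_module TP_module tmap(1)[OF j]] by simp
        show ?thesis
        proof (cases "e j = 0")
          case True
          then have "D j (z j) = (\<lambda>b. \<zero>)" using z[OF j] by (intro D_bcell_zero[OF j]) auto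
          then have "pr (z(j := D j (z j))) = \<zero>\<^bsub>C\<^esub>" by (intro pr_zero[OF DzF[OF j] j]) auto
          then have "pr (z(j := D j (z j))) = \<zero>\<^bsub>?F\<^esub>" unfolding free_simps .
          then have "sigma k (pr (z(j := D j (z j)))) = \<zero>\<^bsub>obj T k\<^esub>"
            using lin_zero[OF free_module_module T_module sigma_lin, of k] by simp
          then show ?thesis unfolding r T_obj prod_module_def using d by simp
        next
          case e1: False
          have ne: "d \<noteq> e(j := 0)"
          proof
            assume "d = e(j := 0)"
            then have "d(j := Suc (d j)) = e" using e01[OF j] e1 by auto
            then show False using False by simp
          qed
          have "sigma k (pr (z(j := D j (z j)))) = single k (e(j := 0)) (pureP (e(j := 0)) (\<lambda>i. s i ((e(j := 0)) i) ((z(j := D j (z j))) i)))"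
            by (rule sigma_pr[OF e0[OF j e1] Dz[OF j]])
          then have "sigma k (pr (z(j := D j (z j)))) d = \<zero>\<^bsub>TP d\<^esub>"
            using ne unfolding single_def by (simp only: restrict_apply'[OF d] simp_thms if_False)
          then show ?thesis unfolding r .
        qed
      qed
      show "sigma k (t j) d = (if par d j then tmap d j (?x (d(j := Suc (d j)))) else \<ominus>\<^bsub>TP d\<^esub> tmap d j (?x (d(j := Suc (d j)))))"
      proof (cases "d(j := Suc (d j)) = e")
        case True
        have "par e j = par d j"
        proof -
          have "e i = d i" if "i < j" for i using fun_cong[OF True, of i] that by simp
          then show ?thesis by (intro arg_cong[of _ _ even] sum.cong) auto
        qed
        then show ?thesis unfolding t_def using main sneg by (cases "par d j") (simp_all only: if_True if_False)
      next
        case False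
        have r: "tmap d j (?x (d(j := Suc (d j)))) = \<zero>\<^bsub>TP d\<^esub>"
          unfolding xd[OF j] using False lin_zero[OF TP_module TP_module tmap(1)[OF j]] by simp
        have "\<ominus>\<^bsub>TP d\<^esub> \<zero>\<^bsub>TP d\<^esub> = \<zero>\<^bsub>TP d\<^esub>" by (rule TP.M.minus_equality[OF TP.M.r_zero]) (rule TP.M.zero_closed)+
        then show ?thesis unfolding t_def r using main[unfolded r] sneg
          by (cases "par d j"; cases "par e j") (simp_all only: if_True if_False)
      qed
    qed
    finally show "bdry T k (sigma (Suc k) (bv c)) d = (\<Oplus>\<^bsub>obj T k\<^esub>j\<in>I. sigma k (t j)) d" ..
  qed
qed

lemma T_bdry_lin: "lin R (obj T (Suc k)) (obj T k) (bdry T k)"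
  unfolding T_obj[of k]
proof (rule prod_lin[OF _ _ T_module])
  fix d assume d: "d \<in> multidegs I k"
  interpret TP: module R "TP d" by (rule TP_module)
  have 1: "lin R (obj T (Suc k)) (TP d) (\<lambda>x. if par d j then tmap d j (x (d(j := Suc (d j)))) else \<ominus>\<^bsub>TP d\<^esub> tmap d j (x (d(j := Suc (d j)))))"
    if j: "j \<in> I" for j
  proof -
    have l: "lin R (obj T (Suc k)) (TP d) (\<lambda>x. tmap d j (x (d(j := Suc (d j)))))"
      unfolding T_obj
      by (rule lin_comp[OF prod_component_lin[OF multidegs_Suc[OF d j], where M="\<lambda>d. TP d"] tmap(1)[OF j]])
    show ?thesis using l lin_neg[OF TP_module l] by (cases "par d j") (simp_all only: if_True if_False)
  qed
  show "lin R (obj T (Suc k)) (TP d) (\<lambda>x. bdry T k x d)"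
    unfolding T_bdry restrict_apply'[OF d] by (rule lin_sum[OF TP_module finite_atLeastAtMost 1])
qed (unfold T_bdry, simp)

lemma sigma_aug_basis:
  assumes c: "c \<in> cellsk n 0"
  shows "aug T (sigma 0 (bv c)) = augC (bv c)"
proof -
  have cc: "c \<in> cells" using c by (simp add: cellsk_def)
  let ?d = "\<lambda>i\<in>I. 0::nat"
  have d0: "?d \<in> multidegs I 0" unfolding multidegs_0 by (rule singletonI)
  have e: "degs c = ?d" using degs_multidegs[OF c] unfolding multidegs_0 by simp
  have al: "lin R (obj (P i) (?d i)) (M i) (aug (P i))" if "i \<in> I" for i
    using complexD(4)[OF P_complex[OF that]] that by simp
  note tm = tensor_map[of "I" "\<lambda>i. obj (P i) (?d i)" M, OF P_module M_module al]
  let ?m = "\<lambda>i\<in>I. s i (?d i) (bv (c i))"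
  have m: "?m \<in> (\<Pi>\<^sub>E i\<in>I. carrier (obj (P i) (?d i)))"
    using s_basis[OF cc] unfolding e by auto
  have "aug T (sigma 0 (bv c)) = tensor_map R I M (\<lambda>i. aug (P i)) (pureP ?d ?m)"
    unfolding T_aug sigma_basis[OF cc] e single_def restrict_apply'[OF d0] by (simp add: tensor_pure_restrict)
  also have "\<dots> = tensor_pure R I M (\<lambda>i. aug (P i) (?m i))" by (rule tm(2)[OF _ _ _ m])
  also have "\<dots> = augC (bv c)"
    unfolding augC_basis[OF cc]
  proof (rule tensor_pure_cong)
    fix i assume i: "i \<in> I"
    have "bv (c i) \<in> carrier (obj (K i) 0)" using basis_bcell[OF cc i] i unfolding e by simp
    then show "aug (P i) (?m i) = \<epsilon> i (bv (c i))"
      using chain_mapD(3)[OF s[OF i]] i by simp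
  qed
  finally show ?thesis .
qed

lemma T_aug_lin: "lin R (obj T 0) TM (aug T)"
proof -
  let ?d = "\<lambda>i\<in>I. 0::nat"
  have d0: "?d \<in> multidegs I 0" unfolding multidegs_0 by (rule singletonI)
  have al: "lin R (obj (P i) (?d i)) (M i) (aug (P i))" if "i \<in> I" for i
    using complexD(4)[OF P_complex[OF that]] that by simp
  note tm = tensor_map(1)[of "I" "\<lambda>i. obj (P i) (?d i)" M, OF P_module M_module al]
  show ?thesis unfolding T_aug[abs_def] T_obj
    by (rule lin_comp[OF prod_component_lin[OF d0, where M="\<lambda>d. TP d"] tm])
qed

lemma sigma_chain_map: "chain_map Cx T sigma"
  unfolding chain_map_def Cx_simps
proof (intro conjI allI ballI sigma_lin)
  fix k x assume x: "x \<in> carrier (CK n (Suc k))"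
  have b: "lin R (CK n (Suc k)) (CK n k) (bd n)"
    using complexD(3)[OF Cx_complex, of k] by simp
  show "bdry T k (sigma (Suc k) x) = sigma k (bd n x)"
    by (rule free_lin_eq[OF T_module lin_comp[OF sigma_lin T_bdry_lin] lin_comp[OF b sigma_lin] sigma_bdry_basis x])
next
  fix x assume x: "x \<in> carrier (CK n 0)"
  have a: "lin R (CK n 0) TM augC"
    using complexD(4)[OF Cx_complex] by simp
  show "aug T (sigma 0 x) = augC x"
    by (rule free_lin_eq[OF TM_module lin_comp[OF sigma_lin T_aug_lin] a sigma_aug_basis x])
qed

end

subsection \<open>Transport of top-degree cochains to a free resolution\<close>

text \<open>
  The two-term complexes have nothing above degree \<open>1\<close>, so in total degree \<open>n\<close> only the multidegree
  \<open>(1, \<dots>, 1)\<close> survives.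
\<close>

lemma rho_top:
  assumes \<rho>: "\<And>i. i \<in> I \<Longrightarrow> chain_map (P i) (K i) (\<rho> i)" and x: "x \<in> carrier (obj T n)"
  shows "rho \<rho> n x = rlift \<rho> (\<lambda>i\<in>I. 1) (x (\<lambda>i\<in>I. 1))"
proof -
  let ?u = "\<lambda>i\<in>I. 1::nat"
  have u: "?u \<in> multidegs I n" by (auto simp: multidegs_def)
  have rc: "rlift \<rho> d (x d) \<in> carrier C" if "d \<in> multidegs I n" for d
    by (rule lin_closed[OF rlift(1)[OF \<rho>] TP_sub[OF that x]])
  have z: "rlift \<rho> d (x d) = \<zero>\<^bsub>C\<^esub>" if d: "d \<in> multidegs I n" "d \<noteq> ?u" for d
  proof -
    have "\<exists>j\<in>I. d j > 1"
    proof (rule ccontr)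
      assume "\<not> ?thesis"
      then have le: "d i \<le> 1" if "i \<in> I" for i using that by (metis not_le_imp_less)
      have "(\<Sum>i\<in>I. d i) = (\<Sum>i\<in>I. 1)" using d(1) by (simp add: multidegs_def)
      then have "d i = 1" if "i \<in> I" for i
        using sum_mono_inv[of d "I" "\<lambda>i. 1" i] le that by simp
      then have "d = ?u" using d(1) by (auto simp: multidegs_def PiE_iff extensional_def fun_eq_iff)
      then show False using d(2) by simp
    qed
    then obtain j where j: "j \<in> I" "d j > 1" by blast
    show ?thesis
    proof (rule tensor_lin_eq[of "I" "\<lambda>i. obj (P i) (d i)", OF P_module C_module rlift(1)[OF \<rho>] lin_const_zero[OF C_module] _ TP_sub[OF d(1) x]])
      fix m assume m: "m \<in> (\<Pi>\<^sub>E i\<in>I. carrier (obj (P i) (d i)))"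
      have c: "\<rho> i (d i) (m i) \<in> carrier (BK i (d i))" if "i \<in> I" for i
        using lin_closed[OF \<rho>_lin[OF \<rho> that] PiE_mem[OF m that]] .
      have "\<rho> j (d j) (m j) = (\<lambda>b. \<zero>)"
        using bcellD[OF c[OF j(1)]] j(2) by (metis less_irrefl not_less0)
      have z: "(\<lambda>i\<in>I. \<rho> i (d i) (m i)) i \<in> carrier (FB i)" if "i \<in> I" for i
        using c[OF that] bcell_sub that by auto
      have "rlift \<rho> d (pureP d m) = rmul \<rho> d m" by (rule rlift(2)[OF \<rho> m])
      also have "\<dots> = \<zero>\<^bsub>C\<^esub>"
        unfolding rmul_def by (rule pr_zero[OF z j(1)]) (use \<open>\<rho> j (d j) (m j) = (\<lambda>b. \<zero>)\<close> j(1) in simp_all)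
      finally show "rlift \<rho> d (pureP d m) = \<zero>\<^bsub>C\<^esub>" .
    qed
  qed
  have "rho \<rho> n x = (\<Oplus>\<^bsub>C\<^esub>d\<in>multidegs I n. if ?u = d then rlift \<rho> d (x d) else \<zero>\<^bsub>C\<^esub>)"
    unfolding rho_def using z rc C.M.zero_closed by (intro C.M.finsum_cong'[OF refl]) (auto simp del: free_simps)
  also have "\<dots> = rlift \<rho> ?u (x ?u)"
    by (rule C.M.add.finprod_singleton[OF u finite_multidegs[OF finite_atLeastAtMost]]) (use rc in auto)
  finally show ?thesis .
qed

lemma cellsk_beyond_zero: "x \<in> carrier (CK n (Suc n)) \<Longrightarrow> x = (\<lambda>c. \<zero>)"
  unfolding cellsk_beyond by (auto simp: free_carrier)

lemma homotopic_top:
  assumes n: "n = Suc l" and F: "complex F TM" "\<And>k. obj F k = free_module R (BF k)"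
    and \<theta>: "chain_map F Cx \<theta>" and \<eta>: "chain_map F Cx \<eta>"
  shows "\<exists>h. lin R (obj F l) (CK n n) h \<and>
    (\<forall>x\<in>carrier (obj F n). \<theta> n x = \<eta> n x \<oplus>\<^bsub>CK n n\<^esub> h (bdry F l x))"
proof -
  from chain_homotopy_exists[OF F Cx_resolution \<theta> \<eta>] obtain h
    where h: "\<And>k. lin R (obj F k) (obj Cx (Suc k)) (h k)"
      "\<And>k x. x \<in> carrier (obj F (Suc k)) \<Longrightarrow> bdry Cx (Suc k) (h (Suc k) x) =
        \<theta> (Suc k) x \<ominus>\<^bsub>obj Cx (Suc k)\<^esub> \<eta> (Suc k) x \<ominus>\<^bsub>obj Cx (Suc k)\<^esub> h k (bdry F k x)" by blast
  interpret Cn: module R "CK n n" by (rule free_module_module)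
  have "\<theta> n x = \<eta> n x \<oplus>\<^bsub>CK n n\<^esub> h l (bdry F l x)" if x: "x \<in> carrier (obj F n)" for x
  proof -
    let ?N = "CK n n"
    have c: "\<theta> n x \<in> carrier ?N" "\<eta> n x \<in> carrier ?N" "h l (bdry F l x) \<in> carrier ?N"
      using lin_closed[OF chain_mapD(1)[OF \<theta>, of n] x] lin_closed[OF chain_mapD(1)[OF \<eta>, of n] x]
        lin_closed[OF h(1) lin_closed[OF complexD(3)[OF F(1), of l, folded n] x], folded n] by simp_all
    have "h n x \<in> carrier (CK n (Suc n))" using lin_closed[OF h(1) x] by simp
    then have "h n x = \<zero>\<^bsub>C\<^esub>" using cellsk_beyond_zero by simp
    then have "bd n (h n x) = \<zero>\<^bsub>?N\<^esub>" using lin_zero[OF C_module C_module bd_lin[OF order_refl]] by simp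
    then have "\<theta> n x \<ominus>\<^bsub>?N\<^esub> \<eta> n x \<ominus>\<^bsub>?N\<^esub> h l (bdry F l x) = \<zero>\<^bsub>?N\<^esub>"
      using h(2)[of x l, folded n, OF x] by simp
    then have "\<theta> n x \<ominus>\<^bsub>?N\<^esub> \<eta> n x = h l (bdry F l x)"
      using module_minus_eq[OF free_module_module Cn.M.minus_closed[OF c(1,2)] c(3)] by simp
    then have "\<eta> n x \<oplus>\<^bsub>?N\<^esub> (\<theta> n x \<ominus>\<^bsub>?N\<^esub> \<eta> n x) = \<eta> n x \<oplus>\<^bsub>?N\<^esub> h l (bdry F l x)" by simp
    moreover have "\<eta> n x \<oplus>\<^bsub>?N\<^esub> (\<theta> n x \<ominus>\<^bsub>?N\<^esub> \<eta> n x) = \<theta> n x"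
      using c(1,2) unfolding a_minus_def by (metis Cn.M.a_lcomm Cn.M.r_neg Cn.M.r_zero Cn.M.a_inv_closed)
    ultimately show ?thesis by simp
  qed
  then show ?thesis using h(1)[of l, folded n] unfolding Cx_simps by blast
qed

text \<open>
  Take \<open>c = \<kappa> \<circ> g\<close> for one chain map \<open>g\<close> from \<open>F\<close> to the cube. Any other chain map, in particular
  \<open>rho \<circ> \<theta>\<close>, is homotopic to \<open>g\<close>, and as the cube ends in degree \<open>n\<close> the homotopy changes \<open>c\<close> by
  a coboundary only. If \<open>c\<close> were a coboundary, composing with a homotopy inverse of \<open>g\<close> would make \<open>\<kappa>\<close> one.
\<close>

lemma transported_class:
  assumes n: "n = Suc l" and F: "resolution F TM" "\<And>k. obj F k = free_module R (BF k)"
    and Pr: "\<And>i. i \<in> I \<Longrightarrow> resolution (P i) (M i)"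
    and A: "module R A" and \<kappa>: "lin R (CK n n) A \<kappa>"
    and nontriv: "\<nexists>h. lin R (CK n l) A h \<and> (\<forall>x\<in>carrier (CK n n). \<kappa> x = h (bd n x))"
  shows "\<exists>\<theta>. chain_map F T \<theta>"
    and "\<exists>c. lin R (obj F n) A c \<and> (\<forall>x\<in>carrier (obj F (Suc n)). c (bdry F n x) = \<zero>\<^bsub>A\<^esub>) \<and>
      (\<nexists>h. lin R (obj F l) A h \<and> (\<forall>x\<in>carrier (obj F n). c x = h (bdry F l x))) \<and>
      (\<forall>\<theta> \<rho>. chain_map F T \<theta> \<longrightarrow> (\<forall>i\<in>I. chain_map (P i) (K i) (\<rho> i)) \<longrightarrow>
        (\<exists>h. lin R (obj F l) A h \<and> (\<forall>x\<in>carrier (obj F n). \<kappa> (rho \<rho> n (\<theta> n x)) = c x \<oplus>\<^bsub>A\<^esub> h (bdry F l x))))"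
proof -
  interpret A: module R A by (rule A)
  have Fc: "complex F TM" using F(1) by (simp add: resolution_def)
  from chain_map_exists[OF Fc F(2) Cx_resolution] obtain g where g: "chain_map F Cx g" by blast
  from chain_map_exists[OF Cx_complex Cx_simps(1) F(1)] obtain \<tau> where \<tau>: "chain_map Cx F \<tau>" by blast
  have "\<exists>s. chain_map (K i) (P i) s" if "i \<in> I" for i
    by (rule chain_map_exists[OF K_complex[OF that] K_simps(1) Pr[OF that]])
  then obtain s where s: "\<And>i. i \<in> I \<Longrightarrow> chain_map (K i) (P i) (s i)" by metis
  show "\<exists>\<theta>. chain_map F T \<theta>"
    using chain_map_comp[OF g sigma_chain_map[OF s]] by blast
  let ?N = "CK n n"
  have gl: "lin R (obj F n) ?N (g n)" using chain_mapD(1)[OF g, of n] by simp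
  let ?c = "\<lambda>x. \<kappa> (g n x)"
  have c1: "lin R (obj F n) A ?c" by (rule lin_comp[OF gl \<kappa>])
  have c2: "?c (bdry F n x) = \<zero>\<^bsub>A\<^esub>" if x: "x \<in> carrier (obj F (Suc n))" for x
  proof -
    have "g (Suc n) x \<in> carrier (CK n (Suc n))"
      using lin_closed[OF chain_mapD(1)[OF g] x] by simp
    then have "g (Suc n) x = \<zero>\<^bsub>C\<^esub>" using cellsk_beyond_zero by simp
    then have "g n (bdry F n x) = \<zero>\<^bsub>?N\<^esub>"
      using chain_mapD(2)[OF g x] lin_zero[OF C_module C_module bd_lin[OF order_refl]] by simp
    then show ?thesis using lin_zero[OF free_module_module A \<kappa>] by simp
  qed
  have c3: "\<nexists>h. lin R (obj F l) A h \<and> (\<forall>x\<in>carrier (obj F n). ?c x = h (bdry F l x))"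
  proof
    assume "\<exists>h. lin R (obj F l) A h \<and> (\<forall>x\<in>carrier (obj F n). ?c x = h (bdry F l x))"
    then obtain h where h: "lin R (obj F l) A h" "\<And>x. x \<in> carrier (obj F n) \<Longrightarrow> ?c x = h (bdry F l x)" by blast
    from homotopic_top[OF n Cx_complex Cx_simps(1) chain_map_comp[OF \<tau> g] chain_map_id] obtain h'
      where h': "lin R (obj Cx l) ?N h'"
        "\<And>x. x \<in> carrier (obj Cx n) \<Longrightarrow> g n (\<tau> n x) = x \<oplus>\<^bsub>?N\<^esub> h' (bdry Cx l x)" by blast
    have \<tau>l: "lin R (CK n l) (obj F l) (\<tau> l)" using chain_mapD(1)[OF \<tau>, of l] by simp
    let ?h = "\<lambda>x. h (\<tau> l x) \<ominus>\<^bsub>A\<^esub> \<kappa> (h' x)"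
    have "lin R (CK n l) A ?h"
      by (rule lin_diff[OF A lin_comp[OF \<tau>l h(1)] lin_comp[OF h'(1)[unfolded Cx_simps] \<kappa>]])
    moreover have "\<kappa> x = ?h (bd n x)" if x: "x \<in> carrier ?N" for x
    proof -
      have b: "bd n x \<in> carrier (CK n l)" using bd_cellsk[OF order_refl, of x l, folded n, OF x] .
      have hb: "h' (bd n x) \<in> carrier ?N" using lin_closed[OF h'(1)] b by simp
      have cl: "\<kappa> x \<in> carrier A" "\<kappa> (h' (bd n x)) \<in> carrier A" using lin_closed[OF \<kappa>] x hb by auto
      have "\<tau> n x \<in> carrier (obj F n)" using lin_closed[OF chain_mapD(1)[OF \<tau>, of n]] x by simp
      then have "\<kappa> (g n (\<tau> n x)) = h (bdry F l (\<tau> n x))" by (rule h(2))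
      also have "bdry F l (\<tau> n x) = \<tau> l (bd n x)" using chain_mapD(2)[OF \<tau>, of x l, folded n] x by simp
      finally have "\<kappa> x \<oplus>\<^bsub>A\<^esub> \<kappa> (h' (bd n x)) = h (\<tau> l (bd n x))"
        using h'(2)[of x] x lin_add[OF \<kappa> x hb] by simp
      then have "?h (bd n x) = (\<kappa> x \<oplus>\<^bsub>A\<^esub> \<kappa> (h' (bd n x))) \<ominus>\<^bsub>A\<^esub> \<kappa> (h' (bd n x))" by simp
      also have "\<dots> = \<kappa> x" using cl by (simp add: a_minus_def A.M.a_assoc A.M.r_neg)
      finally show ?thesis ..
    qed
    ultimately show False using nontriv by blast
  qed
  have c4: "\<exists>h. lin R (obj F l) A h \<and> (\<forall>x\<in>carrier (obj F n). \<kappa> (rho \<rho> n (\<theta> n x)) = ?c x \<oplus>\<^bsub>A\<^esub> h (bdry F l x))"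
    if \<theta>: "chain_map F T \<theta>" and \<rho>: "\<forall>i\<in>I. chain_map (P i) (K i) (\<rho> i)" for \<theta> \<rho>
  proof -
    have r: "chain_map T Cx (rho \<rho>)" using \<rho> by (intro rho_chain_map) auto
    from homotopic_top[OF n Fc F(2) chain_map_comp[OF \<theta> r] g] obtain h
      where h: "lin R (obj F l) ?N h"
        "\<And>x. x \<in> carrier (obj F n) \<Longrightarrow> rho \<rho> n (\<theta> n x) = g n x \<oplus>\<^bsub>?N\<^esub> h (bdry F l x)" by blast
    have "\<kappa> (rho \<rho> n (\<theta> n x)) = ?c x \<oplus>\<^bsub>A\<^esub> \<kappa> (h (bdry F l x))" if x: "x \<in> carrier (obj F n)" for x
    proof -
      have "bdry F l x \<in> carrier (obj F l)" using lin_closed[OF complexD(3)[OF Fc, of l, folded n] x] .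
      then show ?thesis
        unfolding h(2)[OF x] by (intro lin_add[OF \<kappa> lin_closed[OF gl x] lin_closed[OF h(1)]])
    qed
    then show ?thesis using lin_comp[OF h(1) \<kappa>] by blast
  qed
  show "\<exists>c. lin R (obj F n) A c \<and> (\<forall>x\<in>carrier (obj F (Suc n)). c (bdry F n x) = \<zero>\<^bsub>A\<^esub>) \<and>
      (\<nexists>h. lin R (obj F l) A h \<and> (\<forall>x\<in>carrier (obj F n). c x = h (bdry F l x))) \<and>
      (\<forall>\<theta> \<rho>. chain_map F T \<theta> \<longrightarrow> (\<forall>i\<in>I. chain_map (P i) (K i) (\<rho> i)) \<longrightarrow>
        (\<exists>h. lin R (obj F l) A h \<and> (\<forall>x\<in>carrier (obj F n). \<kappa> (rho \<rho> n (\<theta> n x)) = c x \<oplus>\<^bsub>A\<^esub> h (bdry F l x))))"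
    using c1 c2 c3 c4 by (intro exI[of _ ?c] conjI) auto
qed

end

section \<open>The algebra on free idempotents\<close>

lemma finite_submultisets: "finite {a. a \<subseteq># m}"
proof (induction m)
  case empty
  then show ?case by simp
next
  case (add x m)
  have "{a. a \<subseteq># add_mset x m} \<subseteq> {a. a \<subseteq># m} \<union> add_mset x ` {a. a \<subseteq># m}"
  proof
    fix a assume "a \<in> {a. a \<subseteq># add_mset x m}"
    then have a: "a \<subseteq># add_mset x m" by simp
    show "a \<in> {a. a \<subseteq># m} \<union> add_mset x ` {a. a \<subseteq># m}"
    proof (cases "x \<in># a")
      case True
      then obtain a' where "a = add_mset x a'" by (metis mset_add)
      then show ?thesis using a by simp
    next
      case False
      have "count a y \<le> count m y" for y
        using a False by (cases "y = x") (auto simp: subseteq_mset_def not_in_iff dest!: spec[of _ y])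
      then show ?thesis by (simp add: subseteq_mset_def)
    qed
  qed
  then show ?case using add finite_subset by blast
qed

context coeff_ring
begin

lemma restrict_scalars_module:
  assumes B: "cring B" and \<phi>: "\<phi> \<in> ring_hom R B"
  shows "module R (restrict_scalars \<phi> B)"
proof -
  interpret B: cring B by fact
  note h = ring_hom_closed[OF \<phi>] ring_hom_add[OF \<phi>] ring_hom_mult[OF \<phi>] ring_hom_one[OF \<phi>]
  show ?thesis
  proof (rule moduleI[OF is_cring])
    show "abelian_group (restrict_scalars \<phi> B)"
      by (rule abelian_groupI) (auto simp: restrict_scalars_def B.a_ac B.l_neg intro: bexI[of _ "\<ominus>\<^bsub>B\<^esub> x" for x])
  qed (auto simp: restrict_scalars_def h B.l_distr B.r_distr B.m_assoc)
qed

lemma restrict_scalars_simps [simp]: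
  "carrier (restrict_scalars \<phi> B) = carrier B" "\<zero>\<^bsub>restrict_scalars \<phi> B\<^esub> = \<zero>\<^bsub>B\<^esub>"
  "x \<oplus>\<^bsub>restrict_scalars \<phi> B\<^esub> y = x \<oplus>\<^bsub>B\<^esub> y" "r \<odot>\<^bsub>restrict_scalars \<phi> B\<^esub> x = \<phi> r \<otimes>\<^bsub>B\<^esub> x"
  by (simp_all add: restrict_scalars_def)

abbreviation "RM \<equiv> restrict_scalars (\<lambda>r. r) R"

lemma RM_module: "module R RM"
  by (rule restrict_scalars_module[OF is_cring]) (simp add: ring_hom_def)

lemma prod_multilin:
  assumes B: "cring B" and \<phi>: "\<phi> \<in> ring_hom R B" and I: "finite I"
    and f: "\<And>i. i \<in> I \<Longrightarrow> lin R (M i) (restrict_scalars \<phi> B) (f i)"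
  shows "multilin I M (restrict_scalars \<phi> B) (\<lambda>a. \<Otimes>\<^bsub>B\<^esub>i\<in>I. f i (a i))"
proof -
  interpret B: cring B by fact
  have fc: "f i x \<in> carrier B" if "i \<in> I" "x \<in> carrier (M i)" for i x using lin_closed[OF f] that by fastforce
  have split: "(\<Otimes>\<^bsub>B\<^esub>i\<in>I. f i ((a(j := x)) i)) = f j x \<otimes>\<^bsub>B\<^esub> (\<Otimes>\<^bsub>B\<^esub>i\<in>I-{j}. f i (a i))"
    if a: "a \<in> (\<Pi>\<^sub>E i\<in>I. carrier (M i))" and j: "j \<in> I" "x \<in> carrier (M j)" for a j x
  proof -
    have ac: "a i \<in> carrier (M i)" if "i \<in> I" for i using a that by auto
    have "(\<Otimes>\<^bsub>B\<^esub>i\<in>insert j (I-{j}). f i ((a(j := x)) i)) = f j ((a(j := x)) j) \<otimes>\<^bsub>B\<^esub> (\<Otimes>\<^bsub>B\<^esub>i\<in>I-{j}. f i ((a(j := x)) i))"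
      using I j ac by (intro B.finprod_insert) (auto intro: fc)
    also have "(\<Otimes>\<^bsub>B\<^esub>i\<in>I-{j}. f i ((a(j := x)) i)) = (\<Otimes>\<^bsub>B\<^esub>i\<in>I-{j}. f i (a i))"
      using ac by (intro B.finprod_cong') (auto intro: fc)
    finally show ?thesis using j by (simp add: insert_absorb)
  qed
  have rc: "(\<Otimes>\<^bsub>B\<^esub>i\<in>I-{j}. f i (a i)) \<in> carrier B" if a: "a \<in> (\<Pi>\<^sub>E i\<in>I. carrier (M i))" for a j
    using a by (intro B.finprod_closed) (auto intro!: fc)
  show ?thesis
    unfolding multilin_def
  proof (intro conjI ballI)
    fix a assume a: "a \<in> (\<Pi>\<^sub>E i\<in>I. carrier (M i))"
    then show "(\<Otimes>\<^bsub>B\<^esub>i\<in>I. f i (a i)) \<in> carrier (restrict_scalars \<phi> B)"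
      by (auto intro!: B.finprod_closed fc)
    fix j x assume j: "j \<in> I" "x \<in> carrier (M j)"
    { fix y assume y: "y \<in> carrier (M j)"
      have xy: "f j (x \<oplus>\<^bsub>M j\<^esub> y) = f j x \<oplus>\<^bsub>B\<^esub> f j y" using lin_add[OF f[OF j(1)] j(2) y] by simp
      have "(\<Otimes>\<^bsub>B\<^esub>i\<in>I. f i ((a(j := x \<oplus>\<^bsub>M j\<^esub> y)) i)) = f j (x \<oplus>\<^bsub>M j\<^esub> y) \<otimes>\<^bsub>B\<^esub> (\<Otimes>\<^bsub>B\<^esub>i\<in>I-{j}. f i (a i))"
      proof -
        have ac: "a i \<in> carrier (M i)" if "i \<in> I" for i using a that by auto
        have "(\<Otimes>\<^bsub>B\<^esub>i\<in>insert j (I-{j}). f i ((a(j := x \<oplus>\<^bsub>M j\<^esub> y)) i)) = f j (x \<oplus>\<^bsub>M j\<^esub> y) \<otimes>\<^bsub>B\<^esub> (\<Otimes>\<^bsub>B\<^esub>i\<in>I-{j}. f i ((a(j := x \<oplus>\<^bsub>M j\<^esub> y)) i))"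
          using I j y ac xy by (subst B.finprod_insert) (auto intro: fc)
        also have "(\<Otimes>\<^bsub>B\<^esub>i\<in>I-{j}. f i ((a(j := x \<oplus>\<^bsub>M j\<^esub> y)) i)) = (\<Otimes>\<^bsub>B\<^esub>i\<in>I-{j}. f i (a i))"
          using ac by (intro B.finprod_cong') (auto intro: fc)
        finally show ?thesis using j by (simp add: insert_absorb)
      qed
      then show "(\<Otimes>\<^bsub>B\<^esub>i\<in>I. f i ((a(j := x \<oplus>\<^bsub>M j\<^esub> y)) i)) =
          (\<Otimes>\<^bsub>B\<^esub>i\<in>I. f i ((a(j := x)) i)) \<oplus>\<^bsub>restrict_scalars \<phi> B\<^esub> (\<Otimes>\<^bsub>B\<^esub>i\<in>I. f i ((a(j := y)) i))"
        unfolding split[OF a j] split[OF a j(1) y] xy using fc j y rc[OF a] by (simp add: B.l_distr) }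
    { fix r assume r: "r \<in> carrier R"
      have rx: "f j (r \<odot>\<^bsub>M j\<^esub> x) = \<phi> r \<otimes>\<^bsub>B\<^esub> f j x" using lin_smult[OF f[OF j(1)] r j(2)] by simp
      have pr: "\<phi> r \<in> carrier B" by (rule ring_hom_closed[OF \<phi> r])
      have "(\<Otimes>\<^bsub>B\<^esub>i\<in>I. f i ((a(j := r \<odot>\<^bsub>M j\<^esub> x)) i)) = f j (r \<odot>\<^bsub>M j\<^esub> x) \<otimes>\<^bsub>B\<^esub> (\<Otimes>\<^bsub>B\<^esub>i\<in>I-{j}. f i (a i))"
      proof -
        have ac: "a i \<in> carrier (M i)" if "i \<in> I" for i using a that by auto
        have "(\<Otimes>\<^bsub>B\<^esub>i\<in>insert j (I-{j}). f i ((a(j := r \<odot>\<^bsub>M j\<^esub> x)) i)) = f j (r \<odot>\<^bsub>M j\<^esub> x) \<otimes>\<^bsub>B\<^esub> (\<Otimes>\<^bsub>B\<^esub>i\<in>I-{j}. f i ((a(j := r \<odot>\<^bsub>M j\<^esub> x)) i))"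
          using I j pr ac rx by (subst B.finprod_insert) (auto intro: fc)
        also have "(\<Otimes>\<^bsub>B\<^esub>i\<in>I-{j}. f i ((a(j := r \<odot>\<^bsub>M j\<^esub> x)) i)) = (\<Otimes>\<^bsub>B\<^esub>i\<in>I-{j}. f i (a i))"
          using ac by (intro B.finprod_cong') (auto intro: fc)
        finally show ?thesis using j by (simp add: insert_absorb)
      qed
      then show "(\<Otimes>\<^bsub>B\<^esub>i\<in>I. f i ((a(j := r \<odot>\<^bsub>M j\<^esub> x)) i)) =
          r \<odot>\<^bsub>restrict_scalars \<phi> B\<^esub> (\<Otimes>\<^bsub>B\<^esub>i\<in>I. f i ((a(j := x)) i))"
        unfolding split[OF a j] rx using fc j rc[OF a] pr by (simp add: B.m_assoc) }
  qed
qed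

subsection \<open>The polynomial ring as a monoid algebra\<close>

text \<open>
  The polynomial ring on \<open>S\<close> is the free module on these monomials; its maps are handled by their
  values on the basis.
\<close>

definition Mon :: "'s set \<Rightarrow> 's multiset set" where
  "Mon S = {m. set_mset m \<subseteq> S}"

abbreviation "FM S \<equiv> free_module R (Mon S)"

lemma FM_module: "module R (FM S)" by (rule free_module_module)

lemma indexed_const_eq: "indexed_const k = (\<lambda>m. k \<otimes> bv {#} m)" if "k \<in> carrier R"
  using that by (auto simp: indexed_const_def basis_vec_def fun_eq_iff)

lemma indexed_pmult_basis: "indexed_pmult (bv m) i = bv (add_mset i m)"
  unfolding indexed_pmult_def basis_vec_def
  by (auto simp: fun_eq_iff)

lemma indexed_var_eq:
  fixes s :: 's
  shows "indexed_var s = bv {#s#}"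
proof -
  have "indexed_const \<one> = bv ({#} :: 's multiset)" by (auto simp: indexed_const_def basis_vec_def)
  then show ?thesis unfolding indexed_var_def using indexed_pmult_basis[of "{#}" s] by simp
qed

lemma indexed_pset_eq:
  fixes S :: "'s set"
  shows "indexed_pset S (carrier R) = carrier (FM S)"
proof (intro equalityI subsetI)
  interpret F: module R "FM S" by (rule FM_module)
  fix P assume "P \<in> indexed_pset S (carrier R)"
  then show "P \<in> carrier (FM S)"
  proof induction
    case (indexed_const k)
    have "k \<odot>\<^bsub>FM S\<^esub> bv {#} \<in> carrier (FM S)"
      using indexed_const by (intro F.smult_closed basis_vec_closed) (auto simp: Mon_def)
    then show ?case by (simp add: indexed_const_eq[OF indexed_const])
  next
    case (indexed_padd P Q)
    then show ?case using F.M.a_closed[of P Q] by (simp add: indexed_padd_def)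
  next
    case (indexed_pmult P i)
    show ?case
    proof (rule freeI)
      show "finite (add_mset i ` {m. P m \<noteq> \<zero>})" using free_finite[OF indexed_pmult(3)] by simp
      show "add_mset i ` {m. P m \<noteq> \<zero>} \<subseteq> Mon S"
        using free_supp[OF indexed_pmult(3)] indexed_pmult(2) by (fastforce simp: Mon_def)
      show "indexed_pmult P i m \<in> carrier R" for m
        using free_closed[OF indexed_pmult(3)] by (simp add: indexed_pmult_def)
      show "indexed_pmult P i m = \<zero>" if "m \<notin> add_mset i ` {m. P m \<noteq> \<zero>}" for m
        using that by (auto simp: indexed_pmult_def image_iff)
    qed
  qed
next
  fix P assume "P \<in> carrier (FM S)"
  then show "P \<in> indexed_pset S (carrier R)"
  proof (induction rule: free_induct)
    case (basis m)
    then show ?case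
    proof (induction m)
      case empty
      have "indexed_const \<one> = bv ({#} :: 's multiset)" by (auto simp: indexed_const_def basis_vec_def)
      then show ?case using indexed_pset.indexed_const[of \<one> "carrier R" S] by simp
    next
      case (add x m)
      then have "bv m \<in> indexed_pset S (carrier R)" "x \<in> S" by (auto simp: Mon_def)
      then show ?case using indexed_pset.indexed_pmult[of "bv m" S "carrier R" x] by (simp add: indexed_pmult_basis)
    qed
  next
    case zero
    have "indexed_const \<zero> = (\<lambda>b :: 's multiset. \<zero>)" by (auto simp: indexed_const_def)
    then show ?case using indexed_pset.indexed_const[of \<zero> "carrier R" S] by simp
  next
    case (add P Q)
    then show ?case using indexed_pset.indexed_padd[of P S "carrier R" Q] by (simp add: indexed_padd_def)
  next
    case (smult r P)
    from smult(3) show ?case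
    proof induction
      case (indexed_const k)
      have "(\<lambda>b :: 's multiset. r \<otimes> indexed_const k b) = indexed_const (r \<otimes> k)"
        using smult(1) by (auto simp: indexed_const_def)
      then show ?case using indexed_pset.indexed_const[of "r \<otimes> k" "carrier R" S] smult(1) indexed_const by simp
    next
      case (indexed_padd P Q)
      have "carrier_coeff P" "carrier_coeff Q" using indexed_padd(1,2) indexed_pset_in_carrier by auto
      then have "(\<lambda>b. r \<otimes> indexed_padd P Q b) = indexed_padd (\<lambda>b. r \<otimes> P b) (\<lambda>b. r \<otimes> Q b)"
        using smult(1) by (auto simp: indexed_padd_def carrier_coeff_def r_distr)
      then show ?case using indexed_pset.indexed_padd[OF indexed_padd(3,4)] by simp
    next
      case (indexed_pmult P i)
      have "(\<lambda>b. r \<otimes> indexed_pmult P i b) = indexed_pmult (\<lambda>b. r \<otimes> P b) i"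
        using smult(1) by (auto simp: indexed_pmult_def)
      then show ?case using indexed_pset.indexed_pmult[OF indexed_pmult(3,2)] by simp
    qed
  qed
qed

abbreviation "A S \<equiv> mpoly_ring R S"

lemma A_simps [simp]:
  "carrier (A S) = carrier (FM S)" "\<zero>\<^bsub>A S\<^esub> = (\<lambda>m. \<zero>)" "P \<oplus>\<^bsub>A S\<^esub> Q = (\<lambda>m. P m \<oplus> Q m)"
  "\<one>\<^bsub>A S\<^esub> = bv {#}"
proof -
  show "\<one>\<^bsub>A S\<^esub> = bv {#}" by (auto simp: mpoly_ring_def indexed_const_def basis_vec_def)
qed (auto simp: mpoly_ring_def indexed_pset_eq indexed_padd_def indexed_const_def)

lemma A_mult: "P \<otimes>\<^bsub>A S\<^esub> Q = (\<lambda>m. \<Oplus>a\<in>{a. a \<subseteq># m}. P a \<otimes> Q (m - a))"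
  by (simp add: mpoly_ring_def)

lemma A_mult_closed:
  assumes P: "P \<in> carrier (FM S)" and Q: "Q \<in> carrier (FM S)"
  shows "P \<otimes>\<^bsub>A S\<^esub> Q \<in> carrier (FM S)"
proof (rule freeI)
  let ?X = "(\<lambda>(a, b). a + b) ` ({a. P a \<noteq> \<zero>} \<times> {b. Q b \<noteq> \<zero>})"
  show "finite ?X" using free_finite[OF P] free_finite[OF Q] by simp
  show "?X \<subseteq> Mon S" using free_supp[OF P] free_supp[OF Q] by (fastforce simp: Mon_def)
  show "(P \<otimes>\<^bsub>A S\<^esub> Q) m \<in> carrier R" for m
    unfolding A_mult using free_closed[OF P] free_closed[OF Q] by (intro finsum_closed) auto
  show "(P \<otimes>\<^bsub>A S\<^esub> Q) m = \<zero>" if "m \<notin> ?X" for m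
    unfolding A_mult
  proof (rule add.finprod_one_eqI)
    fix a assume a: "a \<in> {a. a \<subseteq># m}"
    have "P a = \<zero> \<or> Q (m - a) = \<zero>"
    proof (rule ccontr)
      assume "\<not> ?thesis"
      then have "a + (m - a) \<in> ?X" by force
      then show False using that a by simp
    qed
    then show "P a \<otimes> Q (m - a) = \<zero>" using free_closed[OF P] free_closed[OF Q] by auto
  qed
qed

lemma A_mult_linear_right:
  assumes P: "P \<in> carrier (FM S)"
  shows "lin R (FM S) (FM S) (\<lambda>Q. P \<otimes>\<^bsub>A S\<^esub> Q)"
proof (rule linI)
  note p = free_closed[OF P]
  fix Q assume Q: "Q \<in> carrier (FM S)"
  note q = free_closed[OF Q]
  show "P \<otimes>\<^bsub>A S\<^esub> Q \<in> carrier (FM S)" by (rule A_mult_closed[OF P Q])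
  { fix Q' assume Q': "Q' \<in> carrier (FM S)"
    note q' = free_closed[OF Q']
    have "(\<Oplus>a\<in>{a. a \<subseteq># m}. P a \<otimes> (Q (m - a) \<oplus> Q' (m - a))) =
       (\<Oplus>a\<in>{a. a \<subseteq># m}. P a \<otimes> Q (m - a)) \<oplus> (\<Oplus>a\<in>{a. a \<subseteq># m}. P a \<otimes> Q' (m - a))" for m
      using p q q' by (subst finsum_addf[symmetric]) (auto simp: r_distr intro!: finsum_cong')
    then show "P \<otimes>\<^bsub>A S\<^esub> (Q \<oplus>\<^bsub>FM S\<^esub> Q') = (P \<otimes>\<^bsub>A S\<^esub> Q) \<oplus>\<^bsub>FM S\<^esub> (P \<otimes>\<^bsub>A S\<^esub> Q')"
      by (simp add: A_mult) }
  { fix r assume r: "r \<in> carrier R"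
    have "(\<Oplus>a\<in>{a. a \<subseteq># m}. P a \<otimes> (r \<otimes> Q (m - a))) = r \<otimes> (\<Oplus>a\<in>{a. a \<subseteq># m}. P a \<otimes> Q (m - a))" for m
      using p q r by (subst finsum_rdistr[OF finite_submultisets]) (auto simp: m_lcomm intro!: finsum_cong')
    then show "P \<otimes>\<^bsub>A S\<^esub> (r \<odot>\<^bsub>FM S\<^esub> Q) = r \<odot>\<^bsub>FM S\<^esub> (P \<otimes>\<^bsub>A S\<^esub> Q)"
      by (simp add: A_mult) }
qed

lemma A_mult_linear_left:
  assumes Q: "Q \<in> carrier (FM S)"
  shows "lin R (FM S) (FM S) (\<lambda>P. P \<otimes>\<^bsub>A S\<^esub> Q)"
proof (rule linI)
  note q = free_closed[OF Q]
  fix P assume P: "P \<in> carrier (FM S)"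
  note p = free_closed[OF P]
  show "P \<otimes>\<^bsub>A S\<^esub> Q \<in> carrier (FM S)" by (rule A_mult_closed[OF P Q])
  { fix P' assume P': "P' \<in> carrier (FM S)"
    note p' = free_closed[OF P']
    have "(\<Oplus>a\<in>{a. a \<subseteq># m}. (P a \<oplus> P' a) \<otimes> Q (m - a)) =
       (\<Oplus>a\<in>{a. a \<subseteq># m}. P a \<otimes> Q (m - a)) \<oplus> (\<Oplus>a\<in>{a. a \<subseteq># m}. P' a \<otimes> Q (m - a))" for m
      using p q p' by (subst finsum_addf[symmetric]) (auto simp: l_distr intro!: finsum_cong')
    then show "(P \<oplus>\<^bsub>FM S\<^esub> P') \<otimes>\<^bsub>A S\<^esub> Q = (P \<otimes>\<^bsub>A S\<^esub> Q) \<oplus>\<^bsub>FM S\<^esub> (P' \<otimes>\<^bsub>A S\<^esub> Q)"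
      by (simp add: A_mult) }
  { fix r assume r: "r \<in> carrier R"
    have "(\<Oplus>a\<in>{a. a \<subseteq># m}. (r \<otimes> P a) \<otimes> Q (m - a)) = r \<otimes> (\<Oplus>a\<in>{a. a \<subseteq># m}. P a \<otimes> Q (m - a))" for m
      using p q r by (subst finsum_rdistr[OF finite_submultisets]) (auto simp: m_assoc intro!: finsum_cong')
    then show "(r \<odot>\<^bsub>FM S\<^esub> P) \<otimes>\<^bsub>A S\<^esub> Q = r \<odot>\<^bsub>FM S\<^esub> (P \<otimes>\<^bsub>A S\<^esub> Q)"
      by (simp add: A_mult) }
qed

lemma A_mult_basis: "bv m \<otimes>\<^bsub>A S\<^esub> bv m' = bv (m + m')"
proof
  fix k
  have "(\<Oplus>a\<in>{a. a \<subseteq># k}. bv m a \<otimes> bv m' (k - a)) =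
    (\<Oplus>a\<in>{a. a \<subseteq># k}. if m = a then bv m' (k - a) else \<zero>)"
    by (intro finsum_cong') (auto simp: basis_vec_def)
  also have "\<dots> = bv (m + m') k"
  proof (cases "m \<subseteq># k")
    case True
    have "(\<Oplus>a\<in>{a. a \<subseteq># k}. if m = a then bv m' (k - a) else \<zero>) = bv m' (k - m)"
      using True finite_submultisets by (intro add.finprod_singleton) (auto simp: basis_vec_def)
    also have "\<dots> = bv (m + m') k"
      using True by (auto simp: basis_vec_def)
    finally show ?thesis .
  next
    case False
    then have "(\<Oplus>a\<in>{a. a \<subseteq># k}. if m = a then bv m' (k - a) else \<zero>) = \<zero>"
      by (intro add.finprod_one_eqI) auto
    moreover have "k \<noteq> m + m'" using False by auto
    ultimately show ?thesis by (simp add: basis_vec_def)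
  qed
  finally show "(bv m \<otimes>\<^bsub>A S\<^esub> bv m') k = bv (m + m') k" by (simp add: A_mult)
qed

lemma Mon_add: "m \<in> Mon S \<Longrightarrow> m' \<in> Mon S \<Longrightarrow> m + m' \<in> Mon S"
  by (auto simp: Mon_def)

lemma A_cring: "cring (A S)"
proof (rule cringI)
  interpret F: module R "FM S" by (rule FM_module)
  note bc = basis_vec_closed[of _ "Mon S"]
  note rl = A_mult_linear_right[where S=S] and ll = A_mult_linear_left[where S=S]
  show "abelian_group (A S)"
    using F.M.abelian_group_axioms
    by (intro abelian_groupI)
      (simp_all, use F.M.a_closed F.M.zero_closed in simp_all,
       auto simp: free_closed a_ac fun_eq_iff dest: F.M.a_inv_closed intro!: bexI[of _ "\<ominus>\<^bsub>FM S\<^esub> x" for x] simp: free_uminus l_neg r_neg)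
  have one: "bv {#} \<in> carrier (FM S)" by (rule bc) (simp add: Mon_def)
  have comm: "P \<otimes>\<^bsub>A S\<^esub> Q = Q \<otimes>\<^bsub>A S\<^esub> P" if P: "P \<in> carrier (FM S)" and Q: "Q \<in> carrier (FM S)" for P Q
  proof (rule free_lin_eq[OF FM_module ll[OF Q] rl[OF Q] _ P])
    fix m assume m: "m \<in> Mon S"
    show "bv m \<otimes>\<^bsub>A S\<^esub> Q = Q \<otimes>\<^bsub>A S\<^esub> bv m"
      by (rule free_lin_eq[OF FM_module rl[OF bc[OF m]] ll[OF bc[OF m]] _ Q]) (simp add: A_mult_basis add.commute)
  qed
  have assoc: "(P \<otimes>\<^bsub>A S\<^esub> Q) \<otimes>\<^bsub>A S\<^esub> U = P \<otimes>\<^bsub>A S\<^esub> (Q \<otimes>\<^bsub>A S\<^esub> U)"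
    if P: "P \<in> carrier (FM S)" and Q: "Q \<in> carrier (FM S)" and U: "U \<in> carrier (FM S)" for P Q U
  proof (rule free_lin_eq[OF FM_module lin_comp[OF ll[OF Q] ll[OF U]] ll[OF A_mult_closed[OF Q U]] _ P])
    fix m assume m: "m \<in> Mon S"
    show "(bv m \<otimes>\<^bsub>A S\<^esub> Q) \<otimes>\<^bsub>A S\<^esub> U = bv m \<otimes>\<^bsub>A S\<^esub> (Q \<otimes>\<^bsub>A S\<^esub> U)"
    proof (rule free_lin_eq[OF FM_module lin_comp[OF rl[OF bc[OF m]] ll[OF U]] lin_comp[OF ll[OF U] rl[OF bc[OF m]]] _ Q])
      fix m' assume m': "m' \<in> Mon S"
      show "(bv m \<otimes>\<^bsub>A S\<^esub> bv m') \<otimes>\<^bsub>A S\<^esub> U = bv m \<otimes>\<^bsub>A S\<^esub> (bv m' \<otimes>\<^bsub>A S\<^esub> U)"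
        unfolding A_mult_basis
        by (rule free_lin_eq[OF FM_module rl[OF bc[OF Mon_add[OF m m']]] lin_comp[OF rl[OF bc[OF m']] rl[OF bc[OF m]]] _ U])
          (simp add: A_mult_basis add.assoc)
    qed
  qed
  show "comm_monoid (A S)"
  proof (rule comm_monoidI)
    fix P assume "P \<in> carrier (A S)"
    then have P: "P \<in> carrier (FM S)" by simp
    have "bv {#} \<otimes>\<^bsub>A S\<^esub> P = P"
      by (rule free_lin_eq[OF FM_module rl[OF one] lin_id _ P]) (simp add: A_mult_basis)
    then show "\<one>\<^bsub>A S\<^esub> \<otimes>\<^bsub>A S\<^esub> P = P" by simp
  qed (use one A_mult_closed assoc comm in auto)
  show "(P \<oplus>\<^bsub>A S\<^esub> Q) \<otimes>\<^bsub>A S\<^esub> U = P \<otimes>\<^bsub>A S\<^esub> U \<oplus>\<^bsub>A S\<^esub> Q \<otimes>\<^bsub>A S\<^esub> U"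
    if "P \<in> carrier (A S)" "Q \<in> carrier (A S)" "U \<in> carrier (A S)" for P Q U
    using lin_add[OF ll[of U], of P Q] that by simp
qed

subsection \<open>The quotient by the idempotent relations\<close>

abbreviation "idem_gen S \<equiv> (\<lambda>s. indexed_var s \<otimes>\<^bsub>A S\<^esub> indexed_var s \<ominus>\<^bsub>A S\<^esub> indexed_var s) ` S"

lemma A_minus: "P \<in> carrier (FM S) \<Longrightarrow> Q \<in> carrier (FM S) \<Longrightarrow> P \<ominus>\<^bsub>A S\<^esub> Q = P \<ominus>\<^bsub>FM S\<^esub> Q"
proof -
  assume P: "P \<in> carrier (FM S)" and Q: "Q \<in> carrier (FM S)"
  interpret A: cring "A S" by (rule A_cring)
  interpret F: module R "FM S" by (rule FM_module)
  have "\<ominus>\<^bsub>A S\<^esub> Q = \<ominus>\<^bsub>FM S\<^esub> Q"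
    using F.M.l_neg[OF Q] F.M.a_inv_closed[OF Q] Q by (intro A.minus_equality) auto
  then show ?thesis by (simp add: a_minus_def)
qed

lemma idem_gen_eq:
  "s \<in> S \<Longrightarrow> indexed_var s \<otimes>\<^bsub>A S\<^esub> indexed_var s \<ominus>\<^bsub>A S\<^esub> indexed_var s = bv {#s, s#} \<ominus>\<^bsub>FM S\<^esub> bv {#s#}"
  unfolding indexed_var_eq A_mult_basis using A_minus[of "bv {#s, s#}" S "bv {#s#}"]
  by (simp add: basis_vec_closed Mon_def)

lemma idem_gen_set: "idem_gen S = (\<lambda>s. bv {#s, s#} \<ominus>\<^bsub>FM S\<^esub> bv {#s#}) ` S"
  by (rule image_cong[OF refl idem_gen_eq])

lemma idem_gen_closed: "idem_gen S \<subseteq> carrier (FM S)"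
proof -
  interpret F: module R "FM S" by (rule FM_module)
  show ?thesis
  proof
    fix x assume "x \<in> idem_gen S"
    then obtain s where s: "s \<in> S" "x = bv {#s, s#} \<ominus>\<^bsub>FM S\<^esub> bv {#s#}" unfolding idem_gen_set by blast
    show "x \<in> carrier (FM S)" unfolding s(2) using s(1)
      by (intro F.M.minus_closed basis_vec_closed) (auto simp: Mon_def)
  qed
qed

lemma idem_ideal_ideal: "ideal (idem_ideal R S) (A S)"
proof -
  interpret A: cring "A S" by (rule A_cring)
  show ?thesis unfolding idem_ideal_def Let_def using idem_gen_closed by (intro A.genideal_ideal) simp
qed

lemma idem_ring_cring: "cring (idem_ring R S)"
  unfolding idem_ring_def by (rule ideal.quotient_is_cring[OF idem_ideal_ideal A_cring])

lemma cls_hom: "idem_cls R S \<in> ring_hom (A S) (idem_ring R S)"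
  using ideal.rcos_ring_hom[OF idem_ideal_ideal, of S] unfolding idem_ring_def idem_cls_def[abs_def] by simp

lemma const_mult: "r \<in> carrier R \<Longrightarrow> P \<in> carrier (FM S) \<Longrightarrow> indexed_const r \<otimes>\<^bsub>A S\<^esub> P = (\<lambda>m. r \<otimes> P m)"
proof -
  assume r: "r \<in> carrier R" and P: "P \<in> carrier (FM S)"
  interpret A: cring "A S" by (rule A_cring)
  have o: "bv {#} \<in> carrier (FM S)" by (rule basis_vec_closed) (simp add: Mon_def)
  have "(r \<odot>\<^bsub>FM S\<^esub> bv {#}) \<otimes>\<^bsub>A S\<^esub> P = r \<odot>\<^bsub>FM S\<^esub> (bv {#} \<otimes>\<^bsub>A S\<^esub> P)"
    by (rule lin_smult[OF A_mult_linear_left[OF P] r o])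
  moreover have "bv {#} \<otimes>\<^bsub>A S\<^esub> P = P" using A.l_one[of P] P by simp
  ultimately show ?thesis by (simp add: indexed_const_eq[OF r])
qed

lemma const_closed: "r \<in> carrier R \<Longrightarrow> indexed_const r \<in> carrier (FM S)"
  using indexed_pset.indexed_const[of r "carrier R" S] indexed_pset_eq by blast

lemma const_hom: "indexed_const \<in> ring_hom R (A S)"
proof (rule ring_hom_memI)
  fix x y assume xy: "x \<in> carrier R" "y \<in> carrier R"
  show "indexed_const (x \<otimes> y) = indexed_const x \<otimes>\<^bsub>A S\<^esub> indexed_const y"
    unfolding const_mult[OF xy(1) const_closed[OF xy(2)]] using xy by (auto simp: indexed_const_def)
next
  show "indexed_const x \<in> carrier (A S)" if "x \<in> carrier R" for x
    using that by (simp add: const_closed)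
qed (auto simp: indexed_const_def basis_vec_def)

abbreviation "scal S \<equiv> (\<lambda>r. idem_cls R S (indexed_const r))"

lemma scal_hom: "scal S \<in> ring_hom R (idem_ring R S)"
  using ring_hom_trans[OF const_hom cls_hom] by (simp add: comp_def)

lemma idem_module_module: "module R (idem_module R S)"
  unfolding idem_module_def by (rule restrict_scalars_module[OF idem_ring_cring scal_hom])

lemma cls_lin: "lin R (FM S) (idem_module R S) (idem_cls R S)"
proof (rule linI)
  fix P assume P: "P \<in> carrier (FM S)"
  show "idem_cls R S P \<in> carrier (idem_module R S)"
    using ring_hom_closed[OF cls_hom, of P] P by (simp add: idem_module_def)
  { fix Q assume "Q \<in> carrier (FM S)"
    then show "idem_cls R S (P \<oplus>\<^bsub>FM S\<^esub> Q) = idem_cls R S P \<oplus>\<^bsub>idem_module R S\<^esub> idem_cls R S Q"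
      using ring_hom_add[OF cls_hom, of P S Q] P by (simp add: idem_module_def) }
  { fix r assume r: "r \<in> carrier R"
    have "idem_cls R S (indexed_const r \<otimes>\<^bsub>A S\<^esub> P) = scal S r \<otimes>\<^bsub>idem_ring R S\<^esub> idem_cls R S P"
      using P by (intro ring_hom_mult[OF cls_hom]) (simp_all add: const_closed[OF r])
    then show "idem_cls R S (r \<odot>\<^bsub>FM S\<^esub> P) = r \<odot>\<^bsub>idem_module R S\<^esub> idem_cls R S P"
      by (simp add: idem_module_def const_mult[OF r P]) }
qed

lemma cls_surj: "carrier (idem_module R S) = idem_cls R S ` carrier (FM S)"
  by (auto simp: idem_module_def idem_ring_def FactRing_def A_RCOSETS_def' idem_cls_def a_r_coset_def')

lemma idem_ideal_sub: "idem_ideal R S \<subseteq> carrier (FM S)"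
  using ideal.axioms(1)[OF idem_ideal_ideal, THEN additive_subgroup.a_subset] by simp

lemma idem_ideal_submodule: "submodule (idem_ideal R S) R (FM S)"
proof -
  interpret F: module R "FM S" by (rule FM_module)
  interpret I: ideal "idem_ideal R S" "A S" by (rule idem_ideal_ideal)
  show ?thesis
  proof (rule F.submoduleI)
    show "idem_ideal R S \<subseteq> carrier (FM S)" by (rule idem_ideal_sub)
    show "\<zero>\<^bsub>FM S\<^esub> \<in> idem_ideal R S"
      using additive_subgroup.zero_closed[OF ideal.axioms(1)[OF idem_ideal_ideal], of S] by simp
    show add: "a \<oplus>\<^bsub>FM S\<^esub> b \<in> idem_ideal R S" if "a \<in> idem_ideal R S" "b \<in> idem_ideal R S" for a b
      using additive_subgroup.a_closed[OF ideal.axioms(1)[OF idem_ideal_ideal] that] by simp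
    show sm: "r \<odot>\<^bsub>FM S\<^esub> a \<in> idem_ideal R S" if "r \<in> carrier R" "a \<in> idem_ideal R S" for r a
    proof -
      have "indexed_const r \<otimes>\<^bsub>A S\<^esub> a \<in> idem_ideal R S"
        by (rule I.I_l_closed[OF that(2)]) (simp add: const_closed[OF that(1)])
      moreover have "a \<in> carrier (FM S)" using that(2) idem_ideal_sub by blast
      ultimately show ?thesis by (simp add: const_mult[OF that(1)])
    qed
    show "\<ominus>\<^bsub>FM S\<^esub> a \<in> idem_ideal R S" if a: "a \<in> idem_ideal R S" for a
    proof -
      have "\<ominus>\<^bsub>FM S\<^esub> a = (\<ominus> \<one>) \<odot>\<^bsub>FM S\<^esub> a"
        using F.smult_l_minus[of \<one> a] a idem_ideal_sub[of S] F.smult_one[of a] by auto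
      then show ?thesis using sm[of "\<ominus> \<one>" a] a by simp
    qed
  qed
qed

lemma idem_cls_coset: "idem_cls R S P = idem_ideal R S +>\<^bsub>FM S\<^esub> P"
  by (auto simp: idem_cls_def a_r_coset_def')

text \<open>
  The ideal is not given as a span over \<open>R\<close>. The polynomials all of whose multiples \<open>g\<close> kills form an
  ideal, and by \<open>gen\<close> this ideal contains the generators.
\<close>

lemma idem_lin_vanish:
  assumes N: "module R N" and g: "lin R (FM S) N g"
    and gen: "\<And>s m. s \<in> S \<Longrightarrow> m \<in> Mon S \<Longrightarrow> g (bv (m + {#s, s#})) = g (bv (m + {#s#}))"
    and P: "P \<in> idem_ideal R S"
  shows "g P = \<zero>\<^bsub>N\<^esub>"
proof -
  interpret A: cring "A S" by (rule A_cring)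
  interpret F: module R "FM S" by (rule FM_module)
  interpret N: module R N by (rule N)
  let ?H = "{P \<in> carrier (FM S). \<forall>Q \<in> carrier (FM S). g (P \<otimes>\<^bsub>A S\<^esub> Q) = \<zero>\<^bsub>N\<^esub>}"
  have "ideal ?H (A S)"
  proof (rule idealI[OF A.ring_axioms])
    have zero: "\<zero>\<^bsub>A S\<^esub> \<in> ?H"
    proof -
      have "g (\<zero>\<^bsub>A S\<^esub> \<otimes>\<^bsub>A S\<^esub> Q) = \<zero>\<^bsub>N\<^esub>" if Q: "Q \<in> carrier (FM S)" for Q
        using A.l_null[of Q] Q lin_zero[OF FM_module N g] by simp
      then show ?thesis using F.M.zero_closed by simp
    qed
    have neg: "\<ominus>\<^bsub>A S\<^esub> a \<in> ?H" if a: "a \<in> ?H" for a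
    proof -
      have ac: "a \<in> carrier (A S)" using a by simp
      have nc: "\<ominus>\<^bsub>A S\<^esub> a \<in> carrier (FM S)" using A.a_inv_closed[OF ac] by simp
      have "g ((\<ominus>\<^bsub>A S\<^esub> a) \<otimes>\<^bsub>A S\<^esub> Q) = \<zero>\<^bsub>N\<^esub>" if Q: "Q \<in> carrier (FM S)" for Q
      proof -
        have QA: "Q \<in> carrier (A S)" using Q by simp
        have aQ: "a \<otimes>\<^bsub>A S\<^esub> Q \<in> carrier (FM S)" "(\<ominus>\<^bsub>A S\<^esub> a) \<otimes>\<^bsub>A S\<^esub> Q \<in> carrier (FM S)"
          using A_mult_closed[OF _ Q] a nc by auto
        have "(\<ominus>\<^bsub>A S\<^esub> a) \<otimes>\<^bsub>A S\<^esub> Q \<oplus>\<^bsub>A S\<^esub> a \<otimes>\<^bsub>A S\<^esub> Q = \<zero>\<^bsub>A S\<^esub>"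
          unfolding A.l_distr[OF A.a_inv_closed[OF ac] ac QA, symmetric] A.l_neg[OF ac] by (rule A.l_null[OF QA])
        then have "g ((\<ominus>\<^bsub>A S\<^esub> a) \<otimes>\<^bsub>A S\<^esub> Q \<oplus>\<^bsub>FM S\<^esub> a \<otimes>\<^bsub>A S\<^esub> Q) = \<zero>\<^bsub>N\<^esub>"
          using lin_zero[OF FM_module N g] by simp
        then show ?thesis unfolding lin_add[OF g aQ(2,1)] using a Q lin_closed[OF g aQ(2)] by simp
      qed
      then show ?thesis using nc by simp
    qed
    have add: "a \<oplus>\<^bsub>A S\<^esub> b \<in> ?H" if a: "a \<in> ?H" and b: "b \<in> ?H" for a b
    proof -
      have "g ((a \<oplus>\<^bsub>FM S\<^esub> b) \<otimes>\<^bsub>A S\<^esub> Q) = \<zero>\<^bsub>N\<^esub>" if Q: "Q \<in> carrier (FM S)" for Q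
        using lin_add[OF lin_comp[OF A_mult_linear_left[OF Q] g], of a b] a b Q by simp
      then show ?thesis using a b F.M.a_closed[of a b] by simp
    qed
    show "subgroup ?H (add_monoid (A S))"
      using zero neg add by (intro subgroup.intro) (simp_all add: a_inv_def)
    fix a x assume a: "a \<in> ?H" and x: "x \<in> carrier (A S)"
    have ac: "a \<in> carrier (A S)" using a by simp
    have "g ((a \<otimes>\<^bsub>A S\<^esub> x) \<otimes>\<^bsub>A S\<^esub> Q) = \<zero>\<^bsub>N\<^esub>" if Q: "Q \<in> carrier (FM S)" for Q
    proof -
      have "(a \<otimes>\<^bsub>A S\<^esub> x) \<otimes>\<^bsub>A S\<^esub> Q = a \<otimes>\<^bsub>A S\<^esub> (x \<otimes>\<^bsub>A S\<^esub> Q)" using A.m_assoc[OF ac x, of Q] Q by simp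
      then show ?thesis using a A_mult_closed[of x S Q] x Q by simp
    qed
    then show r: "a \<otimes>\<^bsub>A S\<^esub> x \<in> ?H" using A_mult_closed[of a S x] a x by simp
    then show "x \<otimes>\<^bsub>A S\<^esub> a \<in> ?H" using A.m_comm[OF ac x] by simp
  qed
  moreover have "idem_gen S \<subseteq> ?H"
  proof
    fix y assume "y \<in> idem_gen S"
    then obtain s where s: "s \<in> S" "y = bv {#s, s#} \<ominus>\<^bsub>FM S\<^esub> bv {#s#}" unfolding idem_gen_set by blast
    have sM: "{#s, s#} \<in> Mon S" "{#s#} \<in> Mon S" using s(1) by (auto simp: Mon_def)
    note b = basis_vec_closed[OF sM(1)] basis_vec_closed[OF sM(2)]
    have y: "y \<in> carrier (FM S)" unfolding s(2) using b by (rule F.M.minus_closed)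
    have "g (y \<otimes>\<^bsub>A S\<^esub> Q) = \<zero>\<^bsub>N\<^esub>" if Q: "Q \<in> carrier (FM S)" for Q
    proof (rule free_lin_eq[OF N lin_comp[OF A_mult_linear_right[OF y] g] lin_const_zero[OF N] _ Q])
      fix m assume m: "m \<in> Mon S"
      have "g (y \<otimes>\<^bsub>A S\<^esub> bv m) = g (bv ({#s, s#} + m) \<ominus>\<^bsub>FM S\<^esub> bv ({#s#} + m))"
        unfolding s(2) lin_minus[OF FM_module FM_module A_mult_linear_left[OF basis_vec_closed[OF m]] b] A_mult_basis ..
      also have "\<dots> = g (bv ({#s, s#} + m)) \<ominus>\<^bsub>N\<^esub> g (bv ({#s#} + m))"
        by (rule lin_minus[OF FM_module N g basis_vec_closed[OF Mon_add[OF sM(1) m]] basis_vec_closed[OF Mon_add[OF sM(2) m]]])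
      also have "\<dots> = \<zero>\<^bsub>N\<^esub>"
        using gen[OF s(1) m] lin_closed[OF g basis_vec_closed[OF Mon_add[OF sM(2) m]]]
        by (simp add: add.commute module_minus_eq[OF N])
      finally show "g (y \<otimes>\<^bsub>A S\<^esub> bv m) = \<zero>\<^bsub>N\<^esub>" .
    qed
    then show "y \<in> ?H" using y by simp
  qed
  ultimately have "idem_ideal R S \<subseteq> ?H" unfolding idem_ideal_def Let_def by (rule A.genideal_minimal)
  then have "g (P \<otimes>\<^bsub>A S\<^esub> \<one>\<^bsub>A S\<^esub>) = \<zero>\<^bsub>N\<^esub>" "P \<in> carrier (A S)"
    using P A.one_closed by auto
  then show ?thesis using A.r_one by metis
qed

lemma idem_lift:
  assumes N: "module R N" and g: "lin R (FM S) N g"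
    and gen: "\<And>s m. s \<in> S \<Longrightarrow> m \<in> Mon S \<Longrightarrow> g (bv (m + {#s, s#})) = g (bv (m + {#s#}))"
  shows "lin R (idem_module R S) N (coset_lift g)"
    and "P \<in> carrier (FM S) \<Longrightarrow> coset_lift g (idem_cls R S P) = g P"
proof -
  note van = idem_lin_vanish[OF N g gen]
  have val: "coset_lift g (idem_cls R S P) = g P" if "P \<in> carrier (FM S)" for P
    unfolding idem_cls_coset by (rule coset_lift_coset[OF FM_module idem_ideal_submodule N g van that])
  then show "P \<in> carrier (FM S) \<Longrightarrow> coset_lift g (idem_cls R S P) = g P" .
  show "lin R (idem_module R S) N (coset_lift g)"
  proof (rule linI)
    interpret F: module R "FM S" by (rule FM_module)
    fix x assume "x \<in> carrier (idem_module R S)"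
    then obtain P where P: "P \<in> carrier (FM S)" "x = idem_cls R S P" unfolding cls_surj by blast
    show "coset_lift g x \<in> carrier N" unfolding P(2) val[OF P(1)] by (rule lin_closed[OF g P(1)])
    { fix y assume "y \<in> carrier (idem_module R S)"
      then obtain Q where Q: "Q \<in> carrier (FM S)" "y = idem_cls R S Q" unfolding cls_surj by blast
      show "coset_lift g (x \<oplus>\<^bsub>idem_module R S\<^esub> y) = coset_lift g x \<oplus>\<^bsub>N\<^esub> coset_lift g y"
        unfolding P(2) Q(2) lin_add[OF cls_lin P(1) Q(1), symmetric] val[OF P(1)] val[OF Q(1)]
          val[OF F.M.a_closed[OF P(1) Q(1)]] by (rule lin_add[OF g P(1) Q(1)]) }
    { fix r assume r: "r \<in> carrier R"
      show "coset_lift g (r \<odot>\<^bsub>idem_module R S\<^esub> x) = r \<odot>\<^bsub>N\<^esub> coset_lift g x"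
        unfolding P(2) lin_smult[OF cls_lin r P(1), symmetric] val[OF P(1)]
          val[OF F.smult_closed[OF r P(1)]] by (rule lin_smult[OF g r P(1)]) }
  qed
qed

abbreviation "xc S s \<equiv> idem_cls R S (indexed_var s)"

lemma cls_basis_closed: "m \<in> Mon S \<Longrightarrow> idem_cls R S (bv m) \<in> carrier (idem_module R S)"
  by (rule lin_closed[OF cls_lin basis_vec_closed])

lemma idem_incl_lin: "lin R (free_module R S) (idem_module R S) (idem_incl R S)"
  unfolding idem_incl_def
  by (rule free_lift_lin[OF idem_module_module]) (auto simp: indexed_var_eq Mon_def intro!: cls_basis_closed)

lemma idem_incl_basis: "s \<in> S \<Longrightarrow> idem_incl R S (bv s) = xc S s"
  unfolding idem_incl_def
  by (rule free_lift_basis[OF idem_module_module]) (auto simp: indexed_var_eq Mon_def intro!: cls_basis_closed)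

lemma cls_relation:
  assumes s: "s \<in> S" and m: "m \<in> Mon S"
  shows "idem_cls R S (bv (m + {#s, s#})) = idem_cls R S (bv (m + {#s#}))"
proof -
  interpret A: cring "A S" by (rule A_cring)
  interpret I: ideal "idem_ideal R S" "A S" by (rule idem_ideal_ideal)
  have sM: "{#s, s#} \<in> Mon S" "{#s#} \<in> Mon S" using s by (auto simp: Mon_def)
  note b = basis_vec_closed[OF sM(1)] basis_vec_closed[OF sM(2)]
  let ?y = "bv {#s, s#} \<ominus>\<^bsub>FM S\<^esub> bv {#s#}"
  have "?y \<in> idem_gen S" unfolding idem_gen_set using s by (rule imageI)
  moreover have "idem_gen S \<subseteq> idem_ideal R S"
    unfolding idem_ideal_def Let_def using idem_gen_closed by (intro A.genideal_self) simp
  ultimately have "?y \<in> idem_ideal R S" by blast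
  then have "?y \<otimes>\<^bsub>A S\<^esub> bv m \<in> idem_ideal R S"
    using basis_vec_closed[OF m] by (intro I.I_r_closed) auto
  then have "bv ({#s, s#} + m) \<ominus>\<^bsub>FM S\<^esub> bv ({#s#} + m) \<in> idem_ideal R S"
    unfolding lin_minus[OF FM_module FM_module A_mult_linear_left[OF basis_vec_closed[OF m]] b] A_mult_basis .
  then show ?thesis
    unfolding idem_cls_coset
    using coset_eq_iff[OF FM_module idem_ideal_submodule basis_vec_closed[OF Mon_add[OF sM(1) m]] basis_vec_closed[OF Mon_add[OF sM(2) m]]]
    by (simp add: add.commute)
qed

lemma idem_map:
  assumes f: "f ` S \<subseteq> S'"
  shows "lin R (idem_module R S) (idem_module R S') (idem_map R S' f)"
    and "s \<in> S \<Longrightarrow> idem_map R S' f (xc S s) = xc S' (f s)"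
proof -
  let ?h = "\<lambda>m. idem_cls R S' (bv (image_mset f m))"
  let ?g = "free_lift R (idem_module R S') ?h"
  have Mf: "image_mset f m \<in> Mon S'" if "m \<in> Mon S" for m using that f by (auto simp: Mon_def)
  have h: "?h m \<in> carrier (idem_module R S')" if "m \<in> Mon S" for m by (rule cls_basis_closed[OF Mf[OF that]])
  have g: "lin R (FM S) (idem_module R S') ?g" using h by (intro free_lift_lin[OF idem_module_module]) auto
  have gb: "?g (bv m) = ?h m" if "m \<in> Mon S" for m
    by (rule free_lift_basis[where f="?h", OF idem_module_module h[OF that]])
  have gen: "?g (bv (m + {#s, s#})) = ?g (bv (m + {#s#}))" if "s \<in> S" "m \<in> Mon S" for s m
  proof -
    have "m + {#s, s#} \<in> Mon S" "m + {#s#} \<in> Mon S" using that by (auto simp: Mon_def)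
    moreover have "f s \<in> S'" using that f by auto
    ultimately show ?thesis using gb cls_relation[of "f s" S' "image_mset f m"] Mf[OF that(2)] by simp
  qed
  note l = idem_lift[OF idem_module_module g gen]
  show "lin R (idem_module R S) (idem_module R S') (idem_map R S' f)" unfolding idem_map_def by (rule l(1))
  assume s: "s \<in> S"
  then have "{#s#} \<in> Mon S" by (simp add: Mon_def)
  then show "idem_map R S' f (xc S s) = xc S' (f s)"
    unfolding idem_map_def indexed_var_eq using l(2)[OF _ _ basis_vec_closed] gb by simp
qed

text \<open>The coefficient functional of the squarefree monomial with variables \<open>V\<close>.\<close>

definition chi :: "'s set \<Rightarrow> ('s multiset \<Rightarrow> 'r) set \<Rightarrow> 'r" where
  "chi V = coset_lift (free_lift R RM (\<lambda>m. if set_mset m = V then \<one> else \<zero>))"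

lemma chi:
  shows "lin R (idem_module R S) RM (chi V)"
    and "m \<in> Mon S \<Longrightarrow> chi V (idem_cls R S (bv m)) = (if set_mset m = V then \<one> else \<zero>)"
    and "P \<in> carrier (FM S) \<Longrightarrow> (\<And>m. P m \<noteq> \<zero> \<Longrightarrow> set_mset m \<noteq> V) \<Longrightarrow> chi V (idem_cls R S P) = \<zero>"
proof -
  let ?h = "\<lambda>m. if set_mset m = V then \<one> else \<zero>"
  let ?g = "free_lift R RM ?h"
  have h: "?h m \<in> carrier RM" for m by simp
  have g: "lin R (FM S) RM ?g" using h by (intro free_lift_lin[OF RM_module]) auto
  have gb: "?g (bv m) = ?h m" for m
    by (rule free_lift_basis[where f="?h", OF RM_module h])
  have gen: "?g (bv (m + {#s, s#})) = ?g (bv (m + {#s#}))" for s m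
    unfolding gb by simp
  note l = idem_lift[OF RM_module g gen]
  show "lin R (idem_module R S) RM (chi V)" unfolding chi_def by (rule l(1))
  show "m \<in> Mon S \<Longrightarrow> chi V (idem_cls R S (bv m)) = (if set_mset m = V then \<one> else \<zero>)"
    unfolding chi_def using l(2)[OF basis_vec_closed] gb by simp
  assume P: "P \<in> carrier (FM S)" and nz: "\<And>m. P m \<noteq> \<zero> \<Longrightarrow> set_mset m \<noteq> V"
  interpret RM: module R RM by (rule RM_module)
  have "?g P = (\<Oplus>\<^bsub>RM\<^esub>m\<in>{m. P m \<noteq> \<zero>}. P m \<odot>\<^bsub>RM\<^esub> ?h m)" by (simp add: free_lift_def)
  also have "\<dots> = \<zero>\<^bsub>RM\<^esub>"
    using nz free_closed[OF P] by (intro RM.M.add.finprod_one_eqI) auto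
  finally show "chi V (idem_cls R S P) = \<zero>" unfolding chi_def using l(2)[OF P] by simp
qed

lemma prod_vars:
  assumes "finite I" "\<And>i. i \<in> I \<Longrightarrow> v i \<in> S"
  shows "\<exists>m\<in>Mon S. set_mset m = v ` I \<and> (\<Otimes>\<^bsub>idem_ring R S\<^esub>i\<in>I. xc S (v i)) = idem_cls R S (bv m)"
  using assms
proof (induction I rule: finite_induct)
  case empty
  interpret Q: cring "idem_ring R S" by (rule idem_ring_cring)
  have "idem_cls R S (bv {#}) = \<one>\<^bsub>idem_ring R S\<^esub>" using ring_hom_one[OF cls_hom, of S] by simp
  moreover have "{#} \<in> Mon S" by (simp add: Mon_def)
  ultimately show ?case unfolding Q.finprod_empty image_empty by (metis set_mset_empty)
next
  case (insert j I)
  interpret Q: cring "idem_ring R S" by (rule idem_ring_cring)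
  from insert obtain m where m: "m \<in> Mon S" "set_mset m = v ` I"
    "(\<Otimes>\<^bsub>idem_ring R S\<^esub>i\<in>I. xc S (v i)) = idem_cls R S (bv m)" by auto
  have jM: "{#v j#} \<in> Mon S" using insert.prems by (simp add: Mon_def)
  have xcc: "xc S (v i) \<in> carrier (idem_ring R S)" if "i \<in> insert j I" for i
    using cls_basis_closed[of "{#v i#}" S] insert.prems[OF that] by (simp add: Mon_def idem_module_def indexed_var_eq)
  have "(\<Otimes>\<^bsub>idem_ring R S\<^esub>i\<in>insert j I. xc S (v i)) = xc S (v j) \<otimes>\<^bsub>idem_ring R S\<^esub> idem_cls R S (bv m)"
    unfolding m(3)[symmetric] using insert.hyps xcc by (intro Q.finprod_insert) auto
  also have "\<dots> = idem_cls R S (bv {#v j#} \<otimes>\<^bsub>A S\<^esub> bv m)"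
    unfolding indexed_var_eq using ring_hom_mult[OF cls_hom, of "bv {#v j#}" S "bv m"]
      basis_vec_closed[OF jM] basis_vec_closed[OF m(1)] by simp
  finally show ?case
    using m jM unfolding A_mult_basis by (intro bexI[of _ "{#v j#} + m"]) (auto simp: Mon_def)
qed

end

section \<open>Free sets for finite set mappings\<close>

lemma is_aleph_Card_order:
  fixes r :: "'a rel"
  shows "is_aleph k r \<Longrightarrow> Card_order r"
proof (induction k arbitrary: r)
  case 0
  then show ?case using Card_order_ordIso natLeq_Card_order by auto
next
  case (Suc l)
  then obtain r' :: "'a rel" where "is_aleph l r'" "r =o cardSuc r'" by auto
  then show ?case using Suc.IH cardSuc_Card_order Card_order_ordIso by blast
qed

lemma is_aleph_infinite:
  fixes r :: "'a rel"
  shows "is_aleph k r \<Longrightarrow> \<not> finite (Field r)"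
proof (induction k arbitrary: r)
  case 0
  then have "r =o |UNIV :: nat set|" using ordIso_transitive[OF _ ordIso_symmetric[OF card_of_nat]] by auto
  then show ?case using card_of_ordIso_finite_Field[OF is_aleph_Card_order[OF 0]] by auto
next
  case (Suc l)
  then obtain r' :: "'a rel" where r': "is_aleph l r'" "r =o cardSuc r'" by auto
  then have c: "\<not> finite (Field (cardSuc r'))" using Suc.IH cardSuc_finite is_aleph_Card_order by blast
  have "cardSuc r' =o |Field (cardSuc r')|"
    using card_of_Field_ordIso[OF cardSuc_Card_order[OF is_aleph_Card_order[OF r'(1)]]] ordIso_symmetric by blast
  then have "r =o |Field (cardSuc r')|" using r'(2) ordIso_transitive by blast
  then show ?case using c card_of_ordIso_finite_Field[OF is_aleph_Card_order[OF Suc.prems]] by blast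
qed

lemma finite_ordLeq_Card_order:
  assumes "finite A" "Card_order r" "\<not> finite (Field r)"
  shows "|A| \<le>o r"
proof -
  have "|A| <o natLeq" using assms(1) finite_iff_ordLess_natLeq by blast
  moreover have "natLeq \<le>o |Field r|" using assms(3) infinite_iff_natLeq_ordLeq by blast
  ultimately have "|A| \<le>o |Field r|" using ordLess_ordLeq_trans ordLess_imp_ordLeq by blast
  then show ?thesis using card_of_Field_ordIso[OF assms(2)] ordLeq_ordIso_trans by blast
qed

lemma is_aleph_unique:
  fixes r r' :: "'a rel"
  shows "is_aleph k r \<Longrightarrow> is_aleph k r' \<Longrightarrow> r =o r'"
proof (induction k arbitrary: r r')
  case 0
  then have "r =o natLeq" "r' =o natLeq" by simp_all
  then show ?case by (rule ordIso_transitive[OF _ ordIso_symmetric])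
next
  case (Suc l)
  obtain s :: "'a rel" where s1: "is_aleph l s" "r =o cardSuc s" using Suc.prems(1) by auto
  obtain s' :: "'a rel" where s2: "is_aleph l s'" "r' =o cardSuc s'" using Suc.prems(2) by auto
  note s = s1 s2
  have "s =o s'" by (rule Suc.IH[OF s1(1) s2(1)])
  then have "cardSuc s =o cardSuc s'"
    using cardSuc_invar_ordIso[OF is_aleph_Card_order[OF s(1)] is_aleph_Card_order[OF s(3)]] by simp
  then show ?case by (rule ordIso_transitive[OF s(2) ordIso_transitive[OF _ ordIso_symmetric[OF s(4)]]])
qed

text \<open>
  The definition of \<^const>\<open>is_aleph\<close> fixes cardinals only up to isomorphism, so the comparison
  goes through uniqueness.
\<close>

lemma is_aleph_mono:
  fixes r r' :: "'a rel"
  shows "is_aleph k r \<Longrightarrow> is_aleph l r' \<Longrightarrow> k \<le> l \<Longrightarrow> r \<le>o r'"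
proof (induction l arbitrary: r')
  case 0
  then show ?case using is_aleph_unique[of 0 r r'] by (intro ordIso_imp_ordLeq) simp
next
  case (Suc l)
  show ?case
  proof (cases "k = Suc l")
    case True
    then show ?thesis using Suc.prems by (intro ordIso_imp_ordLeq is_aleph_unique[of k]) simp_all
  next
    case False
    from Suc.prems obtain s :: "'a rel" where s: "is_aleph l s" "r' =o cardSuc s" by auto
    have "r \<le>o s" using Suc.IH[OF Suc.prems(1) s(1)] False Suc.prems(3) by simp
    moreover have "s \<le>o cardSuc s" by (rule cardSuc_ordLeq[OF is_aleph_Card_order[OF s(1)]])
    ultimately have "r \<le>o cardSuc s" by (rule ordLeq_transitive)
    then show ?thesis by (rule ordLeq_ordIso_trans[OF _ ordIso_symmetric[OF s(2)]])
  qed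
qed

lemma aleph_subset:
  assumes "is_aleph k r" "r \<le>o |S|"
  shows "\<exists>B\<subseteq>S. |B| =o r"
proof -
  have c: "|Field r| =o r" using is_aleph_Card_order[OF assms(1)] by (rule card_of_Field_ordIso)
  then have "|Field r| \<le>o |S|" using assms(2) by (rule ordIso_ordLeq_trans)
  then obtain g where g: "inj_on g (Field r)" "g ` Field r \<subseteq> S" using card_of_ordLeq[of "Field r" S] by blast
  have "bij_betw g (Field r) (g ` Field r)" using g(1) by (simp add: bij_betw_def)
  then have "|g ` Field r| =o |Field r|" by (rule ordIso_symmetric[OF card_of_ordIsoI])
  then have "|g ` Field r| =o r" by (rule ordIso_transitive[OF _ c])
  then show ?thesis using g(2) by blast
qed

lemma card_of_PiE_ordLeq:
  assumes r: "Card_order r" "\<not> finite (Field r)" and B: "\<And>i. i \<in> {1..n} \<Longrightarrow> |B i| \<le>o r"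
  shows "|\<Pi>\<^sub>E i\<in>{1..n::nat}. B i| \<le>o r"
  using B
proof (induction n)
  case 0
  show ?case by (rule finite_ordLeq_Card_order[OF _ r]) simp
next
  case (Suc n)
  have "{1..Suc n} = insert (Suc n) {1..n}" by auto
  then have "(\<Pi>\<^sub>E i\<in>{1..Suc n}. B i) = (\<lambda>(y, g). g(Suc n := y)) ` (B (Suc n) \<times> (\<Pi>\<^sub>E i\<in>{1..n}. B i))"
    by (simp add: PiE_insert_eq)
  moreover have "|B (Suc n) \<times> (\<Pi>\<^sub>E i\<in>{1..n}. B i)| \<le>o r"
    using Suc r by (intro card_of_Times_ordLeq_infinite_Field) auto
  ultimately show ?case by (simp only: ordLeq_transitive[OF card_of_image])
qed

text \<open>Kuratowski's free set theorem in the form with one set for each aleph.\<close>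

lemma free_set:
  fixes S :: "nat \<Rightarrow> 's set"
  assumes "\<And>i. i \<in> {1..n} \<Longrightarrow> aleph_le (i - 1) (S i)"
    and "\<And>i s. finite (f i s)" and "\<And>i s x. i \<in> {1..n} \<Longrightarrow> f i (s(i := x)) = f i s"
  shows "\<exists>s\<in>(\<Pi>\<^sub>E i\<in>{1..n}. S i). \<forall>i\<in>{1..n}. s i \<notin> f i s"
  using assms
proof (induction n arbitrary: S f)
  case 0
  then show ?case by auto
next
  case (Suc n)
  have "\<exists>r :: 's rel. is_aleph (i - 1) r \<and> r \<le>o |S i|" if "i \<in> {1..Suc n}" for i
    using Suc.prems(1)[OF that] by (simp add: aleph_le_def)
  then obtain r :: "nat \<Rightarrow> 's rel" where r: "\<And>i. i \<in> {1..Suc n} \<Longrightarrow> is_aleph (i - 1) (r i)" "\<And>i. i \<in> {1..Suc n} \<Longrightarrow> r i \<le>o |S i|" by metis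
  have "\<exists>B\<subseteq>S i. |B| =o r i" if "i \<in> {1..Suc n}" for i by (rule aleph_subset[OF r(1)[OF that] r(2)[OF that]])
  then obtain B where B: "\<And>i. i \<in> {1..Suc n} \<Longrightarrow> B i \<subseteq> S i" "\<And>i. i \<in> {1..Suc n} \<Longrightarrow> |B i| =o r i" by metis
  let ?N = "Suc n"
  have N: "?N \<in> {1..?N}" by simp
  let ?U = "\<Union>s\<in>(\<Pi>\<^sub>E i\<in>{1..n}. B i). f ?N s"
  \<comment> \<open>the largest set is too big to be covered by the finitely valued family over the smaller ones\<close>
  have "\<not> S ?N \<subseteq> ?U"
  proof
    assume sub: "S ?N \<subseteq> ?U"
    show False
    proof (cases n)
      case 0
      then have "finite ?U" using Suc.prems(2) by simp
      then have "finite (B ?N)" using B(1)[OF N] sub by (meson finite_subset)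
      then show False
        using B(2)[OF N] is_aleph_infinite[OF r(1)[OF N]] card_of_ordIso_finite_Field[OF is_aleph_Card_order[OF r(1)[OF N]]]
        ordIso_symmetric by blast
    next
      case (Suc m)
      then obtain q :: "'s rel" where q: "is_aleph m q" "r ?N =o cardSuc q" using r(1)[OF N] by auto
      note qc = is_aleph_Card_order[OF q(1)] and qi = is_aleph_infinite[OF q(1)]
      have "|B i| \<le>o q" if i: "i \<in> {1..n}" for i
      proof -
        have "r i \<le>o q" using i Suc by (intro is_aleph_mono[OF r(1) q(1)]) auto
        then show ?thesis using i by (intro ordIso_ordLeq_trans[OF B(2)]) auto
      qed
      then have "|\<Pi>\<^sub>E i\<in>{1..n}. B i| \<le>o q" by (intro card_of_PiE_ordLeq qc qi)
      moreover have "|f ?N s| \<le>o q" for s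
        by (rule finite_ordLeq_Card_order[OF Suc.prems(2) qc qi])
      ultimately have "|?U| \<le>o q" by (intro card_of_UNION_ordLeq_infinite_Field qi qc) auto
      then have "|S ?N| \<le>o q" by (rule ordLeq_transitive[OF card_of_mono1[OF sub]])
      then have "r ?N \<le>o q" by (rule ordLeq_transitive[OF r(2)[OF N]])
      then have "cardSuc q \<le>o q" by (rule ordIso_ordLeq_trans[OF ordIso_symmetric[OF q(2)]])
      then show False using cardSuc_greater[OF qc] not_ordLeq_ordLess by blast
    qed
  qed
  then obtain x where x: "x \<in> S ?N" "x \<notin> ?U" by blast
  \<comment> \<open>with \<open>x\<close> chosen outside all sets over the subsets \<open>B i\<close>, only the first \<open>n\<close> coordinates remain\<close>
  have "\<exists>s\<in>(\<Pi>\<^sub>E i\<in>{1..n}. B i). \<forall>i\<in>{1..n}. s i \<notin> f i (s(?N := x))"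
  proof (rule Suc.IH)
    fix i assume i: "i \<in> {1..n}"
    then have "is_aleph (i - 1) (r i)" "r i \<le>o |B i|"
      using r(1)[of i] ordIso_imp_ordLeq[OF ordIso_symmetric[OF B(2)[of i]]] by auto
    then show "aleph_le (i - 1) (B i)" unfolding aleph_le_def by blast
    fix s y
    have "f i (s(i := y, ?N := x)) = f i ((s(?N := x))(i := y))" using i by (simp add: fun_upd_twist)
    also have "\<dots> = f i (s(?N := x))" by (rule Suc.prems(3)) (use i in auto)
    finally show "f i (s(i := y, ?N := x)) = f i (s(?N := x))" .
  qed (rule Suc.prems(2))
  then obtain s where s: "s \<in> (\<Pi>\<^sub>E i\<in>{1..n}. B i)" "\<forall>i\<in>{1..n}. s i \<notin> f i (s(?N := x))" by blast
  have "x \<notin> f ?N (s(?N := x))" using x(2) s(1) unfolding Suc.prems(3)[OF N] by blast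
  moreover have "s(?N := x) \<in> (\<Pi>\<^sub>E i\<in>{1..?N}. S i)"
    using s(1) x(1) B(1) by (fastforce simp: PiE_iff extensional_def)
  moreover have "(s(?N := x)) i \<notin> f i (s(?N := x))" if "i \<in> {1..?N}" for i
    using s(2) calculation(1) that by (cases "i = ?N") auto
  ultimately show ?case by blast
qed

section \<open>Indivisible sequences are pairwise comaximal\<close>

context coeff_ring
begin

lemma tensor2_rels_closed:
  assumes "module R M" "module R N"
  shows "tensor2_rels R M N \<subseteq> carrier (free_module R (carrier M \<times> carrier N))"
proof -
  interpret M: module R M by fact
  interpret N: module R N by fact
  interpret F: module R "free_module R (carrier M \<times> carrier N)" by (rule free_module_module)
  have e: "bv (x, y) \<in> carrier (free_module R (carrier M \<times> carrier N))" if "x \<in> carrier M" "y \<in> carrier N" for x y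
    using that by (intro basis_vec_closed) auto
  show ?thesis
    unfolding tensor2_rels_def Let_def
    by (auto intro!: e F.M.minus_closed F.M.a_closed F.smult_closed simp del: free_simps)
qed

lemma tensor2_null_submodule:
  assumes "module R M" "module R N"
  shows "submodule (tensor2_null R M N) R (free_module R (carrier M \<times> carrier N))"
  unfolding tensor2_null_def by (rule submod_span_submodule[OF free_module_module tensor2_rels_closed[OF assms]])

lemma tensor2_module:
  assumes "module R M" "module R N"
  shows "module R (tensor2 R M N)"
  unfolding tensor2_def by (rule quot_module_module[OF free_module_module tensor2_null_submodule[OF assms]])

lemma tensor2_proj_lin:
  assumes "module R M" "module R N"
  shows "lin R (free_module R (carrier M \<times> carrier N)) (tensor2 R M N)
    (\<lambda>x. tensor2_null R M N +>\<^bsub>free_module R (carrier M \<times> carrier N)\<^esub> x)"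
  unfolding tensor2_def by (rule quot_proj_lin[OF free_module_module tensor2_null_submodule[OF assms]])

lemma tensor2_pure_closed:
  assumes "module R M" "module R N" "x \<in> carrier M" "y \<in> carrier N"
  shows "tensor2_pure R M N x y \<in> carrier (tensor2 R M N)"
  unfolding tensor2_pure_def using assms(3,4)
  by (intro lin_closed[OF tensor2_proj_lin[OF assms(1,2)]] basis_vec_closed) auto

lemma tensor2_rel_eq:
  assumes M: "module R M" and N: "module R N"
    and x: "x \<in> carrier (free_module R (carrier M \<times> carrier N))" and y: "y \<in> carrier (free_module R (carrier M \<times> carrier N))"
    and rel: "x \<ominus>\<^bsub>free_module R (carrier M \<times> carrier N)\<^esub> y \<in> tensor2_rels R M N"
  shows "tensor2_null R M N +>\<^bsub>free_module R (carrier M \<times> carrier N)\<^esub> x =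
    tensor2_null R M N +>\<^bsub>free_module R (carrier M \<times> carrier N)\<^esub> y"
proof -
  have "tensor2_rels R M N \<subseteq> tensor2_null R M N" unfolding tensor2_null_def by (rule submod_span_superset)
  then show ?thesis
    using rel coset_eq_iff[OF free_module_module tensor2_null_submodule[OF M N] x y] by blast
qed

lemma tensor2_pure_lin_left:
  assumes M: "module R M" and N: "module R N" and y: "y \<in> carrier N"
  shows "lin R M (tensor2 R M N) (\<lambda>x. tensor2_pure R M N x y)"
proof (rule linI)
  interpret M: module R M by fact
  let ?F = "free_module R (carrier M \<times> carrier N)"
  interpret F: module R ?F by (rule free_module_module)
  have e: "bv (x, y) \<in> carrier ?F" if "x \<in> carrier M" for x
    using that y by (intro basis_vec_closed) auto
  fix x assume x: "x \<in> carrier M"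
  show "tensor2_pure R M N x y \<in> carrier (tensor2 R M N)" by (rule tensor2_pure_closed[OF M N x y])
  { fix x' assume x': "x' \<in> carrier M"
    have "bv (x \<oplus>\<^bsub>M\<^esub> x', y) \<ominus>\<^bsub>?F\<^esub> (bv (x, y) \<oplus>\<^bsub>?F\<^esub> bv (x', y)) \<in> tensor2_rels R M N"
      unfolding tensor2_rels_def Let_def using x x' y by blast
    from tensor2_rel_eq[OF M N e[OF M.M.a_closed[OF x x']] F.M.a_closed[OF e[OF x] e[OF x']] this]
    show "tensor2_pure R M N (x \<oplus>\<^bsub>M\<^esub> x') y = tensor2_pure R M N x y \<oplus>\<^bsub>tensor2 R M N\<^esub> tensor2_pure R M N x' y"
      unfolding tensor2_pure_def lin_add[OF tensor2_proj_lin[OF M N] e[OF x] e[OF x']] . }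
  { fix r assume r: "r \<in> carrier R"
    have "bv (r \<odot>\<^bsub>M\<^esub> x, y) \<ominus>\<^bsub>?F\<^esub> r \<odot>\<^bsub>?F\<^esub> bv (x, y) \<in> tensor2_rels R M N"
      unfolding tensor2_rels_def Let_def using r x y by blast
    from tensor2_rel_eq[OF M N e[OF M.smult_closed[OF r x]] F.smult_closed[OF r e[OF x]] this]
    show "tensor2_pure R M N (r \<odot>\<^bsub>M\<^esub> x) y = r \<odot>\<^bsub>tensor2 R M N\<^esub> tensor2_pure R M N x y"
      unfolding tensor2_pure_def lin_smult[OF tensor2_proj_lin[OF M N] r e[OF x]] . }
qed

lemma tensor2_pure_lin_right:
  assumes M: "module R M" and N: "module R N" and x: "x \<in> carrier M"
  shows "lin R N (tensor2 R M N) (\<lambda>y. tensor2_pure R M N x y)"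
proof (rule linI)
  interpret N: module R N by fact
  let ?F = "free_module R (carrier M \<times> carrier N)"
  interpret F: module R ?F by (rule free_module_module)
  have e: "bv (x, y) \<in> carrier ?F" if "y \<in> carrier N" for y
    using that x by (intro basis_vec_closed) auto
  fix y assume y: "y \<in> carrier N"
  show "tensor2_pure R M N x y \<in> carrier (tensor2 R M N)" by (rule tensor2_pure_closed[OF M N x y])
  { fix y' assume y': "y' \<in> carrier N"
    have "bv (x, y \<oplus>\<^bsub>N\<^esub> y') \<ominus>\<^bsub>?F\<^esub> (bv (x, y) \<oplus>\<^bsub>?F\<^esub> bv (x, y')) \<in> tensor2_rels R M N"
      unfolding tensor2_rels_def Let_def using x y y' by blast
    from tensor2_rel_eq[OF M N e[OF N.M.a_closed[OF y y']] F.M.a_closed[OF e[OF y] e[OF y']] this]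
    show "tensor2_pure R M N x (y \<oplus>\<^bsub>N\<^esub> y') = tensor2_pure R M N x y \<oplus>\<^bsub>tensor2 R M N\<^esub> tensor2_pure R M N x y'"
      unfolding tensor2_pure_def lin_add[OF tensor2_proj_lin[OF M N] e[OF y] e[OF y']] . }
  { fix r assume r: "r \<in> carrier R"
    have "bv (x, r \<odot>\<^bsub>N\<^esub> y) \<ominus>\<^bsub>?F\<^esub> r \<odot>\<^bsub>?F\<^esub> bv (x, y) \<in> tensor2_rels R M N"
      unfolding tensor2_rels_def Let_def using r x y by blast
    from tensor2_rel_eq[OF M N e[OF N.smult_closed[OF r y]] F.smult_closed[OF r e[OF y]] this]
    show "tensor2_pure R M N x (r \<odot>\<^bsub>N\<^esub> y) = r \<odot>\<^bsub>tensor2 R M N\<^esub> tensor2_pure R M N x y"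
      unfolding tensor2_pure_def lin_smult[OF tensor2_proj_lin[OF M N] r e[OF y]] . }
qed

lemma tensor2_lift_pure:
  assumes M: "module R M" and N: "module R N" and Q: "module R Q"
    and bl: "\<And>y. y \<in> carrier N \<Longrightarrow> lin R M Q (\<lambda>x. b x y)" and br: "\<And>x. x \<in> carrier M \<Longrightarrow> lin R N Q (\<lambda>y. b x y)"
    and x: "x \<in> carrier M" and y: "y \<in> carrier N"
  shows "coset_lift (free_lift R Q (\<lambda>(x, y). b x y)) (tensor2_pure R M N x y) = b x y"
proof -
  interpret M: module R M by fact
  interpret N: module R N by fact
  interpret Q: module R Q by fact
  let ?F = "free_module R (carrier M \<times> carrier N)"
  let ?g = "free_lift R Q (\<lambda>(x, y). b x y)"
  interpret F: module R ?F by (rule free_module_module)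
  have bc: "b x y \<in> carrier Q" if "x \<in> carrier M" "y \<in> carrier N" for x y
    using lin_closed[OF bl[OF that(2)] that(1)] .
  have l: "lin R ?F Q ?g" using bc by (intro free_lift_lin[OF Q]) auto
  have e: "bv (x, y) \<in> carrier ?F" if "x \<in> carrier M" "y \<in> carrier N" for x y
    using that by (intro basis_vec_closed) auto
  have gb: "?g (bv (x, y)) = b x y" if "x \<in> carrier M" "y \<in> carrier N" for x y
    using free_lift_basis[OF Q, of "\<lambda>(x, y). b x y" "(x, y)"] bc[OF that] by simp
  have rel: "?g z = \<zero>\<^bsub>Q\<^esub>" if "z \<in> tensor2_rels R M N" for z
    using that unfolding tensor2_rels_def Let_def
  proof (elim UnE CollectE exE conjE)
    fix x x' y assume z: "z = bv (x \<oplus>\<^bsub>M\<^esub> x', y) \<ominus>\<^bsub>?F\<^esub> (bv (x, y) \<oplus>\<^bsub>?F\<^esub> bv (x', y))"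
      and c: "x \<in> carrier M" "x' \<in> carrier M" "y \<in> carrier N"
    show ?thesis unfolding z lin_minus[OF free_module_module Q l e[OF M.M.a_closed[OF c(1,2)] c(3)] F.M.a_closed[OF e[OF c(1,3)] e[OF c(2,3)]]]
        lin_add[OF l e[OF c(1,3)] e[OF c(2,3)]] gb[OF c(1,3)] gb[OF c(2,3)] gb[OF M.M.a_closed[OF c(1,2)] c(3)]
        lin_add[OF bl[OF c(3)] c(1,2)]
      using bc c by (simp add: module_minus_eq[OF Q])
  next
    fix x y y' assume z: "z = bv (x, y \<oplus>\<^bsub>N\<^esub> y') \<ominus>\<^bsub>?F\<^esub> (bv (x, y) \<oplus>\<^bsub>?F\<^esub> bv (x, y'))"
      and c: "x \<in> carrier M" "y \<in> carrier N" "y' \<in> carrier N"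
    show ?thesis unfolding z lin_minus[OF free_module_module Q l e[OF c(1) N.M.a_closed[OF c(2,3)]] F.M.a_closed[OF e[OF c(1,2)] e[OF c(1,3)]]]
        lin_add[OF l e[OF c(1,2)] e[OF c(1,3)]] gb[OF c(1,2)] gb[OF c(1,3)] gb[OF c(1) N.M.a_closed[OF c(2,3)]]
        lin_add[OF br[OF c(1)] c(2,3)]
      using bc c by (simp add: module_minus_eq[OF Q])
  next
    fix r x y assume z: "z = bv (r \<odot>\<^bsub>M\<^esub> x, y) \<ominus>\<^bsub>?F\<^esub> r \<odot>\<^bsub>?F\<^esub> bv (x, y)"
      and c: "r \<in> carrier R" "x \<in> carrier M" "y \<in> carrier N"
    show ?thesis unfolding z lin_minus[OF free_module_module Q l e[OF M.smult_closed[OF c(1,2)] c(3)] F.smult_closed[OF c(1) e[OF c(2,3)]]]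
        lin_smult[OF l c(1) e[OF c(2,3)]] gb[OF c(2,3)] gb[OF M.smult_closed[OF c(1,2)] c(3)] lin_smult[OF bl[OF c(3)] c(1,2)]
      using bc c by (simp add: module_minus_eq[OF Q])
  next
    fix r x y assume z: "z = bv (x, r \<odot>\<^bsub>N\<^esub> y) \<ominus>\<^bsub>?F\<^esub> r \<odot>\<^bsub>?F\<^esub> bv (x, y)"
      and c: "r \<in> carrier R" "x \<in> carrier M" "y \<in> carrier N"
    show ?thesis unfolding z lin_minus[OF free_module_module Q l e[OF c(2) N.smult_closed[OF c(1,3)]] F.smult_closed[OF c(1) e[OF c(2,3)]]]
        lin_smult[OF l c(1) e[OF c(2,3)]] gb[OF c(2,3)] gb[OF c(2) N.smult_closed[OF c(1,3)]] lin_smult[OF br[OF c(2)] c(1,3)]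
      using bc c by (simp add: module_minus_eq[OF Q])
  qed
  have "?g z = \<zero>\<^bsub>Q\<^esub>" if "z \<in> tensor2_null R M N" for z
    using lin_vanish_span[OF free_module_module Q l tensor2_rels_closed[OF M N] rel] that unfolding tensor2_null_def by blast
  then show ?thesis
    unfolding tensor2_pure_def
    using coset_lift_coset[OF free_module_module tensor2_null_submodule[OF M N] Q l _ e[OF x y]] gb[OF x y] by simp
qed

lemma indiv_target_module: "module R (indiv_target R S)"
proof -
  interpret F: module R "free_module R S" by (rule free_module_module)
  show ?thesis
  proof (rule moduleI[OF is_cring])
    show "abelian_group (indiv_target R S)"
    proof (rule abelian_groupI)
      fix x assume x: "x \<in> carrier (indiv_target R S)"
      obtain a y where ay: "x = (a, y)" by (cases x)
      then have "(\<ominus> a, \<ominus>\<^bsub>free_module R S\<^esub> y) \<in> carrier (indiv_target R S)"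
        using x F.M.a_inv_closed by (auto simp: indiv_target_def dsum_module_def)
      moreover have "(\<ominus> a, \<ominus>\<^bsub>free_module R S\<^esub> y) \<oplus>\<^bsub>indiv_target R S\<^esub> x = \<zero>\<^bsub>indiv_target R S\<^esub>"
        using x ay F.M.l_neg[of y] by (auto simp: indiv_target_def dsum_module_def l_neg)
      ultimately show "\<exists>y\<in>carrier (indiv_target R S). y \<oplus>\<^bsub>indiv_target R S\<^esub> x = \<zero>\<^bsub>indiv_target R S\<^esub>" by blast
    qed (auto simp: indiv_target_def dsum_module_def a_ac simp del: free_simps intro: F.M.a_assoc F.M.a_comm)
  qed (auto simp: indiv_target_def dsum_module_def l_distr r_distr m_assoc F.smult_l_distr F.smult_r_distr F.smult_assoc1
     F.smult_one simp del: free_simps)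
qed

lemma target_simps:
  "carrier (indiv_target R S) = carrier R \<times> carrier (free_module R S)"
  "(a, x) \<oplus>\<^bsub>indiv_target R S\<^esub> (b, y) = (a \<oplus> b, \<lambda>s. x s \<oplus> y s)"
  "r \<odot>\<^bsub>indiv_target R S\<^esub> (a, x) = (r \<otimes> a, \<lambda>s. r \<otimes> x s)"
  "\<zero>\<^bsub>indiv_target R S\<^esub> = (\<zero>, \<lambda>s. \<zero>)"
  by (simp_all add: indiv_target_def dsum_module_def)

abbreviation "tgen \<Psi> s \<equiv> (\<one>, \<lambda>t. \<Psi> s \<otimes> bv s t)"

lemma tgen_closed:
  assumes "\<Psi> \<in> S \<rightarrow> carrier R" "s \<in> S"
  shows "tgen \<Psi> s \<in> carrier (indiv_target R S)"
proof -
  interpret F: module R "free_module R S" by (rule free_module_module)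
  show ?thesis using F.smult_closed[of "\<Psi> s" "bv s"] assms basis_vec_closed[of s S] by (auto simp: target_simps)
qed

lemma indiv_map_lin:
  assumes "\<Psi> \<in> S \<rightarrow> carrier R"
  shows "lin R (free_module R S) (indiv_target R S) (indiv_map R S \<Psi>)"
  unfolding indiv_map_def using tgen_closed[OF assms] by (intro free_lift_lin[OF indiv_target_module]) auto

lemma indiv_map_basis:
  assumes "\<Psi> \<in> S \<rightarrow> carrier R" "s \<in> S"
  shows "indiv_map R S \<Psi> (bv s) = tgen \<Psi> s"
  unfolding indiv_map_def using tgen_closed[OF assms]
  by (subst free_lift_basis[OF indiv_target_module]) auto

text \<open>
  Let \<open>R'\<close> be the quotient by the ideal \<open>J\<close> generated by \<open>\<Psi> s\<close> and \<open>\<Psi> t\<close>, carried over to the type of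
  lists by choosing a representative of each coset. After base change to \<open>R'\<close> the basis vectors
  of \<open>s\<close> and \<open>t\<close> have the same image \<open>(1, 0) \<otimes> 1\<close>, so by injectivity they coincide there. Comparing
  the coefficients at \<open>s\<close> gives \<open>1 = 0\<close> in \<open>R'\<close>, hence \<open>1 \<in> J\<close>.
\<close>

lemma comaximal:
  assumes one: "one_indivisible R S \<Psi>" and st: "s \<in> S" "t \<in> S" "s \<noteq> t"
  shows "\<exists>a\<in>carrier R. \<exists>b\<in>carrier R. \<one> = a \<otimes> \<Psi> s \<oplus> b \<otimes> \<Psi> t"
proof -
  have \<Psi>: "\<Psi> \<in> S \<rightarrow> carrier R"
    and ui: "universally_injective R (indiv_source R S) (indiv_target R S) (indiv_map R S \<Psi>)"
    using one by (auto simp: one_indivisible_def)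
  have pc: "\<Psi> s \<in> carrier R" "\<Psi> t \<in> carrier R" using \<Psi> st by auto
  let ?J = "(PIdl (\<Psi> s)) <+>\<^bsub>R\<^esub> (PIdl (\<Psi> t))"
  have J: "ideal ?J R" by (intro add_ideals cgenideal_ideal pc)
  interpret J: ideal ?J R by (rule J)
  let ?Q = "R Quot ?J"
  have Q: "cring ?Q" by (rule J.quotient_is_cring[OF is_cring])
  \<comment> \<open>any injection of the quotient into the lists over \<open>R\<close> will do\<close>
  define enc where "enc = (\<lambda>K :: 'r set. [SOME r. r \<in> K])"
  have dec: "?J +> (SOME r. r \<in> K) = K" if Kc: "K \<in> carrier ?Q" for K
  proof -
    obtain r where r: "r \<in> carrier R" "K = ?J +> r" using Kc by (auto simp: FactRing_def A_RCOSETS_def' a_r_coset_def')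
    then have "r \<in> K" using J.a_rcos_self by simp
    then have "(SOME r. r \<in> K) \<in> ?J +> r" using r(2) by (metis someI)
    then show ?thesis using J.a_repr_independence' r by metis
  qed
  have inj: "inj_on enc (carrier ?Q)"
    by (rule inj_onI) (metis dec enc_def list.inject)
  let ?R' = "image_ring enc ?Q"
  have iso: "enc \<in> ring_iso ?Q ?R'" by (rule inj_imp_image_ring_iso[OF inj])
  have R': "cring ?R'"
    using cring.ring_iso_imp_img_cring[OF Q iso] by (simp add: image_ring_def image_group_def monoid.defs)
  let ?\<phi> = "\<lambda>r. enc (?J +> r)"
  have \<phi>: "?\<phi> \<in> ring_hom R ?R'"
    using ring_hom_trans[OF J.rcos_ring_hom, of enc ?R'] iso by (simp add: ring_iso_def comp_def)
  interpret R': cring ?R' by (rule R')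
  let ?N = "restrict_scalars ?\<phi> ?R'"
  have N: "module R ?N" by (rule restrict_scalars_module[OF R' \<phi>])
  let ?M = "free_module R S" and ?T = "indiv_target R S" and ?f = "indiv_map R S \<Psi>"
  interpret N: module R ?N by (rule N)
  note M = free_module_module[of S] and T = indiv_target_module[of S]
  have oneN: "\<one>\<^bsub>?R'\<^esub> \<in> carrier ?N" by simp
  have phi0: "?\<phi> r = \<zero>\<^bsub>?R'\<^esub>" if "r \<in> ?J" for r
  proof -
    have "?J +> r = ?J" using J.a_rcos_const that by simp
    then show ?thesis by (simp add: image_ring_zero FactRing_def)
  qed
  have kill: "tensor2_map R ?T ?N ?f (\<lambda>x. x) (tensor2_pure R ?M ?N (bv u) \<one>\<^bsub>?R'\<^esub>) =
      tensor2_pure R ?T ?N (\<one>, \<lambda>s. \<zero>) \<one>\<^bsub>?R'\<^esub>" if u: "u \<in> S" and uJ: "\<Psi> u \<in> ?J" for u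
  proof -
    have uc: "\<Psi> u \<in> carrier R" using \<Psi> u by auto
    have e: "(\<zero>, bv u) \<in> carrier ?T" "(\<one>, \<lambda>s. \<zero>) \<in> carrier ?T"
      using basis_vec_closed[OF u] by (auto simp: target_simps free_carrier)
    interpret T: module R ?T by (rule T)
    have "tensor2_map R ?T ?N ?f (\<lambda>x. x) (tensor2_pure R ?M ?N (bv u) \<one>\<^bsub>?R'\<^esub>) =
       tensor2_pure R ?T ?N (?f (bv u)) \<one>\<^bsub>?R'\<^esub>"
      unfolding tensor2_map_def
      by (rule tensor2_lift_pure[where b="\<lambda>x y. tensor2_pure R ?T ?N (?f x) y", OF M N tensor2_module[OF T N]
        lin_comp[OF indiv_map_lin[OF \<Psi>] tensor2_pure_lin_left[OF T N]] tensor2_pure_lin_right[OF T N lin_closed[OF indiv_map_lin[OF \<Psi>]]]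
        basis_vec_closed[OF u] oneN])
    also have "?f (bv u) = (\<one>, \<lambda>s. \<zero>) \<oplus>\<^bsub>?T\<^esub> \<Psi> u \<odot>\<^bsub>?T\<^esub> (\<zero>, bv u)"
      unfolding indiv_map_basis[OF \<Psi> u] using uc free_closed[OF basis_vec_closed[OF u]] by (simp add: target_simps)
    also have "tensor2_pure R ?T ?N \<dots> \<one>\<^bsub>?R'\<^esub> = tensor2_pure R ?T ?N (\<one>, \<lambda>s. \<zero>) \<one>\<^bsub>?R'\<^esub> \<oplus>\<^bsub>tensor2 R ?T ?N\<^esub>
       \<Psi> u \<odot>\<^bsub>tensor2 R ?T ?N\<^esub> tensor2_pure R ?T ?N (\<zero>, bv u) \<one>\<^bsub>?R'\<^esub>"
      unfolding lin_add[OF tensor2_pure_lin_left[OF T N oneN] e(2) T.smult_closed[OF uc e(1)]]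
        lin_smult[OF tensor2_pure_lin_left[OF T N oneN] uc e(1)] ..
    also have "\<Psi> u \<odot>\<^bsub>tensor2 R ?T ?N\<^esub> tensor2_pure R ?T ?N (\<zero>, bv u) \<one>\<^bsub>?R'\<^esub> =
        tensor2_pure R ?T ?N (\<zero>, bv u) (\<Psi> u \<odot>\<^bsub>?N\<^esub> \<one>\<^bsub>?R'\<^esub>)"
      unfolding lin_smult[OF tensor2_pure_lin_right[OF T N e(1)] uc oneN] ..
    also have "\<Psi> u \<odot>\<^bsub>?N\<^esub> \<one>\<^bsub>?R'\<^esub> = \<zero>\<^bsub>?N\<^esub>" using phi0[OF uJ] by simp
    also have "tensor2_pure R ?T ?N (\<zero>, bv u) \<zero>\<^bsub>?N\<^esub> = \<zero>\<^bsub>tensor2 R ?T ?N\<^esub>"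
      by (rule lin_zero[OF N tensor2_module[OF T N] tensor2_pure_lin_right[OF T N e(1)]])
    also have "tensor2_pure R ?T ?N (\<one>, \<lambda>s. \<zero>) \<one>\<^bsub>?R'\<^esub> \<oplus>\<^bsub>tensor2 R ?T ?N\<^esub> \<zero>\<^bsub>tensor2 R ?T ?N\<^esub> =
      tensor2_pure R ?T ?N (\<one>, \<lambda>s. \<zero>) \<one>\<^bsub>?R'\<^esub>"
    proof -
      interpret TT: module R "tensor2 R ?T ?N" by (rule tensor2_module[OF T N])
      show ?thesis by (rule TT.M.r_zero[OF tensor2_pure_closed[OF T N e(2) oneN]])
    qed
    finally show ?thesis .
  qed
  have sJ: "\<Psi> s \<in> ?J" "\<Psi> t \<in> ?J"
  proof -
    have z: "\<zero> \<in> PIdl (\<Psi> t)" "\<zero> \<in> PIdl (\<Psi> s)"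
      using cgenideal_ideal pc by (meson additive_subgroup.zero_closed ideal.axioms(1))+
    have sum: "h \<oplus> k \<in> ?J" if "h \<in> PIdl (\<Psi> s)" "k \<in> PIdl (\<Psi> t)" for h k
      using that unfolding set_add_def' by blast
    show "\<Psi> s \<in> ?J" using sum[OF cgenideal_self[OF pc(1)] z(1)] pc by simp
    show "\<Psi> t \<in> ?J" using sum[OF z(2) cgenideal_self[OF pc(2)]] pc by simp
  qed
  have injT: "inj_on (tensor2_map R ?T ?N ?f (\<lambda>x. x)) (carrier (tensor2 R ?M ?N))"
    using ui R' \<phi> unfolding universally_injective_def indiv_source_def by blast
  have eq: "tensor2_pure R ?M ?N (bv s) \<one>\<^bsub>?R'\<^esub> = tensor2_pure R ?M ?N (bv t) \<one>\<^bsub>?R'\<^esub>"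
    by (rule inj_onD[OF injT])
      (simp_all only: kill[OF st(1) sJ(1)] kill[OF st(2) sJ(2)] tensor2_pure_closed[OF M N basis_vec_closed[OF st(1)] oneN]
        tensor2_pure_closed[OF M N basis_vec_closed[OF st(2)] oneN])
  \<comment> \<open>the functional on the tensor product that reads off the coefficient at \<open>s\<close>\<close>
  let ?b = "\<lambda>x y. x s \<odot>\<^bsub>?N\<^esub> y"
  have bl: "lin R ?M ?N (\<lambda>x. ?b x y)" if "y \<in> carrier ?N" for y
    using that by (intro linI) (simp_all only: free_simps free_closed N.smult_closed N.smult_l_distr N.smult_assoc1)
  have br: "lin R ?N ?N (\<lambda>y. ?b x y)" if "x \<in> carrier ?M" for x
    by (rule lin_scale[OF N lin_id free_closed[OF that]])
  have "?b (bv s) \<one>\<^bsub>?R'\<^esub> = ?b (bv t) \<one>\<^bsub>?R'\<^esub>"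
  proof -
    have "coset_lift (free_lift R ?N (\<lambda>(x, y). ?b x y)) (tensor2_pure R ?M ?N (bv u) \<one>\<^bsub>?R'\<^esub>) =
        ?b (bv u) \<one>\<^bsub>?R'\<^esub>" if u: "u \<in> S" for u
      by (rule tensor2_lift_pure[where b="?b" and M="?M" and N="?N" and Q="?N"])
        (fact M, fact N, fact N, erule bl, erule br, fact basis_vec_closed[OF u], fact oneN)
    from this[OF st(1)] this[OF st(2)] show ?thesis unfolding eq by simp
  qed
  then have "\<one> \<odot>\<^bsub>?N\<^esub> \<one>\<^bsub>?R'\<^esub> = \<zero> \<odot>\<^bsub>?N\<^esub> \<one>\<^bsub>?R'\<^esub>" using st(3) by (simp only: basis_vec_def if_True if_False simp_thms)
  then have "\<one>\<^bsub>?R'\<^esub> = \<zero>\<^bsub>?R'\<^esub>" using N.smult_one[OF oneN] N.smult_l_null[OF oneN] by simp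
  then have e: "enc \<one>\<^bsub>?Q\<^esub> = enc \<zero>\<^bsub>?Q\<^esub>" by (simp add: image_ring_zero image_ring_one)
  interpret Q: cring ?Q by (rule Q)
  have "\<one>\<^bsub>?Q\<^esub> = \<zero>\<^bsub>?Q\<^esub>" by (rule inj_onD[OF inj e Q.one_closed Q.zero_closed])
  then have "?J +> \<one> = ?J" by (simp add: FactRing_def)
  then have "\<one> \<in> ?J" using J.a_rcos_self[OF one_closed] by simp
  then show ?thesis unfolding set_add_def' cgenideal_def by auto
qed

text \<open>
  An element comaximal to each of several elements is comaximal to their product.
\<close>

lemma comaximal_finite:
  assumes one: "one_indivisible R S \<Psi>" and s: "s \<in> S" and T: "finite T" "T \<subseteq> S" "s \<notin> T"
  shows "\<exists>b\<in>carrier R. \<exists>c\<in>carrier R. \<one> = b \<oplus> c \<otimes> \<Psi> s \<and> (\<forall>t\<in>T. \<exists>d\<in>carrier R. b = d \<otimes> \<Psi> t)"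
  using T
proof (induction T rule: finite_induct)
  case empty
  have "\<Psi> s \<in> carrier R" using one s by (auto simp: one_indivisible_def)
  then show ?case by (intro bexI[of _ \<one>] bexI[of _ \<zero>]) auto
next
  case (insert t T)
  then obtain b c where bc: "b \<in> carrier R" "c \<in> carrier R" "\<one> = b \<oplus> c \<otimes> \<Psi> s" "\<forall>t\<in>T. \<exists>d\<in>carrier R. b = d \<otimes> \<Psi> t" by auto
  obtain a d where ad: "a \<in> carrier R" "d \<in> carrier R" "\<one> = a \<otimes> \<Psi> s \<oplus> d \<otimes> \<Psi> t"
    using comaximal[OF one s, of t] insert.prems by auto
  have pc: "\<Psi> s \<in> carrier R" "\<And>u. u \<in> insert t T \<Longrightarrow> \<Psi> u \<in> carrier R" using one s insert.prems by (auto simp: one_indivisible_def)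
  then have tc: "\<Psi> t \<in> carrier R" by simp
  let ?b = "b \<otimes> d \<otimes> \<Psi> t" and ?c = "b \<otimes> a \<oplus> c"
  have "b = b \<otimes> (a \<otimes> \<Psi> s \<oplus> d \<otimes> \<Psi> t)" using bc(1) by (simp flip: ad(3))
  then have "b \<oplus> c \<otimes> \<Psi> s = b \<otimes> (a \<otimes> \<Psi> s \<oplus> d \<otimes> \<Psi> t) \<oplus> c \<otimes> \<Psi> s" by simp
  also have "\<dots> = ?b \<oplus> ?c \<otimes> \<Psi> s"
    using bc(1,2) ad(1,2) pc(1) tc by algebra
  finally have 1: "\<one> = ?b \<oplus> ?c \<otimes> \<Psi> s" using bc(3) by simp
  have "\<exists>e\<in>carrier R. ?b = e \<otimes> \<Psi> u" if u: "u \<in> insert t T" for u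
  proof (cases "u = t")
    case True
    then show ?thesis using bc(1) ad(2) by (intro bexI[of _ "b \<otimes> d"]) auto
  next
    case False
    then obtain e where e: "e \<in> carrier R" "b = e \<otimes> \<Psi> u" using bc(4) u by auto
    have "?b = (e \<otimes> d \<otimes> \<Psi> t) \<otimes> \<Psi> u" unfolding e(2) using e(1) ad(2) tc pc(2)[OF u] by algebra
    then show ?thesis using e(1) ad(2) tc by (intro bexI[of _ "e \<otimes> d \<otimes> \<Psi> t"]) auto
  qed
  then show ?case using 1 bc(1,2) ad(1,2) tc by (intro bexI[of _ ?b] bexI[of _ ?c]) auto
qed

end

section \<open>A two-term free resolution of the cokernel\<close>

text \<open>
  Basis of a two-term resolution of the cokernel of \<open>f: \<Oplus>\<^sub>S R \<rightarrow> R \<oplus> \<Oplus>\<^sub>S R\<close>. The vertex \<open>Pt\<close> spans the extra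
  factor \<open>R\<close>, \<open>Vx s\<close> and \<open>Es s\<close> are the basis vectors of \<open>s\<close> in the target and in the source of \<open>f\<close>. The
  cells \<open>Vy y\<close> and \<open>Ey y\<close> span a contractible summand, with room for the coboundaries by which
  representing cocycles differ.
\<close>

datatype ('s, 'y) cell = Pt | Vx 's | Vy 'y | Es 's | Ey 'y

primrec is_edge :: "('s, 'y) cell \<Rightarrow> bool" where
  "is_edge Pt \<longleftrightarrow> False"
| "is_edge (Vx s) \<longleftrightarrow> False"
| "is_edge (Vy y) \<longleftrightarrow> False"
| "is_edge (Es s) \<longleftrightarrow> True"
| "is_edge (Ey y) \<longleftrightarrow> True"

definition cell_set :: "'s set \<Rightarrow> 'y set \<Rightarrow> ('s, 'y) cell set" where
  "cell_set S Y = insert Pt (Vx ` S \<union> Vy ` Y \<union> Es ` S \<union> Ey ` Y)"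

lemma cell_set_simps [simp]:
  "Pt \<in> cell_set S Y" "Vx s \<in> cell_set S Y \<longleftrightarrow> s \<in> S" "Vy y \<in> cell_set S Y \<longleftrightarrow> y \<in> Y"
  "Es s \<in> cell_set S Y \<longleftrightarrow> s \<in> S" "Ey y \<in> cell_set S Y \<longleftrightarrow> y \<in> Y"
  by (auto simp: cell_set_def)

context coeff_ring
begin

abbreviation "FC S Y \<equiv> free_module R (cell_set S Y)"

definition vert :: "'r \<times> ('s \<Rightarrow> 'r) \<Rightarrow> ('y \<Rightarrow> 'r) \<Rightarrow> ('s, 'y) cell \<Rightarrow> 'r" where
  "vert p h c = (case c of Pt \<Rightarrow> fst p | Vx s \<Rightarrow> snd p s | Vy y \<Rightarrow> h y | Es s \<Rightarrow> \<zero> | Ey y \<Rightarrow> \<zero>)"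

definition edges :: "('s \<Rightarrow> 'r) \<Rightarrow> ('y \<Rightarrow> 'r) \<Rightarrow> ('s, 'y) cell \<Rightarrow> 'r" where
  "edges x h c = (case c of Pt \<Rightarrow> \<zero> | Vx s \<Rightarrow> \<zero> | Vy y \<Rightarrow> \<zero> | Es s \<Rightarrow> x s | Ey y \<Rightarrow> h y)"

lemma vert_simps [simp]:
  "vert p h Pt = fst p" "vert p h (Vx s) = snd p s" "vert p h (Vy y) = h y"
  "vert p h (Es s) = \<zero>" "vert p h (Ey y) = \<zero>"
  by (simp_all add: vert_def)

lemma edges_simps [simp]:
  "edges x h Pt = \<zero>" "edges x h (Vx s) = \<zero>" "edges x h (Vy y) = \<zero>"
  "edges x h (Es s) = x s" "edges x h (Ey y) = h y"
  by (simp_all add: edges_def)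

lemma vert_closed:
  assumes p: "p \<in> carrier (indiv_target R S)" and h: "h \<in> carrier (free_module R Y)"
  shows "vert p h \<in> carrier (free_module R {c \<in> cell_set S Y. \<not> is_edge c})"
proof -
  have p': "fst p \<in> carrier R" "snd p \<in> carrier (free_module R S)" using p by (auto simp: target_simps)
  show ?thesis
  proof (rule freeI)
    let ?A = "insert Pt (Vx ` {s. snd p s \<noteq> \<zero>} \<union> Vy ` {y. h y \<noteq> \<zero>})"
    show "finite ?A" using free_finite[OF p'(2)] free_finite[OF h] by simp
    show "?A \<subseteq> {c \<in> cell_set S Y. \<not> is_edge c}" using free_supp[OF p'(2)] free_supp[OF h] by auto
    show "vert p h c \<in> carrier R" for c using p' free_closed[OF p'(2)] free_closed[OF h] by (cases c) auto
    show "vert p h c = \<zero>" if "c \<notin> ?A" for c using that by (cases c) auto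
  qed
qed

lemma edges_closed:
  assumes p: "p \<in> carrier (free_module R S)" and h: "h \<in> carrier (free_module R Y)"
  shows "edges p h \<in> carrier (free_module R {c \<in> cell_set S Y. is_edge c})"
proof (rule freeI)
  let ?A = "Es ` {s. p s \<noteq> \<zero>} \<union> Ey ` {y. h y \<noteq> \<zero>}"
  show "finite ?A" using free_finite[OF p] free_finite[OF h] by simp
  show "?A \<subseteq> {c \<in> cell_set S Y. is_edge c}" using free_supp[OF p] free_supp[OF h] by auto
  show "edges p h c \<in> carrier R" for c using free_closed[OF p] free_closed[OF h] by (cases c) auto
  show "edges p h c = \<zero>" if "c \<notin> ?A" for c using that by (cases c) auto
qed

lemma vert_lin:
  assumes "lin R M (indiv_target R S) p" and "lin R M (free_module R Y) h"
  shows "lin R M (free_module R {c \<in> cell_set S Y. \<not> is_edge c}) (\<lambda>x. vert (p x) (h x))"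
proof (rule linI)
  fix x assume x: "x \<in> carrier M"
  note px = lin_closed[OF assms(1) x] and hx = lin_closed[OF assms(2) x]
  show "vert (p x) (h x) \<in> carrier (free_module R {c \<in> cell_set S Y. \<not> is_edge c})" by (rule vert_closed[OF px hx])
  { fix y assume y: "y \<in> carrier M"
    have e: "vert (p x \<oplus>\<^bsub>indiv_target R S\<^esub> p y) (\<lambda>b. h x b \<oplus> h y b) c = vert (p x) (h x) c \<oplus> vert (p y) (h y) c" for c
      by (cases c; cases "p x"; cases "p y") (simp_all add: target_simps)
    show "vert (p (x \<oplus>\<^bsub>M\<^esub> y)) (h (x \<oplus>\<^bsub>M\<^esub> y)) =
        vert (p x) (h x) \<oplus>\<^bsub>free_module R {c \<in> cell_set S Y. \<not> is_edge c}\<^esub> vert (p y) (h y)"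
      unfolding lin_add[OF assms(1) x y] lin_add[OF assms(2) x y] by (simp add: fun_eq_iff e) }
  { fix r assume r: "r \<in> carrier R"
    have e: "vert (r \<odot>\<^bsub>indiv_target R S\<^esub> p x) (\<lambda>b. r \<otimes> h x b) c = r \<otimes> vert (p x) (h x) c" for c
      using r by (cases c; cases "p x") (simp_all add: target_simps)
    show "vert (p (r \<odot>\<^bsub>M\<^esub> x)) (h (r \<odot>\<^bsub>M\<^esub> x)) = r \<odot>\<^bsub>free_module R {c \<in> cell_set S Y. \<not> is_edge c}\<^esub> vert (p x) (h x)"
      unfolding lin_smult[OF assms(1) r x] lin_smult[OF assms(2) r x] by (simp add: fun_eq_iff e) }
qed

lemma edges_lin:
  assumes "lin R M (free_module R S) p" and "lin R M (free_module R Y) h"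
  shows "lin R M (free_module R {c \<in> cell_set S Y. is_edge c}) (\<lambda>x. edges (p x) (h x))"
proof (rule linI)
  fix x assume x: "x \<in> carrier M"
  note px = lin_closed[OF assms(1) x] and hx = lin_closed[OF assms(2) x]
  show "edges (p x) (h x) \<in> carrier (free_module R {c \<in> cell_set S Y. is_edge c})" by (rule edges_closed[OF px hx])
  { fix y assume y: "y \<in> carrier M"
    have e: "edges (\<lambda>b. p x b \<oplus> p y b) (\<lambda>b. h x b \<oplus> h y b) c = edges (p x) (h x) c \<oplus> edges (p y) (h y) c" for c
      by (cases c) simp_all
    show "edges (p (x \<oplus>\<^bsub>M\<^esub> y)) (h (x \<oplus>\<^bsub>M\<^esub> y)) =
        edges (p x) (h x) \<oplus>\<^bsub>free_module R {c \<in> cell_set S Y. is_edge c}\<^esub> edges (p y) (h y)"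
      unfolding lin_add[OF assms(1) x y] lin_add[OF assms(2) x y] by (simp add: fun_eq_iff e) }
  { fix r assume r: "r \<in> carrier R"
    have e: "edges (\<lambda>b. r \<otimes> p x b) (\<lambda>b. r \<otimes> h x b) c = r \<otimes> edges (p x) (h x) c" for c
      using r by (cases c) simp_all
    show "edges (p (r \<odot>\<^bsub>M\<^esub> x)) (h (r \<odot>\<^bsub>M\<^esub> x)) = r \<odot>\<^bsub>free_module R {c \<in> cell_set S Y. is_edge c}\<^esub> edges (p x) (h x)"
      unfolding lin_smult[OF assms(1) r x] lin_smult[OF assms(2) r x] by (simp add: fun_eq_iff e) }
qed

lemma free_sub_lin: "U \<subseteq> V \<Longrightarrow> lin R M (free_module R U) f \<Longrightarrow> lin R M (free_module R V) f"
  using free_mono[of U V] unfolding lin_def by (auto simp: Pi_iff)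

lemma slice_lin:
  assumes g: "inj g" and B: "\<And>s. g s \<in> B \<longleftrightarrow> s \<in> S"
  shows "lin R (free_module R B) (free_module R S) (\<lambda>z s. z (g s))"
proof (rule linI)
  fix z assume z: "z \<in> carrier (free_module R B)"
  show "(\<lambda>s. z (g s)) \<in> carrier (free_module R S)"
  proof (rule freeI)
    show "finite {s. z (g s) \<noteq> \<zero>}"
      using finite_vimageI[OF free_finite[OF z] g] by (simp add: vimage_def)
    show "{s. z (g s) \<noteq> \<zero>} \<subseteq> S" using free_supp[OF z] B by blast
  qed (use free_closed[OF z] in auto)
qed (auto simp: free_closed)

text \<open>
  The direct sum of \<open>f\<close> and the identity from the edges \<open>Ey y\<close> to the vertices \<open>Vy y\<close>.
\<close>

definition cell_bdry :: "'s set \<Rightarrow> ('s \<Rightarrow> 'r) \<Rightarrow> (('s, 'y) cell \<Rightarrow> 'r) \<Rightarrow> (('s, 'y) cell \<Rightarrow> 'r)" where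
  "cell_bdry S \<Psi> w = vert (indiv_map R S \<Psi> (\<lambda>s. w (Es s))) (\<lambda>y. w (Ey y))"

definition tpart :: "(('s, 'y) cell \<Rightarrow> 'r) \<Rightarrow> 'r \<times> ('s \<Rightarrow> 'r)" where
  "tpart z = (z Pt, \<lambda>s. z (Vx s))"

lemma tpart_lin: "lin R (FC S Y) (indiv_target R S) tpart"
proof -
  have l: "lin R (FC S Y) (free_module R S) (\<lambda>z s. z (Vx s))" by (rule slice_lin) (auto simp: inj_def)
  show ?thesis
    by (rule linI) (auto simp: tpart_def target_simps free_closed lin_closed[OF l])
qed

lemma tpart_vert [simp]: "tpart (vert p h) = p" by (simp add: tpart_def)

lemma cell_bdry_lin:
  assumes "\<Psi> \<in> S \<rightarrow> carrier R"
  shows "lin R (FC S Y) (free_module R {c \<in> cell_set S Y. \<not> is_edge c}) (cell_bdry S \<Psi>)"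
proof -
  have "lin R (FC S Y) (free_module R S) (\<lambda>z s. z (Es s))" "lin R (FC S Y) (free_module R Y) (\<lambda>z y. z (Ey y))"
    by (rule slice_lin; simp add: inj_def)+
  then have "lin R (FC S Y) (free_module R {c \<in> cell_set S Y. \<not> is_edge c})
      (\<lambda>z. vert (indiv_map R S \<Psi> (\<lambda>s. z (Es s))) (\<lambda>y. z (Ey y)))"
    by (intro vert_lin lin_comp[OF _ indiv_map_lin[OF assms]])
  then show ?thesis unfolding cell_bdry_def .
qed

lemma cell_bdry_endo:
  assumes "\<Psi> \<in> S \<rightarrow> carrier R"
  shows "lin R (FC S Y) (FC S Y) (cell_bdry S \<Psi>)"
  by (rule free_sub_lin[OF _ cell_bdry_lin[OF assms]]) auto

lemma indiv_map_zero:
  assumes "\<Psi> \<in> S \<rightarrow> carrier R"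
  shows "indiv_map R S \<Psi> (\<lambda>s. \<zero>) = (\<zero>, \<lambda>s. \<zero>)"
  using lin_zero[OF free_module_module indiv_target_module indiv_map_lin[OF assms]] by (simp add: target_simps)

lemma cell_bdry_vertex:
  assumes "\<Psi> \<in> S \<rightarrow> carrier R" and "\<not> is_edge b"
  shows "cell_bdry S \<Psi> (bv b) = (\<lambda>c. \<zero>)"
proof
  fix c
  have "bv b (Es s) = \<zero>" "bv b (Ey y) = \<zero>" for s y using assms(2) by (auto simp: basis_vec_def)
  then show "cell_bdry S \<Psi> (bv b) c = \<zero>"
    by (cases c) (simp_all add: cell_bdry_def indiv_map_zero[OF assms(1)])
qed

lemma cell_bdry_Es:
  fixes S :: "'s set"
  assumes "\<Psi> \<in> S \<rightarrow> carrier R" and "s \<in> S"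
  shows "cell_bdry S \<Psi> (bv (Es s :: ('s, 'y) cell)) = vert (tgen \<Psi> s) (\<lambda>y. \<zero>)"
proof -
  have "(\<lambda>t. bv (Es s :: ('s, 'y) cell) (Es t)) = bv s"
    "(\<lambda>y. bv (Es s :: ('s, 'y) cell) (Ey y)) = (\<lambda>y. \<zero>)"
    by (auto simp: basis_vec_def)
  then show ?thesis by (simp add: cell_bdry_def indiv_map_basis[OF assms])
qed

lemma cell_bdry_Ey:
  fixes S :: "'s set"
  assumes "\<Psi> \<in> S \<rightarrow> carrier R"
  shows "cell_bdry S \<Psi> (bv (Ey y :: ('s, 'y) cell)) = bv (Vy y)"
proof -
  have "(\<lambda>t. bv (Ey y :: ('s, 'y) cell) (Es t)) = (\<lambda>t. \<zero>)"
    "(\<lambda>y'. bv (Ey y :: ('s, 'y) cell) (Ey y')) = bv y"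
    by (auto simp: basis_vec_def)
  then have "cell_bdry S \<Psi> (bv (Ey y)) = vert (\<zero>, \<lambda>s. \<zero>) (bv y)" by (simp add: cell_bdry_def indiv_map_zero[OF assms])
  also have "vert (\<zero>, \<lambda>s. \<zero>) (bv y) c = bv (Vy y) c" for c
    by (cases c) (auto simp: basis_vec_def)
  then have "vert (\<zero>, \<lambda>s. \<zero>) (bv y) = bv (Vy y)" by blast
  finally show ?thesis .
qed

text \<open>
  Let \<open>T\<close> be the set of \<open>s\<close> with \<open>Es s \<in> F\<close>. For \<open>s \<in> T\<close> write \<open>1 = b s + c s \<Psi> s\<close> where
  \<open>b s = d s t \<Psi> t\<close> for all other \<open>t \<in> T\<close>. Then \<open>L\<close> sends \<open>Pt\<close> to the sum of the \<open>b s Es s\<close> and \<open>Vx t\<close> to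
  \<open>c t Es t\<close> minus the sum of the \<open>d s t Es s\<close> with \<open>s \<noteq> t\<close>, so that in \<open>L (Pt + \<Psi> t Vx t)\<close> everything
  cancels except \<open>Es t\<close>.
\<close>

lemma cell_bdry_split:
  fixes S :: "'s set" and Y :: "'y set"
  assumes one: "one_indivisible R S \<Psi>" and F: "finite F" "F \<subseteq> cell_set S Y" "\<And>b. b \<in> F \<Longrightarrow> is_edge b"
  shows "\<exists>L. lin R (FC S Y) (FC S Y) L \<and>
    (\<forall>b\<in>cell_set S Y. \<forall>c. is_edge b \<or> \<not> is_edge c \<longrightarrow> L (bv b) c = \<zero>) \<and>
    (\<forall>b\<in>F. L (cell_bdry S \<Psi> (bv b)) = bv b)"
proof -
  have \<Psi>: "\<Psi> \<in> S \<rightarrow> carrier R" using one by (simp add: one_indivisible_def)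
  define T where "T = {s. Es s \<in> F}"
  have "finite (Es -` F)" using F(1) by (rule finite_vimageI) (simp add: inj_def)
  then have T: "finite T" "T \<subseteq> S" using F(2) by (auto simp: T_def vimage_def)
  have "\<exists>b c d. b \<in> carrier R \<and> c \<in> carrier R \<and> \<one> = b \<oplus> c \<otimes> \<Psi> s \<and> (\<forall>t\<in>T-{s}. d t \<in> carrier R \<and> b = d t \<otimes> \<Psi> t)"
    if s: "s \<in> T" for s
  proof -
    obtain b c where bc: "b \<in> carrier R" "c \<in> carrier R" "\<one> = b \<oplus> c \<otimes> \<Psi> s" "\<forall>t\<in>T-{s}. \<exists>d\<in>carrier R. b = d \<otimes> \<Psi> t"
      using comaximal_finite[OF one, of s "T - {s}"] s T by auto
    from bchoice[of "T-{s}" "\<lambda>t d. d \<in> carrier R \<and> b = d \<otimes> \<Psi> t"] bc(4)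
    obtain d where "\<forall>t\<in>T-{s}. d t \<in> carrier R \<and> b = d t \<otimes> \<Psi> t" by blast
    then show ?thesis using bc(1-3) by blast
  qed
  then obtain b c d where bcd: "\<And>s. s \<in> T \<Longrightarrow> b s \<in> carrier R" "\<And>s. s \<in> T \<Longrightarrow> c s \<in> carrier R"
     "\<And>s. s \<in> T \<Longrightarrow> \<one> = b s \<oplus> c s \<otimes> \<Psi> s"
     "\<And>s t. s \<in> T \<Longrightarrow> t \<in> T \<Longrightarrow> t \<noteq> s \<Longrightarrow> d s t \<in> carrier R \<and> b s = d s t \<otimes> \<Psi> t"
    by (metis insertE insert_Diff)
  have Tc: "\<Psi> t \<in> carrier R" if "t \<in> T" for t using \<Psi> T(2) that by auto
  define q0 where "q0 = (\<lambda>s. if s \<in> T then b s else \<zero>)"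
  define q where "q = (\<lambda>t s. if t \<in> T \<and> s \<in> T then if s = t then c t else \<ominus> d s t else \<zero>)"
  define g :: "('s, 'y) cell \<Rightarrow> ('s, 'y) cell \<Rightarrow> 'r" where
    "g = (\<lambda>a. case a of Pt \<Rightarrow> edges q0 (\<lambda>y. \<zero>) | Vx t \<Rightarrow> edges (q t) (\<lambda>y. \<zero>)
       | Vy y \<Rightarrow> edges (\<lambda>s. \<zero>) (if Ey y \<in> F then bv y else (\<lambda>y. \<zero>)) | Es s \<Rightarrow> (\<lambda>c. \<zero>) | Ey y \<Rightarrow> (\<lambda>c. \<zero>))"
  have q: "q0 \<in> carrier (free_module R S)" "q t \<in> carrier (free_module R S)" for t
    using T bcd by (auto intro!: freeI[of T] simp: q0_def q_def)
  have zc: "(\<lambda>b. \<zero>) \<in> carrier (free_module R U)" for U :: "'u set" by (simp add: free_carrier)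
  have ec: "edges x h \<in> carrier (FC S Y)" if "x \<in> carrier (free_module R S)" "h \<in> carrier (free_module R Y)" for x h
    using edges_closed[OF that] free_mono[of "{c \<in> cell_set S Y. is_edge c}" "cell_set S Y"] by blast
  have gc: "g a \<in> carrier (FC S Y)" if "a \<in> cell_set S Y" for a
    using that q zc by (cases a) (auto simp: g_def intro!: ec basis_vec_closed simp: zc)
  define L where "L = free_lift R (FC S Y) g"
  have Ll: "lin R (FC S Y) (FC S Y) L" unfolding L_def using gc by (intro free_lift_lin free_module_module) auto
  have Lb: "L (bv a) = g a" if "a \<in> cell_set S Y" for a
    unfolding L_def by (rule free_lift_basis[where f=g, OF free_module_module gc[OF that]])
  have 1: "L (bv a) c = \<zero>" if a: "a \<in> cell_set S Y" and "is_edge a \<or> \<not> is_edge c" for a c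
    unfolding Lb[OF a] g_def using that(2) by (cases a; cases c) auto
  have 2: "L (cell_bdry S \<Psi> (bv a)) = bv a" if a: "a \<in> F" for a
  proof -
    consider t where "a = Es t" "t \<in> T" | y where "a = Ey y" using F(3)[OF a] a by (cases a) (auto simp: T_def)
    then show ?thesis
    proof cases
      case 1
      then have tS: "t \<in> S" and tc: "\<Psi> t \<in> carrier R" using T(2) \<Psi> by auto
      have "cell_bdry S \<Psi> (bv a) = bv Pt \<oplus>\<^bsub>FC S Y\<^esub> \<Psi> t \<odot>\<^bsub>FC S Y\<^esub> bv (Vx t)"
      proof
        fix e show "cell_bdry S \<Psi> (bv a) e = (bv Pt \<oplus>\<^bsub>FC S Y\<^esub> \<Psi> t \<odot>\<^bsub>FC S Y\<^esub> bv (Vx t)) e"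
          unfolding 1(1) cell_bdry_Es[OF \<Psi> tS] using tc by (cases e) (auto simp: basis_vec_def)
      qed
      moreover have "bv Pt \<in> carrier (FC S Y)" "bv (Vx t) \<in> carrier (FC S Y)"
        using tS by (auto intro: basis_vec_closed)
      moreover interpret FF: module R "FC S Y" by (rule free_module_module)
      have sc: "\<Psi> t \<odot>\<^bsub>FC S Y\<^esub> bv (Vx t) \<in> carrier (FC S Y)"
        by (rule FF.smult_closed[OF tc calculation(3)])
      ultimately have e: "L (cell_bdry S \<Psi> (bv a)) = g Pt \<oplus>\<^bsub>FC S Y\<^esub> \<Psi> t \<odot>\<^bsub>FC S Y\<^esub> g (Vx t)"
        using lin_add[OF Ll _ sc] lin_smult[OF Ll tc] Lb[of Pt] Lb[of "Vx t"] tS by (simp del: free_simps)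
      have k: "q0 s \<oplus> \<Psi> t \<otimes> q t s = (if s = t then \<one> else \<zero>)" for s
      proof (cases "s \<in> T")
        case True
        show ?thesis
        proof (cases "s = t")
          case True
          then show ?thesis using bcd(1,2)[OF 1(2)] bcd(3)[OF 1(2)] tc 1(2) by (simp add: q0_def q_def m_comm)
        next
          case False
          have d: "d s t \<in> carrier R" "b s = d s t \<otimes> \<Psi> t" using bcd(4)[OF True 1(2)] False by auto
          then show ?thesis using False True 1(2) tc by (simp add: q0_def q_def m_comm[of "\<Psi> t"] l_minus r_neg)
        qed
      next
        case False
        then show ?thesis using 1(2) tc by (auto simp: q0_def q_def)
      qed
      show ?thesis
      proof
        fix u show "L (cell_bdry S \<Psi> (bv a)) u = bv a u"
          unfolding e unfolding 1(1) using tc k by (cases u) (auto simp: g_def basis_vec_def)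
      qed
    next
      case 2
      then have y: "Vy y \<in> cell_set S Y" using a F(2) by auto
      show ?thesis
      proof
        fix u show "L (cell_bdry S \<Psi> (bv a)) u = bv a u"
          unfolding 2 cell_bdry_Ey[OF \<Psi>] Lb[OF y] using a 2 by (cases u) (auto simp: g_def basis_vec_def)
      qed
    qed
  qed
  show ?thesis using Ll 1 2 by blast
qed

lemma indiv_map_inj:
  assumes one: "one_indivisible R S \<Psi>" and x: "x \<in> carrier (free_module R S)" "indiv_map R S \<Psi> x = \<zero>\<^bsub>indiv_target R S\<^esub>"
  shows "x = (\<lambda>s. \<zero>)"
proof -
  have \<Psi>: "\<Psi> \<in> S \<rightarrow> carrier R" using one by (simp add: one_indivisible_def)
  let ?F = "Es ` {s. x s \<noteq> \<zero>} :: ('a, 'a) cell set"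
  have F: "finite ?F" "?F \<subseteq> cell_set S S" "\<And>b. b \<in> ?F \<Longrightarrow> is_edge b" using free_finite[OF x(1)] free_supp[OF x(1)] by auto
  from cell_bdry_split[OF one F] obtain L where L: "lin R (FC S S) (FC S S) L" "\<forall>b\<in>?F. L (cell_bdry S \<Psi> (bv b)) = bv b" by blast
  let ?w = "edges x (\<lambda>y. \<zero>) :: ('a, 'a) cell \<Rightarrow> 'r"
  have w: "?w \<in> carrier (free_module R ?F)"
  proof (rule freeI[OF F(1) subset_refl])
    show "?w c \<in> carrier R" for c using free_closed[OF x(1)] by (cases c) auto
    show "?w c = \<zero>" if "c \<notin> ?F" for c using that by (cases c) auto
  qed
  have sl: "lin R (free_module R ?F) (FC S S) f" if "lin R (FC S S) (FC S S) f" for f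
    using that free_mono[OF F(2)] unfolding lin_def by (auto simp: Pi_iff subset_iff)
  have "L (cell_bdry S \<Psi> ?w) = ?w"
    by (rule free_lin_eq[OF free_module_module sl[OF lin_comp[OF cell_bdry_endo[OF \<Psi>] L(1)]] sl[OF lin_id] _ w]) (use L(2) in blast)
  moreover have "cell_bdry S \<Psi> ?w = (\<lambda>c. \<zero>)"
  proof
    fix c show "cell_bdry S \<Psi> ?w c = \<zero>" using x(2) by (cases c) (simp_all add: cell_bdry_def target_simps)
  qed
  moreover have "L (\<lambda>c. \<zero>) = (\<lambda>c. \<zero>)" using lin_zero[OF free_module_module free_module_module L(1)] by simp
  ultimately have "?w = (\<lambda>c. \<zero>)" by simp
  then have "?w (Es s) = \<zero>" for s by simp
  then show ?thesis by (simp add: fun_eq_iff)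
qed

definition cell_aug :: "'s set \<Rightarrow> ('s \<Rightarrow> 'r) \<Rightarrow> (('s, 'y) cell \<Rightarrow> 'r) \<Rightarrow> ('r \<times> ('s \<Rightarrow> 'r)) set" where
  "cell_aug S \<Psi> z = indiv_map R S \<Psi> ` carrier (free_module R S) +>\<^bsub>indiv_target R S\<^esub> tpart z"

lemma indiv_image_submodule:
  assumes "\<Psi> \<in> S \<rightarrow> carrier R"
  shows "submodule (indiv_map R S \<Psi> ` carrier (free_module R S)) R (indiv_target R S)"
  by (rule lin_image_submodule[OF free_module_module indiv_target_module indiv_map_lin[OF assms]])

lemma indiv_coker_eq:
  "indiv_coker R S \<Psi> = quot_module (indiv_target R S) (indiv_map R S \<Psi> ` carrier (free_module R S))"
  by (simp add: indiv_coker_def coker_def indiv_source_def)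

lemma indiv_coker_module:
  assumes "\<Psi> \<in> S \<rightarrow> carrier R"
  shows "module R (indiv_coker R S \<Psi>)"
  unfolding indiv_coker_eq by (rule quot_module_module[OF indiv_target_module indiv_image_submodule[OF assms]])

lemma cell_aug_lin:
  assumes "\<Psi> \<in> S \<rightarrow> carrier R"
  shows "lin R (FC S Y) (indiv_coker R S \<Psi>) (cell_aug S \<Psi>)"
proof -
  have "lin R (FC S Y) (indiv_coker R S \<Psi>) (\<lambda>z. indiv_map R S \<Psi> ` carrier (free_module R S) +>\<^bsub>indiv_target R S\<^esub> tpart z)"
    unfolding indiv_coker_eq
    by (rule lin_comp[OF tpart_lin quot_proj_lin[OF indiv_target_module indiv_image_submodule[OF assms]]])
  then show ?thesis unfolding cell_aug_def .
qed

lemma indiv_coset_zero: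
  assumes "\<Psi> \<in> S \<rightarrow> carrier R" and p: "p \<in> carrier (indiv_target R S)"
  shows "indiv_map R S \<Psi> ` carrier (free_module R S) +>\<^bsub>indiv_target R S\<^esub> p = \<zero>\<^bsub>indiv_coker R S \<Psi>\<^esub>
    \<longleftrightarrow> p \<in> indiv_map R S \<Psi> ` carrier (free_module R S)"
  unfolding indiv_coker_eq by (rule coset_zero_iff[OF indiv_target_module indiv_image_submodule[OF assms(1)] p])

lemma cell_aug_bdry:
  assumes "\<Psi> \<in> S \<rightarrow> carrier R" and z: "z \<in> carrier (FC S Y)"
  shows "cell_aug S \<Psi> (cell_bdry S \<Psi> z) = \<zero>\<^bsub>indiv_coker R S \<Psi>\<^esub>"
proof -
  have l: "lin R (FC S Y) (free_module R S) (\<lambda>z s. z (Es s))" by (rule slice_lin) (auto simp: inj_def)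
  have "tpart (cell_bdry S \<Psi> z) \<in> indiv_map R S \<Psi> ` carrier (free_module R S)"
    unfolding cell_bdry_def tpart_vert using lin_closed[OF l z] by blast
  then show ?thesis
    unfolding cell_aug_def indiv_coset_zero[OF assms(1) lin_closed[OF tpart_lin lin_closed[OF cell_bdry_endo[OF assms(1)] z]]] .
qed

lemma cell_aug_surj:
  assumes "\<Psi> \<in> S \<rightarrow> carrier R" and x: "x \<in> carrier (indiv_coker R S \<Psi>)"
  shows "\<exists>z\<in>carrier (free_module R {c \<in> cell_set S Y. \<not> is_edge c}). cell_aug S \<Psi> z = x"
proof -
  obtain p where p: "p \<in> carrier (indiv_target R S)" "x = indiv_map R S \<Psi> ` carrier (free_module R S) +>\<^bsub>indiv_target R S\<^esub> p"
    using x unfolding indiv_coker_eq quot_carrier by blast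
  have "(\<lambda>y. \<zero>) \<in> carrier (free_module R Y)" by (simp add: free_carrier)
  from vert_closed[OF p(1) this] show ?thesis by (intro bexI[of _ "vert p (\<lambda>y. \<zero>)"]) (simp_all add: cell_aug_def p(2))
qed

lemma cell_aug_ker:
  assumes "\<Psi> \<in> S \<rightarrow> carrier R" and z: "z \<in> carrier (free_module R {c \<in> cell_set S Y. \<not> is_edge c})" and 0: "cell_aug S \<Psi> z = \<zero>\<^bsub>indiv_coker R S \<Psi>\<^esub>"
  shows "\<exists>w\<in>carrier (FC S Y). cell_bdry S \<Psi> w = z"
proof -
  have sub: "{c \<in> cell_set S Y. \<not> is_edge c} \<subseteq> cell_set S Y" "{c \<in> cell_set S Y. is_edge c} \<subseteq> cell_set S Y" by auto
  have zF: "z \<in> carrier (FC S Y)" using z free_mono[OF sub(1)] by blast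
  from 0 obtain x where x: "x \<in> carrier (free_module R S)" "tpart z = indiv_map R S \<Psi> x"
    unfolding cell_aug_def indiv_coset_zero[OF assms(1) lin_closed[OF tpart_lin zF]] by blast
  have l: "lin R (FC S Y) (free_module R Y) (\<lambda>z y. z (Vy y))" by (rule slice_lin) (auto simp: inj_def)
  let ?w = "edges x (\<lambda>y. z (Vy y))"
  have w: "?w \<in> carrier (FC S Y)" using edges_closed[OF x(1) lin_closed[OF l zF]] free_mono[OF sub(2)] by blast
  have "cell_bdry S \<Psi> ?w = z"
  proof
    fix c show "cell_bdry S \<Psi> ?w c = z c"
      using free_outside[OF z, of c] by (cases c) (auto simp: cell_bdry_def x(2)[symmetric], auto simp: tpart_def)
  qed
  then show ?thesis using w by blast
qed

section \<open>Cocycles of a single factor\<close>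

lemma ext_class_iff:
  "y \<in> ext_class R (Suc l) M N g \<longleftrightarrow> (\<exists>h\<in>mod_hom R (obj (std_res R M) l) N.
     y = (\<lambda>x\<in>carrier (obj (std_res R M) (Suc l)). h (bdry (std_res R M) l x) \<oplus>\<^bsub>N\<^esub> g x))"
proof -
  have "(\<lambda>x\<in>K. (\<lambda>x\<in>K. h x) x \<oplus>\<^bsub>N\<^esub> restrict g K x) = (\<lambda>x\<in>K. h x \<oplus>\<^bsub>N\<^esub> g x)" for h K by auto
  then show ?thesis
    unfolding ext_class_def ext_coboundaries_def a_r_coset_def' hom_module_def
    by (auto simp: cong: restrict_cong)
qed

text \<open>
  \<^const>\<open>ext_push\<close> and \<^const>\<open>ext_tensor\<close> are unions over representatives; nonemptiness rules out empty unions.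
\<close>

lemma ext_class_nonempty:
  assumes "module R N"
  shows "ext_class R (Suc l) M N g \<noteq> {}"
proof -
  have "(\<lambda>x\<in>carrier (obj (std_res R M) l). \<zero>\<^bsub>N\<^esub>) \<in> mod_hom R (obj (std_res R M) l) N"
    unfolding std_res_obj by (rule lin_restrict[OF free_module_module lin_const_zero[OF assms]])
  then show ?thesis using ext_class_iff by blast
qed

lemma indiv_cl_nonempty:
  assumes \<Psi>: "\<Psi> \<in> S \<rightarrow> carrier R"
  shows "indiv_cl R S \<Psi> \<noteq> {}"
proof -
  let ?T = "indiv_target R S" and ?f = "indiv_map R S \<Psi>" and ?M = "indiv_coker R S \<Psi>"
  let ?H = "?f ` carrier (free_module R S)" and ?P = "std_res R ?M"
  note T = indiv_target_module[of S] and H = indiv_image_submodule[OF \<Psi>] and M = indiv_coker_module[OF \<Psi>]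
  have Pc: "complex ?P ?M" using std_res_resolution[OF M] by (simp add: resolution_def)
  note bl = complexD(3)[OF Pc, of 0] and al = complexD(4)[OF Pc]
  have "\<exists>h. lin R (free_module R (std_basis R ?M 0)) ?T h \<and>
      (\<forall>x\<in>carrier (free_module R (std_basis R ?M 0)). ?H +>\<^bsub>?T\<^esub> h x = aug ?P x)"
  proof (rule free_lifting[OF T M])
    show "lin R ?T ?M (\<lambda>x. ?H +>\<^bsub>?T\<^esub> x)" unfolding indiv_coker_eq by (rule quot_proj_lin[OF T H])
    show "lin R (free_module R (std_basis R ?M 0)) ?M (aug ?P)" using al by (simp only: std_res_obj)
    fix b assume "b \<in> std_basis R ?M 0"
    then have "aug ?P (bv b) \<in> carrier ?M"
      by (intro lin_closed[OF al]) (simp add: std_res_obj basis_vec_closed)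
    then show "\<exists>y\<in>carrier ?T. ?H +>\<^bsub>?T\<^esub> y = aug ?P (bv b)" unfolding indiv_coker_eq quot_carrier by fastforce
  qed
  then obtain \<psi> where \<psi>: "lin R (obj ?P 0) ?T \<psi>" "\<And>x. x \<in> carrier (obj ?P 0) \<Longrightarrow> ?H +>\<^bsub>?T\<^esub> \<psi> x = aug ?P x"
    unfolding std_res_obj by blast
  have "\<exists>h. lin R (free_module R (std_basis R ?M 1)) (free_module R S) h \<and>
      (\<forall>x\<in>carrier (free_module R (std_basis R ?M 1)). ?f (h x) = \<psi> (bdry ?P 0 x))"
  proof (rule free_lifting[OF free_module_module T indiv_map_lin[OF \<Psi>]])
    show "lin R (free_module R (std_basis R ?M 1)) ?T (\<lambda>x. \<psi> (bdry ?P 0 x))"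
      using lin_comp[OF bl \<psi>(1)] by (simp add: std_res_obj)
    fix b assume "b \<in> std_basis R ?M 1"
    then have b: "bv b \<in> carrier (obj ?P (Suc 0))" by (simp add: std_res_obj basis_vec_closed)
    have "?H +>\<^bsub>?T\<^esub> \<psi> (bdry ?P 0 (bv b)) = \<zero>\<^bsub>?M\<^esub>"
      unfolding \<psi>(2)[OF lin_closed[OF bl b]] by (rule complexD(6)[OF Pc b])
    then show "\<exists>y\<in>carrier (free_module R S). ?f y = \<psi> (bdry ?P 0 (bv b))"
      unfolding indiv_coset_zero[OF \<Psi> lin_closed[OF \<psi>(1) lin_closed[OF bl b]]] by fastforce
  qed
  then obtain \<phi> where \<phi>: "lin R (obj ?P 1) (free_module R S) \<phi>" "\<And>x. x \<in> carrier (obj ?P 1) \<Longrightarrow> ?f (\<phi> x) = \<psi> (bdry ?P 0 x)"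
    unfolding std_res_obj by blast
  have "restrict \<phi> (carrier (obj ?P 1)) \<in> indiv_cl R S \<Psi>"
    unfolding indiv_cl_def ext_cl_def Let_def indiv_coker_def[symmetric]
  proof (intro CollectI conjI bexI[of _ "restrict \<psi> (carrier (obj ?P 0))"] ballI)
    show "restrict \<phi> (carrier (obj ?P 1)) \<in> mod_hom R (obj ?P 1) (indiv_source R S)"
      unfolding indiv_source_def by (rule lin_restrict[OF complexD(2)[OF Pc] \<phi>(1)])
    show "restrict \<psi> (carrier (obj ?P 0)) \<in> mod_hom R (obj ?P 0) ?T"
      by (rule lin_restrict[OF complexD(2)[OF Pc] \<psi>(1)])
  next
    fix x assume "x \<in> carrier (obj ?P 0)"
    then show "?f ` carrier (indiv_source R S) +>\<^bsub>?T\<^esub> restrict \<psi> (carrier (obj ?P 0)) x = aug ?P x"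
      using \<psi>(2) by (simp add: indiv_source_def)
  next
    fix x assume x: "x \<in> carrier (obj ?P 1)"
    then show "?f (restrict \<phi> (carrier (obj ?P 1)) x) = restrict \<psi> (carrier (obj ?P 0)) (bdry ?P 0 x)"
      using \<phi>(2) lin_closed[OF bl, of x] by simp
  qed
  then show ?thesis by blast
qed

text \<open>
  The cochain through which all representing cocycles factor: \<open>Es s\<close> has value \<open>X s\<close>, and \<open>Ey y\<close> has
  value \<open>y\<close>, an arbitrary element of the algebra.
\<close>

definition cell_val :: "'s set \<Rightarrow> (('s, ('s multiset \<Rightarrow> 'r) set) cell \<Rightarrow> 'r) \<Rightarrow> ('s multiset \<Rightarrow> 'r) set" where
  "cell_val S w = idem_incl R S (\<lambda>s. w (Es s)) \<oplus>\<^bsub>idem_module R S\<^esub> free_lift R (idem_module R S) (\<lambda>y. y) (\<lambda>y. w (Ey y))"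

lemma taut_lin: "module R N \<Longrightarrow> lin R (free_module R (carrier N)) N (free_lift R N (\<lambda>y. y))"
  by (rule free_lift_lin) auto

lemma cell_val_lin: "lin R (FC S (carrier (idem_module R S))) (idem_module R S) (cell_val S)"
proof -
  have "lin R (FC S (carrier (idem_module R S))) (free_module R S) (\<lambda>z s. z (Es s))"
    "lin R (FC S (carrier (idem_module R S))) (free_module R (carrier (idem_module R S))) (\<lambda>z y. z (Ey y))"
    by (rule slice_lin; simp add: inj_def)+
  then have "lin R (FC S (carrier (idem_module R S))) (idem_module R S)
     (\<lambda>w. idem_incl R S (\<lambda>s. w (Es s)) \<oplus>\<^bsub>idem_module R S\<^esub> free_lift R (idem_module R S) (\<lambda>y. y) (\<lambda>y. w (Ey y)))"
    by (rule lin_plus[OF idem_module_module lin_comp[OF _ idem_incl_lin] lin_comp[OF _ taut_lin[OF idem_module_module]]])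
  then show ?thesis unfolding cell_val_def .
qed

lemma cell_val_Es:
  assumes s: "s \<in> S"
  shows "cell_val S (bv (Es s)) = xc S s"
proof -
  let ?N = "idem_module R S"
  interpret N: module R ?N by (rule idem_module_module)
  have 1: "(\<lambda>t. bv (Es s :: ('a, ('a multiset \<Rightarrow> 'r) set) cell) (Es t)) = bv s"
    and 2: "(\<lambda>y. bv (Es s :: ('a, ('a multiset \<Rightarrow> 'r) set) cell) (Ey y)) = (\<lambda>y. \<zero>)"
    by (auto simp: basis_vec_def)
  have "free_lift R ?N (\<lambda>y. y) (\<lambda>y. \<zero>) = \<zero>\<^bsub>?N\<^esub>"
    using lin_zero[OF free_module_module idem_module_module taut_lin[OF idem_module_module]] by simp
  moreover have "xc S s \<in> carrier ?N"
    using lin_closed[OF idem_incl_lin basis_vec_closed[OF s]] idem_incl_basis[OF s] by simp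
  ultimately show ?thesis unfolding cell_val_def 1 2 idem_incl_basis[OF s] by simp
qed

lemma cell_val_edges:
  "cell_val S (edges x h) = idem_incl R S x \<oplus>\<^bsub>idem_module R S\<^esub> free_lift R (idem_module R S) (\<lambda>y. y) h"
  by (simp add: cell_val_def)

text \<open>
  A representative \<open>\<alpha>\<close> is \<open>incl \<circ> \<phi> + h \<circ> bdry\<close>, where \<open>(\<psi>, \<phi>)\<close> is a map from the standard resolution to
  \<open>f\<close>. The module in degree \<open>0\<close> is free, so \<open>h\<close> lifts to a map \<open>g\<close> into the free module on the elements of
  the algebra, and the contractible summand absorbs \<open>h\<close>: take \<open>\<rho>0 = (\<psi>, g)\<close> and
  \<open>\<rho>1 = (\<phi>, g \<circ> bdry)\<close>.
\<close>

lemma factor_cocycle: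
  fixes S :: "'s set"
  assumes one: "one_indivisible R S \<Psi>"
    and \<alpha>: "\<alpha> \<in> ext_push R 1 (indiv_coker R S \<Psi>) (idem_module R S) (idem_incl R S) (indiv_cl R S \<Psi>)"
  defines "Y \<equiv> carrier (idem_module R S)" and "P \<equiv> std_res R (indiv_coker R S \<Psi>)"
  shows "lin R (obj P 1) (idem_module R S) \<alpha>"
    and "\<exists>\<rho>0 \<rho>1. lin R (obj P 0) (free_module R {c \<in> cell_set S Y. \<not> is_edge c}) \<rho>0 \<and>
      lin R (obj P 1) (free_module R {c \<in> cell_set S Y. is_edge c}) \<rho>1 \<and>
      (\<forall>x\<in>carrier (obj P 0). cell_aug S \<Psi> (\<rho>0 x) = aug P x) \<and>
      (\<forall>x\<in>carrier (obj P 1). cell_bdry S \<Psi> (\<rho>1 x) = \<rho>0 (bdry P 0 x)) \<and>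
      (\<forall>x\<in>carrier (obj P 2). \<rho>1 (bdry P 1 x) = (\<lambda>c. \<zero>)) \<and>
      (\<forall>x\<in>carrier (obj P 1). \<alpha> x = cell_val S (\<rho>1 x))"
proof -
  have \<Psi>: "\<Psi> \<in> S \<rightarrow> carrier R" using one by (simp add: one_indivisible_def)
  let ?T = "indiv_target R S" and ?f = "indiv_map R S \<Psi>" and ?N = "idem_module R S"
  note N = idem_module_module[of S]
  have Pc: "complex P (indiv_coker R S \<Psi>)" using std_res_resolution[OF indiv_coker_module[OF \<Psi>]] by (simp add: resolution_def P_def)
  note bl = complexD(3)[OF Pc]
  have P1: "obj P (Suc 0) = obj P 1" "obj P (Suc (Suc 0)) = obj P 2" by (simp_all add: numeral_2_eq_2)
  have "\<exists>\<phi>\<in>indiv_cl R S \<Psi>. \<alpha> \<in> ext_class R (Suc 0) (indiv_coker R S \<Psi>) ?N (\<lambda>x. idem_incl R S (\<phi> x))"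
    using \<alpha> unfolding ext_push_def by simp
  then obtain \<phi> h where \<phi>: "\<phi> \<in> indiv_cl R S \<Psi>" and h': "h \<in> mod_hom R (obj P 0) ?N"
    and \<alpha>_eq: "\<alpha> = (\<lambda>x\<in>carrier (obj P 1). h (bdry P 0 x) \<oplus>\<^bsub>?N\<^esub> idem_incl R S (\<phi> x))"
    unfolding ext_class_iff P_def[symmetric] P1 by blast
  have h: "lin R (obj P 0) ?N h" using h' by (simp add: mod_hom_iff)
  obtain \<psi> where \<psi>': "\<psi> \<in> mod_hom R (obj P 0) ?T"
      "\<And>x. x \<in> carrier (obj P 0) \<Longrightarrow> ?f ` carrier (free_module R S) +>\<^bsub>?T\<^esub> \<psi> x = aug P x"
    and \<phi>l: "lin R (obj P 1) (free_module R S) \<phi>" and \<phi>\<psi>: "\<And>x. x \<in> carrier (obj P 1) \<Longrightarrow> ?f (\<phi> x) = \<psi> (bdry P 0 x)"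
    using \<phi> unfolding indiv_cl_def ext_cl_def Let_def indiv_coker_def[symmetric] P_def[symmetric]
    unfolding indiv_source_def mem_Collect_eq unfolding mod_hom_iff[of \<phi>] by blast
  note \<psi> = \<psi>'(1)[unfolded mod_hom_iff, THEN conjunct1] \<psi>'(2)
  have obj: "obj P k = free_module R (std_basis R (indiv_coker R S \<Psi>) k)" for k by (simp add: P_def std_res_obj)
  interpret N: module R ?N by (rule N)
  have hb: "lin R (obj P 1) ?N (\<lambda>x. h (bdry P 0 x))" using lin_comp[OF bl[of 0] h] by simp
  show "lin R (obj P 1) ?N \<alpha>" unfolding \<alpha>_eq
    by (rule lin_restrict[OF complexD(2)[OF Pc] lin_plus[OF N hb lin_comp[OF \<phi>l idem_incl_lin]],
        unfolded mod_hom_iff, THEN conjunct1])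
  have "\<exists>g. lin R (obj P 0) (free_module R Y) g \<and> (\<forall>x\<in>carrier (obj P 0). free_lift R ?N (\<lambda>y. y) (g x) = h x)"
    unfolding obj
  proof (rule free_lifting[OF free_module_module N])
    show "lin R (free_module R Y) ?N (free_lift R ?N (\<lambda>y. y))" unfolding Y_def by (rule taut_lin[OF N])
    show hl: "lin R (free_module R (std_basis R (indiv_coker R S \<Psi>) 0)) ?N h" using h unfolding obj .
    fix b assume "b \<in> std_basis R (indiv_coker R S \<Psi>) 0"
    then have "h (bv b) \<in> carrier ?N" by (intro lin_closed[OF hl] basis_vec_closed)
    then show "\<exists>y\<in>carrier (free_module R Y). free_lift R ?N (\<lambda>y. y) y = h (bv b)"
      unfolding Y_def using free_lift_basis[where f="\<lambda>y. y", OF N] basis_vec_closed by metis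
  qed
  then obtain g where g: "lin R (obj P 0) (free_module R Y) g" "\<And>x. x \<in> carrier (obj P 0) \<Longrightarrow> free_lift R ?N (\<lambda>y. y) (g x) = h x"
    by blast
  define \<rho>0 :: "_ \<Rightarrow> ('s, ('s multiset \<Rightarrow> 'r) set) cell \<Rightarrow> 'r" where "\<rho>0 = (\<lambda>x. vert (\<psi> x) (g x))"
  define \<rho>1 :: "_ \<Rightarrow> ('s, ('s multiset \<Rightarrow> 'r) set) cell \<Rightarrow> 'r" where "\<rho>1 = (\<lambda>x. edges (\<phi> x) (g (bdry P 0 x)))"
  have r0: "lin R (obj P 0) (free_module R {c \<in> cell_set S Y. \<not> is_edge c}) \<rho>0"
    unfolding \<rho>0_def by (rule vert_lin[OF \<psi>(1) g(1)])
  have gb: "lin R (obj P 1) (free_module R Y) (\<lambda>x. g (bdry P 0 x))" using lin_comp[OF bl[of 0] g(1)] by simp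
  have r1: "lin R (obj P 1) (free_module R {c \<in> cell_set S Y. is_edge c}) \<rho>1"
    unfolding \<rho>1_def by (rule edges_lin[OF \<phi>l gb])
  have c0: "cell_aug S \<Psi> (\<rho>0 x) = aug P x" if "x \<in> carrier (obj P 0)" for x
    unfolding \<rho>0_def cell_aug_def tpart_vert by (rule \<psi>(2)[OF that])
  have c1: "cell_bdry S \<Psi> (\<rho>1 x) = \<rho>0 (bdry P 0 x)" if "x \<in> carrier (obj P 1)" for x
    unfolding \<rho>0_def \<rho>1_def cell_bdry_def by (simp add: \<phi>\<psi>[OF that])
  have c2: "\<rho>1 (bdry P 1 x) = (\<lambda>c. \<zero>)" if x: "x \<in> carrier (obj P 2)" for x
  proof -
    have bx: "bdry P 1 x \<in> carrier (obj P 1)" using lin_closed[OF bl[of 1]] x by (simp add: numeral_2_eq_2)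
    have bb: "bdry P 0 (bdry P 1 x) = \<zero>\<^bsub>obj P 0\<^esub>" using complexD(5)[OF Pc, of x 0] x by (simp add: numeral_2_eq_2)
    have z: "\<psi> \<zero>\<^bsub>obj P 0\<^esub> = \<zero>\<^bsub>?T\<^esub>" "g \<zero>\<^bsub>obj P 0\<^esub> = (\<lambda>y. \<zero>)"
      using lin_zero[OF complexD(2)[OF Pc] indiv_target_module \<psi>(1)] lin_zero[OF complexD(2)[OF Pc] free_module_module g(1)] by simp_all
    have "\<phi> (bdry P 1 x) = (\<lambda>s. \<zero>)"
      by (rule indiv_map_inj[OF one lin_closed[OF \<phi>l bx]]) (simp only: \<phi>\<psi>[OF bx] bb z)
    then have "\<rho>1 (bdry P 1 x) = edges (\<lambda>s. \<zero>) (\<lambda>y. \<zero>)" unfolding \<rho>1_def bb z by simp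
    also have "edges (\<lambda>s. \<zero>) (\<lambda>y. \<zero>) c = \<zero>" for c :: "('s, ('s multiset \<Rightarrow> 'r) set) cell" by (cases c) auto
    then have "edges (\<lambda>s. \<zero>) (\<lambda>y. \<zero>) = (\<lambda>c :: ('s, ('s multiset \<Rightarrow> 'r) set) cell. \<zero>)" by blast
    finally show ?thesis .
  qed
  have c3: "\<alpha> x = cell_val S (\<rho>1 x)" if x: "x \<in> carrier (obj P 1)" for x
  proof -
    have bx: "bdry P 0 x \<in> carrier (obj P 0)" using lin_closed[OF bl[of 0]] x by simp
    show ?thesis unfolding \<alpha>_eq \<rho>1_def cell_val_edges g(2)[OF bx]
      using x lin_closed[OF hb x] lin_closed[OF idem_incl_lin lin_closed[OF \<phi>l x]] by (simp add: N.M.a_comm)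
  qed
  show "\<exists>\<rho>0 \<rho>1. lin R (obj P 0) (free_module R {c \<in> cell_set S Y. \<not> is_edge c}) \<rho>0 \<and>
      lin R (obj P 1) (free_module R {c \<in> cell_set S Y. is_edge c}) \<rho>1 \<and>
      (\<forall>x\<in>carrier (obj P 0). cell_aug S \<Psi> (\<rho>0 x) = aug P x) \<and>
      (\<forall>x\<in>carrier (obj P 1). cell_bdry S \<Psi> (\<rho>1 x) = \<rho>0 (bdry P 0 x)) \<and>
      (\<forall>x\<in>carrier (obj P 2). \<rho>1 (bdry P 1 x) = (\<lambda>c. \<zero>)) \<and>
      (\<forall>x\<in>carrier (obj P 1). \<alpha> x = cell_val S (\<rho>1 x))"
    using r0 r1 c0 c1 c2 c3 by blast
qed

end

section \<open>The class of an indivisible sequence\<close>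

context coeff_ring
begin

lemma RM_structure: "finsum RM f U = finsum R f U" "\<ominus>\<^bsub>RM\<^esub> x = \<ominus> x"
  by (simp_all add: finsum_def finprod_def a_inv_def m_inv_def restrict_scalars_def)

lemma ideal_finsum:
  assumes J: "ideal J R" and "finite U" "\<And>u. u \<in> U \<Longrightarrow> g u \<in> J"
  shows "(\<Oplus>u\<in>U. g u) \<in> J"
  using assms(2,3)
proof (induction U rule: finite_induct)
  interpret J: ideal J R by (rule J)
  case empty
  then show ?case by simp
next
  interpret J: ideal J R by (rule J)
  case (insert u U)
  then have "g u \<in> J" "g u \<in> carrier R" "g \<in> U \<rightarrow> carrier R" using J.Icarr by auto
  then show ?case using insert by (simp add: J.a_closed)
qed

lemma ext_class_mono:
  assumes M: "module R M" and N: "module R N" and h: "lin R (obj (std_res R M) l) N h"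
    and g': "\<And>x. x \<in> carrier (obj (std_res R M) (Suc l)) \<Longrightarrow> g' x \<in> carrier N"
    and g: "\<And>x. x \<in> carrier (obj (std_res R M) (Suc l)) \<Longrightarrow> g x = g' x \<oplus>\<^bsub>N\<^esub> h (bdry (std_res R M) l x)"
  shows "ext_class R (Suc l) M N g \<subseteq> ext_class R (Suc l) M N g'"
proof
  let ?P = "std_res R M"
  interpret N: module R N by (rule N)
  have Pc: "complex ?P M" using std_res_resolution[OF M] by (simp add: resolution_def)
  note bl = complexD(3)[OF Pc, of l]
  fix y assume "y \<in> ext_class R (Suc l) M N g"
  then obtain k where k: "k \<in> mod_hom R (obj ?P l) N"
    "y = (\<lambda>x\<in>carrier (obj ?P (Suc l)). k (bdry ?P l x) \<oplus>\<^bsub>N\<^esub> g x)" unfolding ext_class_iff by blast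
  have kl: "lin R (obj ?P l) N k" using k(1) by (simp add: mod_hom_iff)
  have "y = (\<lambda>x\<in>carrier (obj ?P (Suc l)). restrict (\<lambda>x. k x \<oplus>\<^bsub>N\<^esub> h x) (carrier (obj ?P l)) (bdry ?P l x) \<oplus>\<^bsub>N\<^esub> g' x)"
    unfolding k(2)
  proof (rule restrict_ext)
    fix x assume x: "x \<in> carrier (obj ?P (Suc l))"
    note bx = lin_closed[OF bl x]
    show "k (bdry ?P l x) \<oplus>\<^bsub>N\<^esub> g x = restrict (\<lambda>x. k x \<oplus>\<^bsub>N\<^esub> h x) (carrier (obj ?P l)) (bdry ?P l x) \<oplus>\<^bsub>N\<^esub> g' x"
      using bx lin_closed[OF kl bx] lin_closed[OF h bx] g'[OF x] by (simp add: g[OF x] N.M.a_ac)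
  qed
  then show "y \<in> ext_class R (Suc l) M N g'"
    unfolding ext_class_iff using lin_restrict[OF complexD(2)[OF Pc] lin_plus[OF N kl h]] by blast
qed

text \<open>
  Equality is needed, not inclusion: the union over all representatives must be a single coset.
\<close>

lemma ext_class_eq:
  assumes M: "module R M" and N: "module R N" and h: "lin R (obj (std_res R M) l) N h"
    and g': "\<And>x. x \<in> carrier (obj (std_res R M) (Suc l)) \<Longrightarrow> g' x \<in> carrier N"
    and g: "\<And>x. x \<in> carrier (obj (std_res R M) (Suc l)) \<Longrightarrow> g x = g' x \<oplus>\<^bsub>N\<^esub> h (bdry (std_res R M) l x)"
  shows "ext_class R (Suc l) M N g = ext_class R (Suc l) M N g'"
proof
  show "ext_class R (Suc l) M N g \<subseteq> ext_class R (Suc l) M N g'" by (rule ext_class_mono[OF M N h g' g])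
  let ?P = "std_res R M"
  interpret N: module R N by (rule N)
  have Pc: "complex ?P M" using std_res_resolution[OF M] by (simp add: resolution_def)
  note bl = complexD(3)[OF Pc, of l]
  show "ext_class R (Suc l) M N g' \<subseteq> ext_class R (Suc l) M N g"
  proof (rule ext_class_mono[OF M N lin_neg[OF N h]])
    fix x assume x: "x \<in> carrier (obj ?P (Suc l))"
    note hx = lin_closed[OF h lin_closed[OF bl x]]
    show "g x \<in> carrier N" using g'[OF x] hx by (simp add: g[OF x])
    show "g' x = g x \<oplus>\<^bsub>N\<^esub> \<ominus>\<^bsub>N\<^esub> h (bdry ?P l x)"
      using g'[OF x] hx by (simp add: g[OF x] N.M.a_assoc N.M.r_neg)
  qed
qed

lemma comparison_mapsD: "\<theta> \<in> comparison_maps R P Q \<Longrightarrow> chain_map P Q \<theta>"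
  by (simp add: comparison_maps_def chain_map_def mod_hom_iff)

lemma comparison_maps_restrict:
  assumes P: "complex P M" and "chain_map P Q \<theta>"
  shows "(\<lambda>k. restrict (\<theta> k) (carrier (obj P k))) \<in> comparison_maps R P Q"
  unfolding comparison_maps_def
proof (intro CollectI conjI allI ballI)
  fix k
  show "restrict (\<theta> k) (carrier (obj P k)) \<in> mod_hom R (obj P k) (obj Q k)"
    by (rule lin_restrict[OF complexD(2)[OF P] chain_mapD(1)[OF assms(2)]])
  fix x assume x: "x \<in> carrier (obj P (Suc k))"
  then show "bdry Q k (restrict (\<theta> (Suc k)) (carrier (obj P (Suc k))) x) = restrict (\<theta> k) (carrier (obj P k)) (bdry P k x)"
    using chain_mapD(2)[OF assms(2) x] lin_closed[OF complexD(3)[OF P] x] by simp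
qed (simp add: chain_mapD(3)[OF assms(2)])

lemma Ext_class_nonzero:
  assumes M: "module R M" and N: "module R N" and c: "lin R (obj (std_res R M) (Suc l)) N c"
    and cocycle: "\<And>x. x \<in> carrier (obj (std_res R M) (Suc (Suc l))) \<Longrightarrow> c (bdry (std_res R M) (Suc l) x) = \<zero>\<^bsub>N\<^esub>"
    and nb: "\<nexists>h. lin R (obj (std_res R M) l) N h \<and>
      (\<forall>x\<in>carrier (obj (std_res R M) (Suc l)). c x = h (bdry (std_res R M) l x))"
  shows "ext_class R (Suc l) M N c \<in> carrier (Ext R (Suc l) M N) - {\<zero>\<^bsub>Ext R (Suc l) M N\<^esub>}"
proof -
  let ?P = "std_res R M"
  interpret N: module R N by (rule N)
  have Pc: "complex ?P M" using std_res_resolution[OF M] by (simp add: resolution_def)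
  note bl = complexD(3)[OF Pc]
  let ?c = "restrict c (carrier (obj ?P (Suc l)))"
  have "?c \<in> ext_cocycles R (Suc l) M N"
    unfolding ext_cocycles_def using lin_restrict[OF complexD(2)[OF Pc] c] cocycle lin_closed[OF bl] by auto
  then have "ext_class R (Suc l) M N c \<in> carrier (Ext R (Suc l) M N)"
    unfolding Ext_def quot_module_def ext_class_def by (auto simp: A_RCOSETS_def' a_r_coset_def')
  moreover have "ext_class R (Suc l) M N c \<noteq> \<zero>\<^bsub>Ext R (Suc l) M N\<^esub>"
  proof
    assume "ext_class R (Suc l) M N c = \<zero>\<^bsub>Ext R (Suc l) M N\<^esub>"
    then have eq: "ext_class R (Suc l) M N c = ext_coboundaries R (Suc l) M N" by (simp add: Ext_def quot_module_def)
    have "?c = (\<lambda>x\<in>carrier (obj ?P (Suc l)). (\<lambda>x\<in>carrier (obj ?P l). \<zero>\<^bsub>N\<^esub>) (bdry ?P l x) \<oplus>\<^bsub>N\<^esub> c x)"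
      using lin_closed[OF bl] lin_closed[OF c] by (intro restrict_ext) simp
    then have "?c \<in> ext_class R (Suc l) M N c"
      unfolding ext_class_iff using lin_restrict[OF complexD(2)[OF Pc] lin_const_zero[OF N]] by blast
    then obtain h where h: "h \<in> mod_hom R (obj ?P l) N" "?c = (\<lambda>x\<in>carrier (obj ?P (Suc l)). h (bdry ?P l x))"
      unfolding eq ext_coboundaries_def by auto
    have "c x = h (bdry ?P l x)" if "x \<in> carrier (obj ?P (Suc l))" for x
      using fun_cong[OF h(2), of x] that by simp
    moreover have "lin R (obj ?P l) N h" using h(1) by (simp add: mod_hom_iff)
    ultimately show False using nb by blast
  qed
  ultimately show ?thesis by blast
qed

end

text \<open>
  The top degree is a successor because a coboundary in degree \<open>n\<close> comes from a cochain in degree \<open>n - 1\<close>.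
\<close>

locale indivisible_family = coeff_ring R for R :: "'r ring" (structure) +
  fixes n l :: nat and S :: "nat \<Rightarrow> 's set" and \<Psi> :: "nat \<Rightarrow> 's \<Rightarrow> 'r"
  assumes n: "n = Suc l" and indiv: "indivisible R n S \<Psi>"
begin

lemma one_indiv: "i \<in> {1..n} \<Longrightarrow> one_indivisible R (S i) (\<Psi> i)"
  using indiv by (simp add: indivisible_def)

lemma \<Psi>_closed: "i \<in> {1..n} \<Longrightarrow> \<Psi> i \<in> S i \<rightarrow> carrier R"
  using one_indiv by (auto simp: one_indivisible_def)

abbreviation "NS i \<equiv> idem_module R (S i)"
abbreviation "Mi i \<equiv> indiv_coker R (S i) (\<Psi> i)"

sublocale cube_resolutions R n "\<lambda>i. cell_set (S i) (carrier (NS i))" is_edge "\<lambda>i. cell_bdry (S i) (\<Psi> i)" Mi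
    "\<lambda>i. cell_aug (S i) (\<Psi> i)" "\<lambda>i. std_res R (Mi i)"
proof (intro cube_resolutions.intro aug_cube.intro free_cube.intro coeff_ring_axioms free_cube_axioms.intro aug_cube_axioms.intro cube_resolutions_axioms.intro)
  fix i assume i: "i \<in> {1..n}"
  note \<Psi> = \<Psi>_closed[OF i]
  show "lin R (FC (S i) (carrier (NS i))) (FC (S i) (carrier (NS i))) (cell_bdry (S i) (\<Psi> i))" by (rule cell_bdry_endo[OF \<Psi>])
  show "module R (Mi i)" by (rule indiv_coker_module[OF \<Psi>])
  show "lin R (FC (S i) (carrier (NS i))) (Mi i) (cell_aug (S i) (\<Psi> i))" by (rule cell_aug_lin[OF \<Psi>])
  show "complex (std_res R (Mi i)) (Mi i)" using std_res_resolution[OF indiv_coker_module[OF \<Psi>]] by (simp add: resolution_def)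
  { fix b :: "('s, ('s multiset \<Rightarrow> 'r) set) cell" assume "\<not> is_edge b"
    then show "cell_bdry (S i) (\<Psi> i) (bv b) = (\<lambda>b. \<zero>)" by (rule cell_bdry_vertex[OF \<Psi>]) }
  { fix b c :: "('s, ('s multiset \<Rightarrow> 'r) set) cell" assume "is_edge c"
    then show "cell_bdry (S i) (\<Psi> i) (bv b) c = \<zero>" by (cases c) (simp_all add: cell_bdry_def) }
  { fix F :: "('s, ('s multiset \<Rightarrow> 'r) set) cell set"
    assume "finite F" "F \<subseteq> cell_set (S i) (carrier (NS i))" "\<And>b. b \<in> F \<Longrightarrow> is_edge b"
    then show "\<exists>L. lin R (FC (S i) (carrier (NS i))) (FC (S i) (carrier (NS i))) L \<and>
        (\<forall>b\<in>cell_set (S i) (carrier (NS i)). \<forall>c. is_edge b \<or> \<not> is_edge c \<longrightarrow> L (bv b) c = \<zero>) \<and>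
        (\<forall>b\<in>F. L (cell_bdry (S i) (\<Psi> i) (bv b)) = bv b)"
      by (rule cell_bdry_split[OF one_indiv[OF i]]) }
  { fix z assume "z \<in> carrier (FC (S i) (carrier (NS i)))"
    then show "cell_aug (S i) (\<Psi> i) (cell_bdry (S i) (\<Psi> i) z) = \<zero>\<^bsub>Mi i\<^esub>" by (rule cell_aug_bdry[OF \<Psi>]) }
  { fix x assume "x \<in> carrier (Mi i)"
    then show "\<exists>z\<in>carrier (free_module R {b \<in> cell_set (S i) (carrier (NS i)). \<not> is_edge b}). cell_aug (S i) (\<Psi> i) z = x"
      by (rule cell_aug_surj[OF \<Psi>]) }
  { fix z assume "z \<in> carrier (free_module R {b \<in> cell_set (S i) (carrier (NS i)). \<not> is_edge b})" "cell_aug (S i) (\<Psi> i) z = \<zero>\<^bsub>Mi i\<^esub>"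
    then show "\<exists>w\<in>carrier (FC (S i) (carrier (NS i))). cell_bdry (S i) (\<Psi> i) w = z" by (rule cell_aug_ker[OF \<Psi>]) }
qed

abbreviation "Sg \<equiv> Sigma I S"
abbreviation "NT \<equiv> idem_module R Sg"

abbreviation "mulvars a \<equiv> (\<Otimes>\<^bsub>idem_ring R Sg\<^esub>i\<in>I. idem_map R Sg (Pair i) (a i))"

lemma pair_sub: "i \<in> I \<Longrightarrow> Pair i ` S i \<subseteq> Sg" by auto

lemma idem_prod_multilin:
  assumes "\<And>i. i \<in> I \<Longrightarrow> lin R (Q i) (NS i) (f i)"
  shows "multilin I Q NT (\<lambda>z. mulvars (\<lambda>i. f i (z i)))"
  unfolding idem_module_def[of R Sg]
proof (rule prod_multilin[OF idem_ring_cring scal_hom])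
  fix i assume i: "i \<in> I"
  show "lin R (Q i) (restrict_scalars (scal Sg) (idem_ring R Sg)) (\<lambda>x. idem_map R Sg (Pair i) (f i x))"
    using lin_comp[OF assms[OF i] idem_map(1)[OF pair_sub[OF i]]] unfolding idem_module_def[of R Sg] .
qed simp

text \<open>
  The product of the cochains \<open>cell_val\<close> of the coordinates, each moved to its own copy of the variables.
\<close>

definition cube_val :: "((nat \<Rightarrow> ('s, ('s multiset \<Rightarrow> 'r) set) cell) \<Rightarrow> 'r) \<Rightarrow> ((nat \<times> 's) multiset \<Rightarrow> 'r) set" where
  "cube_val = free_lift R NT (\<lambda>c. mulvars (\<lambda>i. cell_val (S i) (bv (c i))))"

lemma cell_val_multilin:
  "multilin I FB NT (\<lambda>z. mulvars (\<lambda>i. cell_val (S i) (z i)))"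
  by (rule idem_prod_multilin[OF cell_val_lin])

lemma finprod_restrict_arg:
  assumes "\<And>i. i \<in> I \<Longrightarrow> z i \<in> carrier (Q i)" "\<And>i. i \<in> I \<Longrightarrow> lin R (Q i) (NS i) (f i)"
  shows "mulvars (\<lambda>i. f i ((\<lambda>i\<in>I. z i) i)) =
    mulvars (\<lambda>i. f i (z i))"
proof -
  interpret J: cring "idem_ring R Sg" by (rule idem_ring_cring)
  have c: "idem_map R Sg (Pair i) (f i (z i)) \<in> carrier (idem_ring R Sg)" if i: "i \<in> I" for i
    using lin_closed[OF idem_map(1)[OF pair_sub[OF i]] lin_closed[OF assms(2)[OF i] assms(1)[OF i]]] by (simp add: idem_module_def)
  show ?thesis by (rule J.finprod_cong') (use c in auto)
qed

lemma cube_val_gen: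
  assumes c: "c \<in> cells"
  shows "mulvars (\<lambda>i. cell_val (S i) (bv (c i))) \<in> carrier NT"
proof -
  have "(\<lambda>i\<in>I. bv (c i)) \<in> (\<Pi>\<^sub>E i\<in>I. carrier (FB i))" using basis_B[OF c] by auto
  from multilin_closed[OF cell_val_multilin this] show ?thesis
    using finprod_restrict_arg[of "\<lambda>i. bv (c i)" FB "\<lambda>i. cell_val (S i)", OF basis_B[OF c] cell_val_lin] by metis
qed

lemma cube_val_lin: "lin R C NT cube_val"
  unfolding cube_val_def using cube_val_gen by (intro free_lift_lin idem_module_module) auto

lemma cube_val_basis:
  assumes c: "c \<in> cells"
  shows "cube_val (bv c) = mulvars (\<lambda>i. cell_val (S i) (bv (c i)))"
  unfolding cube_val_def
  by (rule free_lift_basis[OF idem_module_module,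
    where f="\<lambda>c. mulvars (\<lambda>i. cell_val (S i) (bv (c i)))", OF cube_val_gen[OF c]])

lemma cube_val_pr:
  assumes z: "z \<in> (\<Pi>\<^sub>E i\<in>I. carrier (FB i))"
  shows "cube_val (pr z) = mulvars (\<lambda>i. cell_val (S i) (z i))"
proof (rule multilin_free_eq[OF _ idem_module_module multilin_post[OF pr_multilin cube_val_lin] cell_val_multilin _ z])
  fix c :: "nat \<Rightarrow> ('s, ('s multiset \<Rightarrow> 'r) set) cell"
  assume "c \<in> (\<Pi>\<^sub>E i\<in>I. cell_set (S i) (carrier (NS i)))"
  then have c: "c \<in> cells" by (simp add: cells_def)
  have "pr (\<lambda>i\<in>I. bv (c i)) = pr (\<lambda>i. bv (c i))" by (rule pr_cong) (auto intro: basis_B[OF c])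
  then show "cube_val (pr (\<lambda>i\<in>I. bv (c i))) = mulvars (\<lambda>i. cell_val (S i) ((\<lambda>i\<in>I. bv (c i)) i))"
    using cube_val_basis[OF c] basis_pr[OF c] finprod_restrict_arg[of "\<lambda>i. bv (c i)" FB "\<lambda>i. cell_val (S i)", OF basis_B[OF c] cell_val_lin] by simp
qed simp

abbreviation "Ps i \<equiv> std_res R (Mi i)"
abbreviation "ones \<equiv> (\<lambda>i\<in>I. 1 :: nat)"

lemma factor_chain_map:
  assumes i: "i \<in> I" and \<alpha>: "\<alpha> \<in> ext_push R 1 (Mi i) (NS i) (idem_incl R (S i)) (indiv_cl R (S i) (\<Psi> i))"
  shows "\<exists>\<rho>. chain_map (Ps i) (K i) \<rho> \<and> (\<forall>x\<in>carrier (obj (Ps i) 1). \<alpha> x = cell_val (S i) (\<rho> 1 x))"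
proof -
  obtain \<rho>0 \<rho>1 where r: "lin R (obj (Ps i) 0) (free_module R {c \<in> cell_set (S i) (carrier (NS i)). \<not> is_edge c}) \<rho>0"
    "lin R (obj (Ps i) 1) (free_module R {c \<in> cell_set (S i) (carrier (NS i)). is_edge c}) \<rho>1"
    "\<forall>x\<in>carrier (obj (Ps i) 0). cell_aug (S i) (\<Psi> i) (\<rho>0 x) = aug (Ps i) x"
    "\<forall>x\<in>carrier (obj (Ps i) 1). cell_bdry (S i) (\<Psi> i) (\<rho>1 x) = \<rho>0 (bdry (Ps i) 0 x)"
    "\<forall>x\<in>carrier (obj (Ps i) 2). \<rho>1 (bdry (Ps i) 1 x) = (\<lambda>c. \<zero>)"
    "\<forall>x\<in>carrier (obj (Ps i) 1). \<alpha> x = cell_val (S i) (\<rho>1 x)"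
    using factor_cocycle(2)[OF one_indiv[OF i] \<alpha>] by blast
  \<comment> \<open>the target vanishes in degrees above \<open>1\<close>\<close>
  define \<rho> where "\<rho> = (\<lambda>k :: nat. if k = 0 then \<rho>0 else if k = 1 then \<rho>1 else (\<lambda>x c. \<zero>))"
  have b1: "bcell i 1 = {c \<in> cell_set (S i) (carrier (NS i)). is_edge c}" by (auto simp: bcell_def)
  have z: "lin R (obj (Ps i) k) (BK i k) (\<lambda>x c. \<zero>)" for k
    using lin_const_zero[OF free_module_module, where M="obj (Ps i) k"] by simp
  have D0: "cell_bdry (S i) (\<Psi> i) (\<lambda>c. \<zero>) = (\<lambda>c. \<zero>)"
    using lin_zero[OF free_module_module free_module_module cell_bdry_endo[OF \<Psi>_closed[OF i]]] by simp
  have "chain_map (Ps i) (K i) \<rho>"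
    unfolding chain_map_def K_simps
  proof (intro conjI allI ballI)
    fix k show "lin R (obj (Ps i) k) (BK i k) (\<rho> k)"
    proof -
      consider "k = 0" | "k = 1" | "k \<noteq> 0" "k \<noteq> 1" by blast
      then show ?thesis
      proof cases
        case 1 show ?thesis unfolding 1 \<rho>_def bcell_0 using r(1) by (simp only: refl if_True)
      next
        case 2 show ?thesis unfolding 2 \<rho>_def b1 using r(2) by (simp only: refl if_True if_False one_neq_zero)
      next
        case 3 then show ?thesis unfolding \<rho>_def using z by (simp only: if_False)
      qed
    qed
    fix x assume x: "x \<in> carrier (obj (Ps i) (Suc k))"
    consider "k = 0" | "k = 1" | "k \<noteq> 0" "k \<noteq> 1" by blast
    then show "cell_bdry (S i) (\<Psi> i) (\<rho> (Suc k) x) = \<rho> k (bdry (Ps i) k x)"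
    proof cases
      case 1 then show ?thesis using x r(4) by (simp add: \<rho>_def)
    next
      case 2 then show ?thesis using x r(5) D0 by (simp add: \<rho>_def numeral_2_eq_2)
    next
      case 3 then show ?thesis by (simp add: \<rho>_def D0)
    qed
  qed (use r(3) in \<open>simp add: \<rho>_def\<close>)
  moreover have "\<forall>x\<in>carrier (obj (Ps i) 1). \<alpha> x = cell_val (S i) (\<rho> 1 x)" using r(6) by (simp add: \<rho>_def)
  ultimately show ?thesis by blast
qed

text \<open>
  Both sides are multilinear; on a family \<open>m\<close> they are the product of the values \<open>\<alpha> i (m i)\<close>.
\<close>

lemma tensor_cocycle:
  assumes \<rho>: "\<And>i. i \<in> I \<Longrightarrow> chain_map (Ps i) (K i) (\<rho> i)"
    and \<alpha>l: "\<And>i. i \<in> I \<Longrightarrow> lin R (obj (Ps i) 1) (NS i) (\<alpha> i)"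
    and \<alpha>: "\<And>i x. i \<in> I \<Longrightarrow> x \<in> carrier (obj (Ps i) 1) \<Longrightarrow> \<alpha> i x = cell_val (S i) (\<rho> i 1 x)"
    and y: "y \<in> carrier (TP ones)"
  shows "idem_tensor_iso R I S (tensor_map R I NS \<alpha> y) = cube_val (rlift \<rho> ones y)"
proof -
  have \<alpha>l': "lin R (obj (Ps i) (ones i)) (NS i) (\<alpha> i)" if "i \<in> I" for i using \<alpha>l[OF that] that by simp
  have isoL: "lin R (tensor R I NS) NT (idem_tensor_iso R I S)"
    unfolding idem_tensor_iso_def
    by (rule tensor_lift(1)[OF idem_module_module idem_module_module idem_prod_multilin[OF lin_id]])
  have tm: "lin R (TP ones) (tensor R I NS) (tensor_map R I NS \<alpha>)"
    by (rule tensor_map(1)[OF P_module idem_module_module \<alpha>l'])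
  show ?thesis
  proof (rule tensor_lin_eq[OF P_module idem_module_module lin_comp[OF tm isoL] lin_comp[OF rlift(1)[of \<rho>, OF \<rho>] cube_val_lin] _ y])
    fix m assume m: "m \<in> (\<Pi>\<^sub>E i\<in>I. carrier (obj (Ps i) (ones i)))"
    then have mi: "m i \<in> carrier (obj (Ps i) 1)" if "i \<in> I" for i using that PiE_mem[OF m that] by simp
    have am: "\<alpha> i (m i) \<in> carrier (NS i)" if "i \<in> I" for i by (rule lin_closed[OF \<alpha>l[OF that] mi[OF that]])
    have e1: "tensor_map R I NS \<alpha> (tensor_pure R I (\<lambda>i. obj (Ps i) (ones i)) m) =
       tensor_pure R I NS (\<lambda>i\<in>I. \<alpha> i (m i))" unfolding tensor_pure_restrict
      by (rule tensor_map(2)[OF P_module idem_module_module \<alpha>l' m])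
    have "idem_tensor_iso R I S (tensor_pure R I NS (\<lambda>i\<in>I. \<alpha> i (m i))) =
       mulvars (\<lambda>i. (\<lambda>i\<in>I. \<alpha> i (m i)) i)"
      unfolding idem_tensor_iso_def
      by (rule tensor_lift(2)[OF idem_module_module idem_module_module idem_prod_multilin[OF lin_id]]) (use am in auto)
    also have "\<dots> = mulvars (\<lambda>i. \<alpha> i (m i))"
      by (rule finprod_restrict_arg[where f="\<lambda>i x. x" and Q=NS, OF am lin_id])
    finally have e2: "idem_tensor_iso R I S (tensor_pure R I NS (\<lambda>i\<in>I. \<alpha> i (m i))) =
      mulvars (\<lambda>i. \<alpha> i (m i))" .
    have rF: "\<rho> i 1 (m i) \<in> carrier (FB i)" if i: "i \<in> I" for i
      using lin_closed[OF \<rho>_FB[of \<rho>, OF \<rho> i] mi[OF i]] .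
    have "rlift \<rho> ones (tensor_pure R I (\<lambda>i. obj (Ps i) (ones i)) m) = pr (\<lambda>i\<in>I. \<rho> i (ones i) (m i))"
      using rlift(2)[of \<rho>, OF \<rho> m] by (simp only: rmul_def)
    also have "(\<lambda>i\<in>I. \<rho> i (ones i) (m i)) = (\<lambda>i\<in>I. \<rho> i 1 (m i))" by (rule restrict_ext) simp
    finally have rp: "rlift \<rho> ones (tensor_pure R I (\<lambda>i. obj (Ps i) (ones i)) m) = pr (\<lambda>i\<in>I. \<rho> i 1 (m i))" .
    have "cube_val (rlift \<rho> ones (tensor_pure R I (\<lambda>i. obj (Ps i) (ones i)) m)) =
      mulvars (\<lambda>i. cell_val (S i) ((\<lambda>i\<in>I. \<rho> i 1 (m i)) i))"
      unfolding rp by (rule cube_val_pr) (use rF in auto)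
    also have "\<dots> = mulvars (\<lambda>i. cell_val (S i) (\<rho> i 1 (m i)))"
      by (rule finprod_restrict_arg[where f="\<lambda>i. cell_val (S i)" and Q=FB, OF rF cell_val_lin])
    also have "\<dots> = mulvars (\<lambda>i. \<alpha> i (m i))"
    proof -
      interpret J: cring "idem_ring R Sg" by (rule idem_ring_cring)
      have "idem_map R Sg (Pair i) (\<alpha> i (m i)) \<in> carrier (idem_ring R Sg)" if i: "i \<in> I" for i
        using lin_closed[OF idem_map(1)[OF pair_sub[OF i]] am[OF i]] by (simp add: idem_module_def)
      then show ?thesis by (intro J.finprod_cong') (use \<alpha> mi in auto)
    qed
    finally show "idem_tensor_iso R I S (tensor_map R I NS \<alpha> (tensor_pure R I (\<lambda>i. obj (Ps i) (ones i)) m)) =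
      cube_val (rlift \<rho> ones (tensor_pure R I (\<lambda>i. obj (Ps i) (ones i)) m))" unfolding e1 e2 by simp
  qed
qed

abbreviation "F' \<equiv> CK n l"

definition ecell :: "(nat \<Rightarrow> 's) \<Rightarrow> nat \<Rightarrow> ('s, ('s multiset \<Rightarrow> 'r) set) cell \<Rightarrow> 'r" where
  "ecell s i = bv (Es (s i))"

lemma ecell_bcell: "i \<in> I \<Longrightarrow> s i \<in> S i \<Longrightarrow> ecell s i \<in> carrier (BK i 1)"
  unfolding ecell_def by (intro basis_vec_closed) (auto simp: bcell_def)

lemma cube_val_edges:
  assumes sP: "s \<in> (\<Pi> i\<in>I. S i)"
  shows "pr (ecell s) \<in> carrier (CK n n)"
    and "\<exists>m\<in>Mon Sg. set_mset m = (\<lambda>i. (i, s i)) ` I \<and> cube_val (pr (ecell s)) = idem_cls R Sg (bv m)"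
proof -
  have s: "s i \<in> S i" if "i \<in> I" for i using sP that by blast
  show "pr (ecell s) \<in> carrier (CK n n)"
  proof (rule pr_cellsk[where d="\<lambda>i. 1"])
    fix i assume i: "i \<in> I"
    show "ecell s i \<in> carrier (BK i 1)" by (rule ecell_bcell[where s=s, OF i s[OF i]])
  qed simp
  have c: "restrict (\<lambda>i. Es (s i)) I \<in> cells" using s by (auto simp: cells_def)
  have e: "ecell s i = bv (restrict (\<lambda>i. Es (s i)) I i)" if "i \<in> I" for i using that by (simp add: ecell_def)
  have "pr (ecell s) = pr (\<lambda>i. bv (restrict (\<lambda>i. Es (s i)) I i))"
    by (rule pr_cong[OF e basis_B[OF c]])
  then have "cube_val (pr (ecell s)) = mulvars (\<lambda>i. cell_val (S i) (bv (restrict (\<lambda>i. Es (s i)) I i)))"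
    using cube_val_basis[OF c] basis_pr[OF c] by simp
  also have "\<dots> = (\<Otimes>\<^bsub>idem_ring R Sg\<^esub>i\<in>I. xc Sg (i, s i))"
  proof -
    interpret J: cring "idem_ring R Sg" by (rule idem_ring_cring)
    have "idem_map R Sg (Pair i) (cell_val (S i) (bv (restrict (\<lambda>i. Es (s i)) I i))) = xc Sg (i, s i)"
      if i: "i \<in> I" for i
      using i cell_val_Es[OF s[OF i]] idem_map(2)[OF pair_sub[OF i] s[OF i]] by simp
    moreover have "xc Sg (i, s i) \<in> carrier (idem_ring R Sg)" if i: "i \<in> I" for i
    proof -
      have "(i, s i) \<in> Sg" using i s by auto
      from lin_closed[OF idem_incl_lin basis_vec_closed[OF this]] show ?thesis
        unfolding idem_incl_basis[OF \<open>(i, s i) \<in> Sg\<close>] by (simp add: idem_module_def)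
    qed
    ultimately show ?thesis by (intro J.finprod_cong') auto
  qed
  finally have "cube_val (pr (ecell s)) = (\<Otimes>\<^bsub>idem_ring R Sg\<^esub>i\<in>I. xc Sg (i, s i))" .
  moreover have "\<exists>m\<in>Mon Sg. set_mset m = (\<lambda>i. (i, s i)) ` I \<and>
      (\<Otimes>\<^bsub>idem_ring R Sg\<^esub>i\<in>I. xc Sg (i, s i)) = idem_cls R Sg (bv m)"
    by (rule prod_vars) (use s in auto)
  ultimately show "\<exists>m\<in>Mon Sg. set_mset m = (\<lambda>i. (i, s i)) ` I \<and> cube_val (pr (ecell s)) = idem_cls R Sg (bv m)"
    by simp
qed

text \<open>
  The boundary of the edge \<open>Es (s j)\<close> is \<open>Pt + \<Psi> j (s j) Vx (s j)\<close>; the first of the two faces does not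
  remember \<open>s j\<close>.
\<close>

lemma edge_faces:
  assumes sP: "s \<in> (\<Pi> i\<in>I. S i)" and j: "j \<in> I"
  shows "pr ((ecell s)(j := bv Pt)) \<in> carrier F'"
    and "pr ((ecell s)(j := bv (Vx (s j)))) \<in> carrier F'"
    and "pr ((ecell s)(j := cell_bdry (S j) (\<Psi> j) (ecell s j))) =
      pr ((ecell s)(j := bv Pt)) \<oplus>\<^bsub>F'\<^esub> \<Psi> j (s j) \<odot>\<^bsub>F'\<^esub> pr ((ecell s)(j := bv (Vx (s j))))"
proof -
  have s: "s i \<in> S i" if "i \<in> I" for i using sP that by blast
  let ?d = "(\<lambda>i. 1 :: nat)(j := 0)"
  have "(\<Sum>i\<in>I. ?d i) = ?d j + (\<Sum>i\<in>I-{j}. ?d i)" by (rule sum.remove[OF finite_atLeastAtMost j])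
  also have "(\<Sum>i\<in>I-{j}. ?d i) = (\<Sum>i\<in>I-{j}. 1)" by (rule sum.cong) auto
  finally have d: "(\<Sum>i\<in>I. ?d i) = l" using j n by simp
  have p: "pr ((ecell s)(j := w)) \<in> carrier F'" if "w \<in> carrier (BK j 0)" for w
  proof (rule pr_cellsk[where d="?d", OF _ d])
    fix i assume "i \<in> I"
    then show "((ecell s)(j := w)) i \<in> carrier (BK i (?d i))"
      using that ecell_bcell[of i s] s by (cases "i = j") simp_all
  qed
  have vb: "bv Pt \<in> carrier (BK j 0)" "bv (Vx (s j)) \<in> carrier (BK j 0)"
    using s[OF j] by (auto intro!: basis_vec_closed simp: bcell_def)
  show "pr ((ecell s)(j := bv Pt)) \<in> carrier F'" "pr ((ecell s)(j := bv (Vx (s j)))) \<in> carrier F'"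
    by (rule p[OF vb(1)], rule p[OF vb(2)])
  have vF: "bv Pt \<in> carrier (FB j)" "bv (Vx (s j)) \<in> carrier (FB j)" using vb bcell_sub by blast+
  have eF: "ecell s i \<in> carrier (FB i)" if "i \<in> I" for i using ecell_bcell[where s=s, OF that s[OF that]] bcell_sub by blast
  have \<Psi>: "\<Psi> j (s j) \<in> carrier R" using \<Psi>_closed[OF j] s[OF j] by auto
  interpret F: module R "FB j" by (rule FB_module)
  have cell_bdry: "cell_bdry (S j) (\<Psi> j) (ecell s j) = bv Pt \<oplus>\<^bsub>FB j\<^esub> \<Psi> j (s j) \<odot>\<^bsub>FB j\<^esub> bv (Vx (s j))"
  proof
    fix e show "cell_bdry (S j) (\<Psi> j) (ecell s j) e = (bv Pt \<oplus>\<^bsub>FB j\<^esub> \<Psi> j (s j) \<odot>\<^bsub>FB j\<^esub> bv (Vx (s j))) e"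
      unfolding ecell_def cell_bdry_Es[OF \<Psi>_closed[OF j] s[OF j]] using \<Psi> by (cases e) (auto simp: basis_vec_def)
  qed
  have m: "restrict (ecell s) I \<in> (\<Pi>\<^sub>E i\<in>I. carrier (FB i))" using eF by auto
  note lin = multilin_coordinate[OF pr_multilin m j]
  have r: "pr ((restrict (ecell s) I)(j := w)) = pr ((ecell s)(j := w))" if "w \<in> carrier (FB j)" for w
    by (rule pr_cong) (use eF that in auto)
  have sc: "\<Psi> j (s j) \<odot>\<^bsub>FB j\<^esub> bv (Vx (s j)) \<in> carrier (FB j)" by (rule F.smult_closed[OF \<Psi> vF(2)])
  show "pr ((ecell s)(j := cell_bdry (S j) (\<Psi> j) (ecell s j))) =
      pr ((ecell s)(j := bv Pt)) \<oplus>\<^bsub>F'\<^esub> \<Psi> j (s j) \<odot>\<^bsub>F'\<^esub> pr ((ecell s)(j := bv (Vx (s j))))"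
    using lin_add[OF lin vF(1) sc] lin_smult[OF lin \<Psi> vF(2)] r[OF vF(1)] r[OF vF(2)] r[OF sc] r[OF F.M.a_closed[OF vF(1) sc]]
    unfolding cell_bdry by simp
qed

lemma bd_edges:
  assumes sP: "s \<in> (\<Pi> i\<in>I. S i)"
  defines "p \<equiv> \<lambda>j. pr ((ecell s)(j := cell_bdry (S j) (\<Psi> j) (ecell s j)))"
  shows "bd n (pr (ecell s)) = (\<Oplus>\<^bsub>F'\<^esub>j\<in>I. if even (\<Sum>i\<in>{i\<in>I. i < j}. 1 :: nat) then p j else \<ominus>\<^bsub>F'\<^esub> p j)"
    and "\<And>j. j \<in> I \<Longrightarrow> p j \<in> carrier F'"
proof -
  have s: "s i \<in> S i" if "i \<in> I" for i using sP that by blast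
  interpret F': module R F' by (rule free_module_module)
  show pF: "p j \<in> carrier F'" if j: "j \<in> I" for j
  proof -
    have "\<Psi> j (s j) \<in> carrier R" using \<Psi>_closed[OF j] s[OF j] by auto
    moreover note ef = edge_faces[OF sP j]
    ultimately have "pr ((ecell s)(j := bv Pt)) \<oplus>\<^bsub>F'\<^esub> \<Psi> j (s j) \<odot>\<^bsub>F'\<^esub> pr ((ecell s)(j := bv (Vx (s j)))) \<in> carrier F'"
      using F'.M.a_closed F'.smult_closed by blast
    then show ?thesis unfolding p_def ef(3) .
  qed
  have sub: "cellsk n l \<subseteq> cells" by (auto simp: cellsk_def)
  then have pC: "p j \<in> carrier C" if "j \<in> I" for j using pF[OF that] free_mono by blast
  let ?e = "\<lambda>j. even (\<Sum>i\<in>{i\<in>I. i < j}. 1 :: nat)"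
  have "bd n (pr (ecell s)) = (\<Oplus>\<^bsub>C\<^esub>j\<in>I. if ?e j then p j else \<ominus>\<^bsub>C\<^esub> p j)"
    unfolding p_def
  proof (rule bd_pr_hom[where d="\<lambda>i. 1"])
    fix i assume i: "i \<in> I"
    show "ecell s i \<in> carrier (BK i 1)" by (rule ecell_bcell[where s=s, OF i s[OF i]])
  qed
  also have "\<dots> = (\<lambda>b. \<Oplus>j\<in>I. (if ?e j then p j else \<ominus>\<^bsub>C\<^esub> p j) b)"
    by (rule free_finsum) (use pC C.M.a_inv_closed in auto)
  also have "\<dots> = (\<lambda>b. \<Oplus>j\<in>I. (if ?e j then p j else \<ominus>\<^bsub>F'\<^esub> p j) b)"
  proof
    fix b
    have "(if ?e j then p j else \<ominus>\<^bsub>C\<^esub> p j) = (if ?e j then p j else \<ominus>\<^bsub>F'\<^esub> p j)" if "j \<in> I" for j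
      unfolding free_uminus[OF pC[OF that]] free_uminus[OF pF[OF that]] ..
    moreover have "(if ?e j then p j else \<ominus>\<^bsub>F'\<^esub> p j) b \<in> carrier R" if "j \<in> I" for j
      using free_closed[OF pF[OF that]] free_closed[OF F'.M.a_inv_closed[OF pF[OF that]]] by simp
    ultimately show "(\<Oplus>j\<in>I. (if ?e j then p j else \<ominus>\<^bsub>C\<^esub> p j) b) = (\<Oplus>j\<in>I. (if ?e j then p j else \<ominus>\<^bsub>F'\<^esub> p j) b)"
      by (intro finsum_cong') auto
  qed
  also have "\<dots> = (\<Oplus>\<^bsub>F'\<^esub>j\<in>I. if ?e j then p j else \<ominus>\<^bsub>F'\<^esub> p j)"
    by (rule free_finsum[symmetric]) (use pF F'.M.a_inv_closed in auto)
  finally show "bd n (pr (ecell s)) = (\<Oplus>\<^bsub>F'\<^esub>j\<in>I. if ?e j then p j else \<ominus>\<^bsub>F'\<^esub> p j)" .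
qed

text \<open>
  With \<open>f j s\<close> the finite set of \<open>t\<close> such that the variable \<open>(j, t)\<close> occurs in a chosen polynomial
  representing the value of \<open>h\<close> on the \<open>j\<close>-th \<open>Pt\<close>-face, a free \<open>s\<close> makes all these values invisible to
  the coefficient functional \<open>chi\<close> of the monomial of all \<open>(j, s j)\<close>.
\<close>

lemma cube_val_nontrivial:
  assumes aleph: "\<And>i. i \<in> I \<Longrightarrow> aleph_le (i - 1) (S i)"
  shows "\<nexists>h. lin R F' NT h \<and> (\<forall>x\<in>carrier (CK n n). cube_val x = h (bd n x))"
proof
  assume "\<exists>h. lin R F' NT h \<and> (\<forall>x\<in>carrier (CK n n). cube_val x = h (bd n x))"
  then obtain h where h: "lin R F' NT h" "\<And>x. x \<in> carrier (CK n n) \<Longrightarrow> cube_val x = h (bd n x)" by blast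
  have "\<forall>e\<in>carrier NT. \<exists>Q. Q \<in> carrier (FM Sg) \<and> idem_cls R Sg Q = e" unfolding cls_surj by blast
  then obtain rep where rep: "\<And>e. e \<in> carrier NT \<Longrightarrow> rep e \<in> carrier (FM Sg) \<and> idem_cls R Sg (rep e) = e" by metis
  define a where "a = (\<lambda>j s. h (pr ((ecell s)(j := bv Pt))))"
  define f where "f = (\<lambda>j s. if a j s \<in> carrier NT then {t. \<exists>m. rep (a j s) m \<noteq> \<zero> \<and> (j, t) \<in># m} else {})"
  have "finite (f j s)" for j s
  proof (cases "a j s \<in> carrier NT")
    case True
    have "f j s \<subseteq> snd ` (\<Union>m\<in>{m. rep (a j s) m \<noteq> \<zero>}. set_mset m)"
    proof
      fix t assume "t \<in> f j s"
      then obtain m where "rep (a j s) m \<noteq> \<zero>" "(j, t) \<in># m" using True by (auto simp: f_def)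
      then show "t \<in> snd ` (\<Union>m\<in>{m. rep (a j s) m \<noteq> \<zero>}. set_mset m)" by (intro image_eqI[of _ _ "(j, t)"]) auto
    qed
    moreover have "finite \<dots>" by (intro finite_imageI finite_UN_I free_finite[OF conjunct1[OF rep[OF True]]]) simp
    ultimately show ?thesis by (rule finite_subset)
  qed (simp add: f_def)
  moreover have "f j (s(j := x)) = f j s" for j s x
  proof -
    have "(ecell (s(j := x)))(j := w) = (ecell s)(j := w)" for w by (auto simp: ecell_def fun_eq_iff)
    then show ?thesis by (simp add: f_def a_def)
  qed
  ultimately have "\<exists>s\<in>(\<Pi>\<^sub>E i\<in>I. S i). \<forall>i\<in>I. s i \<notin> f i s" by (intro free_set[OF aleph])
  then obtain s where s: "\<And>i. i \<in> I \<Longrightarrow> s i \<in> S i" "\<And>i. i \<in> I \<Longrightarrow> s i \<notin> f i s" by blast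
  then have sP: "s \<in> (\<Pi> i\<in>I. S i)" by blast
  let ?V = "(\<lambda>i. (i, s i)) ` I"
  let ?g = "\<lambda>x. chi ?V (h x)"
  have g: "lin R F' RM ?g" by (rule lin_comp[OF h(1) chi(1)])
  have g0: "?g (pr ((ecell s)(j := bv Pt))) = \<zero>" if j: "j \<in> I" for j
  proof -
    have ac: "a j s \<in> carrier NT" unfolding a_def by (rule lin_closed[OF h(1) edge_faces(1)[OF sP j]])
    have "set_mset m \<noteq> ?V" if m: "rep (a j s) m \<noteq> \<zero>" for m
    proof
      assume "set_mset m = ?V"
      then have "(j, s j) \<in># m" using j by simp
      then show False using s(2)[OF j] ac m by (auto simp: f_def)
    qed
    then have "chi ?V (idem_cls R Sg (rep (a j s))) = \<zero>" by (rule chi(3)[OF conjunct1[OF rep[OF ac]]])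
    then show ?thesis using rep[OF ac] by (simp add: a_def)
  qed
  let ?p = "\<lambda>j. pr ((ecell s)(j := cell_bdry (S j) (\<Psi> j) (ecell s j)))"
  let ?J = "Idl ((\<lambda>i. \<Psi> i (s i)) ` I)"
  have \<Psi>c: "\<Psi> j (s j) \<in> carrier R" if "j \<in> I" for j using \<Psi>_closed[OF that] s(1)[OF that] by auto
  have J: "ideal ?J R" by (rule genideal_ideal) (use \<Psi>c in auto)
  interpret J: ideal ?J R by (rule J)
  interpret F': module R F' by (rule free_module_module)
  have gp: "?g (?p j) \<in> ?J" if j: "j \<in> I" for j
  proof -
    note ef = edge_faces[OF sP j]
    have "?g (?p j) = \<zero> \<oplus> \<Psi> j (s j) \<otimes> ?g (pr ((ecell s)(j := bv (Vx (s j)))))"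
      unfolding ef(3) lin_add[OF g ef(1) F'.smult_closed[OF \<Psi>c[OF j] ef(2)]] lin_smult[OF g \<Psi>c[OF j] ef(2)] g0[OF j] by simp
    moreover have "?g (pr ((ecell s)(j := bv (Vx (s j))))) \<in> carrier R" using lin_closed[OF g ef(2)] by simp
    moreover have "\<Psi> j (s j) \<in> ?J" by (rule subsetD[OF genideal_self]) (use \<Psi>c j in auto)
    ultimately show ?thesis using J.I_r_closed \<Psi>c[OF j] by simp
  qed
  let ?t = "\<lambda>j. if even (\<Sum>i\<in>{i\<in>I. i < j}. 1 :: nat) then ?p j else \<ominus>\<^bsub>F'\<^esub> ?p j"
  have pF: "?p j \<in> carrier F'" if "j \<in> I" for j by (rule bd_edges(2)[OF sP that])
  have "?g (bd n (pr (ecell s))) = (\<Oplus>\<^bsub>RM\<^esub>j\<in>I. ?g (?t j))"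
    unfolding bd_edges(1)[OF sP]
    by (rule lin_finsum[OF free_module_module RM_module g]) (use pF F'.M.a_inv_closed in auto)
  also have "\<dots> = (\<Oplus>j\<in>I. ?g (?t j))" by (rule RM_structure)
  also have "\<dots> \<in> ?J"
  proof (rule ideal_finsum[OF J])
    fix j assume j: "j \<in> I"
    have "?g (\<ominus>\<^bsub>F'\<^esub> ?p j) = \<ominus> ?g (?p j)"
      using lin_uminus[OF free_module_module RM_module g pF[OF j]] by (simp only: RM_structure)
    then show "?g (?t j) \<in> ?J" using gp[OF j] J.a_inv_closed[OF gp[OF j]] by (cases "even (\<Sum>i\<in>{i\<in>I. i < j}. 1 :: nat)") (simp_all only: if_True if_False)
  qed simp
  finally have "?g (bd n (pr (ecell s))) \<in> ?J" .
  moreover obtain m where m: "m \<in> Mon Sg" "set_mset m = ?V" "cube_val (pr (ecell s)) = idem_cls R Sg (bv m)"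
    using cube_val_edges(2)[OF sP] by blast
  moreover have "h (bd n (pr (ecell s))) = cube_val (pr (ecell s))" using h(2)[OF cube_val_edges(1)[OF sP]] by simp
  moreover have "chi ?V (idem_cls R Sg (bv m)) = \<one>" unfolding chi(2)[OF m(1)] m(2) by simp
  ultimately have "\<one> \<in> ?J" by metis
  then have "?J = carrier R" by (rule J.one_imp_carrier)
  then show False using sP indiv unfolding indivisible_def by blast
qed

lemma ones_multidegs: "ones \<in> multidegs I n"
  by (simp add: multidegs_def)

lemma indivisible_class_nonzero:
  assumes aleph: "\<And>i. i \<in> I \<Longrightarrow> aleph_le (i - 1) (S i)"
  shows "ext_push R n TM NT (idem_tensor_iso R I S)
      (ext_tensor R I (\<lambda>i. 1) Mi NS (\<lambda>i. ext_push R 1 (Mi i) (NS i) (idem_incl R (S i)) (indiv_cl R (S i) (\<Psi> i))))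
    \<in> carrier (Ext R n TM NT) - {\<zero>\<^bsub>Ext R n TM NT\<^esub>}"
proof -
  let ?F = "std_res R TM" and ?iso = "idem_tensor_iso R I S"
  let ?\<alpha> = "\<lambda>i. ext_push R 1 (Mi i) (NS i) (idem_incl R (S i)) (indiv_cl R (S i) (\<Psi> i))"
  let ?E = "ext_tensor R I (\<lambda>i. 1) Mi NS ?\<alpha>"
  note TM = tensor_module[OF M_module] and NT = idem_module_module[of Sg]
  have F: "resolution ?F TM" by (rule std_res_resolution[OF TM])
  then have Fc: "complex ?F TM" by (simp add: resolution_def)
  have sub: "cellsk n n \<subseteq> cells" by (auto simp: cellsk_def)
  have Ps: "resolution (Ps i) (Mi i)" if "i \<in> I" for i by (rule std_res_resolution[OF M_module[OF that]])
  note tc = transported_class[OF n F std_res_obj Ps NT lin_free_mono[OF sub cube_val_lin] cube_val_nontrivial[OF aleph]]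
  obtain \<theta>0 where \<theta>0: "chain_map ?F T \<theta>0" using tc(1) by blast
  obtain c where c: "lin R (obj ?F n) NT c" "\<forall>x\<in>carrier (obj ?F (Suc n)). c (bdry ?F n x) = \<zero>\<^bsub>NT\<^esub>"
    "\<nexists>h. lin R (obj ?F l) NT h \<and> (\<forall>x\<in>carrier (obj ?F n). c x = h (bdry ?F l x))"
    "\<And>\<theta> \<rho>. chain_map ?F T \<theta> \<Longrightarrow> \<forall>i\<in>I. chain_map (Ps i) (K i) (\<rho> i) \<Longrightarrow>
        \<exists>h. lin R (obj ?F l) NT h \<and> (\<forall>x\<in>carrier (obj ?F n). cube_val (rho \<rho> n (\<theta> n x)) = c x \<oplus>\<^bsub>NT\<^esub> h (bdry ?F l x))"
    using tc(2) by blast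
  have isoL: "lin R (tensor R I NS) NT ?iso"
    unfolding idem_tensor_iso_def
    by (rule tensor_lift(1)[OF idem_module_module idem_module_module idem_prod_multilin[OF lin_id]])
  have TN: "module R (tensor R I NS)" by (rule tensor_module[OF idem_module_module])
  interpret N: module R NT by (rule NT)
  have bl: "lin R (obj ?F n) (obj ?F l) (bdry ?F l)" using complexD(3)[OF Fc, of l] n by simp
  have sum1: "(\<Sum>i\<in>I. 1 :: nat) = n" by simp
  have E: "?E = (\<Union>\<phi>\<in>Pi\<^sub>E I ?\<alpha>. \<Union>\<theta>\<in>comparison_maps R ?F T. ext_class R n TM (tensor R I NS)
      (\<lambda>x. tensor_map R I NS \<phi> (\<theta> n x ones)))"
    unfolding ext_tensor_def sum1 by simp
  have ne: "?E \<noteq> {}"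
  proof -
    have "?\<alpha> i \<noteq> {}" if i: "i \<in> I" for i
    proof -
      obtain \<phi> where "\<phi> \<in> indiv_cl R (S i) (\<Psi> i)" using indiv_cl_nonempty[OF \<Psi>_closed[OF i]] unfolding ex_in_conv[symmetric] ..
      moreover obtain y where "y \<in> ext_class R 1 (Mi i) (NS i) (\<lambda>x. idem_incl R (S i) (\<phi> x))"
        using ext_class_nonempty[OF idem_module_module, of 0 "Mi i" "S i" "\<lambda>x. idem_incl R (S i) (\<phi> x)"]
        unfolding ex_in_conv[symmetric] One_nat_def ..
      ultimately have "y \<in> ?\<alpha> i" unfolding ext_push_def by blast
      then show ?thesis by (metis empty_iff)
    qed
    then have "\<not> (\<exists>i\<in>I. ?\<alpha> i = {})" by blast
    then have "Pi\<^sub>E I ?\<alpha> \<noteq> {}" unfolding PiE_eq_empty_iff .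
    then obtain \<phi> where \<phi>: "\<phi> \<in> Pi\<^sub>E I ?\<alpha>" unfolding ex_in_conv[symmetric] ..
    let ?\<theta> = "\<lambda>k. restrict (\<theta>0 k) (carrier (obj ?F k))"
    have \<theta>: "?\<theta> \<in> comparison_maps R ?F T" by (rule comparison_maps_restrict[OF Fc \<theta>0])
    obtain y where y: "y \<in> ext_class R n TM (tensor R I NS) (\<lambda>x. tensor_map R I NS \<phi> (?\<theta> n x ones))"
      using ext_class_nonempty[OF TN, where l=l, folded n] unfolding ex_in_conv[symmetric] by blast
    have "y \<in> ?E" unfolding E by (rule UN_I, rule \<phi>, rule UN_I, rule \<theta>, rule y)
    then show ?thesis by (metis empty_iff)
  qed
  have same: "ext_class R n TM NT (\<lambda>x. ?iso (y x)) = ext_class R n TM NT c" if y: "y \<in> ?E" for y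
  proof -
    obtain \<phi> \<theta> where \<phi>: "\<phi> \<in> Pi\<^sub>E I ?\<alpha>" and \<theta>: "\<theta> \<in> comparison_maps R ?F T"
      and y': "y \<in> ext_class R n TM (tensor R I NS) (\<lambda>x. tensor_map R I NS \<phi> (\<theta> n x ones))"
      using y unfolding E by blast
    have \<phi>i: "\<phi> i \<in> ?\<alpha> i" if "i \<in> I" for i using \<phi> that by blast
    have \<phi>l: "lin R (obj (Ps i) 1) (NS i) (\<phi> i)" if i: "i \<in> I" for i
      by (rule factor_cocycle(1)[OF one_indiv[OF i] \<phi>i[OF i]])
    have "\<forall>i\<in>I. \<exists>\<rho>. chain_map (Ps i) (K i) \<rho> \<and> (\<forall>x\<in>carrier (obj (Ps i) 1). \<phi> i x = cell_val (S i) (\<rho> 1 x))"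
      by (intro ballI factor_chain_map \<phi>i)
    from bchoice[OF this] obtain \<rho> where \<rho>': "\<forall>i\<in>I. chain_map (Ps i) (K i) (\<rho> i) \<and>
      (\<forall>x\<in>carrier (obj (Ps i) 1). \<phi> i x = cell_val (S i) (\<rho> i 1 x))" ..
    have \<rho>: "\<And>i. i \<in> I \<Longrightarrow> chain_map (Ps i) (K i) (\<rho> i)"
      "\<And>i x. i \<in> I \<Longrightarrow> x \<in> carrier (obj (Ps i) 1) \<Longrightarrow> \<phi> i x = cell_val (S i) (\<rho> i 1 x)"
      using \<rho>' by (fast, fast)
    have \<rho>c: "\<forall>i\<in>I. chain_map (Ps i) (K i) (\<rho> i)" using \<rho>' by fast
    have \<theta>c: "chain_map ?F T \<theta>" by (rule comparison_mapsD[OF \<theta>])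
    obtain h where h: "lin R (obj ?F l) NT h"
      "\<And>x. x \<in> carrier (obj ?F n) \<Longrightarrow> cube_val (rho \<rho> n (\<theta> n x)) = c x \<oplus>\<^bsub>NT\<^esub> h (bdry ?F l x)"
      using c(4)[OF \<theta>c \<rho>c] by (elim exE conjE) (rule that, assumption, erule bspec)
    obtain k where k': "k \<in> mod_hom R (obj ?F l) (tensor R I NS)"
      and yk: "y = (\<lambda>x\<in>carrier (obj ?F n). k (bdry ?F l x) \<oplus>\<^bsub>tensor R I NS\<^esub> tensor_map R I NS \<phi> (\<theta> n x ones))"
      using y' unfolding ext_class_iff[where l=l, folded n] by blast
    have k: "lin R (obj ?F l) (tensor R I NS) k" using k' by (simp add: mod_hom_iff)
    note ik = lin_comp[OF k isoL]
    have tl: "lin R (TP ones) (tensor R I NS) (tensor_map R I NS \<phi>)"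
      by (rule tensor_map(1)[OF P_module idem_module_module]) (use \<phi>l in auto)
    have eq: "?iso (y x) = c x \<oplus>\<^bsub>NT\<^esub> (h (bdry ?F l x) \<oplus>\<^bsub>NT\<^esub> ?iso (k (bdry ?F l x)))"
      if x: "x \<in> carrier (obj ?F n)" for x
    proof -
      have tx: "\<theta> n x \<in> carrier (obj T n)" by (rule lin_closed[OF chain_mapD(1)[OF \<theta>c] x])
      then have tp: "\<theta> n x ones \<in> carrier (TP ones)" by (rule TP_sub[OF ones_multidegs])
      note bx = lin_closed[OF bl x]
      have "?iso (tensor_map R I NS \<phi> (\<theta> n x ones)) = cube_val (rlift \<rho> ones (\<theta> n x ones))"
        by (rule tensor_cocycle[OF \<rho>(1) \<phi>l \<rho>(2) tp])
      also have "\<dots> = cube_val (rho \<rho> n (\<theta> n x))" using rho_top[of \<rho>, OF \<rho>(1) tx] by simp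
      also have "\<dots> = c x \<oplus>\<^bsub>NT\<^esub> h (bdry ?F l x)" by (rule h(2)[OF x])
      finally have "?iso (y x) = ?iso (k (bdry ?F l x)) \<oplus>\<^bsub>NT\<^esub> (c x \<oplus>\<^bsub>NT\<^esub> h (bdry ?F l x))"
        using x lin_add[OF isoL lin_closed[OF k bx] lin_closed[OF tl tp]] by (simp add: yk)
      then show ?thesis
        using N.M.a_lcomm[OF lin_closed[OF ik bx] lin_closed[OF c(1) x] lin_closed[OF h(1) bx]]
          N.M.a_comm[OF lin_closed[OF ik bx] lin_closed[OF h(1) bx]] by (simp only:)
    qed
    show ?thesis
      by (rule ext_class_eq[where l=l, folded n, OF TM NT lin_plus[OF NT h(1) ik] lin_closed[OF c(1)] eq])
  qed
  have "ext_push R n TM NT ?iso ?E = ext_class R n TM NT c"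
  proof -
    have "ext_push R n TM NT ?iso ?E = (\<Union>y\<in>?E. ext_class R n TM NT (\<lambda>x. ?iso (y x)))" by (rule ext_push_def)
    also have "\<dots> = (\<Union>y\<in>?E. ext_class R n TM NT c)" by (rule SUP_cong[OF refl same])
    also have "\<dots> = ext_class R n TM NT c" using ne by (simp only: UN_constant if_False)
    finally show ?thesis .
  qed
  also have "ext_class R n TM NT c \<in> carrier (Ext R n TM NT) - {\<zero>\<^bsub>Ext R n TM NT\<^esub>}"
    by (rule Ext_class_nonzero[where l=l, folded n, OF TM NT c(1) bspec[OF c(2)] c(3)])
  finally show ?thesis .
qed

end

theorem theorem2p1p4:
  fixes R :: "'r ring" and n :: nat
    and S :: "nat \<Rightarrow> 's set" and \<Psi> :: "nat \<Rightarrow> 's \<Rightarrow> 'r"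
  assumes "cring R" and "n \<ge> 1"
    and "indivisible R n S \<Psi>"
    and "\<forall>i \<in> {1..n}. aleph_le (i - 1) (S i)"
  shows
    "ext_push R n (tensor R {1..n} (\<lambda>i. indiv_coker R (S i) (\<Psi> i)))
       (idem_module R (Sigma {1..n} S)) (idem_tensor_iso R {1..n} S)
       (ext_tensor R {1..n} (\<lambda>i. 1)
          (\<lambda>i. indiv_coker R (S i) (\<Psi> i)) (\<lambda>i. idem_module R (S i))
          (\<lambda>i. ext_push R 1 (indiv_coker R (S i) (\<Psi> i)) (idem_module R (S i))
                 (idem_incl R (S i)) (indiv_cl R (S i) (\<Psi> i))))
     \<in> carrier (Ext R n (tensor R {1..n} (\<lambda>i. indiv_coker R (S i) (\<Psi> i)))
                  (idem_module R (Sigma {1..n} S)))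
       - {\<zero>\<^bsub>Ext R n (tensor R {1..n} (\<lambda>i. indiv_coker R (S i) (\<Psi> i)))
             (idem_module R (Sigma {1..n} S))\<^esub>}"
proof -
  obtain l where "n = Suc l" using assms(2) by (cases n) auto
  then interpret indivisible_family R n l S \<Psi>
    using assms(1,3) by (intro indivisible_family.intro coeff_ring.intro indivisible_family_axioms.intro)
  show ?thesis by (rule indivisible_class_nonzero) (use assms(4) in blast)
qed

end
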